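(* Let $M$ be a simply connected manifold of dimension $m$. (1) Let $f:M\to S_s^{m+k}$ be a smooth immersion with flat normal bundle, such that the induced metric has signature $r$, and constant curvature $c\in(-\infty,0)\cup(1,\infty)$. Then there is, uniquely up to an action by the isometry group of $\mathbf{R}_s^{m+k}$, a canonically defined immersion with flat normal bundle $\hat f:M\to\mathbf{R}_s^{m+k}$, with the same induced metric. The same statement holds with the roles of $S_s^{m+k}$ and $\mathbf{R}_s^{m+k}$ reversed. (2) Statement (1) is also valid substituting $H_s^{m+k}$ for $S_s^{m+k}$ and $(-\infty,-1)\cup(0,\infty)$ for $(-\infty,0)\cup(1,\infty)$.
   Context: **Spaces.** The signature of a nondegenerate symmetric bilinear form is its number of negative directions; $s\ge r$. $\mathbf{R}^n_s$ denotes $\mathbf{R}^n$ with the flat pseudo-Euclidean metric of signature $s$. $S^n_s=\{x\in\mathbf{R}^{n+1}_s: x^tJx=1\}$ is the pseudo-Riemannian unit sphere and $H^n_s=\{x\in\mathbf{R}^{n+1}_{s+1}: x^tJx=-1\}$ is the pseudo-Riemannian hyperbolic space, where in each case $J$ is the diagonal matrix, with entries $\pm1$, of the ambient metric. "Constant curvature" means constant sectional curvature of the induced metric. "Flat normal bundle" means that the connection induced on the normal bundle of the immersion in its target space has zero curvature. **Meaning of "canonically defined".** The theorem as worded does not expand this phrase. It refers to the immersion produced by the following construction, and the uniqueness is that of the output of this construction, not uniqueness among all immersions with the given induced metric. Let $\epsilon=1$ for the sphere and $\epsilon=-1$ for the hyperbolic space. Let $J_1$, $J_2$ be diagonal matrices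 with entries $\pm1$, of sizes $m$ and $k$, having $r$ and $s-r$ negative entries respectively, with $\mathrm{diag}(J_1,J_2,\epsilon)$ the metric on the space containing the sphere or hyperbolic space, and $\mathrm{diag}(J_1,J_2)$ the metric on $\mathbf{R}_s^{m+k}$. Fix a base point $p\in M$ and, after an ambient isometry, take a frame $F=[e_1,\dots,e_m,n_1,\dots,n_k,f]$ on a simply connected neighbourhood of $p$, orthonormal with respect to $\mathrm{diag}(J_1,J_2,\epsilon)$, with the $e_i$ tangent and the $n_j$ normal to $f$, and with $F(p)=I$. In blocks of sizes $m,k,1$ write $$F^{-1}dF=\begin{pmatrix}\omega&\beta&\theta\\ \alpha&\eta&0\\ -\epsilon\theta^tJ_1&0&0\end{pmatrix},\qquad \alpha=-J_2\beta^tJ_1 .$$ Put $\kappa=\frac{i\sqrt{\epsilon c}}{\sqrt{1-\epsilon c}}$, which is real for the allowed $c$, and solve $$\hat F^{-1}d\hat F=\begin{pmatrix}\omega&\kappa\beta&\theta\\ \kappa\alpha&\eta&0\\ 0&0&0\end{pmatrix},\qquad \hat F(p)=I .$$ Then $\hat F=\begin{pmatrix}T&\hat f\\0&1\end{pmatrix}$, which defines $\hat f$. The result does not depend on the choice of frame (changing $F$ by right multiplication by $\mathrm{diag}(G_1,G_2,1)$, $G(p)=I$, changes $\hat F$ in the same way), and carrying out the construction on simply connected neighbourhoods containing $p$ of the various points of $M$ gives $\hat f$ on all of $M$. For the reversed roles the construction is performed in the opposite direction. *)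

theory Defs
  imports "HOL-Analysis.Analysis"
begin

section \<open>Smooth maps and smooth manifolds\<close>

fun Ck_on :: "nat \<Rightarrow> ('v::euclidean_space) set \<Rightarrow> ('v \<Rightarrow> 'w::real_normed_vector) \<Rightarrow> bool" where
  "Ck_on 0 S f \<longleftrightarrow> continuous_on S f"
| "Ck_on (Suc k) S f \<longleftrightarrow> (\<forall>u\<in>S. f differentiable (at u)) \<and>
     (\<forall>v. Ck_on k S (\<lambda>u. frechet_derivative f (at u) v))"

text \<open>Infinitely differentiable on \<open>S\<close>; only meant for open \<open>S\<close>.\<close>

definition smooth_on :: "('v::euclidean_space) set \<Rightarrow> ('v \<Rightarrow> 'w::real_normed_vector) \<Rightarrow> bool" where
  "smooth_on S f \<longleftrightarrow> (\<forall>k. Ck_on k S f)"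

text \<open>The manifold \<open>M\<close> is a whole type \<open>'a\<close> (Hausdorff and second countable) with a smooth atlas.
  A chart is a pair of its domain and its coordinate map. The atlas need not be maximal: everything
  below is independent of the choice of atlas within a smooth structure.\<close>

type_synonym ('a, 'm) chart = "'a set \<times> ('a \<Rightarrow> real ^ 'm)"

text \<open>Expression of a map in the coordinates of a chart.\<close>

definition rep :: "('a, 'm) chart \<Rightarrow> ('a \<Rightarrow> 'w) \<Rightarrow> real ^ 'm \<Rightarrow> 'w" where
  "rep ch f = f \<circ> inv_into (fst ch) (snd ch)"

definition is_chart :: "('a::topological_space, 'm::finite) chart \<Rightarrow> bool" where
  "is_chart ch \<longleftrightarrow> open (fst ch) \<and> open (snd ch ` fst ch) \<and> inj_on (snd ch) (fst ch) \<and>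
     continuous_on (fst ch) (snd ch) \<and>
     continuous_on (snd ch ` fst ch) (inv_into (fst ch) (snd ch))"

definition smooth_atlas ::
    "('a::{t2_space, second_countable_topology}, 'm::finite) chart set \<Rightarrow> bool" where
  "smooth_atlas \<A> \<longleftrightarrow> (\<forall>ch\<in>\<A>. is_chart ch) \<and> (\<Union>ch\<in>\<A>. fst ch) = UNIV \<and>
     (\<forall>ch\<in>\<A>. \<forall>ch'\<in>\<A>. smooth_on (snd ch ` (fst ch \<inter> fst ch')) (rep ch (snd ch')))"

definition smooth_map_on ::
    "('a, 'm::finite) chart set \<Rightarrow> 'a set \<Rightarrow> ('a \<Rightarrow> 'w::real_normed_vector) \<Rightarrow> bool" where
  "smooth_map_on \<A> U f \<longleftrightarrow> (\<forall>ch\<in>\<A>. smooth_on (snd ch ` (fst ch \<inter> U)) (rep ch f))"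

text \<open>The differential of \<open>f\<close> at \<open>x\<close>, with tangent vectors written in the coordinates of a chart
  around \<open>x\<close>.\<close>

definition mdiff ::
    "('a, 'm::finite) chart \<Rightarrow> ('a \<Rightarrow> 'w::real_normed_vector) \<Rightarrow> 'a \<Rightarrow> real ^ 'm \<Rightarrow> 'w" where
  "mdiff ch f x v = frechet_derivative (rep ch f) (at (snd ch x)) v"

definition immersion :: "('a, 'm::finite) chart set \<Rightarrow> ('a \<Rightarrow> 'w::real_normed_vector) \<Rightarrow> bool" where
  "immersion \<A> f \<longleftrightarrow> smooth_map_on \<A> UNIV f \<and> (\<forall>ch\<in>\<A>. \<forall>x\<in>fst ch. inj (mdiff ch f x))"

section \<open>Pseudo-Euclidean spaces, spheres and hyperbolic spaces\<close>

text \<open>The bilinear form of the diagonal matrix with diagonal \<open>J\<close>. The space \<open>\<real>\<^sup>n\<close> of signature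
  \<open>s\<close> is \<open>real ^ 'n\<close> with this form, where \<open>J\<close> has entries \<open>\<plusminus>1\<close> and exactly \<open>s\<close> entries \<open>-1\<close>.\<close>

definition pform :: "('i::finite \<Rightarrow> real) \<Rightarrow> real ^ 'i \<Rightarrow> real ^ 'i \<Rightarrow> real" where
  "pform J x y = (\<Sum>i\<in>UNIV. J i * x $ i * y $ i)"

text \<open>\<open>diag(J, \<epsilon>)\<close>, the metric of a space of one dimension more; \<open>None\<close> is the last index.\<close>

definition ext :: "real \<Rightarrow> ('n \<Rightarrow> real) \<Rightarrow> 'n option \<Rightarrow> real" where
  "ext \<epsilon> J = case_option \<epsilon> J"

text \<open>If \<open>J\<close> has \<open>s\<close> negative entries, the ambient space has signature \<open>s\<close> for the sphere and
  \<open>s + 1\<close> for the hyperbolic space.\<close>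

definition pseudo_sphere :: "('n::finite \<Rightarrow> real) \<Rightarrow> (real ^ 'n option) set" where
  "pseudo_sphere J = {x. pform (ext 1 J) x x = 1}"

definition pseudo_hyperbolic :: "('n::finite \<Rightarrow> real) \<Rightarrow> (real ^ 'n option) set" where
  "pseudo_hyperbolic J = {x. pform (ext (-1) J) x x = -1}"

text \<open>Tangent spaces at \<open>y\<close> of the target: a quadric \<open>pform J y y = const\<close>, and flat space.\<close>

definition quadric_tangent :: "('i::finite \<Rightarrow> real) \<Rightarrow> real ^ 'i \<Rightarrow> (real ^ 'i) set" where
  "quadric_tangent J y = {\<xi>. pform J \<xi> y = 0}"

definition flat_tangent :: "real ^ 'i \<Rightarrow> (real ^ 'i) set" where
  "flat_tangent y = UNIV"

text \<open>The orthogonal group of the form, acting as the isometry group of the sphere or hyperbolic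
  space when the form is the ambient one, and the group of rigid motions, the isometry group of
  pseudo-Euclidean space.\<close>

definition pseudo_orthogonal :: "('i::finite \<Rightarrow> real) \<Rightarrow> (real ^ 'i \<Rightarrow> real ^ 'i) \<Rightarrow> bool" where
  "pseudo_orthogonal J \<Phi> \<longleftrightarrow> linear \<Phi> \<and> (\<forall>x y. pform J (\<Phi> x) (\<Phi> y) = pform J x y)"

definition rigid_motion :: "('i::finite \<Rightarrow> real) \<Rightarrow> (real ^ 'i \<Rightarrow> real ^ 'i) \<Rightarrow> bool" where
  "rigid_motion J \<Phi> \<longleftrightarrow> (\<exists>Q b. pseudo_orthogonal J Q \<and> \<Phi> = (\<lambda>x. Q x + b))"

section \<open>Induced metric, its signature and its sectional curvature\<close>

definition induced_metric ::
    "('i::finite \<Rightarrow> real) \<Rightarrow> ('a, 'm::finite) chart \<Rightarrow> ('a \<Rightarrow> real ^ 'i) \<Rightarrow> 'a \<Rightarrow>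
     real ^ 'm \<Rightarrow> real ^ 'm \<Rightarrow> real" where
  "induced_metric J ch f x v w = pform J (mdiff ch f x v) (mdiff ch f x w)"

definition same_induced_metric ::
    "('a, 'm::finite) chart set \<Rightarrow> ('i::finite \<Rightarrow> real) \<Rightarrow> ('a \<Rightarrow> real ^ 'i) \<Rightarrow>
     ('j::finite \<Rightarrow> real) \<Rightarrow> ('a \<Rightarrow> real ^ 'j) \<Rightarrow> bool" where
  "same_induced_metric \<A> J f J' f' \<longleftrightarrow>
     (\<forall>ch\<in>\<A>. \<forall>x\<in>fst ch. \<forall>v w. induced_metric J ch f x v w = induced_metric J' ch f' x v w)"

text \<open>A nondegenerate symmetric bilinear form whose maximal negative definite subspaces have
  dimension \<open>r\<close>.\<close>

definition has_signature :: "('v::euclidean_space \<Rightarrow> 'v \<Rightarrow> real) \<Rightarrow> nat \<Rightarrow> bool" where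
  "has_signature B r \<longleftrightarrow>
     (\<forall>v. (\<forall>w. B v w = 0) \<longrightarrow> v = 0) \<and>
     (\<exists>W. subspace W \<and> (\<forall>v\<in>W. v \<noteq> 0 \<longrightarrow> B v v < 0) \<and> dim W = r) \<and>
     (\<forall>W. subspace W \<and> (\<forall>v\<in>W. v \<noteq> 0 \<longrightarrow> B v v < 0) \<longrightarrow> dim W \<le> r)"

definition induced_signature ::
    "('a, 'm::finite) chart set \<Rightarrow> ('i::finite \<Rightarrow> real) \<Rightarrow> ('a \<Rightarrow> real ^ 'i) \<Rightarrow> nat \<Rightarrow> bool" where
  "induced_signature \<A> J f r \<longleftrightarrow>
     (\<forall>ch\<in>\<A>. \<forall>x\<in>fst ch. has_signature (induced_metric J ch f x) r)"

definition partial :: "'m::finite \<Rightarrow> (real ^ 'm \<Rightarrow> real) \<Rightarrow> real ^ 'm \<Rightarrow> real" where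
  "partial i h u = frechet_derivative h (at u) (axis i 1)"

definition metric_matrix ::
    "('i::finite \<Rightarrow> real) \<Rightarrow> ('a, 'm::finite) chart \<Rightarrow> ('a \<Rightarrow> real ^ 'i) \<Rightarrow>
     real ^ 'm \<Rightarrow> real ^ 'm ^ 'm" where
  "metric_matrix J ch f u =
     (\<chi> i j. induced_metric J ch f (inv_into (fst ch) (snd ch) u) (axis i 1) (axis j 1))"

text \<open>\<open>christoffel G l i j\<close> is the \<open>l\<close>-component of the Levi-Civita derivative of the \<open>j\<close>-th
  coordinate field along the \<open>i\<close>-th one, and \<open>riemann G l k i j\<close> the \<open>l\<close>-component of
  \<open>R(\<partial>i, \<partial>j)\<partial>k\<close>, with the convention \<open>R(X, Y) = [\<nabla>X, \<nabla>Y] - \<nabla>[X, Y]\<close>.\<close>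

definition christoffel ::
    "(real ^ 'm \<Rightarrow> real ^ 'm ^ 'm) \<Rightarrow> 'm::finite \<Rightarrow> 'm \<Rightarrow> 'm \<Rightarrow> real ^ 'm \<Rightarrow> real" where
  "christoffel G l i j u = (\<Sum>p\<in>UNIV. matrix_inv (G u) $ l $ p *
     (partial i (\<lambda>u. G u $ j $ p) u + partial j (\<lambda>u. G u $ i $ p) u
        - partial p (\<lambda>u. G u $ i $ j) u)) / 2"

definition riemann ::
    "(real ^ 'm \<Rightarrow> real ^ 'm ^ 'm) \<Rightarrow> 'm::finite \<Rightarrow> 'm \<Rightarrow> 'm \<Rightarrow> 'm \<Rightarrow> real ^ 'm \<Rightarrow> real" where
  "riemann G l k i j u =
     partial i (christoffel G l j k) u - partial j (christoffel G l i k) u +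
     (\<Sum>p\<in>UNIV. christoffel G l i p u * christoffel G p j k u
               - christoffel G l j p u * christoffel G p i k u)"

definition curvature_operator ::
    "(real ^ 'm \<Rightarrow> real ^ 'm ^ 'm) \<Rightarrow> real ^ 'm::finite \<Rightarrow> real ^ 'm \<Rightarrow> real ^ 'm \<Rightarrow> real ^ 'm \<Rightarrow>
     real ^ 'm" where
  "curvature_operator G u X Y Z =
     (\<chi> l. \<Sum>i\<in>UNIV. \<Sum>j\<in>UNIV. \<Sum>k\<in>UNIV. X $ i * Y $ j * Z $ k * riemann G l k i j u)"

definition plane_area ::
    "(real ^ 'm \<Rightarrow> real ^ 'm ^ 'm) \<Rightarrow> real ^ 'm::finite \<Rightarrow> real ^ 'm \<Rightarrow> real ^ 'm \<Rightarrow> real" where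
  "plane_area G u X Y = (X \<bullet> (G u *v X)) * (Y \<bullet> (G u *v Y)) - (X \<bullet> (G u *v Y))\<^sup>2"

definition sectional_curvature ::
    "(real ^ 'm \<Rightarrow> real ^ 'm ^ 'm) \<Rightarrow> real ^ 'm::finite \<Rightarrow> real ^ 'm \<Rightarrow> real ^ 'm \<Rightarrow> real" where
  "sectional_curvature G u X Y =
     (curvature_operator G u X Y Y \<bullet> (G u *v X)) / plane_area G u X Y"

text \<open>Sectional curvature is defined for nondegenerate planes only; there are none if \<open>M\<close> is
  one-dimensional.\<close>

definition constant_curvature ::
    "('a, 'm::finite) chart set \<Rightarrow> ('i::finite \<Rightarrow> real) \<Rightarrow> ('a \<Rightarrow> real ^ 'i) \<Rightarrow> real \<Rightarrow> bool" where
  "constant_curvature \<A> J f c \<longleftrightarrow>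
     (\<forall>ch\<in>\<A>. \<forall>u\<in>snd ch ` fst ch. \<forall>X Y. plane_area (metric_matrix J ch f) u X Y \<noteq> 0 \<longrightarrow>
        sectional_curvature (metric_matrix J ch f) u X Y = c)"

section \<open>The normal bundle and its connection\<close>

text \<open>\<open>\<tau>\<close> is the field of tangent spaces of the target; \<open>u\<close> is a point of the coordinate domain.\<close>

definition normal_space ::
    "('i::finite \<Rightarrow> real) \<Rightarrow> (real ^ 'i \<Rightarrow> (real ^ 'i) set) \<Rightarrow> ('a, 'm::finite) chart \<Rightarrow>
     ('a \<Rightarrow> real ^ 'i) \<Rightarrow> real ^ 'm \<Rightarrow> (real ^ 'i) set" where
  "normal_space J \<tau> ch f u =
     {\<xi> \<in> \<tau> (rep ch f u). \<forall>v. pform J \<xi> (frechet_derivative (rep ch f) (at u) v) = 0}"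

definition orth_proj ::
    "('i::finite \<Rightarrow> real) \<Rightarrow> (real ^ 'i) set \<Rightarrow> real ^ 'i \<Rightarrow> real ^ 'i" where
  "orth_proj J N x = (THE y. y \<in> N \<and> (\<forall>z\<in>N. pform J (x - y) z = 0))"

text \<open>Covariant derivative of a normal field \<open>\<xi>\<close> (a function of the coordinates) in the direction
  of the constant coordinate vector \<open>v\<close>. Projecting the ambient derivative first to the tangent
  space of the target, which gives the target's connection, and then to the normal space is the same
  as projecting it directly, because the normal space is contained in that tangent space.\<close>

definition normal_deriv ::
    "('i::finite \<Rightarrow> real) \<Rightarrow> (real ^ 'i \<Rightarrow> (real ^ 'i) set) \<Rightarrow> ('a, 'm::finite) chart \<Rightarrow>
     ('a \<Rightarrow> real ^ 'i) \<Rightarrow> real ^ 'm \<Rightarrow> (real ^ 'm \<Rightarrow> real ^ 'i) \<Rightarrow> real ^ 'm \<Rightarrow> real ^ 'i" where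
  "normal_deriv J \<tau> ch f v \<xi> u =
     orth_proj J (normal_space J \<tau> ch f u) (frechet_derivative \<xi> (at u) v)"

text \<open>Zero curvature: constant coordinate fields commute, so no bracket term occurs.\<close>

definition flat_normal_bundle ::
    "('a, 'm::finite) chart set \<Rightarrow> ('i::finite \<Rightarrow> real) \<Rightarrow> (real ^ 'i \<Rightarrow> (real ^ 'i) set) \<Rightarrow>
     ('a \<Rightarrow> real ^ 'i) \<Rightarrow> bool" where
  "flat_normal_bundle \<A> J \<tau> f \<longleftrightarrow>
     (\<forall>ch\<in>\<A>. \<forall>W \<xi>. open W \<and> W \<subseteq> snd ch ` fst ch \<and> smooth_on W \<xi> \<and>
        (\<forall>u\<in>W. \<xi> u \<in> normal_space J \<tau> ch f u) \<longrightarrow>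
        (\<forall>u\<in>W. \<forall>v w. normal_deriv J \<tau> ch f v (normal_deriv J \<tau> ch f w \<xi>) u
                       = normal_deriv J \<tau> ch f w (normal_deriv J \<tau> ch f v \<xi>) u))"

section \<open>The canonical construction\<close>

text \<open>Matrices are indexed by \<open>'n option\<close>. The indices of the first block (size \<open>m\<close>) are the
  \<open>Some i\<close> with \<open>i \<in> T\<close>, those of the second block (size \<open>k\<close>) the \<open>Some i\<close> with \<open>i \<notin> T\<close>, and
  \<open>None\<close> is the last block; so \<open>J\<close> restricted to \<open>T\<close> and to \<open>- T\<close> gives \<open>J\<^sub>1\<close> and \<open>J\<^sub>2\<close>.
  Entries are addressed as \<open>A $ row $ column\<close>.\<close>

definition orthonormal_frame :: "('i::finite \<Rightarrow> real) \<Rightarrow> real ^ 'i ^ 'i \<Rightarrow> bool" where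
  "orthonormal_frame J E \<longleftrightarrow>
     (\<forall>a b. pform J (column a E) (column b E) = (if a = b then J a else 0))"

text \<open>The columns in \<open>T\<close> are tangent to \<open>f\<close>, the other ones are normal in the target.\<close>

definition adapted_frame ::
    "('a, 'm::finite) chart set \<Rightarrow> ('i::finite \<Rightarrow> real) \<Rightarrow> (real ^ 'i \<Rightarrow> (real ^ 'i) set) \<Rightarrow>
     ('a \<Rightarrow> real ^ 'i) \<Rightarrow> 'a set \<Rightarrow> 'n set \<Rightarrow> ('n \<Rightarrow> 'a \<Rightarrow> real ^ 'i) \<Rightarrow> bool" where
  "adapted_frame \<A> J \<tau> f U T e \<longleftrightarrow>
     (\<forall>ch\<in>\<A>. \<forall>x\<in>U \<inter> fst ch.
        (\<forall>i\<in>T. e i x \<in> range (mdiff ch f x)) \<and>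
        (\<forall>i\<in>-T. e i x \<in> normal_space J \<tau> ch f (snd ch x)))"

text \<open>\<open>F = [e, n, f]\<close> for a map \<open>f\<close> into the quadric.\<close>

definition quadric_frame ::
    "('a, 'm::finite) chart set \<Rightarrow> real \<Rightarrow> ('n::finite \<Rightarrow> real) \<Rightarrow> 'n set \<Rightarrow>
     ('a \<Rightarrow> real ^ 'n option) \<Rightarrow> 'a set \<Rightarrow> ('a \<Rightarrow> real ^ 'n option ^ 'n option) \<Rightarrow> bool" where
  "quadric_frame \<A> \<epsilon> J T f U F \<longleftrightarrow>
     smooth_map_on \<A> U F \<and>
     (\<forall>x\<in>U. orthonormal_frame (ext \<epsilon> J) (F x) \<and> column None (F x) = f x) \<and>
     adapted_frame \<A> (ext \<epsilon> J) (quadric_tangent (ext \<epsilon> J)) f U T (\<lambda>i x. column (Some i) (F x))"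

text \<open>The frame with blocks \<open>(E, f; 0, 1)\<close>, where \<open>E = [e, n]\<close>, for a map \<open>f\<close> into flat space.\<close>

definition flat_frame ::
    "('a, 'm::finite) chart set \<Rightarrow> ('n::finite \<Rightarrow> real) \<Rightarrow> 'n set \<Rightarrow>
     ('a \<Rightarrow> real ^ 'n) \<Rightarrow> 'a set \<Rightarrow> ('a \<Rightarrow> real ^ 'n option ^ 'n option) \<Rightarrow> bool" where
  "flat_frame \<A> J T f U F \<longleftrightarrow>
     smooth_map_on \<A> U F \<and>
     (\<forall>x\<in>U. orthonormal_frame J (\<chi> i j. F x $ Some i $ Some j) \<and>
        (\<forall>i. F x $ Some i $ None = f x $ i) \<and>
        (\<forall>j. F x $ None $ Some j = 0) \<and> F x $ None $ None = 1) \<and>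
     adapted_frame \<A> J flat_tangent f U T (\<lambda>j x. \<chi> i. F x $ Some i $ Some j)"

text \<open>The value of \<open>F\<^sup>-\<^sup>1 dF\<close> on a tangent vector.\<close>

definition mc_form ::
    "('a, 'm::finite) chart \<Rightarrow> ('a \<Rightarrow> real ^ 'i::finite ^ 'i) \<Rightarrow> 'a \<Rightarrow> real ^ 'm \<Rightarrow> real ^ 'i ^ 'i"
  where "mc_form ch F x v = matrix_inv (F x) ** mdiff ch F x v"

text \<open>With \<open>csqrt\<close> the principal square root, the complex number is real if \<open>\<epsilon> * c < 0\<close> or
  \<open>\<epsilon> * c > 1\<close>.\<close>

definition kappa :: "real \<Rightarrow> real \<Rightarrow> real" where
  "kappa \<epsilon> c = Re (\<i> * csqrt (complex_of_real (\<epsilon> * c)) / csqrt (complex_of_real (1 - \<epsilon> * c)))"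

text \<open>The passage between the two matrices of one-forms, for a value of the forms on one vector:
  \<open>hat_matrix\<close> scales the blocks \<open>\<alpha>\<close> and \<open>\<beta>\<close> and removes the last row, \<open>unhat_matrix\<close> is its
  inverse and recreates the last row \<open>-\<epsilon> \<theta>\<^sup>t J\<^sub>1\<close>.\<close>

definition hat_matrix ::
    "real \<Rightarrow> 'n::finite set \<Rightarrow> real ^ 'n option ^ 'n option \<Rightarrow> real ^ 'n option ^ 'n option" where
  "hat_matrix \<kappa> T \<Omega> = (\<chi> a b. case a of None \<Rightarrow> 0 | Some i \<Rightarrow>
     (case b of None \<Rightarrow> (if i \<in> T then \<Omega> $ a $ b else 0)
      | Some j \<Rightarrow> (if i \<in> T \<longleftrightarrow> j \<in> T then \<Omega> $ a $ b else \<kappa> * \<Omega> $ a $ b)))"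

definition unhat_matrix ::
    "real \<Rightarrow> real \<Rightarrow> ('n \<Rightarrow> real) \<Rightarrow> 'n::finite set \<Rightarrow> real ^ 'n option ^ 'n option \<Rightarrow>
     real ^ 'n option ^ 'n option" where
  "unhat_matrix \<kappa> \<epsilon> J T \<Omega> = (\<chi> a b. case a of
       None \<Rightarrow> (case b of None \<Rightarrow> 0
                | Some j \<Rightarrow> (if j \<in> T then - \<epsilon> * \<Omega> $ Some j $ None * J j else 0))
     | Some i \<Rightarrow>
        (case b of None \<Rightarrow> (if i \<in> T then \<Omega> $ a $ b else 0)
         | Some j \<Rightarrow> (if i \<in> T \<longleftrightarrow> j \<in> T then \<Omega> $ a $ b else \<Omega> $ a $ b / \<kappa>)))"

text \<open>\<open>H\<close> is a solution on \<open>U\<close> of \<open>H\<^sup>-\<^sup>1 dH = L (F\<^sup>-\<^sup>1 dF)\<close>, \<open>H(p) = I\<close>.\<close>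

definition transformed_frame ::
    "('a, 'm::finite) chart set \<Rightarrow> 'a set \<Rightarrow> 'a \<Rightarrow>
     (real ^ 'i::finite ^ 'i \<Rightarrow> real ^ 'i ^ 'i) \<Rightarrow>
     ('a \<Rightarrow> real ^ 'i ^ 'i) \<Rightarrow> ('a \<Rightarrow> real ^ 'i ^ 'i) \<Rightarrow> bool" where
  "transformed_frame \<A> U p L F H \<longleftrightarrow>
     smooth_map_on \<A> U H \<and> (\<forall>x\<in>U. invertible (H x)) \<and> H p = mat 1 \<and>
     (\<forall>ch\<in>\<A>. \<forall>x\<in>U \<inter> fst ch. \<forall>v. mc_form ch H x v = L (mc_form ch F x v))"

text \<open>\<open>canonical_flat \<A> \<epsilon> J T c f p g\<close>: the construction with base point \<open>p\<close>, applied to the map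
  \<open>f\<close> into the sphere (\<open>\<epsilon> = 1\<close>) or hyperbolic space (\<open>\<epsilon> = -1\<close>), yields the map \<open>g\<close> into flat
  space. The isometry \<open>\<Phi>\<close>, which makes \<open>F p = mat 1\<close> possible, is fixed once; the neighbourhood
  \<open>U\<close> of \<open>p\<close> and the frame on it depend on the point \<open>q\<close> where \<open>g\<close> is to be found.\<close>

definition canonical_flat ::
    "('a::topological_space, 'm::finite) chart set \<Rightarrow> real \<Rightarrow> ('n::finite \<Rightarrow> real) \<Rightarrow> 'n set \<Rightarrow>
     real \<Rightarrow> ('a \<Rightarrow> real ^ 'n option) \<Rightarrow> 'a \<Rightarrow> ('a \<Rightarrow> real ^ 'n) \<Rightarrow> bool" where
  "canonical_flat \<A> \<epsilon> J T c f p g \<longleftrightarrow>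
     (\<exists>\<Phi>. pseudo_orthogonal (ext \<epsilon> J) \<Phi> \<and>
       (\<forall>q. \<exists>U F H. open U \<and> simply_connected U \<and> p \<in> U \<and> q \<in> U \<and>
          quadric_frame \<A> \<epsilon> J T (\<Phi> \<circ> f) U F \<and> F p = mat 1 \<and>
          transformed_frame \<A> U p (hat_matrix (kappa \<epsilon> c) T) F H \<and>
          (\<forall>x\<in>U. \<forall>i. g x $ i = H x $ Some i $ None)))"

text \<open>The construction in the opposite direction.\<close>

definition canonical_quadric ::
    "('a::topological_space, 'm::finite) chart set \<Rightarrow> real \<Rightarrow> ('n::finite \<Rightarrow> real) \<Rightarrow> 'n set \<Rightarrow>
     real \<Rightarrow> ('a \<Rightarrow> real ^ 'n) \<Rightarrow> 'a \<Rightarrow> ('a \<Rightarrow> real ^ 'n option) \<Rightarrow> bool" where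
  "canonical_quadric \<A> \<epsilon> J T c f p g \<longleftrightarrow>
     (\<exists>\<Phi>. rigid_motion J \<Phi> \<and>
       (\<forall>q. \<exists>U F H. open U \<and> simply_connected U \<and> p \<in> U \<and> q \<in> U \<and>
          flat_frame \<A> J T (\<Phi> \<circ> f) U F \<and> F p = mat 1 \<and>
          transformed_frame \<A> U p (unhat_matrix (kappa \<epsilon> c) \<epsilon> J T) F H \<and>
          (\<forall>x\<in>U. g x = column None (H x))))"

end

theory Submission
  imports Defs
begin

text \<open>
  The construction rests on one algebraic fact. In an adapted frame the structure equations of a map
  into a space of curvature \<open>\<delta>\<close> split into the Gauss, Codazzi and Ricci equations. The Codazzi equations
  are linear in the second fundamental form, so they survive scaling it by \<open>\<kappa>\<close>. A flat normal bundle
  says that the quadratic term of the Ricci equations vanishes, so they survive as well. The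
  induced metric has constant curvature \<open>c\<close> precisely if the quadratic term of the Gauss equations is
  \<open>c - \<delta>\<close> times the one of the metric, hence scaling can be compensated by changing the ambient
  curvature to \<open>\<delta>'\<close> with \<open>\<kappa>\<^sup>2 (c - \<delta>) = c - \<delta>'\<close>. For \<open>\<delta> = \<epsilon>\<close> and \<open>\<delta>' = 0\<close> this
  is the number \<open>\<kappa>\<close> of the construction; for the opposite direction it is the inverse. So the transformed form \<open>L (F\<^sup>-\<^sup>1 dF)\<close> is flat
  (\<open>unhat_flat\<close>), and \<open>dH = H L (F\<^sup>-\<^sup>1 dF)\<close> is integrable (\<open>frobenius_local\<close>).

  Both target spaces are treated at once. Flat space is the affine hyperplane where the last
  coordinate is one; its rigid motions are then the linear group of the degenerate form
  \<open>diag(J, 0)\<close> that fixes the last coordinate. The parameter \<open>\<delta>\<close>, which is \<open>\<plusminus>1\<close> for the quadric and \<open>0\<close>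
  for the hyperplane, gives the curvature, the form and the group (\<open>isom_group\<close>).

  To pass from local frames to all of \<open>M\<close>, the product \<open>Q = H F\<^sup>-\<^sup>1\<close> is considered. Changing the frame by a
  gauge transformation changes \<open>F\<close> and \<open>H\<close> in the same way (\<open>solves_gauge\<close>), so \<open>Q\<close> does not depend on the
  frame, and the possible \<open>Q\<close> form a local system. On a simply connected \<open>M\<close> it has a global solution with
  given value at one point (\<open>global_solution\<close>). The transformed map is \<open>Q f\<close>, with adapted frames \<open>Q F\<close>;
  its metric, its normal curvature and its target are read off from their Maurer-Cartan form.
  Uniqueness is that of \<open>Q\<close>: two solutions differ by a constant of the target's isometry group
  (\<open>solutions_congruent\<close>), also if the base points or the normalising isometries are different.

  The literal construction asks, for each point \<open>q\<close>, for one simply connected open set that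
  contains both \<open>q\<close> and the base point and carries a smooth adapted frame. Such sets are found by
  dragging: the points that can be reached form an open and closed set (\<open>framed_closed\<close>).

  Sectional curvature is given through Christoffel symbols. Koszul's formula shows that in a frame
  they are the Maurer-Cartan connection, after which the Gauss equation on nondegenerate planes
  extends by density and polarization (\<open>gauss\<close>).
\<close>

section \<open>Calculus of smooth maps\<close>

abbreviation ddir :: "'v::real_normed_vector => ('v => 'w::real_normed_vector) => 'v => 'w" where
 "ddir v f u \<equiv> frechet_derivative f (at u) v"

lemma frechet_derivative_cong_open:
 assumes "open S" "u : S" "!!x. x : S ==> f x = g x"
 shows "frechet_derivative f (at u) = frechet_derivative g (at u)"
proof -
 have "(f has_derivative D) (at u) \<longleftrightarrow> (g has_derivative D) (at u)" for D
  using has_derivative_transform_within_open[OF _ assms(1,2)] assms(3) by metis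
 then show ?thesis by (simp add: frechet_derivative_def)
qed

lemma differentiable_cong_open:
 assumes "open S" "u : S" "!!x. x : S ==> f x = g x"
 shows "f differentiable (at u) \<longleftrightarrow> g differentiable (at u)"
 using has_derivative_transform_within_open[OF _ assms(1,2)] assms(3)
 unfolding differentiable_def by metis

lemma ddir_eq: "(f has_derivative D) (at u) ==> ddir v f u = D v"
 by (metis frechet_derivative_at)

lemma has_derivative_ddir: "f differentiable (at u) ==> (f has_derivative (%v. ddir v f u)) (at u)"
 by (simp add: frechet_derivative_works[symmetric])

lemma linear_ddir: "f differentiable (at u) ==> linear (%v. ddir v f u)"
 using has_derivative_ddir has_derivative_linear by blast

lemma Ck_on_cong:
 assumes "open S" "!!x. x : S ==> f x = g x" "Ck_on k S f"
 shows "Ck_on k S g"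
 using assms(2,3)
proof (induction k arbitrary: f g)
 case 0
 then have "continuous_on S f" "!!x. x : S ==> f x = g x" by auto
 then have "continuous_on S g" by (rule continuous_on_eq)
 then show ?case by simp
next
 case (Suc k)
 have "g differentiable (at u)" if "u : S" for u
 proof -
  have "f differentiable (at u)" using Suc.prems that by simp
  then show ?thesis using differentiable_cong_open[OF assms(1) that, of f g] Suc.prems(1) by simp
 qed
 moreover have "Ck_on k S (ddir v g)" for v
 proof (rule Suc.IH[of "ddir v f"])
  show "ddir v f x = ddir v g x" if "x : S" for x
   using frechet_derivative_cong_open[OF assms(1) that, of f g] Suc.prems(1) by simp
  show "Ck_on k S (ddir v f)" using Suc.prems(2) by simp
 qed
 ultimately show ?case by simp
qed

lemma Ck_on_subset: "Ck_on k S f ==> T \<subseteq> S ==> Ck_on k T f"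
 by (induction k arbitrary: f) (auto intro: continuous_on_subset)

lemma Ck_on_imp_continuous: "Ck_on k S f ==> continuous_on S f"
 by (cases k) (auto intro!: continuous_at_imp_continuous_on differentiable_imp_continuous_within)

lemma Ck_on_SucD: "Ck_on (Suc k) S f ==> Ck_on k S f"
proof (induction k arbitrary: f)
 case 0
 then show ?case using Ck_on_imp_continuous by (metis Ck_on.simps(1))
next
 case (Suc k)
 show ?case using Suc.prems Suc.IH
  by (subst Ck_on.simps(2)) (metis Ck_on.simps(2))
qed

lemma Ck_on_SucI:
 assumes "open S" "!!u. u : S ==> (f has_derivative D u) (at u)"
  "!!v. Ck_on k S (%u. D u v)"
 shows "Ck_on (Suc k) S f"
proof -
 have "Ck_on k S (ddir v f)" for v
  by (rule Ck_on_cong[OF assms(1) _ assms(3)[of v]]) (metis assms(2) frechet_derivative_at)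
 then show ?thesis using assms(2) by (auto simp: differentiable_def)
qed

lemma Ck_on_const: "Ck_on k S (%u. c)"
proof (induction k arbitrary: c)
 case (Suc k)
 have "frechet_derivative (%u. c) (at u) = (%v. 0)" for u
  by (metis frechet_derivative_at has_derivative_const)
 then show ?case using Suc by simp
qed simp

lemma Ck_on_bounded_linear:
 assumes "bounded_linear L" "open S" "Ck_on k S f"
 shows "Ck_on k S (%u. L (f u))"
 using assms(3)
proof (induction k arbitrary: f)
 case 0
 then show ?case using assms(1) by (simp add: bounded_linear.continuous_on)
next
 case (Suc k)
 show ?case
 proof (rule Ck_on_SucI[OF assms(2), where D="%u v. L (ddir v f u)"])
  show "((%u. L (f u)) has_derivative (%v. L (ddir v f u))) (at u)" if "u : S" for u
   using bounded_linear.has_derivative[OF assms(1)] has_derivative_ddir Suc.prems that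
   by (metis Ck_on.simps(2))
 qed (use Suc in auto)
qed

lemma Ck_on_add:
 assumes "open S" "Ck_on k S f" "Ck_on k S g"
 shows "Ck_on k S (%u. f u + g u)"
 using assms(2,3)
proof (induction k arbitrary: f g)
 case 0
 then show ?case by (simp add: continuous_on_add)
next
 case (Suc k)
 show ?case
 proof (rule Ck_on_SucI[OF assms(1), where D="%u v. ddir v f u + ddir v g u"])
  show "((%u. f u + g u) has_derivative (%v. ddir v f u + ddir v g u)) (at u)" if "u : S" for u
   using Suc.prems that by (auto intro!: has_derivative_add has_derivative_ddir)
 qed (use Suc in auto)
qed

lemma Ck_on_bilinear:
 assumes "bounded_bilinear B" "open S" "Ck_on k S f" "Ck_on k S g"
 shows "Ck_on k S (%u. B (f u) (g u))"
 using assms(3,4)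
proof (induction k arbitrary: f g)
 case 0
 then show ?case using assms(1) by (simp add: bounded_bilinear.continuous_on)
next
 case (Suc k)
 show ?case
 proof (rule Ck_on_SucI[OF assms(2), where D="%u v. B (f u) (ddir v g u) + B (ddir v f u) (g u)"])
  show "((%u. B (f u) (g u)) has_derivative (%v. B (f u) (ddir v g u) + B (ddir v f u) (g u))) (at u)"
   if "u : S" for u
   using Suc.prems that by (auto intro!: bounded_bilinear.FDERIV[OF assms(1)] has_derivative_ddir)
  have "Ck_on k S f" "Ck_on k S g" "Ck_on k S (ddir v f)" "Ck_on k S (ddir v g)" for v
   using Suc.prems Ck_on_SucD by (blast, blast, auto)
  then show "Ck_on k S (%u. B (f u) (ddir v g u) + B (ddir v f u) (g u))" for v
   by (intro Ck_on_add[OF assms(2)] Suc.IH)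
 qed
qed

lemma Ck_on_sum:
 assumes "open S" "!!i. i : I ==> Ck_on k S (f i)"
 shows "Ck_on k S (%u. SUM i:I. f i u)"
proof (cases "finite I")
 case True
 then show ?thesis using assms(2)
  by (induction I) (auto intro!: Ck_on_const Ck_on_add[OF assms(1)])
qed (simp add: Ck_on_const)

lemma Ck_on_compose:
 fixes f :: "'v::euclidean_space => 'w::real_normed_vector" and g :: "'x::euclidean_space => 'v"
 assumes "open S" "open T" "Ck_on k T f" "Ck_on k S g" "g ` S \<subseteq> T"
 shows "Ck_on k S (%u. f (g u))"
 using assms(3,4)
proof (induction k arbitrary: f)
 case 0
 then show ?case using assms(5) continuous_on_compose2 by auto
next
 case (Suc k)
 show ?case
 proof (rule Ck_on_SucI[OF assms(1), where D="%u v. SUM b:Basis. (ddir v g u \<bullet> b) *\<^sub>R ddir b f (g u)"])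
  show "((%u. f (g u)) has_derivative (%v. SUM b:Basis. (ddir v g u \<bullet> b) *\<^sub>R ddir b f (g u))) (at u)"
   if "u : S" for u
  proof -
   have f: "f differentiable (at (g u))" using Suc.prems(1) assms(5) that by auto
   have "((%u. f (g u)) has_derivative (%v. ddir (ddir v g u) f (g u))) (at u)"
    using Suc.prems that by (auto intro!: has_derivative_compose[OF has_derivative_ddir has_derivative_ddir] f)
   moreover have "ddir (ddir v g u) f (g u) = (SUM b:Basis. (ddir v g u \<bullet> b) *\<^sub>R ddir b f (g u))" for v
   proof -
    have "ddir (ddir v g u) f (g u) = ddir (SUM b:Basis. (ddir v g u \<bullet> b) *\<^sub>R b) f (g u)"
     by (simp add: euclidean_representation)
    then show ?thesis
     using linear_ddir[OF f] by (simp add: linear_sum linear_cmul)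
   qed
   ultimately show ?thesis by simp
  qed
  show "Ck_on k S (%u. SUM b:Basis. (ddir v g u \<bullet> b) *\<^sub>R ddir b f (g u))" for v
  proof (intro Ck_on_sum assms Ck_on_bilinear[OF bounded_bilinear_scaleR])
   show "Ck_on k S (%u. ddir v g u \<bullet> b)" for b
    using Suc.prems by (intro Ck_on_bounded_linear[OF bounded_linear_inner_left] assms) auto
   show "Ck_on k S (%u. ddir b f (g u))" for b
    by (rule Suc.IH) (use Suc.prems(1) Ck_on_SucD[OF Suc.prems(2)] in auto)
  qed
 qed
qed

lemma Ck_on_local:
 assumes "!!u. u : S ==> EX T. open T & u : T & Ck_on k T f"
 shows "Ck_on k S f"
 using assms
proof (induction k arbitrary: f)
 case 0
 then show ?case
  by (auto intro!: continuous_at_imp_continuous_on simp: continuous_on_eq_continuous_at) 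
   (metis continuous_on_eq_continuous_at)
next
 case (Suc k)
 have "f differentiable (at u)" if u: "u : S" for u
 proof -
  obtain T where "open T" "u : T" "Ck_on (Suc k) T f" using Suc.prems[OF u] by blast
  then show ?thesis by simp
 qed
 moreover have "Ck_on k S (ddir v f)" for v
 proof (rule Suc.IH)
  fix u assume u: "u : S"
  obtain T where "open T" "u : T" "Ck_on (Suc k) T f" using Suc.prems[OF u] by blast
  then have "open T & u : T & Ck_on k T (ddir v f)" by simp
  then show "EX T. open T & u : T & Ck_on k T (ddir v f)" ..
 qed
 ultimately show ?case by simp
qed

lemma smooth_on_cong: "open S ==> (!!x. x : S ==> f x = g x) ==> smooth_on S f ==> smooth_on S g"
 unfolding smooth_on_def using Ck_on_cong by metis

lemma smooth_on_subset: "smooth_on S f ==> T \<subseteq> S ==> smooth_on T f"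
 unfolding smooth_on_def using Ck_on_subset by metis

lemma smooth_on_local:
 "(!!u. u : S ==> EX T. open T & u : T & smooth_on T f) ==> smooth_on S f"
 unfolding smooth_on_def using Ck_on_local by metis

lemma smooth_on_const [simp]: "smooth_on S (%u. c)"
 by (simp add: smooth_on_def Ck_on_const)

lemma smooth_on_ident [simp]: "open S ==> smooth_on S (%u. u)"
 unfolding smooth_on_def
proof
 fix k show "open S ==> Ck_on k S (%u. u)"
  by (cases k) (auto intro!: Ck_on_SucI[where D="%u v. v"] simp: Ck_on_const simp del: Ck_on.simps(2))
qed

lemma smooth_on_bounded_linear:
 "bounded_linear L ==> open S ==> smooth_on S f ==> smooth_on S (%u. L (f u))"
 by (simp add: smooth_on_def Ck_on_bounded_linear)

lemma smooth_on_add: "open S ==> smooth_on S f ==> smooth_on S g ==> smooth_on S (%u. f u + g u)"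
 by (simp add: smooth_on_def Ck_on_add)

lemma smooth_on_bilinear: "bounded_bilinear B ==> open S ==> smooth_on S f ==> smooth_on S g ==>
 smooth_on S (%u. B (f u) (g u))"
 by (simp add: smooth_on_def Ck_on_bilinear)

lemma smooth_on_sum: "open S ==> (!!i. i : I ==> smooth_on S (f i)) ==> smooth_on S (%u. SUM i:I. f i u)"
 by (simp add: smooth_on_def Ck_on_sum)

lemma smooth_on_compose: "open S ==> open T ==> smooth_on T f ==> smooth_on S g ==> g ` S \<subseteq> T ==>
 smooth_on S (%u. f (g u))"
 unfolding smooth_on_def using Ck_on_compose by blast

lemma smooth_on_ddir: "smooth_on S f ==> smooth_on S (ddir v f)"
 unfolding smooth_on_def using Ck_on.simps(2) by blast

lemma smooth_on_differentiable: "smooth_on S f ==> u : S ==> f differentiable (at u)"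
 unfolding smooth_on_def using Ck_on.simps(2) by blast

lemma smooth_on_has_derivative: "smooth_on S f ==> u : S ==> (f has_derivative (%v. ddir v f u)) (at u)"
 by (simp add: has_derivative_ddir smooth_on_differentiable)

lemma smooth_on_continuous: "smooth_on S f ==> continuous_on S f"
 unfolding smooth_on_def using Ck_on_imp_continuous by blast

lemma smooth_on_mult: 
 fixes f g :: "'v::euclidean_space => real"
 shows "open S ==> smooth_on S f ==> smooth_on S g ==> smooth_on S (%u. f u * g u)"
 by (rule smooth_on_bilinear[OF bounded_bilinear_mult])

lemma smooth_on_scaleR: 
 "open S ==> smooth_on S f ==> smooth_on S g ==> smooth_on S (%u. f u *\<^sub>R g u)"
 by (rule smooth_on_bilinear[OF bounded_bilinear_scaleR])

lemma smooth_on_minus: "open S ==> smooth_on S f ==> smooth_on S (%u. - f u)"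
 by (rule smooth_on_bounded_linear[OF bounded_linear_minus[OF bounded_linear_ident]])

lemma smooth_on_diff: "open S ==> smooth_on S f ==> smooth_on S g ==> smooth_on S (%u. f u - g u)"
 using smooth_on_add[of S f "%u. - g u"] smooth_on_minus[of S g] by simp

lemma smooth_on_prod:
 fixes f :: "'i => 'v::euclidean_space => real"
 assumes "open S" "!!i. i : I ==> smooth_on S (f i)"
 shows "smooth_on S (%u. \<Prod>i\<in>I. f i u)"
proof (cases "finite I")
 case True
 then show ?thesis using assms(2)
  by (induction I) (auto intro!: smooth_on_mult[OF assms(1)])
qed simp

lemma smooth_on_vec_nth: "open S ==> smooth_on S f ==> smooth_on S (%u. f u $ i)"
 by (rule smooth_on_bounded_linear[OF bounded_linear_vec_nth])

lemma smooth_on_vec_lambda: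
 fixes f :: "'i::finite => 'v::euclidean_space => 'w::real_normed_vector"
 assumes "open S" "!!i. smooth_on S (f i)"
 shows "smooth_on S (%u. \<chi> i. f i u)"
proof -
 have bl: "bounded_linear (%w::'w. (\<chi> j. if j = i then w else 0) :: 'w ^ 'i)" for i
 proof (rule bounded_linear_intro[where K=1])
  fix w :: 'w
  have "norm ((\<chi> j. if j = i then w else 0) :: 'w ^ 'i) = L2_set (%j. if j = i then norm w else 0) UNIV"
   by (simp add: norm_vec_def if_distrib[of norm] cong: if_cong)
  also have "\<dots> = norm w" by (simp add: L2_set_def if_distrib[of "%x. x ^ 2"] cong: if_cong)
  finally show "norm ((\<chi> j. if j = i then w else 0) :: 'w ^ 'i) <= norm w * 1" by simp
 qed (auto simp: vec_eq_iff)
 have "(\<chi> i. f i u) = (SUM i:UNIV. (\<chi> j. if j = i then f i u else 0))" for u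
  by (simp add: vec_eq_iff)
 then show ?thesis
  by (simp only:) (intro smooth_on_sum smooth_on_bounded_linear[OF bl] assms)
qed

lemma matrix_mult_add_left: "(A + B) ** C = A ** C + B ** C"
 for A B :: "real ^ 'n::finite ^ 'm::finite" and C :: "real ^ 'p::finite ^ 'n"
 by (vector matrix_matrix_mult_def sum.distrib[symmetric] field_simps)

lemma matrix_inv_right: "invertible A ==> A ** matrix_inv A = mat 1"
 and matrix_inv_left: "invertible A ==> matrix_inv A ** A = mat 1"
 for A :: "real ^ 'n::finite ^ 'n"
 unfolding matrix_inv_def invertible_def by (metis (mono_tags, lifting) someI_ex)+

lemma bounded_bilinear_matrix_mult:
 "bounded_bilinear ((**) :: real ^ 'n::finite ^ 'm::finite => real ^ 'p::finite ^ 'n => real ^ 'p ^ 'm)"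
 by (rule bilinear_conv_bounded_bilinear[THEN iffD1])
  (auto simp: bilinear_def matrix_add_ldistrib matrix_mult_add_left matrix_scalar_ac
   scalar_matrix_assoc intro!: linearI)

lemma smooth_on_matrix_mult:
 fixes A :: "'v::euclidean_space => real ^ 'n::finite ^ 'm::finite"
  and B :: "'v => real ^ 'p::finite ^ 'n"
 shows "open S ==> smooth_on S A ==> smooth_on S B ==> smooth_on S (%u. A u ** B u)"
 by (rule smooth_on_bilinear[OF bounded_bilinear_matrix_mult])

lemma Ck_on_real_inverse: "Ck_on k (-{0}) (inverse :: real => real)"
proof (induction k)
 case 0
 then show ?case by (auto intro!: continuous_intros)
next
 case (Suc k)
 have o: "open (-{0::real})" by auto
 show ?case
 proof (rule Ck_on_SucI[OF o, where D="%u v. v * (- (inverse u * inverse u))"])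
  show "((inverse :: real => real) has_derivative (%v. v * (- (inverse u * inverse u)))) (at u)"
   if "u : -{0}" for u :: real
   using that by (auto intro!: derivative_eq_intros simp: algebra_simps)
  show "Ck_on k (- {0}) (%u. v * - (inverse u * inverse u))" for v :: real
   by (intro Ck_on_bilinear[OF bounded_bilinear_mult o] Ck_on_const Suc
     Ck_on_bounded_linear[OF bounded_linear_minus[OF bounded_linear_ident] o])
 qed
qed

lemma smooth_on_inverse:
 fixes f :: "'v::euclidean_space => real"
 assumes "open S" "smooth_on S f" "!!u. u : S ==> f u ~= 0"
 shows "smooth_on S (%u. inverse (f u))"
 by (rule smooth_on_compose[OF assms(1) _ _ assms(2), of "-{0}" inverse])
  (use assms(3) Ck_on_real_inverse in \<open>auto simp: smooth_on_def\<close>)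

lemma Ck_on_real_sqrt: "Ck_on k {0<..} sqrt"
proof (induction k)
 case 0
 then show ?case by (auto intro!: continuous_intros)
next
 case (Suc k)
 show ?case
 proof (rule Ck_on_SucI[OF open_greaterThan, where D="%u v. v * (inverse (sqrt u) * (1/2))"])
  show "(sqrt has_derivative (%v. v * (inverse (sqrt u) * (1/2)))) (at u)" if "u : {0<..}" for u
   using that by (auto intro!: derivative_eq_intros simp: field_simps)
  show "Ck_on k {0<..} (%u. v * (inverse (sqrt u) * (1/2)))" for v :: real
   by (intro Ck_on_bilinear[OF bounded_bilinear_mult] Ck_on_const open_greaterThan
     Ck_on_compose[OF _ _ Ck_on_real_inverse Suc]) auto
 qed
qed

lemma smooth_on_sqrt:
 fixes f :: "'v::euclidean_space => real"
 assumes "open S" "smooth_on S f" "!!u. u : S ==> f u > 0"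
 shows "smooth_on S (%u. sqrt (f u))"
 by (rule smooth_on_compose[OF assms(1) _ _ assms(2), of "{0<..}" sqrt])
  (use assms(3) Ck_on_real_sqrt in \<open>auto simp: smooth_on_def\<close>)

lemma smooth_on_det:
 fixes A :: "'v::euclidean_space => real ^ 'n::finite ^ 'n"
 assumes "open S" "!!i j. smooth_on S (%u. A u $ i $ j)"
 shows "smooth_on S (%u. det (A u))"
 unfolding det_def by (intro smooth_on_sum smooth_on_mult smooth_on_prod assms smooth_on_const)

text \<open>Cramer's rule writes the entries of the inverse as quotients of determinants, so no
 differentiability of matrix inversion itself is needed.\<close>

lemma smooth_on_matrix_inv:
 fixes A :: "'v::euclidean_space => real ^ 'n::finite ^ 'n"
 assumes "open S" "smooth_on S A" "!!u. u : S ==> invertible (A u)"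
 shows "smooth_on S (%u. matrix_inv (A u))"
proof (rule smooth_on_cong[OF assms(1)])
 let ?C = "%u k l. \<chi> i j. if j = k then axis l 1 $ i else A u $ i $ j"
 have A: "smooth_on S (%u. A u $ i $ j)" for i j
  by (rule smooth_on_vec_nth[OF assms(1) smooth_on_vec_nth[OF assms(1,2)]])
 show "smooth_on S (%u. \<chi> k. \<chi> l. det (?C u k l) * inverse (det (A u)))"
 proof (intro smooth_on_vec_lambda assms(1) smooth_on_mult smooth_on_inverse smooth_on_det A)
  show "smooth_on S (%u. ?C u k l $ i $ j)" for k l i j
   using A by (cases "j = k") auto
 qed (use assms invertible_det_nz in auto)
 fix u assume u: "u : S"
 have "A u *v (matrix_inv (A u) *v axis l 1) = axis l 1" for l
  using assms(3)[OF u] by (simp add: matrix_vector_mul_assoc matrix_inv_right)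
 then have "matrix_inv (A u) *v axis l 1 = (\<chi> k. det (?C u k l) / det (A u))" for l
  using cramer[of "A u"] assms(3)[OF u] invertible_det_nz by blast
 then have "(matrix_inv (A u) *v axis l 1) $ k = det (?C u k l) / det (A u)" for k l by simp
 then show "(\<chi> k l. det (?C u k l) * inverse (det (A u))) = matrix_inv (A u)"
  by (simp add: vec_eq_iff matrix_vector_mul_component inner_axis divide_inverse)
qed

text \<open>Schwarz: both iterated derivatives are limits of the same second difference quotient.\<close>

lemma ddir_commute_real:
 fixes f :: "'v::euclidean_space => real" and v w :: 'v
 assumes "open S" "smooth_on S f" "u : S"
 shows "ddir w (ddir v f) u = ddir v (ddir w f) u"
proof -
 have mean: "EX x:cball u e. f (u + t *\<^sub>R a + t *\<^sub>R b) - f (u + t *\<^sub>R a) - f (u + t *\<^sub>R b) + f u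
    = t * t * ddir b (ddir a f) x"
  if e: "cball u e \<subseteq> S" and t: "t > 0" "t * (norm a + norm b) <= e" for a b e t
 proof -
  have inS: "u + r *\<^sub>R a + s *\<^sub>R b : cball u e" if "0 <= r" "r <= t" "0 <= s" "s <= t" for r s
  proof -
   have "norm (r *\<^sub>R a + s *\<^sub>R b) <= r * norm a + s * norm b"
    using norm_triangle_ineq[of "r *\<^sub>R a" "s *\<^sub>R b"] that by simp
   also have "\<dots> <= t * norm a + t * norm b"
    using that by (intro add_mono mult_right_mono) auto
   finally have "norm (r *\<^sub>R a + s *\<^sub>R b) <= e" using t by (simp add: algebra_simps)
   then show ?thesis
    by (metis add.assoc add_diff_cancel_left' dist_commute dist_norm mem_cball)
  qed
  define g where "g r = f (u + r *\<^sub>R a + t *\<^sub>R b) - f (u + r *\<^sub>R a)" for r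
  have dg: "(g has_derivative (%h. h * (ddir a f (u + r *\<^sub>R a + t *\<^sub>R b) - ddir a f (u + r *\<^sub>R a)))) (at r)"
   if r: "0 <= r" "r <= t" for r
  proof -
   have 1: "((%r. f (u + r *\<^sub>R a + s *\<^sub>R b)) has_derivative (%h. ddir (h *\<^sub>R a) f (u + r *\<^sub>R a + s *\<^sub>R b))) (at r)"
    if "0 <= s" "s <= t" for s
   proof (rule has_derivative_compose[where f="%r. u + r *\<^sub>R a + s *\<^sub>R b"])
    show "((%r. u + r *\<^sub>R a + s *\<^sub>R b) has_derivative (%h. h *\<^sub>R a)) (at r)"
     by (auto intro!: derivative_eq_intros)
   qed (use inS[OF r that] e assms(2) smooth_on_has_derivative in blast)
   have lin: "ddir (h *\<^sub>R a) f x = h * ddir a f x" if "x : S" for h x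
    using linear_cmul[OF linear_ddir[OF smooth_on_differentiable[OF assms(2) that]]] by simp
   show ?thesis unfolding g_def
    using has_derivative_diff[OF 1[of t] 1[of 0]] inS[OF r, of t] inS[OF r, of 0] t e lin
    by (simp add: subset_iff algebra_simps)
  qed
  obtain r where r: "0 < r" "r < t"
   "g t - g 0 = t * (ddir a f (u + r *\<^sub>R a + t *\<^sub>R b) - ddir a f (u + r *\<^sub>R a))"
  proof -
   have "\<exists>z>0. z < t & g t - g 0 = (t - 0) * (ddir a f (u + z *\<^sub>R a + t *\<^sub>R b) - ddir a f (u + z *\<^sub>R a))"
    by (rule MVT2[OF t(1)]) (use dg in \<open>auto simp: has_field_derivative_def mult_commute_abs\<close>)
   then show ?thesis using that by auto
  qed
  define k where "k s = ddir a f (u + r *\<^sub>R a + s *\<^sub>R b)" for s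
  have dk: "(k has_derivative (%h. h * ddir b (ddir a f) (u + r *\<^sub>R a + s *\<^sub>R b))) (at s)"
   if s: "0 <= s" "s <= t" for s
  proof -
   have x: "u + r *\<^sub>R a + s *\<^sub>R b : S" using inS[of r s] r s e by auto
   have sm: "smooth_on S (ddir a f)" by (rule smooth_on_ddir[OF assms(2)])
   have "(k has_derivative (%h. ddir (h *\<^sub>R b) (ddir a f) (u + r *\<^sub>R a + s *\<^sub>R b))) (at s)"
    unfolding k_def
   proof (rule has_derivative_compose[where f="%s. u + r *\<^sub>R a + s *\<^sub>R b"])
    show "((%s. u + r *\<^sub>R a + s *\<^sub>R b) has_derivative (%h. h *\<^sub>R b)) (at s)"
     by (auto intro!: derivative_eq_intros)
   qed (use x sm smooth_on_has_derivative in blast)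
   then show ?thesis
    using linear_cmul[OF linear_ddir[OF smooth_on_differentiable[OF sm x]]] by simp
  qed
  have "\<exists>z>0. z < t & k t - k 0 = (t - 0) * ddir b (ddir a f) (u + r *\<^sub>R a + z *\<^sub>R b)"
   by (rule MVT2[OF t(1)]) (use dk in \<open>auto simp: has_field_derivative_def mult_commute_abs\<close>)
  then obtain s where s: "0 < s" "s < t" "k t - k 0 = t * ddir b (ddir a f) (u + r *\<^sub>R a + s *\<^sub>R b)"
   by auto
  have "f (u + t *\<^sub>R a + t *\<^sub>R b) - f (u + t *\<^sub>R a) - f (u + t *\<^sub>R b) + f u = g t - g 0"
   by (simp add: g_def)
  also have "\<dots> = t * (k t - k 0)" using r by (simp add: k_def)
  also have "\<dots> = t * t * ddir b (ddir a f) (u + r *\<^sub>R a + s *\<^sub>R b)" using s by simp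
  finally show ?thesis using inS[of r s] r s by (metis less_imp_le)
 qed
 let ?p = "ddir w (ddir v f)" and ?q = "ddir v (ddir w f)"
 have cont: "isCont ?p u" "isCont ?q u"
  using assms smooth_on_continuous[OF smooth_on_ddir[OF smooth_on_ddir[OF assms(2)]]]
  by (auto simp: continuous_on_eq_continuous_at)
 have small: "\<bar>?p u - ?q u\<bar> <= e" if "e > 0" for e
 proof -
  obtain d1 where d1: "d1 > 0" "!!x. dist x u < d1 ==> dist (?p x) (?p u) < e/2"
   using cont(1) \<open>e > 0\<close> unfolding continuous_at_eps_delta by (metis half_gt_zero)
  obtain d2 where d2: "d2 > 0" "!!x. dist x u < d2 ==> dist (?q x) (?q u) < e/2"
   using cont(2) \<open>e > 0\<close> unfolding continuous_at_eps_delta by (metis half_gt_zero)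
  obtain d3 where d3: "d3 > 0" "cball u d3 \<subseteq> S" using assms open_contains_cball by blast
  define d where "d = min (min d1 d2 / 2) d3"
  have d: "d > 0" "d < d1" "d < d2" "cball u d \<subseteq> S"
   using d1 d2 d3 by (auto simp: d_def)
  define t where "t = d / (norm v + norm w + 1)"
  have t: "t > 0" "t * (norm v + norm w) <= d" "t * (norm w + norm v) <= d"
   using d by (auto simp: t_def field_simps add_pos_nonneg add_nonneg_pos)
  obtain x where x: "x : cball u d" "f (u + t *\<^sub>R v + t *\<^sub>R w) - f (u + t *\<^sub>R v) - f (u + t *\<^sub>R w) + f u = t * t * ?p x"
   using mean[OF d(4) t(1,2)] by blast
  obtain y where y: "y : cball u d" "f (u + t *\<^sub>R w + t *\<^sub>R v) - f (u + t *\<^sub>R w) - f (u + t *\<^sub>R v) + f u = t * t * ?q y"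
   using mean[OF d(4) t(1,3)] by blast
  have "t * t * ?p x = t * t * ?q y" using x(2) y(2) by (simp add: algebra_simps)
  then have "?p x = ?q y" using t(1) by simp
  moreover have "dist (?p x) (?p u) < e/2" "dist (?q y) (?q u) < e/2"
   using d1(2)[of x] d2(2)[of y] x(1) y(1) d by (auto simp: dist_commute)
  ultimately show ?thesis by (simp add: dist_real_def abs_if split: if_splits)
 qed
 then have "\<bar>?p u - ?q u\<bar> <= 0" by (rule field_le_epsilon) (simp only: add_0 small)
 then show ?thesis by simp
qed

lemma ddir_bounded_linear:
 assumes "bounded_linear L" "f differentiable (at u)"
 shows "ddir v (%u. L (f u)) u = L (ddir v f u)"
 by (rule ddir_eq) (use bounded_linear.has_derivative[OF assms(1)] has_derivative_ddir[OF assms(2)] in blast)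

lemma ddir_commute:
 fixes f :: "'v::euclidean_space => 'w::euclidean_space" and v w :: 'v
 assumes "open S" "smooth_on S f" "u : S"
 shows "ddir w (ddir v f) u = ddir v (ddir w f) u"
proof (rule euclidean_eqI)
 fix b :: 'w
 have 1: "ddir a (%x. f x \<bullet> b) x = ddir a f x \<bullet> b" if "x : S" for a x
  by (rule ddir_bounded_linear[OF bounded_linear_inner_left]) (rule smooth_on_differentiable[OF assms(2) that])
 have 2: "ddir c (ddir a (%x. f x \<bullet> b)) u = ddir c (ddir a f) u \<bullet> b" for a c
 proof -
  have "ddir c (ddir a (%x. f x \<bullet> b)) u = ddir c (%x. ddir a f x \<bullet> b) u"
   using frechet_derivative_cong_open[OF assms(1,3), of "ddir a (%x. f x \<bullet> b)" "%x. ddir a f x \<bullet> b"] 1 by simp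
  also have "\<dots> = ddir c (ddir a f) u \<bullet> b"
   by (rule ddir_bounded_linear[OF bounded_linear_inner_left])
    (rule smooth_on_differentiable[OF smooth_on_ddir[OF assms(2)] assms(3)])
  finally show ?thesis .
 qed
 show "ddir w (ddir v f) u \<bullet> b = ddir v (ddir w f) u \<bullet> b"
  using ddir_commute_real[OF assms(1) smooth_on_bounded_linear[OF bounded_linear_inner_left[of b] assms(1,2)] assms(3), where w=w and v=v]
  by (simp add: 2)
qed

text \<open>The derivatives of \<open>exp (-1 / t)\<close>, extended by zero, are combinations of the functions
 \<open>t\<^sup>-\<^sup>n exp (-1 / t)\<close>; so it is this whole family whose smoothness is shown by induction.\<close>

definition flat_exp :: "nat => real => real" where
 "flat_exp n t = (if t > 0 then inverse t ^ n * exp (- inverse t) else 0)"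

lemma flat_exp_tendsto: "(flat_exp n \<longlongrightarrow> 0) (at 0)"
proof (rule filterlim_split_at)
 have "((%x. x ^ n / exp x) \<longlongrightarrow> (0::real)) at_top" by (rule tendsto_power_div_exp_0)
 from filterlim_compose[OF this filterlim_inverse_at_top_right]
 have "((%t. inverse t ^ n / exp (inverse t)) \<longlongrightarrow> (0::real)) (at_right 0)" .
 then show "(flat_exp n \<longlongrightarrow> 0) (at_right 0)"
  by (rule Lim_transform_eventually)
   (auto simp: flat_exp_def exp_minus divide_inverse eventually_at_filter)
 have "((%t. 0) \<longlongrightarrow> (0::real)) (at_left 0)" by simp
 then show "(flat_exp n \<longlongrightarrow> 0) (at_left 0)"
  by (rule Lim_transform_eventually) (auto simp: flat_exp_def eventually_at_filter)
qed

lemma flat_exp_has_derivative: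
 "(flat_exp n has_real_derivative (flat_exp (n + 2) t - n * flat_exp (n + 1) t)) (at t)"
proof -
 consider "t > 0" | "t < 0" | "t = 0" by linarith
 then show ?thesis
 proof cases
  case 1
  have pw: "k ~= 0 ==> t * t ^ (k - Suc 0) = t ^ k" for k by (cases k) auto
  have "((%t. inverse t ^ n * exp (- inverse t)) has_real_derivative
    (flat_exp (n + 2) t - n * flat_exp (n + 1) t)) (at t)"
   using 1
   by (cases n; auto intro!: derivative_eq_intros simp: flat_exp_def field_simps power2_eq_square; metis pw)
  then show ?thesis
   by (rule has_field_derivative_transform_within_open[where S="{0<..}"]) (use 1 in \<open>auto simp: flat_exp_def\<close>)
 next
  case 2
  have "((%t. 0) has_real_derivative 0) (at t)" by simp
  then have "(flat_exp n has_real_derivative 0) (at t)"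
   by (rule has_field_derivative_transform_within_open[where S="{..<0}"]) (use 2 in \<open>auto simp: flat_exp_def\<close>)
  then show ?thesis using 2 by (simp add: flat_exp_def)
 next
  case 3
  have "((%h. (flat_exp n (0 + h) - flat_exp n 0) / h) \<longlongrightarrow> 0) (at 0)"
   by (rule Lim_transform_eventually[OF flat_exp_tendsto[of "Suc n"]])
    (auto simp: flat_exp_def eventually_at_filter divide_inverse)
  then show ?thesis using 3 by (simp add: DERIV_def flat_exp_def)
 qed
qed

lemma smooth_on_flat_exp: "smooth_on UNIV (flat_exp n)"
proof -
 have "Ck_on k UNIV (flat_exp n)" for k
 proof (induction k arbitrary: n)
  case 0
  show ?case unfolding Ck_on.simps by (rule DERIV_continuous_on[OF flat_exp_has_derivative])
 next
  case (Suc k)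
  show ?case
  proof (rule Ck_on_SucI[where D="%u v. v * (flat_exp (n + 2) u + (- n) * flat_exp (n + 1) u)"])
   show "(flat_exp n has_derivative (%v. v * (flat_exp (n + 2) u + (- n) * flat_exp (n + 1) u))) (at u)" for u
    using flat_exp_has_derivative[of n u] by (simp add: has_field_derivative_def mult_commute_abs)
   show "Ck_on k UNIV (%u. v * (flat_exp (n + 2) u + (- n) * flat_exp (n + 1) u))" for v
    by (intro Ck_on_bilinear[OF bounded_bilinear_mult] Ck_on_add Ck_on_const Suc open_UNIV)
  qed simp
 qed
 then show ?thesis by (simp add: smooth_on_def)
qed

text \<open>Besides the bump itself, a Lipschitz constant is recorded: it makes \<open>u + \<beta> u *\<^sub>R w\<close> invertible
 for short vectors \<open>w\<close>.\<close>

lemma smooth_bump: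
 fixes a :: "'v::euclidean_space"
 assumes "r > 0"
 obtains \<beta> :: "'v => real" and L where "smooth_on UNIV \<beta>" "\<beta> a = 1" "!!x. r <= dist a x ==> \<beta> x = 0"
  "L > 0" "!!x y. \<bar>\<beta> x - \<beta> y\<bar> <= L * norm (x - y)"
proof -
 define b where "b = (%x. flat_exp 0 (r\<^sup>2 - (x - a) \<bullet> (x - a)))"
 define \<beta> where "\<beta> = (%x. inverse (flat_exp 0 (r\<^sup>2)) * b x)"
 have pos: "flat_exp 0 (r\<^sup>2) > 0" using assms by (simp add: flat_exp_def)
 have "smooth_on UNIV b"
  unfolding b_def
  by (rule smooth_on_compose[OF open_UNIV open_UNIV smooth_on_flat_exp])
   (auto intro!: smooth_on_diff smooth_on_bilinear[OF bounded_bilinear_inner])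
 then have sm: "smooth_on UNIV \<beta>"
  unfolding \<beta>_def by (intro smooth_on_mult) auto
 have out: "\<beta> x = 0" if "r <= dist a x" for x
 proof -
  have "r\<^sup>2 <= (x - a) \<bullet> (x - a)"
   using that assms by (simp add: dist_norm norm_minus_commute power2_norm_eq_inner[symmetric] power_mono)
  then show ?thesis by (simp add: \<beta>_def b_def flat_exp_def)
 qed
 have dout: "ddir v \<beta> x = 0" if "r < dist a x" for v x
 proof -
  have "frechet_derivative \<beta> (at x) = frechet_derivative (%x. 0) (at x)"
   by (rule frechet_derivative_cong_open[of "- cball a r"]) (use that out in auto)
  then show ?thesis by simp
 qed
 have "\<exists>C>0. ALL x. \<bar>ddir i \<beta> x\<bar> <= C" for i
 proof -
  have "compact (ddir i \<beta> ` cball a r)"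
   by (rule compact_continuous_image[OF continuous_on_subset[OF smooth_on_continuous[OF smooth_on_ddir[OF sm]]]]) auto
  then obtain C where C: "C > 0" "!!x. x : cball a r ==> norm (ddir i \<beta> x) <= C"
   using bounded_pos[of "ddir i \<beta> ` cball a r"] compact_imp_bounded by auto
  then have "\<bar>ddir i \<beta> x\<bar> <= C" for x
   using dout[where v=i and x=x] C by (cases "x : cball a r") auto
  then show ?thesis using C by blast
 qed
 then obtain C where C: "!!i. C i > 0" "!!i x. \<bar>ddir i \<beta> x\<bar> <= C i" by metis
 define L where "L = (SUM i:Basis. C i)"
 have "\<bar>ddir v \<beta> x\<bar> <= L * norm v" for v x
 proof -
  have "ddir v \<beta> x = ddir (SUM i:Basis. (v \<bullet> i) *\<^sub>R i) \<beta> x" by (simp add: euclidean_representation)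
  also have "\<dots> = (SUM i:Basis. (v \<bullet> i) * ddir i \<beta> x)"
   using linear_ddir[OF smooth_on_differentiable[OF sm]] by (simp add: linear_sum linear_cmul)
  finally have "\<bar>ddir v \<beta> x\<bar> <= (SUM i:Basis. \<bar>v \<bullet> i\<bar> * \<bar>ddir i \<beta> x\<bar>)"
   by (metis (no_types, lifting) abs_mult sum.cong sum_abs)
  also have "\<dots> <= (SUM i:Basis. norm v * C i)"
   by (intro sum_mono mult_mono C) (auto simp: Basis_le_norm)
  finally show ?thesis by (simp add: L_def sum_distrib_left mult.commute)
 qed
 then have "norm (\<beta> x - \<beta> y) <= L * norm (x - y)" for x y
  by (intro differentiable_bound[where S=UNIV and f'="%x v. ddir v \<beta> x"])
   (auto intro!: onorm_le smooth_on_has_derivative[OF sm])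
 moreover have "L > 0" unfolding L_def using C by (intro sum_pos) auto
 moreover have "\<beta> a = 1" using pos by (simp add: \<beta>_def b_def)
 ultimately show ?thesis using that sm out by simp
qed

section \<open>Linear total differential equations\<close>

lemma has_derivative_integral_param:
 fixes g :: "real \<times> 'v::euclidean_space => 'w::euclidean_space"
 assumes T: "open T" "smooth_on T g" and U: "open U" "{0..1} \<times> U \<subseteq> T" and x0: "x0 : U"
 shows "((%x. integral {0..1} (%t. g (t, x))) has_derivative
  (%v. integral {0..1} (%t. ddir (0, v) g (t, x0)))) (at x0)"
proof -
 obtain e where e: "e > 0" "ball x0 e \<subseteq> U" using U(1) x0 open_contains_ball by blast
 have sub: "{0..1} \<times> ball x0 e \<subseteq> T" using e U(2) by auto
 define G where "G = (%x t. Blinfun (%v. ddir (0, v) g (t, x)))"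
 have dg: "g differentiable (at z)" if "z : T" for z using smooth_on_differentiable[OF T(2) that] .
 have G: "blinfun_apply (G x t) v = ddir (0, v) g (t, x)" if "t : {0..1}" "x : ball x0 e" for x t v
 proof -
  have "(t, x) : T" using that sub by auto
  moreover have "linear (%v::'v. (0::real, v))" by (auto intro!: linearI)
  ultimately have "linear (%v. ddir (0, v) g (t, x))"
   using linear_compose[OF _ linear_ddir[OF dg]] unfolding o_def by blast
  then show ?thesis unfolding G_def
   using linear_conv_bounded_linear bounded_linear_Blinfun_apply by metis
 qed
 have cg: "continuous_on ({0..1} \<times> ball x0 e) g"
  using smooth_on_continuous[OF T(2)] sub continuous_on_subset by blast
 have cG: "continuous_on (ball x0 e \<times> cbox 0 1) (%(x, t). G x t)"
 proof (rule continuous_on_blinfun_componentwise)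
  fix i :: 'v assume "i : Basis"
  have "continuous_on (ball x0 e \<times> cbox 0 1) (%z. ddir (0, i) g (snd z, fst z))"
   by (rule continuous_on_compose2[OF smooth_on_continuous[OF smooth_on_ddir[OF T(2)]]])
    (use sub in \<open>auto intro!: continuous_intros\<close>)
  then show "continuous_on (ball x0 e \<times> cbox 0 1) (%z. blinfun_apply (case z of (x, t) => G x t) i)"
   by (rule continuous_on_eq) (use G in auto)
 qed
 have "((%x. integral (cbox 0 1) (%t. g (t, x))) has_derivative
   blinfun_apply (integral (cbox 0 1) (G x0))) (at x0 within ball x0 e)"
 proof (rule leibniz_rule[where fx=G and f="%x t. g (t, x)", OF _ _ cG])
  fix x t assume xt: "x : ball x0 e" "t : cbox (0::real) 1"
  have "((%x. g (t, x)) has_derivative (%v. ddir (0, v) g (t, x))) (at x)"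
   by (rule has_derivative_compose[where f="%x. (t, x)" and g=g, OF _ has_derivative_ddir[OF dg]])
    (use xt sub in \<open>auto intro!: derivative_eq_intros\<close>)
  then show "((%x. g (t, x)) has_derivative blinfun_apply (G x t)) (at x within ball x0 e)"
   using has_derivative_at_withinI G xt by (metis (no_types, lifting) cbox_interval ext)
 next
  fix x assume x: "x : ball x0 e"
  show "(%t. g (t, x)) integrable_on cbox 0 1"
   by (rule integrable_continuous, rule continuous_on_compose2[OF cg])
    (use x in \<open>auto intro!: continuous_intros\<close>)
 qed (use e in auto)
 moreover have "blinfun_apply (integral (cbox 0 1) (G x0)) v = integral {0..1} (%t. ddir (0, v) g (t, x0))" for v
 proof -
  have "continuous_on (cbox 0 1) (%t. case (x0, t) of (x, t) => G x t)"
   by (rule continuous_on_compose2[OF cG]) (use e in \<open>auto intro!: continuous_intros\<close>)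
  then have "G x0 integrable_on cbox 0 1" by (intro integrable_continuous) simp
  then show ?thesis
   using G e by (auto simp: blinfun_apply_integral intro!: integral_cong)
 qed
 ultimately have "((%x. integral {0..1} (%t. g (t, x))) has_derivative
   (%v. integral {0..1} (%t. ddir (0, v) g (t, x0)))) (at x0 within ball x0 e)"
  by (simp add: has_derivative_eq_rhs fun_eq_iff)
 then show ?thesis
  using e by (simp add: at_within_open[of x0 "ball x0 e"])
qed

text \<open>Differentiation under the integral sign reproduces an integral of the same kind, which gives all
 orders by induction.\<close>

lemma smooth_on_integral_param:
 fixes g :: "real \<times> 'v::euclidean_space => 'w::euclidean_space"
 assumes T: "open T" "smooth_on T g" and U: "open U" "{0..1} \<times> U \<subseteq> T"
 shows "smooth_on U (%x. integral {0..1} (%t. g (t, x)))"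
proof -
 have "Ck_on k U (%x. integral {0..1} (%t. g (t, x)))" for k
  using T(2)
 proof (induction k arbitrary: g)
  case 0
  then show ?case
   using has_derivative_integral_param[OF T(1) _ U] has_derivative_continuous
   by (metis Ck_on.simps(1) continuous_at_imp_continuous_on)
 next
  case (Suc k)
  show ?case
   by (rule Ck_on_SucI[OF U(1) has_derivative_integral_param[OF T(1) Suc.prems U]])
    (auto intro: Suc.IH smooth_on_ddir[OF Suc.prems])
 qed
 then show ?thesis by (simp add: smooth_on_def)
qed

text \<open>The homotopy operator of the Poincare lemma, for a one-form \<open>a\<close> that need not be closed: the
 derivative of the primitive misses \<open>a\<close> by a mean value of the exterior derivative of \<open>a\<close> on the
 segment.\<close>

lemma homotopy_operator:
 fixes a :: "'v::euclidean_space => 'v => 'w::euclidean_space"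
 assumes lin: "!!u. u : ball x0 r ==> linear (a u)"
  and sm: "!!v. smooth_on (ball x0 r) (%u. a u v)"
 defines "p \<equiv> %t x. x0 + t *\<^sub>R (x - x0)"
 defines "h \<equiv> %x. integral {0..1} (%t. a (p t x) (x - x0))"
 shows "smooth_on (ball x0 r) h"
  and "!!x C. x : ball x0 r ==> (!!t. t : {0..1} ==> norm (a (p t x) (x - x0)) <= C) ==> norm (h x) <= C"
  and "!!x v C. x : ball x0 r ==> (!!t. t : {0..1} ==> norm (ddir v (%u. a u (x - x0)) (p t x)
    - ddir (x - x0) (%u. a u v) (p t x)) <= C) ==> norm (ddir v h x - a x v) <= C"
proof -
 let ?B = "ball x0 r"
 have pin: "p t x : ?B" if "t : {0..1}" "x : ?B" for t x
 proof -
  have "norm (t *\<^sub>R (x - x0)) <= 1 * norm (x - x0)" using that by (simp add: mult_left_le_one_le)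
  then show ?thesis using that by (simp add: p_def dist_norm norm_minus_commute)
 qed
 define q :: "real \<times> 'v => 'v" where "q = (%z. p (fst z) (snd z))"
 define T where "T = q -` ?B"
 have contq: "continuous_on UNIV q" unfolding q_def p_def by (intro continuous_intros)
 have T: "open T" unfolding T_def by (rule open_vimage[OF open_ball contq])
 have TB: "{0..1} \<times> ?B \<subseteq> T" using pin by (auto simp: T_def q_def)
 have smq: "smooth_on T q" unfolding q_def p_def
  by (intro smooth_on_add smooth_on_scaleR smooth_on_diff smooth_on_const T
    smooth_on_bounded_linear[OF bounded_linear_fst] smooth_on_bounded_linear[OF bounded_linear_snd] smooth_on_ident)
 define g where "g = (%z. SUM b:Basis. ((snd z - x0) \<bullet> b) *\<^sub>R a (q z) b)"
 have smg: "smooth_on T g" unfolding g_def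
  by (intro smooth_on_sum smooth_on_scaleR smooth_on_bounded_linear[OF bounded_linear_inner_left] smooth_on_diff
    smooth_on_const T smooth_on_bounded_linear[OF bounded_linear_snd] smooth_on_ident
    smooth_on_compose[OF T open_ball sm smq]) (auto simp: T_def)
 have expand: "a u w = (SUM b:Basis. (w \<bullet> b) *\<^sub>R a u b)" if "u : ?B" for u w
 proof -
  have "a u w = a u (SUM b:Basis. (w \<bullet> b) *\<^sub>R b)" by (simp add: euclidean_representation)
  then show ?thesis using lin[OF that] by (simp add: linear_sum linear_cmul)
 qed
 have geq: "g (t, x) = a (p t x) (x - x0)" if "t : {0..1}" "x : ?B" for t x
  unfolding g_def q_def fst_conv snd_conv by (rule expand[OF pin[OF that], symmetric])
 have hg: "integral {0..1} (%t. g (t, x)) = h x" if "x : ?B" for x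
  unfolding h_def using geq that by (intro integral_cong) auto
 show "smooth_on ?B h"
  using smooth_on_cong[OF open_ball _ smooth_on_integral_param[OF T smg open_ball TB], of h] hg by simp
 have da: "(%u. a u w) differentiable (at u)" if "u : ?B" for u w
  using smooth_on_differentiable[OF sm that] .
 have dsum: "ddir v (%u. a u w) u = (SUM b:Basis. (w \<bullet> b) *\<^sub>R ddir v (%u. a u b) u)"
  if "u : ?B" for u v w
 proof -
  have "((%u. SUM b:Basis. (w \<bullet> b) *\<^sub>R a u b) has_derivative
    (%v. SUM b:Basis. (w \<bullet> b) *\<^sub>R ddir v (%u. a u b) u)) (at u)"
   by (intro has_derivative_sum has_derivative_scaleR_right has_derivative_ddir da that)
  then have "((%u. a u w) has_derivative (%v. SUM b:Basis. (w \<bullet> b) *\<^sub>R ddir v (%u. a u b) u)) (at u)"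
   by (rule has_derivative_transform_within_open[OF _ open_ball that]) (use expand in metis)
  then show ?thesis by (rule ddir_eq)
 qed
 have ca: "continuous_on {0..1} (%t. a (p t x) w)" if "x : ?B" for x w
  by (rule continuous_on_compose2[OF smooth_on_continuous[OF sm]])
   (use pin that in \<open>auto intro!: continuous_intros simp: p_def\<close>)
 have cda: "continuous_on {0..1} (%t. ddir v (%u. a u w) (p t x))" if "x : ?B" for x v w
  by (rule continuous_on_compose2[OF smooth_on_continuous[OF smooth_on_ddir[OF sm]]])
   (use pin that in \<open>auto intro!: continuous_intros simp: p_def\<close>)
 have bound: "norm (integral {0..1} k) <= C"
  if "continuous_on {0..1} k" "!!t. t : {0..1} ==> norm (k t) <= C" for k :: "real => 'w" and C
  using integral_norm_bound_integral[of k "{0..1}" "%t. C"] that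
  by (simp add: integrable_continuous_interval)
 show "norm (h x) <= C" if "x : ?B" "!!t. t : {0..1} ==> norm (a (p t x) (x - x0)) <= C" for x C
  unfolding h_def by (rule bound[OF ca[OF that(1)] that(2)])
 show "norm (ddir v h x - a x v) <= C" if x: "x : ?B" and C: "!!t. t : {0..1} ==>
   norm (ddir v (%u. a u (x - x0)) (p t x) - ddir (x - x0) (%u. a u v) (p t x)) <= C" for x v C
 proof -
  let ?z = "x - x0"
  let ?k = "%t. ddir v (%u. a u ?z) (p t x) - ddir ?z (%u. a u v) (p t x)"
  have dg: "ddir (0, v) g (t, x) = a (p t x) v + t *\<^sub>R ddir v (%u. a u ?z) (p t x)" if t: "t : {0..1}" for t
  proof -
   have zT: "(t, x) : T" using TB t x by auto
   have "((%x. g (t, x)) has_derivative (%v. ddir (0, v) g (t, x))) (at x)"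
    by (rule has_derivative_compose[where f="%x. (t, x)" and g=g,
       OF _ has_derivative_ddir[OF smooth_on_differentiable[OF smg zT]]])
     (auto intro!: derivative_eq_intros)
   moreover have "((%x. g (t, x)) has_derivative (%v. a (p t x) v + t *\<^sub>R ddir v (%u. a u ?z) (p t x))) (at x)"
   proof -
    have pd: "((%x. p t x) has_derivative (%v. t *\<^sub>R v)) (at x)"
     unfolding p_def by (auto intro!: derivative_eq_intros)
    have 1: "((%x. a (p t x) b) has_derivative (%v. t *\<^sub>R ddir v (%u. a u b) (p t x))) (at x)" for b
     using has_derivative_compose[OF pd has_derivative_ddir[OF da[OF pin[OF t x]]]]
      linear_cmul[OF linear_ddir[OF da[OF pin[OF t x]]]] by simp
    have 4: "((%x. SUM b:Basis. ((x - x0) \<bullet> b) *\<^sub>R a (p t x) b) has_derivative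
      (%v. SUM b:Basis. (?z \<bullet> b) *\<^sub>R (t *\<^sub>R ddir v (%u. a u b) (p t x)) + (v \<bullet> b) *\<^sub>R a (p t x) b)) (at x)"
     by (intro has_derivative_sum has_derivative_scaleR 1) (auto intro!: derivative_eq_intros)
    have 5: "(SUM b:Basis. (?z \<bullet> b) *\<^sub>R (t *\<^sub>R ddir v (%u. a u b) (p t x)) + (v \<bullet> b) *\<^sub>R a (p t x) b)
     = a (p t x) v + t *\<^sub>R ddir v (%u. a u ?z) (p t x)" for v
    proof -
     have 2: "ddir v (%u. a u ?z) (p t x) = (SUM b:Basis. (?z \<bullet> b) *\<^sub>R ddir v (%u. a u b) (p t x))"
      by (rule dsum[OF pin[OF t x]])
     have 3: "a (p t x) v = (SUM b:Basis. (v \<bullet> b) *\<^sub>R a (p t x) b)" by (rule expand[OF pin[OF t x]])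
     show ?thesis
      unfolding 2 3 scaleR_sum_right sum.distrib scaleR_scaleR mult.commute[of t]
      by (rule add.commute)
    qed
    show ?thesis unfolding g_def q_def fst_conv snd_conv using 4 unfolding 5 .
   qed
   ultimately have "(%v. ddir (0, v) g (t, x)) = (%v. a (p t x) v + t *\<^sub>R ddir v (%u. a u ?z) (p t x))"
    by (rule has_derivative_unique)
   then show ?thesis by (rule fun_cong)
  qed
  have ftc: "((%t. t *\<^sub>R ddir ?z (%u. a u v) (p t x) + a (p t x) v) has_integral
    (1 *\<^sub>R a (p 1 x) v - 0 *\<^sub>R a (p 0 x) v)) {0..1}"
  proof (rule fundamental_theorem_of_calculus)
   fix t :: real assume t: "t : {0..1}"
   have "((%t. a (p t x) v) has_derivative (%s. ddir (s *\<^sub>R ?z) (%u. a u v) (p t x))) (at t)"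
   proof (rule has_derivative_compose[where f="%t. p t x", OF _ has_derivative_ddir[OF da[OF pin[OF t x]]]])
    show "((%t. p t x) has_derivative (%s. s *\<^sub>R ?z)) (at t)"
     unfolding p_def by (auto intro!: derivative_eq_intros)
   qed
   then have "((%t. a (p t x) v) has_vector_derivative ddir ?z (%u. a u v) (p t x)) (at t)"
    using linear_cmul[OF linear_ddir[OF da[OF pin[OF t x]]]] by (simp add: has_vector_derivative_def)
   from has_vector_derivative_at_within[OF has_vector_derivative_scaleR[OF DERIV_ident this]]
   show "((%t. t *\<^sub>R a (p t x) v) has_vector_derivative
     t *\<^sub>R ddir ?z (%u. a u v) (p t x) + a (p t x) v) (at t within {0..1})" by simp
  qed simp
  have "(h has_derivative (%v. integral {0..1} (%t. ddir (0, v) g (t, x)))) (at x)"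
   by (rule has_derivative_transform_within_open[OF has_derivative_integral_param[OF T smg open_ball TB x] open_ball x hg])
  then have "ddir v h x = integral {0..1} (%t. ddir (0, v) g (t, x))" by (rule ddir_eq)
  also have "\<dots> = integral {0..1} (%t. t *\<^sub>R ?k t + (t *\<^sub>R ddir ?z (%u. a u v) (p t x) + a (p t x) v))"
   by (intro integral_cong) (simp add: dg algebra_simps)
  also have "\<dots> = integral {0..1} (%t. t *\<^sub>R ?k t) + a x v"
  proof -
   have "(%t. t *\<^sub>R ?k t) integrable_on {0..1}"
    by (intro integrable_continuous_interval continuous_intros cda x)
   from has_integral_add[OF integrable_integral[OF this] ftc]
   show ?thesis by (simp add: integral_unique p_def)
  qed
  finally have "ddir v h x - a x v = integral {0..1} (%t. t *\<^sub>R ?k t)" by simp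
  moreover have "norm (integral {0..1} (%t. t *\<^sub>R ?k t)) <= C"
  proof (rule bound)
   show "continuous_on {0..1} (%t. t *\<^sub>R ?k t)" by (intro continuous_intros cda x)
   show "norm (t *\<^sub>R ?k t) <= C" if "t : {0..1}" for t
   proof -
    have "norm (t *\<^sub>R ?k t) <= 1 * norm (?k t)" using that by (simp add: mult_left_le_one_le)
    then show ?thesis using C[OF that] by simp
   qed
  qed
  ultimately show ?thesis by simp
 qed
qed

lemma one_form_bound:
 fixes \<Omega> :: "'v::euclidean_space => 'v => 'b::real_normed_vector"
 assumes "open D" "x0 : D" "!!u. u : D ==> linear (\<Omega> u)" "!!v. continuous_on D (%u. \<Omega> u v)"
 obtains R M where "R > 0" "M > 0" "cball x0 R \<subseteq> D" "!!u v. u : cball x0 R ==> norm (\<Omega> u v) <= M * norm v"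
proof -
 obtain R where R: "R > 0" "cball x0 R \<subseteq> D" using assms open_contains_cball by blast
 have "\<exists>C>0. ALL u:cball x0 R. norm (\<Omega> u i) <= C" for i
 proof -
  have "compact ((%u. \<Omega> u i) ` cball x0 R)"
   by (rule compact_continuous_image[OF continuous_on_subset[OF assms(4) R(2)] compact_cball])
  then show ?thesis using bounded_pos[of "(%u. \<Omega> u i) ` cball x0 R"] compact_imp_bounded by auto
 qed
 then obtain C where C: "!!i. C i > 0" "!!i u. u : cball x0 R ==> norm (\<Omega> u i) <= C i" by metis
 have "norm (\<Omega> u v) <= (SUM i:Basis. C i) * norm v" if "u : cball x0 R" for u v
 proof -
  have "\<Omega> u v = \<Omega> u (SUM i:Basis. (v \<bullet> i) *\<^sub>R i)" by (simp add: euclidean_representation)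
  also have "\<dots> = (SUM i:Basis. (v \<bullet> i) *\<^sub>R \<Omega> u i)"
   using assms(3)[of u] R that by (auto simp: linear_sum linear_cmul)
  finally have "norm (\<Omega> u v) <= (SUM i:Basis. norm ((v \<bullet> i) *\<^sub>R \<Omega> u i))"
   using norm_sum by metis
  also have "\<dots> <= (SUM i:Basis. norm v * C i)"
   unfolding norm_scaleR by (intro sum_mono mult_mono C that) (auto simp: Basis_le_norm)
  finally show ?thesis by (simp add: sum_distrib_left mult.commute)
 qed
 moreover have "(SUM i:(Basis::'v set). C i) > 0" using C by (intro sum_pos) auto
 ultimately show ?thesis using that R by blast
qed

text \<open>Flatness makes the error \<open>E\<^sub>n = dy\<^sub>n - y\<^sub>n \<Omega>\<close> of the iterates of
 \<open>y \<mapsto> c + \<integral> y \<Omega>\<close> satisfy a linear recursion, so the derivatives of the iterates converge as fast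
 as the iterates.\<close>

lemma frobenius_local:
 fixes \<Omega> :: "'v::euclidean_space => 'v => 'b::real_normed_vector"
  and m :: "'w::euclidean_space => 'b => 'w"
 assumes m: "bounded_bilinear m" and D: "open D" "x0 : D"
  and lin: "!!u. u : D ==> linear (\<Omega> u)"
  and sm: "!!v. smooth_on D (%u. \<Omega> u v)"
  and flat: "!!u v w y. u : D ==> m y (ddir w (%u. \<Omega> u v) u) - m y (ddir v (%u. \<Omega> u w) u)
    = m (m y (\<Omega> u v)) (\<Omega> u w) - m (m y (\<Omega> u w)) (\<Omega> u v)"
 obtains r where "r > 0" "ball x0 r \<subseteq> D"
  "!!c. EX y. y x0 = c & (ALL x:ball x0 r. (y has_derivative (%v. m (y x) (\<Omega> x v))) (at x))"
proof -
 interpret m: bounded_bilinear m by (rule m)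
 obtain R M where RM: "R > 0" "M > 0" "cball x0 R \<subseteq> D" "!!u v. u : cball x0 R ==> norm (\<Omega> u v) <= M * norm v"
  using one_form_bound[OF D lin smooth_on_continuous[OF sm]] by blast
 obtain K where K: "K > 0" "!!a b. norm (m a b) <= norm a * norm b * K" using m.pos_bounded by blast
 define r where "r = min R (1 / (4 * K * M))"
 have r: "r > 0" "r <= R" "K * M * r <= 1/4"
  using RM K by (auto simp: r_def min_def field_simps)
 let ?B = "ball x0 r"
 have BD: "?B \<subseteq> D" using r RM by (meson ball_subset_cball order_trans subset_ball)
 have Om: "norm (\<Omega> u v) <= M * norm v" if "u : ?B" for u v
  using RM(4)[of u v] that r by auto
 have ex: "EX y. y x0 = c & (ALL x:?B. (y has_derivative (%v. m (y x) (\<Omega> x v))) (at x))" for c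
 proof -
  define p where "p = (%t x. x0 + t *\<^sub>R (x - x0))"
  define y where "y = rec_nat (%x. c) (%n f x. c + integral {0..1} (%t. m (f (p t x)) (\<Omega> (p t x) (x - x0))))"
  have y0: "y 0 = (%x. c)" by (simp add: y_def)
  have yS: "y (Suc n) = (%x. c + integral {0..1} (%t. m (y n (p t x)) (\<Omega> (p t x) (x - x0))))" for n
   by (simp add: y_def)
  have pin: "p t x : ?B" if "t : {0..1}" "x : ?B" for t x
  proof -
   have "norm (t *\<^sub>R (x - x0)) <= 1 * norm (x - x0)" using that by (simp add: mult_left_le_one_le)
   then show ?thesis using that by (simp add: p_def dist_norm norm_minus_commute)
  qed
  have linm: "linear (%v. m z (\<Omega> u v))" if "u : ?B" for u z
   using linear_compose[OF lin bounded_linear.linear[OF m.bounded_linear_right[of z]], of u] that BD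
   by (auto simp: o_def)
  have smO: "smooth_on ?B (%u. \<Omega> u v)" for v using smooth_on_subset[OF sm BD] .
  have smy: "smooth_on ?B (y n)" for n
  proof (induction n)
   case (Suc n)
   have "smooth_on ?B (%x. integral {0..1} (%t. m (y n (p t x)) (\<Omega> (p t x) (x - x0))))"
    using homotopy_operator(1)[of x0 r "%u v. m (y n u) (\<Omega> u v)", OF linm smooth_on_bilinear[OF m open_ball Suc smO]]
    by (simp add: p_def)
   then show ?case unfolding yS by (intro smooth_on_add) auto
  qed (simp add: y0)
  have hb: "norm (integral {0..1} (%t. m (k (p t x)) (\<Omega> (p t x) (x - x0)))) <= C / 4"
   if k: "smooth_on ?B k" "!!x. x : ?B ==> norm (k x) <= C" "x : ?B" for k C x
  proof -
   have C0: "C \<ge> 0" using k(2)[OF k(3)] norm_ge_zero order_trans by blast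
   have "norm (m (k (p t x)) (\<Omega> (p t x) (x - x0))) <= C / 4" if t: "t : {0..1}" for t
   proof -
    have "norm (m (k (p t x)) (\<Omega> (p t x) (x - x0))) <= C * (M * r) * K"
     using k pin[OF t k(3)] Om[of "p t x" "x - x0"] RM K C0
     by (intro order_trans[OF K(2)] mult_right_mono mult_mono)
      (auto simp: dist_norm norm_minus_commute intro!: order_trans[OF Om] mult_left_mono)
    also have "\<dots> = C * (K * M * r)" by simp
    also have "\<dots> <= C * (1/4)" using r C0 by (intro mult_left_mono)
    finally show ?thesis by simp
   qed
   then show ?thesis
    using homotopy_operator(2)[of x0 r "%u v. m (k u) (\<Omega> u v)", OF linm smooth_on_bilinear[OF m open_ball k(1) smO] k(3), of "C / 4"]
    unfolding p_def by blast
  qed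
  have integrable: "(%t. m (k (p t x)) (\<Omega> (p t x) (x - x0))) integrable_on {0..1}"
   if "smooth_on ?B k" "x : ?B" for k x
  proof (rule integrable_continuous_interval)
   have "continuous_on {0..1} (%t. k (p t x))" "continuous_on {0..1} (%t. \<Omega> (p t x) v)" for v
    by (rule continuous_on_compose2[OF smooth_on_continuous[OF that(1)]]
      continuous_on_compose2[OF smooth_on_continuous[OF smO]];
      use pin that in \<open>auto intro!: continuous_intros simp: p_def\<close>)+
   then show "continuous_on {0..1} (%t. m (k (p t x)) (\<Omega> (p t x) (x - x0)))"
    by (intro m.continuous_on)
  qed
  have dy: "norm (y (Suc n) x - y n x) <= norm c * (1/2) ^ n" if "x : ?B" for n x
   using that
  proof (induction n arbitrary: x)
   case 0
   have "norm (integral {0..1} (%t. m c (\<Omega> (p t x) (x - x0)))) <= norm c / 4"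
    using hb[of "%x. c" "norm c" x] 0 by simp
   also have "\<dots> <= norm c" using norm_ge_zero[of c] by linarith
   finally show ?case by (simp add: yS y0)
  next
   case (Suc n)
   let ?k = "%x. y (Suc n) x - y n x"
   have "y (Suc (Suc n)) x - y (Suc n) x = integral {0..1} (%t. m (?k (p t x)) (\<Omega> (p t x) (x - x0)))"
    unfolding yS[of "Suc n"] unfolding yS[of n]
    using integral_diff[OF integrable[OF smy[of "Suc n"] Suc.prems] integrable[OF smy[of n] Suc.prems]]
    by (simp add: m.diff_left yS)
   then have "norm (y (Suc (Suc n)) x - y (Suc n) x) <= norm c * (1/2) ^ n / 4"
    using hb[of ?k "norm c * (1/2) ^ n" x] smooth_on_diff[OF open_ball smy smy] Suc by simp
   also have "\<dots> <= norm c * (1/2) ^ Suc n" by (simp add: divide_simps)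
   finally show ?case .
  qed
  define A where "A = 4 * K * M * norm c"
  have A0: "A \<ge> 0" using K RM by (simp add: A_def)
  define E where "E n x v = ddir v (y n) x - m (y n x) (\<Omega> x v)" for n x v
  have E: "norm (E n x v) <= A * (3/4) ^ n * norm v" if "x : ?B" for n x v
   using that
  proof (induction n arbitrary: x v)
   case 0
   have "ddir v (y 0) x = 0" by (simp add: y0)
   then have "norm (E 0 x v) <= norm c * (M * norm v) * K"
    using Om[OF 0] K RM by (auto simp: E_def y0 intro!: order_trans[OF K(2)] mult_right_mono mult_left_mono)
   also have "\<dots> <= A * norm v" using K RM by (simp add: A_def mult_ac)
   finally show ?case by simp
  next
   case (Suc n)
   let ?a = "%u v. m (y n u) (\<Omega> u v)" and ?z = "x - x0"
   let ?e = "A * (3/4) ^ n"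
   have e0: "?e \<ge> 0" using A0 by simp
   have z: "norm ?z < r" using Suc.prems by (simp add: dist_norm norm_minus_commute)
   have "norm (ddir v (%x. integral {0..1} (%t. ?a (p t x) (x - x0))) x - ?a x v) <= ?e * norm v / 2"
   proof -
    have "norm (ddir v (%u. ?a u ?z) (p t x) - ddir ?z (%u. ?a u v) (p t x)) <= ?e * norm v / 2"
     if t: "t : {0..1}" for t
    proof -
     let ?u = "p t x"
     have u: "?u : ?B" using pin t Suc.prems by blast
     have d: "ddir v (%u. ?a u w) ?u = m (y n ?u) (ddir v (%u. \<Omega> u w) ?u) + m (ddir v (y n) ?u) (\<Omega> ?u w)" for v w
      by (rule ddir_eq[OF m.FDERIV[OF has_derivative_ddir has_derivative_ddir]])
       (rule smooth_on_differentiable[OF smy u] smooth_on_differentiable[OF smO u])+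
     have "ddir v (%u. ?a u ?z) ?u - ddir ?z (%u. ?a u v) ?u
       = m (E n ?u v) (\<Omega> ?u ?z) - m (E n ?u ?z) (\<Omega> ?u v)"
      using flat[of ?u "y n ?u" v ?z] u BD unfolding d E_def
      by (simp add: m.diff_left subset_iff algebra_simps)
     also have "norm \<dots> <= norm (E n ?u v) * norm (\<Omega> ?u ?z) * K + norm (E n ?u ?z) * norm (\<Omega> ?u v) * K"
      by (intro order_trans[OF norm_triangle_ineq4] add_mono K)
     also have "\<dots> <= (?e * norm v) * (M * r) * K + (?e * r) * (M * norm v) * K"
     proof -
      have "norm (\<Omega> ?u ?z) <= M * r" using Om[OF u, of ?z] z RM by (smt (verit) mult_left_mono)
      moreover have "norm (E n ?u ?z) <= ?e * r" using Suc.IH[OF u, of ?z] z e0 by (smt (verit) mult_left_mono)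
      ultimately show ?thesis
       using Suc.IH[OF u] Om[OF u] K RM e0 r by (intro add_mono mult_right_mono mult_mono) auto
     qed
     also have "\<dots> = ?e * norm v * 2 * (K * M * r)" by simp
     also have "\<dots> <= ?e * norm v * 2 * (1/4)" using r e0 by (intro mult_left_mono) auto
     finally show ?thesis by (simp add: mult_ac)
    qed
    then show ?thesis
     using homotopy_operator(3)[of x0 r ?a, OF linm smooth_on_bilinear[OF m open_ball smy smO] Suc.prems, where C="?e * norm v / 2"]
     unfolding p_def by blast
   qed
   moreover have "ddir v (y (Suc n)) x = ddir v (%x. integral {0..1} (%t. ?a (p t x) (x - x0))) x"
   proof (rule ddir_eq)
    let ?h = "%x. integral {0..1} (%t. ?a (p t x) (x - x0))"
    have "smooth_on ?B ?h"
     using homotopy_operator(1)[of x0 r ?a, OF linm smooth_on_bilinear[OF m open_ball smy smO]]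
     by (simp add: p_def)
    from has_derivative_add[OF has_derivative_const smooth_on_has_derivative[OF this Suc.prems]]
    show "(y (Suc n) has_derivative (%v. ddir v ?h x)) (at x)" unfolding yS by simp
   qed
   moreover have "norm (?a x v - m (y (Suc n) x) (\<Omega> x v)) <= ?e / 4 * norm v"
   proof -
    have "norm (?a x v - m (y (Suc n) x) (\<Omega> x v)) = norm (m (y (Suc n) x - y n x) (\<Omega> x v))"
     by (simp add: m.diff_left norm_minus_commute)
    also have "\<dots> <= (norm c * (1/2) ^ n) * (M * norm v) * K"
     using dy[OF Suc.prems, of n] Om[OF Suc.prems] K RM
     by (intro order_trans[OF K(2)] mult_right_mono mult_mono) auto
    also have "\<dots> <= (norm c * (3/4) ^ n) * (M * norm v) * K"
     using K RM by (intro mult_right_mono mult_left_mono power_mono) auto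
    finally show ?thesis by (simp add: A_def mult_ac)
   qed
   ultimately have "norm (E (Suc n) x v) <= ?e * norm v / 2 + ?e / 4 * norm v"
    unfolding E_def by (smt (verit) norm_diff_triangle_ineq norm_triangle_ineq diff_add_cancel add_diff_eq)
   also have "\<dots> = A * (3/4) ^ Suc n * norm v" by (simp add: algebra_simps)
   finally show ?case .
  qed
  define Y where "Y x = c + (\<Sum>n. y (Suc n) x - y n x)" for x
  have yY: "norm (y n x - Y x) <= 2 * norm c * (1/2) ^ n" if "x : ?B" for n x
  proof -
   let ?d = "%n. y (Suc n) x - y n x"
   have sg: "summable (%k. norm c * (1/2) ^ k)" by (intro summable_mult) simp
   have s: "summable ?d"
    by (rule summable_comparison_test[OF _ sg]) (use dy that in auto)
   have "(\<Sum>k<n. ?d k) = y n x - c" by (subst sum_lessThan_telescope) (simp add: y0)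
   then have "(\<Sum>k. ?d (k + n)) = Y x - y n x" using suminf_minus_initial_segment[OF s, of n] by (simp add: Y_def)
   moreover have "norm (\<Sum>k. ?d (k + n)) <= (\<Sum>k. norm c * (1/2) ^ (k + n))"
    by (rule norm_suminf_le) (use dy[OF that] sg summable_iff_shift[of "%k. norm c * (1/2) ^ k" n] in auto)
   moreover have "(\<Sum>k. norm c * (1/2) ^ (k + n)) = norm c * (1/2) ^ n * (\<Sum>k. (1/2) ^ k)"
    by (subst suminf_mult[symmetric]) (auto simp: power_add mult_ac)
   moreover have "(\<Sum>k. (1/2::real) ^ k) = 2" by (subst suminf_geometric) auto
   ultimately show ?thesis by (simp add: norm_minus_commute)
  qed
  have lim: "(%n. y n x) \<longlonglongrightarrow> Y x" if "x : ?B" for x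
  proof (rule LIM_zero_cancel, rule tendsto_norm_zero_cancel, rule tendsto_sandwich[of "%n. 0"])
   show "(%n. 2 * norm c * (1/2::real) ^ n) \<longlonglongrightarrow> 0"
    by (intro tendsto_mult_right_zero LIMSEQ_realpow_zero) auto
  qed (use yY that in auto)
  have "EX g. ALL x:?B. (%n. y n x) \<longlonglongrightarrow> g x & (g has_derivative (%v. m (Y x) (\<Omega> x v))) (at x within ?B)"
  proof (rule has_derivative_sequence[OF convex_ball, where f'="%n x v. ddir v (y n) x"])
   show "(y n has_derivative (%v. ddir v (y n) x)) (at x within ?B)" if "x : ?B" for n x
    using smooth_on_has_derivative[OF smy that] has_derivative_at_withinI by blast
   show "(%n. y n x0) \<longlonglongrightarrow> Y x0" using lim r by simp
   fix e :: real assume "e > 0"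
   have "(%n. A * (3/4) ^ n + 2 * norm c * (1/2) ^ n * M * K) \<longlonglongrightarrow> A * 0 + 2 * norm c * 0 * M * K"
    by (intro tendsto_intros LIMSEQ_realpow_zero) auto
   then have "\<forall>\<^sub>F n in sequentially. A * (3/4) ^ n + 2 * norm c * (1/2) ^ n * M * K < e"
    using \<open>e > 0\<close> order_tendstoD(2) by fastforce
   then show "\<forall>\<^sub>F n in sequentially. ALL x:?B. ALL h. norm (ddir h (y n) x - m (Y x) (\<Omega> x h)) <= e * norm h"
   proof (rule eventually_mono, intro ballI allI)
    fix n x h assume n: "A * (3/4) ^ n + 2 * norm c * (1/2) ^ n * M * K < e" and x: "x : ?B"
    have "ddir h (y n) x - m (Y x) (\<Omega> x h) = E n x h + m (y n x - Y x) (\<Omega> x h)"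
     by (simp add: E_def m.diff_left)
    also have "norm \<dots> <= A * (3/4) ^ n * norm h + (2 * norm c * (1/2) ^ n) * (M * norm h) * K"
     using E[OF x] yY[OF x, of n] Om[OF x] K RM
     by (intro order_trans[OF norm_triangle_ineq] add_mono order_trans[OF K(2)] mult_right_mono mult_mono) auto
    also have "\<dots> = (A * (3/4) ^ n + 2 * norm c * (1/2) ^ n * M * K) * norm h" by (simp add: algebra_simps)
    also have "\<dots> <= e * norm h" using n by (intro mult_right_mono) auto
    finally show "norm (ddir h (y n) x - m (Y x) (\<Omega> x h)) <= e * norm h" .
   qed
  qed (use r in auto)
  then obtain g where g: "!!x. x : ?B ==> (%n. y n x) \<longlonglongrightarrow> g x"
   "!!x. x : ?B ==> (g has_derivative (%v. m (Y x) (\<Omega> x v))) (at x within ?B)" by blast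
  have gY: "g x = Y x" if "x : ?B" for x using LIMSEQ_unique[OF g(1)[OF that] lim[OF that]] .
  have x0: "x0 : ?B" using r by simp
  have "y n x0 = c" for n
  proof (cases n)
   case (Suc k)
   have "p t x0 = x0" for t by (simp add: p_def)
   moreover have "\<Omega> x0 0 = 0" using linear_0[OF lin[OF D(2)]] .
   ultimately show ?thesis by (simp add: Suc yS m.zero_right)
  qed (simp add: y0)
  then have "g x0 = c" using LIMSEQ_unique[OF g(1)[OF x0], of c] by simp
  moreover have "(g has_derivative (%v. m (g x) (\<Omega> x v))) (at x)" if x: "x : ?B" for x
   using g(2)[OF x] unfolding gY[OF x] at_within_open[OF x open_ball] .
  ultimately show ?thesis by blast
 qed
 show ?thesis by (rule that[OF r(1) BD ex])
qed

lemma linear_pde_zero_local: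
 fixes \<Omega> :: "'v::euclidean_space => 'v => 'b::real_normed_vector"
  and m :: "'w::euclidean_space => 'b => 'w"
 assumes m: "bounded_bilinear m" and D: "open D" "x0 : D"
  and lin: "!!u. u : D ==> linear (\<Omega> u)" and cont: "!!v. continuous_on D (%u. \<Omega> u v)"
  and y: "!!x. x : D ==> (y has_derivative (%v. m (y x) (\<Omega> x v))) (at x)" "y x0 = 0"
 shows "\<exists>r>0. ball x0 r \<subseteq> D & (ALL x:ball x0 r. y x = 0)"
proof -
 obtain R M where RM: "R > 0" "M > 0" "cball x0 R \<subseteq> D" "!!u v. u : cball x0 R ==> norm (\<Omega> u v) <= M * norm v"
  using one_form_bound[OF D lin cont] by blast
 obtain K where K: "K > 0" "!!a b. norm (m a b) <= norm a * norm b * K"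
  using bounded_bilinear.pos_bounded[OF m] by blast
 define r where "r = min R (1 / (2 * K * M))"
 have r: "r > 0" "r <= R" "K * M * r <= 1/2" using RM K by (auto simp: r_def min_def field_simps)
 have sub: "cball x0 r \<subseteq> D" using r RM by (meson order_trans subset_cball)
 have "continuous_on (cball x0 r) (%x. norm (y x))"
  using y(1) sub has_derivative_continuous by (intro continuous_intros continuous_at_imp_continuous_on) blast
 then obtain x1 where x1: "x1 : cball x0 r" "!!x. x : cball x0 r ==> norm (y x) <= norm (y x1)"
  using continuous_attains_sup[of "cball x0 r" "%x. norm (y x)"] r by auto
 have "norm (y x1 - y x0) <= (norm (y x1) * M * K) * norm (x1 - x0)"
 proof (rule differentiable_bound[OF convex_cball])
  fix x assume x: "x : cball x0 r"
  show "(y has_derivative (%v. m (y x) (\<Omega> x v))) (at x within cball x0 r)"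
   using y(1) sub x has_derivative_at_withinI by blast
  show "onorm (%v. m (y x) (\<Omega> x v)) <= norm (y x1) * M * K"
  proof (rule onorm_le)
   fix v
   have "norm (m (y x) (\<Omega> x v)) <= norm (y x1) * (M * norm v) * K"
    using x1(2)[OF x] RM(4)[of x v] x r K RM
    by (intro order_trans[OF K(2)] mult_right_mono mult_mono) auto
   then show "norm (m (y x) (\<Omega> x v)) <= norm (y x1) * M * K * norm v" by (simp add: mult_ac)
  qed
 qed (use x1 r in auto)
 also have "\<dots> <= (norm (y x1) * M * K) * r"
  using x1 K RM by (intro mult_left_mono) (auto simp: dist_norm norm_minus_commute)
 also have "\<dots> = norm (y x1) * (K * M * r)" by simp
 also have "\<dots> <= norm (y x1) * (1/2)" using r by (intro mult_left_mono) auto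
 finally have "norm (y x1) <= norm (y x1) * (1/2)" using y(2) by simp
 then have "y x = 0" if "x : ball x0 r" for x using x1(2)[of x] that by simp
 then show ?thesis using r sub ball_subset_cball by blast
qed

text \<open>On a small ball around a zero of the difference of two solutions, the mean value estimate bounds
 the maximum of the difference by half of itself. So the set where they agree is open; it is closed by
 continuity.\<close>

lemma linear_pde_unique:
 fixes \<Omega> :: "'v::euclidean_space => 'v => 'b::real_normed_vector"
  and m :: "'w::euclidean_space => 'b => 'w"
 assumes m: "bounded_bilinear m" and D: "open D" "connected D" "x0 : D"
  and lin: "!!u. u : D ==> linear (\<Omega> u)" and cont: "!!v. continuous_on D (%u. \<Omega> u v)"
  and y: "!!x. x : D ==> (y has_derivative (%v. m (y x) (\<Omega> x v))) (at x)"
  and z: "!!x. x : D ==> (z has_derivative (%v. m (z x) (\<Omega> x v))) (at x)"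
  and eq: "y x0 = z x0" and x: "x : D"
 shows "y x = z x"
proof -
 let ?w = "%x. y x - z x"
 have w: "(?w has_derivative (%v. m (?w x) (\<Omega> x v))) (at x)" if "x : D" for x
  using has_derivative_diff[OF y[OF that] z[OF that]] by (simp add: bounded_bilinear.diff_left[OF m])
 have contw: "continuous_on D ?w"
  using w has_derivative_continuous by (intro continuous_at_imp_continuous_on) blast
 have "?w x = 0"
 proof (rule connected_induction_simple[OF D(2,3) x, where P="%x. ?w x = 0"])
  fix a assume a: "a : D"
  show "EX T. openin (top_of_set D) T & a : T & (ALL x:T. ALL y:T. ?w x = 0 --> ?w y = 0)"
  proof (cases "?w a = 0")
   case True
   then obtain r where "r > 0" "ball a r \<subseteq> D" "ALL x:ball a r. ?w x = 0"
    using linear_pde_zero_local[OF m D(1) a lin cont w] by blast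
   then show ?thesis by (intro exI[of _ "ball a r"]) (auto simp: openin_open_eq[OF D(1)])
  next
   case False
   have "openin (top_of_set D) (D \<inter> ?w -` (-{0}))"
    by (rule continuous_openin_preimage_gen[OF contw]) auto
   then show ?thesis using a False by (intro exI[of _ "D \<inter> ?w -` (-{0})"]) auto
  qed
 qed (use eq in simp)
 then show ?thesis by simp
qed

text \<open>The equation expresses each derivative of \<open>y\<close> through \<open>y\<close> and the smooth forms, so regularity is
 gained one order at a time.\<close>

lemma linear_pde_smooth:
 fixes \<Omega> :: "'v::euclidean_space => 'v => 'b::real_normed_vector"
  and m :: "'w::euclidean_space => 'b => 'w"
 assumes m: "bounded_bilinear m" and D: "open D" and sm: "!!v. smooth_on D (%u. \<Omega> u v)"
  and y: "!!x. x : D ==> (y has_derivative (%v. m (y x) (\<Omega> x v))) (at x)"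
 shows "smooth_on D y"
proof -
 have "Ck_on k D y" for k
 proof (induction k)
  case 0
  have "continuous_on D y"
   by (rule continuous_at_imp_continuous_on) (use y has_derivative_continuous in blast)
  then show ?case by simp
 next
  case (Suc k)
  show ?case
   by (rule Ck_on_SucI[OF D y Ck_on_bilinear[OF m D Suc]]) (use sm in \<open>auto simp: smooth_on_def\<close>)
 qed
 then show ?thesis by (simp add: smooth_on_def)
qed

section \<open>Local systems on simply connected spaces\<close>

lemma simply_connected_path_connected:
 fixes S :: "'a::topological_space set"
 assumes "simply_connected S"
 shows "path_connected S"
 unfolding path_connected_def
proof (intro ballI)
 fix x y assume xy: "x : S" "y : S"
 have "homotopic_loops S (%t. x) (%t. y)"
  using assms[unfolded simply_connected_def, rule_format, of "%t. x" "%t. y"] xy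
  by (auto simp: path_def pathstart_def pathfinish_def path_image_def)
 then obtain h where h: "continuous_on ({0..1::real} \<times> {0..1::real}) h" "h : ({0..1} \<times> {0..1}) \<rightarrow> S"
  "ALL t:{0..1}. h (0, t) = x" "ALL t:{0..1}. h (1, t) = y"
  unfolding homotopic_loops by blast
 have "path (%s. h (s, 0))" unfolding path_def
  by (rule continuous_on_compose2[OF h(1)]) (auto intro!: continuous_intros)
 then show "EX g. path g & path_image g \<subseteq> S & pathstart g = x & pathfinish g = y"
  using h(2-4) by (intro exI[of _ "%s. h (s, 0)"]) (auto simp: path_image_def pathstart_def pathfinish_def Pi_iff)
qed

lemma simply_connected_connected:
 fixes S :: "'a::topological_space set"
 assumes "simply_connected S"
 shows "connected S"
 using path_connected_imp_connected[OF simply_connected_path_connected[OF assms]] .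

text \<open>The solutions of a flat linear equation without their equation: on small sets they are determined
 by, and exist for, any value at any point. The gluing argument for simply connected spaces needs
 only this.\<close>

locale local_system =
 fixes Sol :: "'a::topological_space set => ('a => 'w) => bool"
 assumes Sol_open: "Sol V Q ==> open V"
  and restrict: "Sol V Q ==> open V' ==> V' \<subseteq> V ==> Sol V' Q"
  and cong: "Sol V Q ==> (!!x. x : V ==> Q x = Q' x) ==> Sol V Q'"
  and glue: "(!!x. x : V ==> EX N. x : N & N \<subseteq> V & Sol N Q) ==> Sol V Q"
  and basic: "open W ==> x : W ==> EX B. open B & x : B & B \<subseteq> W & path_connected B &
   (ALL y:B. ALL w. EX Q. Sol B Q & Q y = w) &
   (ALL Q Q' y z. Sol B Q & Sol B Q' & y : B & z : B & Q y = Q' y --> Q z = Q' z)"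
begin

text \<open>\<open>R\<close> is a section along \<open>h\<close>: near every point of \<open>K\<close> it is the pullback of a solution.\<close>

definition horizontal :: "('p::topological_space => 'a) => 'p set => ('p => 'w) => bool" where
 "horizontal h K R \<longleftrightarrow> (ALL z:K. EX N V Q. open N & z : N & Sol V Q &
   (ALL z':N \<inter> K. h z' : V & R z' = Q (h z')))"

lemma horizontalE:
 assumes "horizontal h K R" "z : K"
 obtains N V Q where "open N" "z : N" "Sol V Q" "ALL z':N \<inter> K. h z' : V & R z' = Q (h z')"
 using assms unfolding horizontal_def by (metis IntI)

lemma horizontalI:
 assumes "!!z. z : K ==> EX N V Q. open N & z : N & Sol V Q & (ALL z':N \<inter> K. h z' : V & R z' = Q (h z'))"
 shows "horizontal h K R"
 using assms unfolding horizontal_def by blast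

lemma horizontal_subset: 
 assumes "horizontal h K R" "K' \<subseteq> K"
 shows "horizontal h K' R"
proof (rule horizontalI)
 fix z assume "z : K'"
 then have "z : K" using assms by blast
 then obtain N V Q where "open N" "z : N" "Sol V Q" "ALL z':N \<inter> K. h z' : V & R z' = Q (h z')"
  by (rule horizontalE[OF assms(1)])
 then show "EX N V Q. open N & z : N & Sol V Q & (ALL z':N \<inter> K'. h z' : V & R z' = Q (h z'))"
  using assms(2) by (intro exI[of _ N] exI[of _ V] exI[of _ Q]) auto
qed

lemma horizontal_cong:
 assumes "horizontal h K R" "!!z. z : K ==> h z = h' z"
 shows "horizontal h' K R"
proof (rule horizontalI)
 fix z assume "z : K"
 then obtain N V Q where "open N" "z : N" "Sol V Q" "ALL z':N \<inter> K. h z' : V & R z' = Q (h z')"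
  by (rule horizontalE[OF assms(1)])
 then show "EX N V Q. open N & z : N & Sol V Q & (ALL z':N \<inter> K. h' z' : V & R z' = Q (h' z'))"
  using assms(2) by (intro exI[of _ N] exI[of _ V] exI[of _ Q]) auto
qed

lemma horizontal_Sol:
 assumes "Sol V Q" "h ` K \<subseteq> V"
 shows "horizontal h K (%z. Q (h z))"
 by (rule horizontalI, rule exI[of _ UNIV], rule exI[of _ V], rule exI[of _ Q]) (use assms in auto)

lemma horizontal_compose:
 assumes "horizontal h K R" "continuous_on K' \<phi>" "\<phi> ` K' \<subseteq> K"
 shows "horizontal (%z. h (\<phi> z)) K' (%z. R (\<phi> z))"
proof (rule horizontalI)
 fix z assume z: "z : K'"
 obtain N V Q where N: "open N" "\<phi> z : N" "Sol V Q" "ALL z':N \<inter> K. h z' : V & R z' = Q (h z')"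
  by (rule horizontalE[OF assms(1), of "\<phi> z"]) (use assms(3) z in auto)
 obtain N' where N': "open N'" "N' \<inter> K' = \<phi> -` N \<inter> K'"
  using assms(2) N(1) unfolding continuous_on_open_invariant by blast
 show "EX N V Q. open N & z : N & Sol V Q & (ALL z':N \<inter> K'. h (\<phi> z') : V & R (\<phi> z') = Q (h (\<phi> z')))"
  using N N' z assms(3) by (intro exI[of _ N'] exI[of _ V] exI[of _ Q]) auto
qed

lemma local_agree:
 assumes "Sol V Q" "Sol V' Q'" "x : V" "x : V'"
 obtains B where "open B" "x : B" "B \<subseteq> V \<inter> V'" "ALL y:B. ALL z:B. Q y = Q' y --> Q z = Q' z"
proof -
 have "open (V \<inter> V')" "x : V \<inter> V'" using Sol_open assms by auto
 then obtain B where B: "open B" "x : B" "B \<subseteq> V \<inter> V'"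
  "ALL Q Q' y z. Sol B Q & Sol B Q' & y : B & z : B & Q y = Q' y --> Q z = Q' z"
  using basic[of "V \<inter> V'" x] by blast
 moreover have "Sol B Q" "Sol B Q'" using restrict B assms by blast+
 ultimately show ?thesis using that[OF B(1-3)] by metis
qed

lemma horizontal_unique:
 assumes "connected K" "continuous_on K h" "horizontal h K R" "horizontal h K R'" "a : K" "b : K" "R a = R' a"
 shows "R b = R' b"
proof (rule connected_induction_simple[OF assms(1,5,6), where P="%z. R z = R' z"])
 fix z assume z: "z : K"
 obtain N V Q where N: "open N" "z : N" "Sol V Q" "ALL z':N \<inter> K. h z' : V & R z' = Q (h z')"
  by (rule horizontalE[OF assms(3) z])
 obtain N' V' Q' where N': "open N'" "z : N'" "Sol V' Q'" "ALL z':N' \<inter> K. h z' : V' & R' z' = Q' (h z')"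
  by (rule horizontalE[OF assms(4) z])
 obtain B where B: "open B" "h z : B" "ALL y:B. ALL z:B. Q y = Q' y --> Q z = Q' z"
  by (rule local_agree[OF N(3) N'(3), of "h z"]) (use N N' z in auto)
 let ?T = "(K \<inter> h -` B) \<inter> (K \<inter> (N \<inter> N'))"
 have "openin (top_of_set K) ?T"
  by (intro openin_Int continuous_openin_preimage_gen[OF assms(2) B(1)] openin_open_Int open_Int N(1) N'(1))
 moreover have "ALL x:?T. ALL y:?T. R x = R' x --> R y = R' y" using N(4) N'(4) B(3) by auto
 ultimately show "EX T. openin (top_of_set K) T & z : T & (ALL x:T. ALL y:T. R x = R' x --> R y = R' y)"
  using z B(2) N(2) N'(2) by (intro exI[of _ ?T]) auto
qed fact

lemma Sol_unique:
 assumes "connected V" "Sol V Q" "Sol V Q'" "a : V" "b : V" "Q a = Q' a"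
 shows "Q b = Q' b"
proof -
 have "horizontal id V (%z. Q (id z))" "horizontal id V (%z. Q' (id z))"
  by (rule horizontal_Sol[OF assms(2)] horizontal_Sol[OF assms(3)]; simp)+
 from horizontal_unique[OF assms(1) continuous_on_id' this assms(4,5)] assms(6) show ?thesis by (simp add: id_def)
qed

lemma horizontal_paste:
 fixes h :: "'p::topological_space => 'a"
 assumes "closed A" "closed C" "horizontal h A R" "horizontal h C R'" "continuous_on UNIV h"
  and eq: "!!z. z : A \<inter> C ==> R z = R' z"
 shows "horizontal h (A \<union> C) (%z. if z : A then R z else R' z)"
 unfolding horizontal_def
proof
 let ?R = "%z. if z : A then R z else R' z"
 let ?goal = "%z. EX N V Q. open N & z : N & Sol V Q & (ALL z':N \<inter> (A \<union> C). h z' : V & ?R z' = Q (h z'))"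
 fix z assume "z : A \<union> C"
 then consider "z : A" "z ~: C" | "z ~: A" "z : C" | "z : A" "z : C" by blast
 then show "?goal z"
 proof cases
  case 1
  obtain N V Q where N: "open N" "z : N" "Sol V Q" "ALL z':N \<inter> A. h z' : V & R z' = Q (h z')"
   by (rule horizontalE[OF assms(3) 1(1)])
  have "open (N - C)" using N assms by auto
  then show ?thesis using N 1 by (intro exI[of _ "N - C"] exI[of _ V] exI[of _ Q]) auto
 next
  case 2
  obtain N V Q where N: "open N" "z : N" "Sol V Q" "ALL z':N \<inter> C. h z' : V & R' z' = Q (h z')"
   by (rule horizontalE[OF assms(4) 2(2)])
  have "open (N - A)" using N assms by auto
  then show ?thesis using N 2 by (intro exI[of _ "N - A"] exI[of _ V] exI[of _ Q]) auto
 next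
  case 3
  obtain N V Q where N: "open N" "z : N" "Sol V Q" "ALL z':N \<inter> A. h z' : V & R z' = Q (h z')"
   by (rule horizontalE[OF assms(3) 3(1)])
  obtain N' V' Q' where N': "open N'" "z : N'" "Sol V' Q'" "ALL z':N' \<inter> C. h z' : V' & R' z' = Q' (h z')"
   by (rule horizontalE[OF assms(4) 3(2)])
  obtain B where B: "open B" "h z : B" "B \<subseteq> V \<inter> V'" "ALL y:B. ALL z:B. Q y = Q' y --> Q z = Q' z"
   by (rule local_agree[OF N(3) N'(3), of "h z"]) (use N N' 3 in auto)
  have "Q (h z) = Q' (h z)" using eq 3 N N' by (metis IntI)
  then have QQ: "Q y = Q' y" if "y : B" for y using B that by blast
  let ?N = "N \<inter> N' \<inter> h -` B"
  have "open ?N" using N N' open_vimage[OF B(1) assms(5)] by auto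
  moreover have "ALL z':?N \<inter> (A \<union> C). h z' : V & ?R z' = Q (h z')"
   using N(4) N'(4) QQ B(3) by auto
  ultimately show ?thesis using N N' B by (intro exI[of _ ?N] exI[of _ V] exI[of _ Q]) auto
 qed
qed

definition liftable :: "('p::topological_space => 'a) => 'p set => bool" where
 "liftable h K \<longleftrightarrow> (ALL z:K. ALL w. EX R. horizontal h K R & R z = w)"

lemma liftableD: "liftable h K ==> z : K ==> EX R. horizontal h K R & R z = w"
 unfolding liftable_def by blast

lemma liftable_Un:
 fixes h :: "'p::topological_space => 'a"
 assumes "closed A" "closed C" "liftable h A" "liftable h C" "continuous_on UNIV h"
  and conn: "connected (A \<inter> C)" "A \<inter> C ~= {}"
 shows "liftable h (A \<union> C)"
proof -
 have *: "EX R. horizontal h (A \<union> C) R & R z = w"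
  if prems: "closed A" "closed C" "liftable h A" "liftable h C" "connected (A \<inter> C)" "A \<inter> C ~= {}" "z : A"
  for A C z w
 proof -
  obtain R where R: "horizontal h A R" "R z = w" using prems unfolding liftable_def by blast
  obtain z0 where z0: "z0 : A \<inter> C" using prems by blast
  obtain R' where R': "horizontal h C R'" "R' z0 = R z0" using prems z0 unfolding liftable_def by blast
  have "R z = R' z" if "z : A \<inter> C" for z
   by (rule horizontal_unique[OF \<open>connected (A \<inter> C)\<close> continuous_on_subset[OF assms(5)]
      horizontal_subset[OF R(1)] horizontal_subset[OF R'(1)] z0 that]) (use R' in auto)
  note P = horizontal_paste[OF prems(1,2) R(1) R'(1) assms(5) this]
  show ?thesis by (rule exI[of _ "%z. if z : A then R z else R' z"]) (use P R prems in auto)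
 qed
 show ?thesis
  unfolding liftable_def using *[of A C] *[of C A] assms by (auto simp: Int_commute Un_commute)
qed

lemma liftable_small:
 assumes "continuous_on UNIV h"
 shows "EX N. open N & z : N & (\<forall>K\<subseteq>N. liftable h K)"
proof -
 obtain B where B: "open B" "h z : B" "ALL y:B. ALL w. EX Q. Sol B Q & Q y = w"
  using basic[of UNIV "h z"] by auto
 have "liftable h K" if "K \<subseteq> h -` B" for K
  unfolding liftable_def
 proof (intro ballI allI)
  fix z w assume "z : K"
  then have "h z : B" using that by blast
  then obtain Q where "Sol B Q" "Q (h z) = w" using B(3) by blast
  then show "EX R. horizontal h K R & R z = w"
   using horizontal_Sol[of B Q h K] that by (intro exI[of _ "%z. Q (h z)"]) auto
 qed
 then show ?thesis using open_vimage[OF B(1) assms] B(2) by (intro exI[of _ "h -` B"]) simp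
qed

lemma liftable_rectangle:
 fixes h :: "real \<times> real => 'a"
 assumes h: "continuous_on UNIV h" and "a <= b" "c <= d"
 shows "liftable h ({a..b} \<times> {c..d})"
proof -
 define L where "L a b c d \<longleftrightarrow> (a <= b --> c <= d --> liftable h ({a..b} \<times> {c..d}))" for a b c d
 have strip: "\<exists>e>0. ALL a b. a <= s & s <= b & b - a < e --> L a b c d" if "c <= d" for s c d
  using that
 proof (induction rule: Bolzano[where P="%c d. \<exists>e>0. ALL a b. a <= s & s <= b & b - a < e --> L a b c d"])
  case (trans t u v)
  obtain e e' where e: "e > 0" "ALL a b. a <= s & s <= b & b - a < e --> L a b t u"
   "e' > 0" "ALL a b. a <= s & s <= b & b - a < e' --> L a b u v" using trans by blast
  have "L a b t v" if ab: "a <= s" "s <= b" "b - a < min e e'" for a b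
  proof -
   have "liftable h ({a..b} \<times> {t..u})" "liftable h ({a..b} \<times> {u..v})"
    using e ab trans by (auto simp: L_def)
   moreover have "{a..b} \<times> {t..u} \<inter> {a..b} \<times> {u..v} = {a..b} \<times> {u}" using trans by auto
   moreover have "connected ({a..b} \<times> {u})" by (intro connected_Times) auto
   moreover have "{a..b} \<times> {t..u} \<union> {a..b} \<times> {u..v} = {a..b} \<times> {t..v}" using trans by auto
   ultimately show ?thesis
    using liftable_Un[of "{a..b} \<times> {t..u}" "{a..b} \<times> {u..v}" h] h ab
    by (auto simp: L_def closed_Times)
  qed
  then show ?case using e by (intro exI[of _ "min e e'"]) auto
 next
  case (local t)
  obtain N where N: "open N" "(s, t) : N" "\<forall>K\<subseteq>N. liftable h K"
   using liftable_small[OF h, of "(s, t)"] by blast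
  obtain A B where AB: "open A" "s : A" "open B" "t : B" "A \<times> B \<subseteq> N"
   using open_prod_elim[OF N(1,2)] by (metis mem_Sigma_iff)
  obtain e e' where e: "e > 0" "ball s e \<subseteq> A" "e' > 0" "ball t e' \<subseteq> B"
   using AB open_contains_ball by meson
  have "L a b c d" if "a <= s & s <= b & b - a < e" "c <= t & t <= d & d - c < e'" for a b c d
  proof -
   have "{a..b} \<subseteq> ball s e" "{c..d} \<subseteq> ball t e'" using that by (auto simp: dist_real_def)
   then have "{a..b} \<times> {c..d} \<subseteq> N" using e AB by blast
   then show ?thesis using N by (simp add: L_def)
  qed
  then show ?case using e by blast
 qed
 have "L a b c d"
  using \<open>a <= b\<close>
 proof (induction rule: Bolzano[where P="%a b. L a b c d"])
  case (trans s t u)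
  have "liftable h ({s..t} \<times> {c..d})" "liftable h ({t..u} \<times> {c..d})"
   using trans \<open>c <= d\<close> by (auto simp: L_def)
  moreover have "{s..t} \<times> {c..d} \<inter> {t..u} \<times> {c..d} = {t} \<times> {c..d}" using trans by auto
  moreover have "connected ({t} \<times> {c..d})" by (intro connected_Times) auto
  moreover have "{s..t} \<times> {c..d} \<union> {t..u} \<times> {c..d} = {s..u} \<times> {c..d}" using trans by auto
  ultimately show ?case
   using liftable_Un[of "{s..t} \<times> {c..d}" "{t..u} \<times> {c..d}" h] h \<open>c <= d\<close>
   by (auto simp: L_def closed_Times)
 next
  case (local s)
  then show ?case using strip[OF \<open>c <= d\<close>, of s] by auto
 qed
 then show ?thesis using assms by (simp add: L_def)
qed

definition transports :: "(real => 'a) => 'w => 'w => bool" where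
 "transports g w v \<longleftrightarrow> (EX R. horizontal g {0..1} R & R 0 = w & R 1 = v)"

lemma continuous_on_clamped:
 assumes "continuous_on ({0..1} \<times> {0..1::real}) (h :: real \<times> real => 'a)"
 shows "continuous_on UNIV (%z. h (max 0 (min 1 (fst z)), max 0 (min 1 (snd z))))"
 by (rule continuous_on_compose2[OF assms]) (auto intro!: continuous_intros)

lemma transports_exists:
 assumes "path g"
 shows "EX v. transports g w v"
proof -
 have cg: "continuous_on ({0..1} \<times> {0..1}) (%z::real \<times> real. g (snd z))"
  by (rule continuous_on_compose2[of "{0..1}" g]) (use assms in \<open>auto simp: path_def intro!: continuous_intros\<close>)
 have "EX R. horizontal (%z::real \<times> real. g (max 0 (min 1 (snd z)))) ({0..1} \<times> {0..1}) R & R (0, 0) = w"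
  using liftableD[OF liftable_rectangle[OF continuous_on_clamped[OF cg], of 0 1 0 1], of "(0, 0)" w] by simp
 then obtain R where R: "horizontal (%z::real \<times> real. g (max 0 (min 1 (snd z)))) ({0..1} \<times> {0..1}) R" "R (0, 0) = w"
  by blast
 have "horizontal (%t. g (max 0 (min 1 (snd (0::real, t))))) {0..1} (%t. R (0, t))"
  by (rule horizontal_compose[OF R(1)]) (auto intro!: continuous_intros)
 then have "horizontal g {0..1} (%t. R (0, t))" by (rule horizontal_cong) auto
 then show ?thesis unfolding transports_def using R(2) by blast
qed

lemma transports_unique:
 assumes "path g" "transports g w v" "transports g w v'"
 shows "v = v'"
 using horizontal_unique[of "{0..1}" g] assms unfolding transports_def path_def
 by (metis atLeastAtMost_iff connected_Icc order_refl zero_le_one)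

lemma horizontal_join:
 assumes "horizontal (g +++ g') {0..1} R" "pathfinish g = pathstart g'"
 shows "horizontal g {0..1} (%t. R (t / 2))" "horizontal g' {0..1} (%t. R ((t + 1) / 2))"
proof -
 have "horizontal (%t. (g +++ g') (t / 2)) {0..1} (%t. R (t / 2))"
  by (rule horizontal_compose[OF assms(1)]) (auto intro!: continuous_intros)
 then show "horizontal g {0..1} (%t. R (t / 2))"
  by (rule horizontal_cong) (auto simp: joinpaths_def)
 have "horizontal (%t. (g +++ g') ((t + 1) / 2)) {0..1} (%t. R ((t + 1) / 2))"
  by (rule horizontal_compose[OF assms(1)]) (auto intro!: continuous_intros)
 then show "horizontal g' {0..1} (%t. R ((t + 1) / 2))"
  by (rule horizontal_cong) (use assms(2) in \<open>auto simp: joinpaths_def pathstart_def pathfinish_def field_simps\<close>)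
qed

text \<open>A free homotopy from a loop to a constant loop lifts to the square. The lifts along its two
 sides run over the same path of base points and agree at the constant end, hence at the loop.\<close>

lemma transports_loop:
 assumes "homotopic_loops UNIV g (%t. p)" "transports g w v"
 shows "v = w"
proof -
 obtain h where h: "continuous_on ({0..1::real} \<times> {0..1::real}) h" "!!t. t : {0..1} ==> h (0, t) = g t"
  "!!t. t : {0..1} ==> h (1, t) = p" "!!s. s : {0..1} ==> h (s, 1) = h (s, 0)"
  using assms(1) unfolding homotopic_loops by (auto simp: pathstart_def pathfinish_def)
 let ?S = "{0..1::real} \<times> {0..1::real}"
 have "EX R. horizontal (%z. h (max 0 (min 1 (fst z)), max 0 (min 1 (snd z)))) ?S R & R (0, 0) = w"
  using liftableD[OF liftable_rectangle[OF continuous_on_clamped[OF h(1)], of 0 1 0 1], of "(0, 0)" w] by simp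
 then obtain R where R: "horizontal (%z. h (max 0 (min 1 (fst z)), max 0 (min 1 (snd z)))) ?S R" "R (0, 0) = w"
  by blast
 then have Rh: "horizontal h ?S R" by (intro horizontal_cong[OF R(1)]) auto
 have edge: "horizontal (%t. h (\<phi> t)) {0..1} (%t. R (\<phi> t))"
  if "continuous_on {0..1} \<phi>" "\<phi> ` {0..1} \<subseteq> ?S" for \<phi> :: "real => real \<times> real"
  by (rule horizontal_compose[OF Rh that])
 have conth: "continuous_on {0..1} (%s. h (s, 0))"
  by (rule continuous_on_compose2[OF h(1)]) (auto intro!: continuous_intros)
 have "horizontal (%s. h (1, s)) {0..1} (%s. R (1, s))"
  by (rule edge) (auto intro!: continuous_intros)
 then have 1: "horizontal (%s. p) {0..1::real} (%s. R (1, s))"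
  by (rule horizontal_cong) (use h in auto)
 obtain B where B: "p : B" "ALL y:B. ALL w. EX Q. Sol B Q & Q y = w"
  using basic[of UNIV p] by auto
 then obtain Q where BQ: "p : B" "Sol B Q" "Q p = R (1, 0)" by blast
 have "R (1, 1) = R (1, 0)"
  using horizontal_unique[OF _ _ 1 horizontal_Sol[OF BQ(2), of "%s. p" "{0..1}"], of 0 1] BQ by auto
 moreover have "horizontal (%s. h (s, 0)) {0..1} (%s. R (s, 0))"
  by (rule edge) (auto intro!: continuous_intros)
 moreover have "horizontal (%s. h (s, 1)) {0..1} (%s. R (s, 1))"
  by (rule edge) (auto intro!: continuous_intros)
 then have "horizontal (%s. h (s, 0)) {0..1} (%s. R (s, 1))"
  by (rule horizontal_cong) (use h in auto)
 ultimately have "R (0, 1) = R (0, 0)"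
  using horizontal_unique[OF connected_Icc conth, of "%s. R (s, 1)" "%s. R (s, 0)" 1 0] by auto
 moreover have "horizontal (%s. h (0, s)) {0..1} (%s. R (0, s))"
  by (rule edge) (auto intro!: continuous_intros)
 then have "horizontal g {0..1} (%s. R (0, s))"
  by (rule horizontal_cong) (use h in auto)
 then have "transports g w (R (0, 1))" unfolding transports_def using R(2) by blast
 moreover have "path g" using homotopic_loops_imp_path[OF assms(1)] by simp
 ultimately show ?thesis using transports_unique[OF _ assms(2)] R(2) by simp
qed

lemma transports_path_independent:
 assumes "simply_connected (UNIV :: 'a set)" "path g" "path g'"
  "pathstart g = pathstart g'" "pathfinish g = pathfinish g'"
  "transports g w v" "transports g' w v'"
 shows "v = v'"
proof -
 let ?l = "g +++ reversepath g'"
 have l: "path ?l" using assms by simp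
 have const: "path (%t::real. pathstart g)" by (simp add: path_def)
 have "homotopic_loops UNIV ?l (%t. pathstart g)"
  using assms(1,4) l const unfolding simply_connected_def
  by (auto simp: pathstart_def pathfinish_def path_image_def reversepath_def joinpaths_def)
 moreover obtain u where u: "transports ?l w u" using transports_exists[OF l] by blast
 ultimately have "u = w" using transports_loop by blast
 obtain R where R: "horizontal ?l {0..1} R" "R 0 = w" "R 1 = w"
  using u \<open>u = w\<close> unfolding transports_def by blast
 have fin: "pathfinish g = pathstart (reversepath g')" using assms by simp
 have "transports g w (R (1/2))"
  unfolding transports_def using horizontal_join(1)[OF R(1) fin] R(2) by (intro exI[of _ "%t. R (t / 2)"]) auto
 moreover have "horizontal (%t. reversepath g' (1 - t)) {0..1} (%t. R (((1 - t) + 1) / 2))"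
  by (rule horizontal_compose[OF horizontal_join(2)[OF R(1) fin]]) (auto intro!: continuous_intros)
 then have "horizontal g' {0..1} (%t. R (((1 - t) + 1) / 2))"
  by (rule horizontal_cong) (auto simp: reversepath_def)
 then have "transports g' w (R (1/2))"
  unfolding transports_def using R(3) by (intro exI[of _ "%t. R (((1 - t) + 1) / 2)"]) auto
 ultimately show ?thesis using transports_unique assms by metis
qed

text \<open>Continue the value at \<open>p\<close> along paths. Simple connectedness makes the result independent of the
 path.\<close>

theorem global_solution:
 assumes "simply_connected (UNIV :: 'a set)"
 shows "EX Q. Sol UNIV Q & Q p = w"
proof -
 have pc: "path_connected (UNIV :: 'a set)" by (rule simply_connected_path_connected[OF assms])
 define Q where "Q x = (SOME v. EX g. path g & pathstart g = p & pathfinish g = x & transports g w v)" for x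
 have Q: "Q (pathfinish g) = v" if "path g" "pathstart g = p" "transports g w v" for g v
  unfolding Q_def
  by (rule some_equality) (use that transports_path_independent[OF assms] in metis)+
 have ex: "EX g. path g & pathstart g = p & pathfinish g = x & transports g w (Q x)" for x
 proof -
  obtain g where "path g" "pathstart g = p" "pathfinish g = x"
   using pc unfolding path_connected_def by blast
  then show ?thesis using Q transports_exists[of g w] by metis
 qed
 have "Sol UNIV Q"
 proof (rule glue)
  fix x :: 'a
  obtain B where B: "open B" "x : B" "path_connected B" "ALL y:B. ALL w. EX Q. Sol B Q & Q y = w"
   using basic[of UNIV x] by auto
  obtain QB where QB: "Sol B QB" "QB x = Q x" using B by blast
  obtain g where g: "path g" "pathstart g = p" "pathfinish g = x" "transports g w (Q x)"
   using ex by blast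
  have "QB y = Q y" if y: "y : B" for y
  proof -
   obtain b where b: "path b" "path_image b \<subseteq> B" "pathstart b = x" "pathfinish b = y"
    using B(2,3) y unfolding path_connected_def by blast
   have gb: "path (g +++ b)" "pathstart (g +++ b) = p" "pathfinish (g +++ b) = y" using g b by auto
   obtain R where R: "horizontal (g +++ b) {0..1} R" "R 0 = w"
    using transports_exists[OF gb(1), of w] unfolding transports_def by blast
   have fin: "pathfinish g = pathstart b" using g b by simp
   have "transports g w (R (1/2))"
    unfolding transports_def using horizontal_join(1)[OF R(1) fin] R(2) by (intro exI[of _ "%t. R (t / 2)"]) auto
   then have mid: "R (1/2) = Q x" using transports_unique[OF g(1)] g(4) by blast
   have "R 1 = QB (b 1)"
    using horizontal_unique[OF connected_Icc _ horizontal_join(2)[OF R(1) fin] horizontal_Sol[OF QB(1), of b "{0..1}"], of 0 1]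
     b mid QB(2) by (auto simp: path_def path_image_def pathstart_def)
   moreover have "transports (g +++ b) w (R 1)" unfolding transports_def using R by blast
   ultimately show ?thesis using Q[OF gb(1,2)] gb(3) b(4) by (simp add: pathfinish_def)
  qed
  then have "Sol B Q" using cong[OF QB(1)] by blast
  then show "EX N. x : N & N \<subseteq> UNIV & Sol N Q" using B by blast
 qed
 moreover have "Q p = w"
 proof -
  obtain B where B: "p : B" "ALL y:B. ALL w. EX Q. Sol B Q & Q y = w"
   using basic[of UNIV p] by auto
  then obtain Q0 where "p : B" "Sol B Q0" "Q0 p = w" by blast
  then have "transports (%t. p) w w" unfolding transports_def
   using horizontal_Sol[of B Q0 "%t. p" "{0..1}"] by auto
  then show ?thesis using Q[of "%t. p" w] by (simp add: path_def pathstart_def pathfinish_def)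
 qed
 ultimately show ?thesis by blast
qed

end

section \<open>Smooth maps on manifolds\<close>

lemma rep_apply: "rep ch f u = f (inv_into (fst ch) (snd ch) u)"
 by (simp add: rep_def)

lemma simply_connected_homeomorphic_image:
 fixes S :: "'p::topological_space set" and T :: "'q::topological_space set"
 assumes "homeomorphism S T f g" "simply_connected S"
 shows "simply_connected T"
 unfolding simply_connected_def
proof (intro allI impI)
 fix p q :: "real => 'q"
 assume pq: "path p & pathfinish p = pathstart p & path_image p \<subseteq> T &
  path q & pathfinish q = pathstart q & path_image q \<subseteq> T"
 have g: "continuous_on T g" "g ` T = S" "!!y. y : T ==> f (g y) = y" and f: "continuous_on S f" "f ` S = T"
  using assms(1) by (auto simp: homeomorphism_def)
 have *: "path (g \<circ> r) & pathfinish (g \<circ> r) = pathstart (g \<circ> r) & path_image (g \<circ> r) \<subseteq> S"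
  if "path r" "pathfinish r = pathstart r" "path_image r \<subseteq> T" for r
  using that g continuous_on_subset[OF g(1) that(3)]
  by (auto simp: path_continuous_image pathfinish_compose pathstart_compose path_image_compose)
 have "homotopic_loops S (g \<circ> p) (g \<circ> q)"
  using assms(2)[unfolded simply_connected_def, rule_format, of "g \<circ> p" "g \<circ> q"] *[of p] *[of q] pq by blast
 then have "homotopic_loops T (f \<circ> (g \<circ> p)) (f \<circ> (g \<circ> q))"
  by (rule homotopic_loops_continuous_image) (use f in auto)
 moreover have "homotopic_loops T p (f \<circ> (g \<circ> p))" "homotopic_loops T (f \<circ> (g \<circ> q)) q"
 proof -
  have e: "homotopic_loops T r (f \<circ> (g \<circ> r))" if "path r" "path_image r \<subseteq> T" "pathfinish r = pathstart r" for r
   by (rule homotopic_loops_eq) (use that g(3) in \<open>auto simp: path_image_def subset_iff\<close>)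
  show "homotopic_loops T p (f \<circ> (g \<circ> p))" using e pq by blast
  show "homotopic_loops T (f \<circ> (g \<circ> q)) q" using e pq homotopic_loops_sym by blast
 qed
 ultimately show "homotopic_loops T p q" using homotopic_loops_trans by blast
qed

locale smooth_manifold =
 fixes \<A> :: "('a::{t2_space, second_countable_topology}, 'm::finite) chart set"
 assumes atlas: "smooth_atlas \<A>"
begin

lemma chart_cover: obtains ch where "ch : \<A>" "x : fst ch"
proof -
 have "x : (\<Union>ch\<in>\<A>. fst ch)" using atlas by (simp add: smooth_atlas_def)
 then show ?thesis using that by blast
qed

lemma
 assumes "ch : \<A>"
 shows chart_open: "open (fst ch)"
  and chart_image_open: "open (snd ch ` fst ch)"
  and chart_inj: "inj_on (snd ch) (fst ch)"
  and chart_cont: "continuous_on (fst ch) (snd ch)"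
  and chart_inv_cont: "continuous_on (snd ch ` fst ch) (inv_into (fst ch) (snd ch))"
 using assms atlas by (auto simp: smooth_atlas_def is_chart_def)

lemma transition_smooth:
 "ch : \<A> ==> ch' : \<A> ==> smooth_on (snd ch ` (fst ch \<inter> fst ch')) (rep ch (snd ch'))"
 using atlas by (simp add: smooth_atlas_def)

lemma chart_inv: "ch : \<A> ==> x : fst ch ==> inv_into (fst ch) (snd ch) (snd ch x) = x"
 by (rule inv_into_f_f[OF chart_inj])

lemma rep_chart: "ch : \<A> ==> x : fst ch ==> rep ch f (snd ch x) = f x"
 by (simp add: rep_apply chart_inv)

lemma open_chart_image:
 assumes "ch : \<A>" "open N" "N \<subseteq> fst ch"
 shows "open (snd ch ` N)"
proof -
 have "snd ch ` N = inv_into (fst ch) (snd ch) -` N \<inter> snd ch ` fst ch"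
  using assms chart_inv[OF assms(1)] by (auto simp: image_iff subset_iff) 
 then show ?thesis
  using chart_inv_cont[OF assms(1), unfolded continuous_on_open_vimage[OF chart_image_open[OF assms(1)]]] assms(2) by simp
qed

lemma open_chart_image_Int: "ch : \<A> ==> open N ==> open (snd ch ` (fst ch \<inter> N))"
 by (rule open_chart_image) (simp_all add: chart_open open_Int)

lemma open_chart_vimage:
 assumes "ch : \<A>" "open W"
 shows "open (fst ch \<inter> snd ch -` W)"
 using chart_cont[OF assms(1), unfolded continuous_on_open_vimage[OF chart_open[OF assms(1)]]] assms(2)
 by (simp add: Int_commute)

lemma smooth_map_onD: "smooth_map_on \<A> N f ==> ch : \<A> ==> N \<subseteq> fst ch ==> smooth_on (snd ch ` N) (rep ch f)"
 unfolding smooth_map_on_def by (metis Int_absorb1)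

lemma smooth_map_on_subset: "smooth_map_on \<A> N f ==> N' \<subseteq> N ==> smooth_map_on \<A> N' f"
 unfolding smooth_map_on_def by (meson Int_mono image_mono smooth_on_subset subset_refl)

lemma smooth_map_on_cong:
 assumes "open N" "!!x. x : N ==> f x = g x" "smooth_map_on \<A> N f"
 shows "smooth_map_on \<A> N g"
 unfolding smooth_map_on_def
proof
 fix ch assume ch: "ch : \<A>"
 show "smooth_on (snd ch ` (fst ch \<inter> N)) (rep ch g)"
 proof (rule smooth_on_cong)
  show "open (snd ch ` (fst ch \<inter> N))" using ch assms(1) open_chart_image_Int by blast
  show "smooth_on (snd ch ` (fst ch \<inter> N)) (rep ch f)" using assms(3) ch by (simp add: smooth_map_on_def)
 qed (use ch assms(2) in \<open>auto simp: rep_chart[OF ch]\<close>)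
qed

lemma smooth_map_on_local:
 assumes "!!x. x : U ==> EX N. open N & x : N & smooth_map_on \<A> N f"
 shows "smooth_map_on \<A> U f"
 unfolding smooth_map_on_def
proof
 fix ch assume ch: "ch : \<A>"
 show "smooth_on (snd ch ` (fst ch \<inter> U)) (rep ch f)"
 proof (rule smooth_on_local)
  fix u assume "u : snd ch ` (fst ch \<inter> U)"
  then obtain x where x: "u = snd ch x" "x : fst ch" "x : U" by auto
  obtain N where N: "open N" "x : N" "smooth_map_on \<A> N f" using assms[OF x(3)] by blast
  have "open (snd ch ` (fst ch \<inter> N))" using ch N open_chart_image_Int by blast
  then show "EX T. open T & u : T & smooth_on T (rep ch f)"
   using N x ch by (intro exI[of _ "snd ch ` (fst ch \<inter> N)"]) (auto simp: smooth_map_on_def)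
 qed
qed

lemma smooth_map_on_chartI:
 assumes ch: "ch : \<A>" and N: "open N" "N \<subseteq> fst ch" and sm: "smooth_on (snd ch ` N) (rep ch f)"
 shows "smooth_map_on \<A> N f"
 unfolding smooth_map_on_def
proof
 fix ch' assume ch': "ch' : \<A>"
 let ?S = "snd ch' ` (fst ch' \<inter> N)"
 have S: "open ?S" using ch' N open_chart_image_Int by blast
 show "smooth_on ?S (rep ch' f)"
 proof (rule smooth_on_cong[OF S])
  show "smooth_on ?S (%u. rep ch f (rep ch' (snd ch) u))"
   by (rule smooth_on_compose[OF S open_chart_image[OF ch N] sm smooth_on_subset[OF transition_smooth[OF ch' ch]]])
    (use N in \<open>auto simp: rep_chart[OF ch']\<close>)
  fix u assume "u : ?S"
  then obtain x where "u = snd ch' x" "x : fst ch'" "x : N" by auto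
  then show "rep ch f (rep ch' (snd ch) u) = rep ch' f u"
   using N by (auto simp: rep_chart[OF ch'] rep_chart[OF ch])
 qed
qed

lemma smooth_map_on_bounded_linear:
 assumes "bounded_linear L" "open N" "smooth_map_on \<A> N f"
 shows "smooth_map_on \<A> N (%x. L (f x))"
 unfolding smooth_map_on_def
proof
 fix ch assume ch: "ch : \<A>"
 have "open (snd ch ` (fst ch \<inter> N))" using ch assms(2) open_chart_image_Int by blast
 then have "smooth_on (snd ch ` (fst ch \<inter> N)) (%u. L (rep ch f u))"
  using assms(3) ch by (intro smooth_on_bounded_linear[OF assms(1)]) (auto simp: smooth_map_on_def)
 then show "smooth_on (snd ch ` (fst ch \<inter> N)) (rep ch (%x. L (f x)))" by (simp add: rep_def o_def)
qed

lemma smooth_map_on_bilinear: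
 assumes "bounded_bilinear B" "open N" "smooth_map_on \<A> N f" "smooth_map_on \<A> N g"
 shows "smooth_map_on \<A> N (%x. B (f x) (g x))"
 unfolding smooth_map_on_def
proof
 fix ch assume ch: "ch : \<A>"
 have "open (snd ch ` (fst ch \<inter> N))" using ch assms(2) open_chart_image_Int by blast
 then have "smooth_on (snd ch ` (fst ch \<inter> N)) (%u. B (rep ch f u) (rep ch g u))"
  using assms(3,4) ch by (intro smooth_on_bilinear[OF assms(1)]) (auto simp: smooth_map_on_def)
 then show "smooth_on (snd ch ` (fst ch \<inter> N)) (rep ch (%x. B (f x) (g x)))" by (simp add: rep_def o_def)
qed

lemma smooth_map_on_const [simp]: "smooth_map_on \<A> N (%x. c)"
 by (simp add: smooth_map_on_def rep_def o_def)

lemma smooth_map_on_matrix_inv: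
 fixes F :: "'a => real ^ 'i::finite ^ 'i"
 assumes "open N" "smooth_map_on \<A> N F" "!!x. x : N ==> invertible (F x)"
 shows "smooth_map_on \<A> N (%x. matrix_inv (F x))"
 unfolding smooth_map_on_def
proof
 fix ch assume ch: "ch : \<A>"
 have "open (snd ch ` (fst ch \<inter> N))" using ch assms(1) open_chart_image_Int by blast
 then have "smooth_on (snd ch ` (fst ch \<inter> N)) (%u. matrix_inv (rep ch F u))"
  using assms(2,3) ch
  by (intro smooth_on_matrix_inv) (auto simp: smooth_map_on_def rep_chart[OF ch])
 then show "smooth_on (snd ch ` (fst ch \<inter> N)) (rep ch (%x. matrix_inv (F x)))" by (simp add: rep_def o_def)
qed

lemma smooth_map_on_matrix_mult:
 fixes A :: "'a => real ^ 'i::finite ^ 'j::finite" and B :: "'a => real ^ 'k::finite ^ 'i"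
 shows "open N ==> smooth_map_on \<A> N A ==> smooth_map_on \<A> N B ==> smooth_map_on \<A> N (%x. A x ** B x)"
 by (rule smooth_map_on_bilinear[OF bounded_bilinear_matrix_mult])


lemma smooth_map_on_differentiable:
 assumes "smooth_map_on \<A> N f" "ch : \<A>" "x : fst ch" "x : N"
 shows "rep ch f differentiable (at (snd ch x))"
 by (rule smooth_on_differentiable[of "snd ch ` (fst ch \<inter> N)"]) (use assms in \<open>auto simp: smooth_map_on_def\<close>)

lemma mdiff_has_derivative:
 assumes "smooth_map_on \<A> N f" "ch : \<A>" "x : fst ch" "x : N"
 shows "(rep ch f has_derivative mdiff ch f x) (at (snd ch x))"
 using has_derivative_ddir[OF smooth_map_on_differentiable[OF assms]] by (simp add: mdiff_def[abs_def])

lemma mdiff_eq: "(rep ch f has_derivative D) (at (snd ch x)) ==> mdiff ch f x = D"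
 by (metis frechet_derivative_at mdiff_def ext)

lemma rep_has_derivative_cong:
 assumes "ch : \<A>" "x : fst ch" "open N" "x : N" "!!y. y : N ==> f y = g y"
  "(rep ch f has_derivative D) (at (snd ch x))"
 shows "(rep ch g has_derivative D) (at (snd ch x))"
proof (rule has_derivative_transform_within_open[OF assms(6), of "snd ch ` (fst ch \<inter> N)"])
 show "open (snd ch ` (fst ch \<inter> N))" using assms open_chart_image_Int by blast
qed (use assms in \<open>auto simp: rep_chart[OF assms(1)]\<close>)

lemma mdiff_cong:
 assumes "ch : \<A>" "x : fst ch" "open N" "x : N" "!!y. y : N ==> f y = g y"
 shows "mdiff ch f x = mdiff ch g x"
proof -
 have "frechet_derivative (rep ch f) (at (snd ch x)) = frechet_derivative (rep ch g) (at (snd ch x))"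
  by (rule frechet_derivative_cong_open[OF open_chart_image_Int[OF assms(1,3)]])
   (use assms in \<open>auto simp: rep_chart[OF assms(1)]\<close>)
 then show ?thesis by (simp add: mdiff_def[abs_def])
qed

text \<open>The chain rule for a change of charts.\<close>

lemma rep_has_derivative_change:
 assumes "ch : \<A>" "ch' : \<A>" "x : fst ch" "x : fst ch'" "(rep ch f has_derivative D) (at (snd ch x))"
 shows "(rep ch' f has_derivative (%v. D (mdiff ch' (snd ch) x v))) (at (snd ch' x))"
proof -
 let ?S = "snd ch' ` (fst ch' \<inter> fst ch)"
 have S: "open ?S" by (rule open_chart_image_Int[OF assms(2) chart_open[OF assms(1)]])
 have "(rep ch' (snd ch) has_derivative (%v. mdiff ch' (snd ch) x v)) (at (snd ch' x))"
  using smooth_on_has_derivative[OF transition_smooth[OF assms(2,1)], of "snd ch' x"] assms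
  by (simp add: mdiff_def)
 from has_derivative_compose[OF this, of "rep ch f" D]
 have "((%u. rep ch f (rep ch' (snd ch) u)) has_derivative (%v. D (mdiff ch' (snd ch) x v))) (at (snd ch' x))"
  using assms(5) by (simp add: rep_chart[OF assms(2,4)])
 then show ?thesis
  by (rule has_derivative_transform_within_open[OF _ S])
   (use assms in \<open>auto simp: rep_chart[OF assms(1)] rep_chart[OF assms(2)]\<close>)
qed

lemma mdiff_change:
 assumes "smooth_map_on \<A> N f" "ch : \<A>" "ch' : \<A>" "x : fst ch" "x : fst ch'" "x : N"
 shows "mdiff ch' f x v = mdiff ch f x (mdiff ch' (snd ch) x v)"
 using mdiff_eq[OF rep_has_derivative_change[OF assms(2-5) mdiff_has_derivative[OF assms(1,2,4,6)]]] by simp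


text \<open>Coordinate balls serve as the simply connected neighbourhoods in all local constructions.\<close>

lemma chart_ball:
 assumes "open W" "x : W"
 obtains ch r B where "ch : \<A>" "x : fst ch" "r > 0" "open B" "x : B" "B \<subseteq> W" "B \<subseteq> fst ch"
  "snd ch ` B = ball (snd ch x) r" "simply_connected B"
proof -
 obtain ch where ch: "ch : \<A>" "x : fst ch" by (rule chart_cover)
 have "open (snd ch ` (fst ch \<inter> W))" using ch assms open_chart_image_Int by blast
 then obtain r where r: "r > 0" "ball (snd ch x) r \<subseteq> snd ch ` (fst ch \<inter> W)"
  using ch assms open_contains_ball by blast
 define B where "B = fst ch \<inter> snd ch -` ball (snd ch x) r"
 have B: "open B" unfolding B_def by (rule open_chart_vimage[OF ch(1) open_ball])
 have im: "snd ch ` B = ball (snd ch x) r" unfolding B_def using r by auto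
 have "B \<subseteq> W"
 proof
  fix y assume y: "y : B"
  then obtain z where "z : fst ch" "z : W" "snd ch y = snd ch z" using r im by blast
  then show "y : W" using y inj_onD[OF chart_inj[OF ch(1)]] unfolding B_def by blast
 qed
 moreover have "simply_connected B"
 proof (rule simply_connected_homeomorphic_image)
  show "homeomorphism (ball (snd ch x) r) B (inv_into (fst ch) (snd ch)) (snd ch)"
   unfolding homeomorphism_def
  proof (intro conjI)
   show "inv_into (fst ch) (snd ch) ` ball (snd ch x) r = B"
    unfolding im[symmetric] using chart_inv[OF ch(1)] by (force simp: B_def image_iff)
   show "continuous_on (ball (snd ch x) r) (inv_into (fst ch) (snd ch))"
    by (rule continuous_on_subset[OF chart_inv_cont[OF ch(1)]]) (use r in auto)
   show "continuous_on B (snd ch)"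
    by (rule continuous_on_subset[OF chart_cont[OF ch(1)]]) (auto simp: B_def)
   show "ALL u:ball (snd ch x) r. snd ch (inv_into (fst ch) (snd ch) u) = u"
    using r by (metis f_inv_into_f image_mono inf_le1 subsetD)
   show "ALL y:B. inv_into (fst ch) (snd ch) (snd ch y) = y"
    using chart_inv[OF ch(1)] by (auto simp: B_def)
  qed (rule im)
  show "simply_connected (ball (snd ch x) r)" by (rule convex_imp_simply_connected[OF convex_ball])
 qed
 ultimately show ?thesis using that[OF ch r(1) B] ch r im by (auto simp: B_def)
qed

end

section \<open>Matrix algebra of adapted frames\<close>

lemma sum_option: "(SUM c:UNIV. f c) = f None + (SUM i:UNIV. f (Some i))"
 for f :: "'n::finite option => real"
proof -
 have "(SUM c:range Some. f c) = (SUM i:UNIV. f (Some i))" by (subst sum.reindex) (auto simp: inj_on_def)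
 then show ?thesis by (simp add: UNIV_option_conv)
qed

lemma sum_split: "(SUM i:UNIV. f i) = (SUM i:T. f i) + (SUM i:-T. f i)"
 for f :: "'n::finite => real"
 using sum.union_disjoint[of T "-T" f] by simp

lemma matrix_mult_nth: "(A ** B) $ a $ b = (SUM c:UNIV. A $ a $ c * B $ c $ b)"
 by (simp add: matrix_matrix_mult_def)

lemma unhat_nth:
 "unhat_matrix \<mu> \<epsilon> J T \<Omega> $ Some i $ Some j = (if (i : T) = (j : T) then \<Omega> $ Some i $ Some j else \<Omega> $ Some i $ Some j / \<mu>)"
 "unhat_matrix \<mu> \<epsilon> J T \<Omega> $ Some i $ None = (if i : T then \<Omega> $ Some i $ None else 0)"
 "unhat_matrix \<mu> \<epsilon> J T \<Omega> $ None $ Some j = (if j : T then - \<epsilon> * \<Omega> $ Some j $ None * J j else 0)"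
 "unhat_matrix \<mu> \<epsilon> J T \<Omega> $ None $ None = 0"
 by (simp_all add: unhat_matrix_def)

text \<open>Both passages are instances of one: the flat space is the case \<open>\<epsilon> = 0\<close>.\<close>

lemma hat_eq_unhat: "hat_matrix \<kappa> T \<Omega> = unhat_matrix (1 / \<kappa>) 0 J T \<Omega>"
proof (rule vec_eq_iff[THEN iffD2], rule allI, rule vec_eq_iff[THEN iffD2], rule allI)
 fix a b show "hat_matrix \<kappa> T \<Omega> $ a $ b = unhat_matrix (1 / \<kappa>) 0 J T \<Omega> $ a $ b"
  by (cases a; cases b) (auto simp: hat_matrix_def unhat_matrix_def)
qed

lemma matrix_eqI: "(!!a b. A $ a $ b = B $ a $ b) ==> A = B"
 by (simp add: vec_eq_iff)

lemma bounded_linear_unhat: "bounded_linear (unhat_matrix \<mu> \<epsilon> J T)"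
proof -
 have "linear (unhat_matrix \<mu> \<epsilon> J T)"
 proof (rule linearI)
  show "unhat_matrix \<mu> \<epsilon> J T (A + B) = unhat_matrix \<mu> \<epsilon> J T A + unhat_matrix \<mu> \<epsilon> J T B" for A B
  proof (rule matrix_eqI)
   fix a b show "unhat_matrix \<mu> \<epsilon> J T (A + B) $ a $ b = (unhat_matrix \<mu> \<epsilon> J T A + unhat_matrix \<mu> \<epsilon> J T B) $ a $ b"
    by (cases a; cases b) (auto simp: unhat_nth algebra_simps add_divide_distrib)
  qed
  show "unhat_matrix \<mu> \<epsilon> J T (r *\<^sub>R A) = r *\<^sub>R unhat_matrix \<mu> \<epsilon> J T A" for r A
  proof (rule matrix_eqI)
   fix a b show "unhat_matrix \<mu> \<epsilon> J T (r *\<^sub>R A) $ a $ b = (r *\<^sub>R unhat_matrix \<mu> \<epsilon> J T A) $ a $ b"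
    by (cases a; cases b) (auto simp: unhat_nth)
  qed
 qed
 then show ?thesis by (rule linear_conv_bounded_linear[THEN iffD1])
qed

definition diag_mat :: "('i::finite => real) => real ^ 'i ^ 'i" where
 "diag_mat d = (\<chi> a b. if a = b then d a else 0)"

lemma diag_mat_mult:
 "(diag_mat d ** A) $ a $ b = d a * A $ a $ b" "(A ** diag_mat d) $ a $ b = A $ a $ b * d b"
 by (simp_all add: matrix_mult_nth diag_mat_def if_distrib[of "%x. x * y" for y] if_distrib[of "%x. y * x" for y]
   cong: if_cong)

lemma transpose_nth: "transpose A $ a $ b = A $ b $ a"
 by (simp add: transpose_def)

text \<open>The isometry group of the quadric (\<open>\<delta> = \<plusminus>1\<close>) acts on the ambient space linearly; the
 isometry group of flat space (\<open>\<delta> = 0\<close>) acts linearly on the hyperplane at height one. The rows,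
 rather than the columns, give both by one equation, since the form \<open>diag(J, 0)\<close> is the right one
 on the dual space.\<close>

definition isom_group :: "real => ('n::finite => real) => real ^ 'n option ^ 'n option => bool" where
 "isom_group \<delta> J G \<longleftrightarrow> G ** diag_mat (ext \<delta> J) ** transpose G = diag_mat (ext \<delta> J) &
   (\<delta> = 0 --> (ALL b. G $ None $ b = (if b = None then 1 else 0)))"

definition isom_algebra :: "real => ('n::finite => real) => real ^ 'n option ^ 'n option => bool" where
 "isom_algebra \<delta> J A \<longleftrightarrow> (ALL i j. A $ Some i $ Some j * J j + J i * A $ Some j $ Some i = 0) &
   (ALL j. A $ None $ Some j = - \<delta> * A $ Some j $ None * J j) & A $ None $ None = 0"

locale signs =
 fixes J :: "'n::finite => real" and \<delta> :: real
 assumes J: "!!i. J i * J i = 1" and \<delta>: "\<delta> : {-1, 0, 1}"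
begin

lemma J_nz: "J i ~= 0"
 using J[of i] by auto

lemma J_sq: "J i * (J i * x) = x" "J i * (x * J i) = x"
 by (metis J mult.assoc mult_1_left) (metis J mult.assoc mult.commute mult_1_left)

lemma group_invertible:
 assumes "isom_group \<delta> J G"
 shows "invertible G"
proof -
 have "x = 0" if x: "transpose G *v x = 0" for x
 proof -
  have "diag_mat (ext \<delta> J) *v x = G ** diag_mat (ext \<delta> J) ** transpose G *v x"
   using assms by (simp add: isom_group_def)
  also have "\<dots> = 0" using x by (simp add: matrix_vector_mul_assoc[symmetric])
  finally have "ALL a. ext \<delta> J a * x $ a = 0"
   by (simp add: vec_eq_iff matrix_vector_mult_def diag_mat_def if_distrib[of "%x. x * y" for y] cong: if_cong)
  then have S: "x $ Some i = 0" for i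
   using J_nz[of i] by (metis ext_def mult_eq_0_iff option.simps(5))
  have N: "x $ None = 0"
  proof (cases "\<delta> = 0")
   case True
   have "(transpose G *v x) $ None = G $ None $ None * x $ None"
    by (simp add: matrix_vector_mult_def transpose_nth sum_option S)
   then show ?thesis using x assms True by (simp add: isom_group_def)
  next
   case False
   then show ?thesis using \<open>ALL a. ext \<delta> J a * x $ a = 0\<close> by (metis ext_def mult_eq_0_iff option.simps(4))
  qed
  show ?thesis unfolding vec_eq_iff using S N by (metis option.exhaust zero_index)
 qed
 then have "EX B. B ** transpose G = mat 1" by (simp add: matrix_left_invertible_ker)
 then have "EX B. G ** B = mat 1" unfolding left_invertible_transpose .
 then show ?thesis by (simp add: invertible_right_inverse)
qed

lemma group_mult:
 assumes "isom_group \<delta> J A" "isom_group \<delta> J B"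
 shows "isom_group \<delta> J (A ** B)"
 unfolding isom_group_def
proof
 have "A ** B ** diag_mat (ext \<delta> J) ** transpose (A ** B) = A ** (B ** diag_mat (ext \<delta> J) ** transpose B) ** transpose A"
  by (simp add: matrix_transpose_mul matrix_mul_assoc)
 then show "A ** B ** diag_mat (ext \<delta> J) ** transpose (A ** B) = diag_mat (ext \<delta> J)"
  using assms by (simp add: isom_group_def)
 show "\<delta> = 0 --> (ALL b. (A ** B) $ None $ b = (if b = None then 1 else 0))"
  using assms by (auto simp: isom_group_def matrix_mult_nth if_distrib[of "%x. x * y" for y] cong: if_cong)
qed

lemma group_one: "isom_group \<delta> J (mat 1)"
 unfolding isom_group_def by (simp add: transpose_mat) (simp add: mat_def)

lemma group_inv:
 assumes "isom_group \<delta> J A"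
 shows "isom_group \<delta> J (matrix_inv A)"
 unfolding isom_group_def
proof
 let ?B = "matrix_inv A" and ?D = "diag_mat (ext \<delta> J)"
 have inv: "A ** ?B = mat 1" "?B ** A = mat 1"
  using matrix_inv_right matrix_inv_left group_invertible[OF assms] by auto
 have "?B ** ?D ** transpose ?B = ?B ** (A ** ?D ** transpose A) ** transpose ?B"
  using assms by (simp add: isom_group_def)
 also have "\<dots> = (?B ** A) ** ?D ** transpose (?B ** A)" by (simp add: matrix_transpose_mul matrix_mul_assoc)
 finally show "?B ** ?D ** transpose ?B = ?D" by (simp add: inv transpose_mat)
 show "\<delta> = 0 --> (ALL b. ?B $ None $ b = (if b = None then 1 else 0))"
 proof (intro impI allI)
  fix b assume "\<delta> = 0"
  then have "(A ** ?B) $ None $ b = ?B $ None $ b"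
   using assms by (simp add: isom_group_def matrix_mult_nth if_distrib[of "%x. x * y" for y] cong: if_cong)
  then show "?B $ None $ b = (if b = None then 1 else 0)" by (auto simp: inv mat_def)
 qed
qed

lemma group_inv_nth:
 assumes "isom_group \<delta> J A"
 shows "ext \<delta> J a * A $ b $ a = matrix_inv A $ a $ b * ext \<delta> J b"
proof -
 let ?D = "diag_mat (ext \<delta> J)"
 have "?D ** transpose A = matrix_inv A ** (A ** ?D ** transpose A)"
  using matrix_inv_left[OF group_invertible[OF assms]] by (simp add: matrix_mul_assoc)
 then have "?D ** transpose A = matrix_inv A ** ?D" using assms by (simp add: isom_group_def)
 then have "(?D ** transpose A) $ a $ b = (matrix_inv A ** ?D) $ a $ b" by simp
 then show ?thesis by (simp add: diag_mat_mult transpose_nth)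
qed

lemma group_columns:
 assumes "isom_group \<delta> J A"
 shows "pform (ext \<delta> J) (column (Some i) A) (column (Some j) A) = (if i = j then J i else 0)"
proof -
 let ?B = "matrix_inv A"
 have 1: "J a * A $ Some b $ Some a = ?B $ Some a $ Some b * J b" for a b
  using group_inv_nth[OF assms, of "Some a" "Some b"] by (simp add: ext_def)
 have 2: "J a * A $ None $ Some a = ?B $ Some a $ None * \<delta>" for a
  using group_inv_nth[OF assms, of "Some a" None] by (simp add: ext_def)
 have "J i * pform (ext \<delta> J) (column (Some i) A) (column (Some j) A)
   = (SUM c:UNIV. ?B $ Some i $ c * A $ c $ Some j)"
 proof -
  have "J i * (J c * A $ Some c $ Some i * A $ Some c $ Some j) = ?B $ Some i $ Some c * A $ Some c $ Some j" for c
   using 1[of i c] J_sq by (metis (no_types, opaque_lifting) mult.assoc mult.commute)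
  moreover have "J i * (\<delta> * A $ None $ Some i * A $ None $ Some j) = ?B $ Some i $ None * A $ None $ Some j"
  proof (cases "\<delta> = 0")
   case True
   then show ?thesis using assms by (simp add: isom_group_def)
  next
   case False
   then have "\<delta> * \<delta> = 1" using \<delta> by auto
   then show ?thesis using 2[of i] by (metis (no_types, opaque_lifting) mult.assoc mult.commute mult_1_left)
  qed
  moreover have "pform (ext \<delta> J) (column (Some i) A) (column (Some j) A)
   = \<delta> * A $ None $ Some i * A $ None $ Some j + (SUM c:UNIV. J c * A $ Some c $ Some i * A $ Some c $ Some j)"
   by (simp add: pform_def sum_option column_def ext_def)
  ultimately show ?thesis by (simp only: sum_option distrib_left sum_distrib_left)
 qed
 also have "\<dots> = (?B ** A) $ Some i $ Some j" by (simp add: matrix_mult_nth)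
 also have "\<dots> = (if i = j then 1 else 0)" 
  by (simp add: matrix_inv_left[OF group_invertible[OF assms]] mat_def)
 finally show ?thesis using J_sq[of i] J[of i] by (metis mult.right_neutral mult_zero_right)
qed

lemma unhat_algebra:
 assumes "isom_algebra \<delta>' J \<Omega>"
 shows "isom_algebra \<delta> J (unhat_matrix \<mu> \<delta> J T \<Omega>)"
proof -
 let ?L = "unhat_matrix \<mu> \<delta> J T \<Omega>"
 have "?L $ Some i $ Some j * J j + J i * ?L $ Some j $ Some i = 0" for i j
 proof -
  have "?L $ Some i $ Some j * J j + J i * ?L $ Some j $ Some i
   = (if (i : T) = (j : T) then 1 else 1 / \<mu>) * (\<Omega> $ Some i $ Some j * J j + J i * \<Omega> $ Some j $ Some i)"
   by (auto simp: unhat_nth add_divide_distrib)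
  then show ?thesis using assms by (simp add: isom_algebra_def)
 qed
 then show ?thesis unfolding isom_algebra_def by (auto simp: unhat_nth)
qed

text \<open>Differentiating the relation that defines the group shows that \<open>F\<^sup>-\<^sup>1 dF\<close> takes values in the Lie
 algebra.\<close>

lemma algebra_of_tangent:
 assumes F: "isom_group \<delta> J F"
  and d: "dF ** diag_mat (ext \<delta> J) ** transpose F + F ** diag_mat (ext \<delta> J) ** transpose dF = 0"
  and row: "\<delta> = 0 ==> ALL b. dF $ None $ b = 0"
 shows "isom_algebra \<delta> J (matrix_inv F ** dF)"
proof -
 let ?D = "diag_mat (ext \<delta> J)" and ?\<Omega> = "matrix_inv F ** dF"
 have inv: "F ** matrix_inv F = mat 1" "matrix_inv F ** F = mat 1"
  using matrix_inv_right matrix_inv_left group_invertible[OF F] by auto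
 have dF: "dF = F ** ?\<Omega>" by (simp add: matrix_mul_assoc inv)
 have "matrix_inv F ** (dF ** ?D ** transpose F + F ** ?D ** transpose dF) ** transpose (matrix_inv F)
   = ?\<Omega> ** ?D ** transpose (matrix_inv F ** F) + (matrix_inv F ** F) ** ?D ** transpose ?\<Omega>"
  by (simp add: matrix_transpose_mul matrix_mul_assoc matrix_add_ldistrib matrix_mult_add_left)
 then have "?\<Omega> ** ?D + ?D ** transpose ?\<Omega> = 0"
  unfolding d inv by (simp add: transpose_mat)
 then have "(?\<Omega> ** ?D + ?D ** transpose ?\<Omega>) $ a $ b = 0" for a b by simp
 then have e: "?\<Omega> $ a $ b * ext \<delta> J b + ext \<delta> J a * ?\<Omega> $ b $ a = 0" for a b
  by (simp add: diag_mat_mult transpose_nth)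
 have 1: "?\<Omega> $ Some i $ Some j * J j + J i * ?\<Omega> $ Some j $ Some i = 0" for i j
  using e[of "Some i" "Some j"] by (simp add: ext_def)
 have 2: "?\<Omega> $ None $ Some j = - \<delta> * ?\<Omega> $ Some j $ None * J j" for j
 proof -
  have "?\<Omega> $ None $ Some j * J j = - \<delta> * ?\<Omega> $ Some j $ None"
   using e[of None "Some j"] by (simp add: ext_def)
  then have "?\<Omega> $ None $ Some j * J j * J j = - \<delta> * ?\<Omega> $ Some j $ None * J j" by simp
  then show ?thesis by (simp add: J mult.assoc)
 qed
 have 3: "?\<Omega> $ None $ None = 0"
 proof (cases "\<delta> = 0")
  case True
  have "dF $ None $ None = ?\<Omega> $ None $ None"
   by (subst dF) (use F True in \<open>simp add: isom_group_def matrix_mult_nth[of F] if_distrib[of "%x. x * y" for y] cong: if_cong\<close>)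
  then show ?thesis using row[OF True] by simp
 next
  case False
  then show ?thesis using e[of None None] by (simp add: ext_def)
 qed
 show ?thesis unfolding isom_algebra_def using 1 2 3 by blast
qed

text \<open>A gauge transformation is a change of adapted frame: block diagonal with last block one.\<close>

definition gauge :: "'n set => real ^ 'n option ^ 'n option => bool" where
 "gauge T G \<longleftrightarrow> isom_group \<delta> J G & G $ None $ None = 1 & (ALL i. G $ Some i $ None = 0 & G $ None $ Some i = 0) &
   (ALL i j. (i : T) ~= (j : T) --> G $ Some i $ Some j = 0)"

lemma gaugeI:
 assumes G: "isom_group \<delta> J G" and col: "!!a. G $ a $ None = (if a = None then 1 else 0)"
  and T: "!!i j. i ~: T ==> j : T ==> G $ Some i $ Some j = 0"
  and T': "!!i j. i ~: T ==> j : T ==> matrix_inv G $ Some i $ Some j = 0"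
 shows "gauge T G"
proof -
 have inv: "matrix_inv G ** G = mat 1" using matrix_inv_left group_invertible[OF G] by auto
 have "(matrix_inv G ** G) $ a $ None = matrix_inv G $ a $ None" for a
  by (simp add: matrix_mult_nth col if_distrib[of "%x. y * x" for y] cong: if_cong)
 then have col': "matrix_inv G $ a $ None = (if a = None then 1 else 0)" for a
  by (simp add: inv mat_def)
 have "G $ None $ Some i = 0" for i
  using group_inv_nth[OF G, of "Some i" None] col'[of "Some i"] J_nz[of i] by (simp add: ext_def)
 moreover have "G $ Some i $ Some j = 0" if "i : T" "j ~: T" for i j
  using group_inv_nth[OF G, of "Some j" "Some i"] T'[OF that(2,1)] J_nz[of j] by (simp add: ext_def)
 ultimately show ?thesis unfolding gauge_def using G col T by auto
qed

lemma gauge_orthogonal: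
 assumes "gauge T G"
 shows "(SUM c:UNIV. J c * G $ Some c $ Some i * G $ Some c $ Some j) = (if i = j then J i else 0)"
 using group_columns[of G i j] assms by (simp add: gauge_def pform_def sum_option column_def ext_def)

text \<open>Scaling blocks commutes with block diagonal matrices. Therefore the transformation of a
 Maurer-Cartan form under a change of adapted frame is also the one of the scaled form.\<close>

lemma gauge_change:
 assumes G: "gauge T G" and eq: "G ** \<Omega>' = \<Omega> ** G + dG"
  and dG: "!!a b. a = None | b = None ==> dG $ a $ b = 0" "!!i j. (i : T) ~= (j : T) ==> dG $ Some i $ Some j = 0"
  and \<Omega>: "!!i. i ~: T ==> \<Omega> $ Some i $ None = 0" "!!i. i ~: T ==> \<Omega>' $ Some i $ None = 0"
 shows "G ** unhat_matrix \<mu> \<delta>' J T \<Omega>' = unhat_matrix \<mu> \<delta>' J T \<Omega> ** G + dG"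
proof (rule matrix_eqI)
 fix a b
 let ?L = "unhat_matrix \<mu> \<delta>' J T"
 have G0: "G $ None $ None = 1" "G $ Some i $ None = 0" "G $ None $ Some i = 0" for i
  using G by (auto simp: gauge_def)
 have G1: "G $ Some i $ Some j = 0" if "(i : T) ~= (j : T)" for i j using G that by (auto simp: gauge_def)
 have e: "(G ** \<Omega>') $ a $ b = (\<Omega> ** G) $ a $ b + dG $ a $ b" for a b using eq by simp
 have e1: "(SUM c:UNIV. G $ Some i $ Some c * \<Omega>' $ Some c $ b) = (\<Omega> ** G) $ Some i $ b + dG $ Some i $ b" for i b
  using e[of "Some i" b] by (simp add: matrix_mult_nth[of G] sum_option G0)
 have eN: "(SUM c:UNIV. G $ Some i $ Some c * \<Omega>' $ Some c $ None) = \<Omega> $ Some i $ None" for i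
  using e1[of i None] by (simp add: matrix_mult_nth sum_option G0 dG)
 have eS: "(SUM c:UNIV. G $ Some i $ Some c * \<Omega>' $ Some c $ Some j)
   = (SUM c:UNIV. \<Omega> $ Some i $ Some c * G $ Some c $ Some j) + dG $ Some i $ Some j" for i j
  using e1[of i "Some j"] by (simp add: matrix_mult_nth sum_option G0)
 show "(G ** ?L \<Omega>') $ a $ b = (?L \<Omega> ** G + dG) $ a $ b"
 proof (cases a)
  case None
  show ?thesis
  proof (cases b)
   case None
   then show ?thesis using \<open>a = None\<close> by (simp add: matrix_mult_nth sum_option G0 unhat_nth dG)
  next
   case (Some j)
   have "(?L \<Omega> ** G) $ None $ Some j = (SUM c:UNIV. (if c : T then - \<delta>' * \<Omega> $ Some c $ None * J c else 0) * G $ Some c $ Some j)"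
    by (simp add: matrix_mult_nth sum_option unhat_nth)
   also have "\<dots> = (SUM c:UNIV. - \<delta>' * (\<Omega> $ Some c $ None * J c * G $ Some c $ Some j))"
    by (intro sum.cong refl) (auto simp: \<Omega>)
   also have "\<dots> = - \<delta>' * (SUM c:UNIV. (SUM l:UNIV. G $ Some c $ Some l * \<Omega>' $ Some l $ None) * J c * G $ Some c $ Some j)"
    by (simp add: sum_distrib_left eN)
   also have "(SUM c:UNIV. (SUM l:UNIV. G $ Some c $ Some l * \<Omega>' $ Some l $ None) * J c * G $ Some c $ Some j)
     = (SUM l:UNIV. (SUM c:UNIV. J c * G $ Some c $ Some l * G $ Some c $ Some j) * \<Omega>' $ Some l $ None)"
    unfolding sum_distrib_right by (subst sum.swap) (simp add: mult_ac)
   also have "\<dots> = J j * \<Omega>' $ Some j $ None"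
    unfolding gauge_orthogonal[OF G] by (simp add: if_distrib[of "%x. x * y" for y] cong: if_cong)
   finally have "(?L \<Omega> ** G) $ None $ Some j = - \<delta>' * (J j * \<Omega>' $ Some j $ None)" .
   moreover have "(G ** ?L \<Omega>') $ None $ Some j = - \<delta>' * (J j * \<Omega>' $ Some j $ None)"
    by (simp add: matrix_mult_nth sum_option G0 unhat_nth \<Omega> mult_ac)
   ultimately show ?thesis using Some None by (simp add: dG)
  qed
 next
  case (Some i)
  show ?thesis
  proof (cases b)
   case None
   have "(G ** ?L \<Omega>') $ Some i $ None = (SUM c:UNIV. G $ Some i $ Some c * \<Omega>' $ Some c $ None)"
    by (simp add: matrix_mult_nth sum_option G0 unhat_nth) (auto intro!: sum.cong simp: \<Omega>)
   moreover have "(?L \<Omega> ** G) $ Some i $ None = \<Omega> $ Some i $ None"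
    by (simp add: matrix_mult_nth sum_option G0 unhat_nth \<Omega>)
   ultimately show ?thesis using Some None by (simp add: eN dG)
  next
   case bj: (Some j)
   let ?s = "if (i : T) = (j : T) then 1 else 1 / \<mu>"
   have p1: "G $ Some i $ Some c * ?L \<Omega>' $ Some c $ Some j = ?s * (G $ Some i $ Some c * \<Omega>' $ Some c $ Some j)"
    and p2: "?L \<Omega> $ Some i $ Some c * G $ Some c $ Some j = ?s * (\<Omega> $ Some i $ Some c * G $ Some c $ Some j)" for c
    using G1[of i c] G1[of c j] by (auto simp: unhat_nth)
   have "(G ** ?L \<Omega>') $ Some i $ Some j = (SUM c:UNIV. ?s * (G $ Some i $ Some c * \<Omega>' $ Some c $ Some j))"
    unfolding matrix_mult_nth sum_option p1 by (simp add: G0)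
   also have "\<dots> = ?s * ((SUM c:UNIV. \<Omega> $ Some i $ Some c * G $ Some c $ Some j) + dG $ Some i $ Some j)"
    by (simp only: sum_distrib_left[symmetric] eS)
   also have "\<dots> = (SUM c:UNIV. ?s * (\<Omega> $ Some i $ Some c * G $ Some c $ Some j)) + dG $ Some i $ Some j"
    using dG(2)[of i j] by (auto simp: sum_distrib_left distrib_left)
   also have "(SUM c:UNIV. ?s * (\<Omega> $ Some i $ Some c * G $ Some c $ Some j)) = (?L \<Omega> ** G) $ Some i $ Some j"
    unfolding matrix_mult_nth sum_option p2 by (simp add: G0)
   finally show ?thesis using Some bj by simp
  qed
 qed
qed

end

text \<open>The Gauss and Ricci equations \<open>\<beta>\<and>\<alpha> = (\<delta> - c) \<theta>\<and>\<theta>\<^sup>t J\<^sub>1\<close> and \<open>\<alpha>\<and>\<beta> = 0\<close>, evaluated on a pair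
 of vectors on which the form \<open>F\<^sup>-\<^sup>1 dF\<close> takes the values \<open>A\<close> and \<open>B\<close>.\<close>

definition gauss_eq :: "('n::finite => real) => 'n set => real => real ^ 'n option ^ 'n option => real ^ 'n option ^ 'n option => bool" where
 "gauss_eq J T k A B \<longleftrightarrow> (ALL a:T. ALL b:T.
   (SUM c:-T. A $ Some a $ Some c * B $ Some c $ Some b - B $ Some a $ Some c * A $ Some c $ Some b)
    = - k * (A $ Some a $ None * B $ Some b $ None - B $ Some a $ None * A $ Some b $ None) * J b)"

definition ricci_eq :: "'n::finite set => real ^ 'n option ^ 'n option => real ^ 'n option ^ 'n option => bool" where
 "ricci_eq T A B \<longleftrightarrow> (ALL a:-T. ALL b:-T.
   (SUM c:T. A $ Some a $ Some c * B $ Some c $ Some b - B $ Some a $ Some c * A $ Some c $ Some b) = 0)"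

lemma ricci_eq_unhat: "ricci_eq T A B ==> ricci_eq T (unhat_matrix \<mu> \<delta>' J T A) (unhat_matrix \<mu> \<delta>' J T B)"
 unfolding ricci_eq_def
proof (intro ballI)
 fix a b assume h: "ALL a:-T. ALL b:-T.
   (SUM c:T. A $ Some a $ Some c * B $ Some c $ Some b - B $ Some a $ Some c * A $ Some c $ Some b) = 0"
  and ab: "a : -T" "b : -T"
 let ?L = "unhat_matrix \<mu> \<delta>' J T"
 have "(SUM c:T. ?L A $ Some a $ Some c * ?L B $ Some c $ Some b - ?L B $ Some a $ Some c * ?L A $ Some c $ Some b)
  = (SUM c:T. A $ Some a $ Some c * B $ Some c $ Some b - B $ Some a $ Some c * A $ Some c $ Some b) / (\<mu> * \<mu>)"
  unfolding sum_divide_distrib using ab by (intro sum.cong refl) (auto simp: unhat_nth diff_divide_distrib)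
 then show "(SUM c:T. ?L A $ Some a $ Some c * ?L B $ Some c $ Some b - ?L B $ Some a $ Some c * ?L A $ Some c $ Some b) = 0"
  using h ab by simp
qed

text \<open>The transformed form is flat again. The Codazzi equation is homogeneous in the second
 fundamental form, so scaling does not affect it; in the Gauss equation the scaling
 compensates the change of the ambient curvature from \<open>\<delta>\<close> to \<open>\<delta>'\<close>.\<close>

lemma (in signs) unhat_flat:
 assumes A: "isom_algebra \<delta> J A" "!!i. i ~: T ==> A $ Some i $ None = 0"
  and B: "isom_algebra \<delta> J B" "!!i. i ~: T ==> B $ Some i $ None = 0"
  and X: "X = A ** B - B ** A" "!!i. i ~: T ==> X $ Some i $ None = 0"
  and gauss: "gauss_eq J T (c - \<delta>) A B" and ricci: "ricci_eq T A B"
  and \<mu>: "\<mu> ~= 0" "c - \<delta> = \<mu> * \<mu> * (c - \<delta>')"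
 shows "unhat_matrix \<mu> \<delta>' J T X = unhat_matrix \<mu> \<delta>' J T A ** unhat_matrix \<mu> \<delta>' J T B
  - unhat_matrix \<mu> \<delta>' J T B ** unhat_matrix \<mu> \<delta>' J T A"
proof (rule matrix_eqI)
 fix a b
 let ?L = "unhat_matrix \<mu> \<delta>' J T"
 have A0: "A $ None $ Some j = - \<delta> * A $ Some j $ None * J j" "A $ None $ None = 0"
  and B0: "B $ None $ Some j = - \<delta> * B $ Some j $ None * J j" "B $ None $ None = 0" for j
  using A B by (auto simp: isom_algebra_def)
 have skew: "C $ Some i $ Some j * J i = - J j * C $ Some j $ Some i" if "isom_algebra \<delta> J C" for C i j
 proof -
  have "C $ Some i $ Some j * J j = - J i * C $ Some j $ Some i"
   using that by (simp add: isom_algebra_def eq_neg_iff_add_eq_0)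
  then have "C $ Some i $ Some j * J j * (J i * J j) = - J i * C $ Some j $ Some i * (J i * J j)" by simp
  then show ?thesis using J J_sq by (simp add: mult_ac)
 qed
 define P where "P S a b = (SUM c:S. A $ a $ Some c * B $ Some c $ b - B $ a $ Some c * A $ Some c $ b)" for S a b
 have Xe: "X $ a $ b = A $ a $ None * B $ None $ b - B $ a $ None * A $ None $ b + P T a b + P (-T) a b" for a b
  unfolding X P_def by (simp add: matrix_mult_nth sum_option sum_split[where T=T] sum_subtractf)
 define S where "S U a b = (SUM c:U. ?L A $ a $ Some c * ?L B $ Some c $ b - ?L B $ a $ Some c * ?L A $ Some c $ b)" for U a b
 have Le: "(?L A ** ?L B - ?L B ** ?L A) $ a $ b
   = ?L A $ a $ None * ?L B $ None $ b - ?L B $ a $ None * ?L A $ None $ b + S T a b + S (-T) a b" for a b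
  unfolding S_def by (simp add: matrix_mult_nth sum_option sum_split[where T=T] sum_subtractf)
 let ?s = "%i j. if (i : T) = (j : T) then 1 else 1 / \<mu>"
 have ST: "S T (Some i) (Some j) = (if i : T then 1 else 1 / \<mu>) * (if j : T then 1 else 1 / \<mu>) * P T (Some i) (Some j)" for i j
  unfolding S_def P_def sum_distrib_left by (intro sum.cong refl) (auto simp: unhat_nth algebra_simps)
 have SN: "S (-T) (Some i) (Some j) = (if i : T then 1 / \<mu> else 1) * (if j : T then 1 / \<mu> else 1) * P (-T) (Some i) (Some j)" for i j
  unfolding S_def P_def sum_distrib_left by (intro sum.cong refl) (auto simp: unhat_nth algebra_simps)
 have PN: "P (-T) a None = 0" for a unfolding P_def by (intro sum.neutral) (use A B in auto)
 have PT: "P T (Some i) None = X $ Some i $ None" for i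
  using Xe[of "Some i" None] PN A0 B0 by simp
 have SNN: "S (-T) a None = 0" for a unfolding S_def by (intro sum.neutral) (simp add: unhat_nth)
 have STN: "S T (Some i) None = (if i : T then 1 else 1 / \<mu>) * P T (Some i) None" for i
  unfolding S_def P_def sum_distrib_left by (intro sum.cong refl) (auto simp: unhat_nth algebra_simps)
 have SNb: "S (-T) None b = 0" for b
  unfolding S_def by (intro sum.neutral) (simp add: unhat_nth)
 have STb: "S T None (Some j) = (if j : T then 1 else 1 / \<mu>) * (- \<delta>' * J j * P T (Some j) None)" for j
  unfolding S_def P_def sum_distrib_left
 proof (intro sum.cong refl)
  fix c assume c: "c : T"
  have "A $ Some c $ None * J c * B $ Some c $ Some j = - J j * B $ Some j $ Some c * A $ Some c $ None"
  proof -
   have "A $ Some c $ None * J c * B $ Some c $ Some j = A $ Some c $ None * (B $ Some c $ Some j * J c)" by simp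
   then show ?thesis unfolding skew[OF B(1), of c j] by simp
  qed
  moreover have "B $ Some c $ None * J c * A $ Some c $ Some j = - J j * A $ Some j $ Some c * B $ Some c $ None"
  proof -
   have "B $ Some c $ None * J c * A $ Some c $ Some j = B $ Some c $ None * (A $ Some c $ Some j * J c)" by simp
   then show ?thesis unfolding skew[OF A(1), of c j] by simp
  qed
  ultimately show "?L A $ None $ Some c * ?L B $ Some c $ Some j - ?L B $ None $ Some c * ?L A $ Some c $ Some j =
   (if j : T then 1 else 1 / \<mu>) * (- \<delta>' * J j *
     (A $ Some j $ Some c * B $ Some c $ None - B $ Some j $ Some c * A $ Some c $ None))"
   using c by (simp add: unhat_nth) (auto simp: algebra_simps add_divide_distrib diff_divide_distrib)
 qed
 show "?L X $ a $ b = (?L A ** ?L B - ?L B ** ?L A) $ a $ b"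
 proof (cases a)
  case aN: None
  show ?thesis
  proof (cases b)
   case None
   have "S T None None = 0" unfolding S_def by (intro sum.neutral) (simp add: unhat_nth)
   then show ?thesis using aN None Le[of None None] by (simp add: unhat_nth SNN)
  next
   case (Some j)
   then show ?thesis
    using aN Le[of None "Some j"] X(2)[of j] by (simp add: unhat_nth SNb STb PT)
  qed
 next
  case ai: (Some i)
  show ?thesis
  proof (cases b)
   case None
   then show ?thesis
    using ai Le[of "Some i" None] X(2)[of i] by (simp add: unhat_nth SNN STN PT)
  next
   case (Some j)
   let ?R = "(A $ Some i $ None * B $ Some j $ None - B $ Some i $ None * A $ Some j $ None) * J j"
   have Xij: "X $ Some i $ Some j = - \<delta> * ?R + P T (Some i) (Some j) + P (-T) (Some i) (Some j)"
    unfolding Xe A0 B0 by (simp add: algebra_simps)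
   have Lij: "(?L A ** ?L B - ?L B ** ?L A) $ Some i $ Some j
    = (if i : T & j : T then - \<delta>' * ?R else 0) + S T (Some i) (Some j) + S (-T) (Some i) (Some j)"
    unfolding Le by (simp add: unhat_nth algebra_simps)
   have R0: "?R = 0" if "i ~: T | j ~: T" using that A B by auto
   consider "i : T" "j : T" | "i ~: T" "j ~: T" | "i : T" "j ~: T" | "i ~: T" "j : T" by blast
   then show ?thesis
   proof cases
    case 1
    have P1: "P (-T) (Some i) (Some j) = - (c - \<delta>) * ?R"
     using gauss 1 unfolding gauss_eq_def P_def by (simp add: mult.assoc)
    have aux: "- (\<mu> * \<mu> * k) * r / (\<mu> * \<mu>) = - k * r" for k r using \<mu>(1) by simp
    have "S (-T) (Some i) (Some j) = P (-T) (Some i) (Some j) / (\<mu> * \<mu>)"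
     using SN[of i j] 1 by simp
    also have "\<dots> = - (c - \<delta>') * ?R" unfolding P1 \<mu>(2) by (rule aux)
    finally have S1: "S (-T) (Some i) (Some j) = - (c - \<delta>') * ?R" .
    have "S T (Some i) (Some j) = P T (Some i) (Some j)" using ST[of i j] 1 by simp
    then have "(?L A ** ?L B - ?L B ** ?L A) $ Some i $ Some j
     = - \<delta>' * ?R + P T (Some i) (Some j) + - (c - \<delta>') * ?R" using Lij S1 1 by simp
    also have "\<dots> = - \<delta> * ?R + P T (Some i) (Some j) + - (c - \<delta>) * ?R"
     by (simp only: left_diff_distrib mult_minus_left minus_diff_eq)
    also have "\<dots> = X $ Some i $ Some j" using Xij P1 by simp
    finally show ?thesis unfolding ai Some using 1 by (simp add: unhat_nth)
   next
    case 2
    have "P T (Some i) (Some j) = 0" using ricci 2 unfolding ricci_eq_def P_def by auto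
    then show ?thesis
     using 2 Xij Lij R0 ST[of i j] SN[of i j] unfolding ai Some by (simp add: unhat_nth)
   next
    case 3
    then show ?thesis
     using Xij Lij R0 ST[of i j] SN[of i j] unfolding ai Some by (simp add: unhat_nth add_divide_distrib)
   next
    case 4
    then show ?thesis
     using Xij Lij R0 ST[of i j] SN[of i j] unfolding ai Some by (simp add: unhat_nth add_divide_distrib)
   qed
  qed
 qed
qed

section \<open>Symmetric bilinear forms\<close>

lemma bilinear_simps:
 fixes h :: "'v::real_vector => 'v => real"
 assumes "bilinear h"
 shows "h (x + y) z = h x z + h y z" "h z (x + y) = h z x + h z y"
  "h (r *\<^sub>R x) z = r * h x z" "h z (r *\<^sub>R x) = r * h z x"
 using assms by (simp_all add: bilinear_ladd bilinear_radd bilinear_lmul bilinear_rmul)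

text \<open>An algebraic curvature tensor is determined by its sectional values.\<close>

lemma curvature_polarization:
 fixes h :: "'q => 'v::real_vector => 'v => real"
 assumes bil: "!!q. bilinear (h q)" and sym: "!!q x y. h q x y = h q y x"
  and zero: "!!x y. (SUM q:Q. s q * (h q x x * h q y y - (h q x y)\<^sup>2)) = 0"
 shows "(SUM q:Q. s q * (h q v x * h q w z - h q w x * h q v z)) = 0"
proof -
 define R where "R v w x z = (SUM q:Q. s q * (h q v x * h q w z - h q w x * h q v z))" for v w x z
 note b = bilinear_simps[OF bil]
 have R0: "R x y x y = 0" for x y
  using zero[of x y] sym[of _ x y] unfolding R_def by (simp add: power2_eq_square)
 have pair: "R v w x z = R x z v w" for v w x z
  unfolding R_def using sym by (intro sum.cong refl) (metis (no_types, opaque_lifting) mult.commute)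
 have anti: "R v w x z = - R w v x z" "R v w x z = - R v w z x" for v w x z
  unfolding R_def sum_negf[symmetric] by (intro sum.cong refl; simp add: algebra_simps)+
 have bianchi: "R v w x z + R w x v z + R x v w z = 0" for v w x z
  unfolding R_def sum.distrib[symmetric]
  by (intro sum.neutral ballI) (simp add: algebra_simps sym[of _ v] sym[of _ w x])
 have l1: "R (v + v') w x z = R v w x z + R v' w x z" for v v' w x z
  unfolding R_def sum.distrib[symmetric] by (intro sum.cong refl) (simp add: b algebra_simps)
 have l2: "R v (w + w') x z = R v w x z + R v w' x z" for v w w' x z
  unfolding R_def sum.distrib[symmetric] by (intro sum.cong refl) (simp add: b algebra_simps)
 have l3: "R v w (x + x') z = R v w x z + R v w x' z" for v w x x' z
  unfolding R_def sum.distrib[symmetric] by (intro sum.cong refl) (simp add: b algebra_simps)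
 have l4: "R v w x (z + z') = R v w x z + R v w x z'" for v w x z z'
  unfolding R_def sum.distrib[symmetric] by (intro sum.cong refl) (simp add: b algebra_simps)
 have 1: "R x y x z = 0" for x y z
  using R0[of x "y + z"] R0[of x y] R0[of x z] pair[of x y x z] by (simp add: l2 l4)
 have 2: "R x y v z = - R v y x z" for x y v z
  using 1[of "x + v" y z] 1[of x y z] 1[of v y z] by (simp add: l1 l3)
 have "R w x v z = R v w x z" "R x v w z = R v w x z"
  using 2[of w x v z] 2[of x v w z] anti(1)[of v x w z] anti(1)[of w v x z] by simp_all
 then have "R v w x z = 0" using bianchi[of v w x z] by simp
 then show ?thesis by (simp add: R_def)
qed

text \<open>The nondegenerate planes are dense.\<close>

lemma sectional_zero_dense:
 fixes h :: "'q => 'v::real_vector => 'v => real" and g :: "'v => 'v => real"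
 assumes bil: "!!q. bilinear (h q)" "bilinear g" and sym: "!!q x y. h q x y = h q y x" "!!x y. g x y = g y x"
  and zero: "!!x y. g x x * g y y - (g x y)\<^sup>2 ~= 0 ==> (SUM q:Q. s q * (h q x x * h q y y - (h q x y)\<^sup>2)) = 0"
  and plane: "g x' x' * g y' y' - (g x' y')\<^sup>2 ~= 0"
 shows "(SUM q:Q. s q * (h q x x * h q y y - (h q x y)\<^sup>2)) = 0"
proof -
 have quad: "h (a + t *\<^sub>R a') (b + t *\<^sub>R b') = h a b + t * (h a b' + h a' b) + t\<^sup>2 * h a' b'"
  if "bilinear h" for h :: "'v => 'v => real" and a a' b b' t
  by (simp add: bilinear_simps[OF that] algebra_simps power2_eq_square)
 define p where "p a b c d e f k l m = [:a, b, c:] * [:d, e, f:] - [:k, l, m:] * [:k, l, m :: real:]"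
  for a b c d e f k l m
 have p4: "coeff (p a b c d e f k l m) 4 = c * f - m * m" for a b c d e f k l m
  by (simp add: p_def numeral_eq_Suc)
 have pp: "poly (p a b c d e f k l m) t = (a + t * b + t\<^sup>2 * c) * (d + t * e + t\<^sup>2 * f) - (k + t * l + t\<^sup>2 * m)\<^sup>2"
  for a b c d e f k l m t
  by (simp add: p_def power2_eq_square algebra_simps)
 let ?x = "%t. x + t *\<^sub>R x'" and ?y = "%t. y + t *\<^sub>R y'"
 define P where "P h = p (h x x) (h x x' + h x' x) (h x' x') (h y y) (h y y' + h y' y) (h y' y')
  (h x y) (h x y' + h x' y) (h x' y')" for h :: "'v => 'v => real"
 have P: "poly (P h) t = h (?x t) (?x t) * h (?y t) (?y t) - (h (?x t) (?y t))\<^sup>2" if "bilinear h" for h t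
  unfolding P_def pp quad[OF that] ..
 have "P g ~= 0"
  using p4 plane unfolding P_def by (metis coeff_0 power2_eq_square)
 then have fin: "finite {t. poly (P g) t = 0}" by (rule poly_roots_finite)
 define F where "F = (SUM q:Q. smult (s q) (P (h q)))"
 have F: "poly F t = (SUM q:Q. s q * (h q (?x t) (?x t) * h q (?y t) (?y t) - (h q (?x t) (?y t))\<^sup>2))" for t
  unfolding F_def poly_sum poly_smult by (intro sum.cong refl) (simp add: P[OF bil(1)])
 have "poly F t = 0" if "poly (P g) t ~= 0" for t
  unfolding F by (rule zero) (use that P[OF bil(2), of t] in simp)
 then have "- {t. poly (P g) t = 0} \<subseteq> {t. poly F t = 0}" by auto
 moreover have "infinite (- {t. poly (P g) t = 0})"
  using fin infinite_UNIV_char_0[where 'a=real] by (metis Compl_partition finite_Un)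
 ultimately have "infinite {t. poly F t = 0}" using finite_subset by blast
 then have "F = 0" using poly_roots_finite by blast
 then have "poly F 0 = 0" by simp
 then show ?thesis unfolding F by simp
qed

lemma orthonormal_basis_exists:
 fixes B :: "'v::euclidean_space => 'v => real"
 assumes B: "bilinear B" "!!x y. B x y = B y x" and V: "subspace V"
  and nondeg: "!!v. v : V ==> (!!w. w : V ==> B v w = 0) ==> v = 0"
 shows "EX S. finite S & S \<subseteq> V & V \<subseteq> span S & card S = dim V &
  (ALL x:S. ALL y:S. x ~= y --> B x y = 0) & (ALL x:S. B x x = 1 | B x x = -1)"
 using V nondeg
proof (induction "dim V" arbitrary: V rule: less_induct)
 case less
 note b = bilinear_simps[OF B(1)]
 show ?case
 proof (cases "V \<subseteq> {0}")
  case True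
  then have "dim V = 0" by simp
  then show ?thesis using True by (intro exI[of _ "{}"]) auto
 next
  case False
  have "EX v:V. B v v ~= 0"
  proof (rule ccontr)
   assume n: "~ (EX v:V. B v v ~= 0)"
   have "B v w = 0" if "v : V" "w : V" for v w
   proof -
    have "B (v + w) (v + w) = 0" using n that less.prems(1) subspace_add by blast
    then show ?thesis using n that B(2)[of w v] by (simp add: b)
   qed
   then show False using less.prems(2) False by blast
  qed
  then obtain v where v: "v : V" "B v v ~= 0" by blast
  define e where "e = (1 / sqrt \<bar>B v v\<bar>) *\<^sub>R v"
  have e: "e : V" using v less.prems(1) by (simp add: e_def subspace_scale)
  have "B e e = B v v / (sqrt \<bar>B v v\<bar> * sqrt \<bar>B v v\<bar>)" by (simp add: e_def b)
  then have "B e e = B v v / \<bar>B v v\<bar>" by simp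
  then have ee: "B e e = 1 | B e e = -1" using v by (auto simp: abs_if split: if_splits)
  define V' where "V' = {w : V. B e w = 0}"
  have V': "subspace V'" "V' \<subseteq> V"
   using less.prems(1) by (auto simp: V'_def subspace_def b bilinear_rzero[OF B(1)])
  have "e ~: V'" using ee by (auto simp: V'_def)
  define pr where "pr w = w - (B e e * B e w) *\<^sub>R e" for w
  have pr: "pr w : V'" if "w : V" for w
  proof -
   have "B e (pr w) = B e w - B e e * B e w * B e e"
    unfolding pr_def by (simp add: bilinear_rsub[OF B(1)] b)
   also have "\<dots> = 0" using ee by auto
   finally show ?thesis using that e less.prems(1) by (simp add: V'_def pr_def subspace_diff subspace_scale)
  qed
  have "e ~: span V'" using \<open>e ~: V'\<close> V'(1) by (metis span_eq_iff)
  then have dim: "dim (insert e V') = dim V' + 1" by (simp add: dim_insert)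
  have "V \<subseteq> span (insert e V')"
  proof
   fix w assume "w : V"
   then have "pr w : span (insert e V')" using pr by (meson insertCI span_base)
   moreover have "(B e e * B e w) *\<^sub>R e : span (insert e V')" by (intro span_scale span_base) simp
   ultimately have "pr w + (B e e * B e w) *\<^sub>R e : span (insert e V')" by (rule span_add)
   then show "w : span (insert e V')" by (simp add: pr_def)
  qed
  then have dV: "dim V = dim V' + 1"
   using dim dim_subset[of V "span (insert e V')"] dim_subset[of "insert e V'" V] e V'(2) dim_span
   by (metis insert_subset order_antisym)
  have "EX S. finite S & S \<subseteq> V' & V' \<subseteq> span S & card S = dim V' &
   (ALL x:S. ALL y:S. x ~= y --> B x y = 0) & (ALL x:S. B x x = 1 | B x x = -1)"
  proof (rule less.hyps[OF _ V'(1)])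
   show "dim V' < dim V" using dV by simp
   fix v assume v: "v : V'" "!!w. w : V' ==> B v w = 0"
   have "B v w = 0" if "w : V" for w
   proof -
    have "B v (pr w) = B v w - B e e * B e w * B v e" unfolding pr_def by (simp add: bilinear_rsub[OF B(1)] b)
    moreover have "B v e = 0" using v(1) B(2)[of v e] by (simp add: V'_def)
    ultimately show ?thesis using v(2)[OF pr[OF that]] by simp
   qed
   then show "v = 0" using less.prems(2) v V' by blast
  qed
  then obtain S where S: "finite S" "S \<subseteq> V'" "V' \<subseteq> span S" "card S = dim V'"
   "ALL x:S. ALL y:S. x ~= y --> B x y = 0" "ALL x:S. B x x = 1 | B x x = -1" by blast
  have "e ~: S" using S \<open>e ~: V'\<close> by blast
  moreover have "V \<subseteq> span (insert e S)"
  proof -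
   have "insert e V' \<subseteq> span (insert e S)"
    using S(3) span_mono[of S "insert e S"] span_base[of e "insert e S"] by blast
   then have "span (insert e V') \<subseteq> span (insert e S)" by (simp add: span_minimal)
   then show ?thesis using \<open>V \<subseteq> span (insert e V')\<close> by blast
  qed
  moreover have "ALL x:insert e S. ALL y:insert e S. x ~= y --> B x y = 0"
  proof -
   have "B e x = 0" "B x e = 0" if "x : S" for x
    using S(2) that B(2)[of x e] by (auto simp: V'_def)
   then show ?thesis using S(5) by auto
  qed
  ultimately show ?thesis
   using S e ee V' dV by (intro exI[of _ "insert e S"]) auto
 qed
qed

text \<open>Sylvester's law of inertia: a negative definite subspace meets the span of the positive members of
 \<open>S\<close> only in zero, which bounds its dimension; the negative members span a subspace that attains it.\<close>

lemma inertia: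
 fixes B :: "'v::euclidean_space => 'v => real"
 assumes B: "bilinear B" and S: "finite S" "V \<subseteq> span S" "card S = dim V" "S \<subseteq> V"
  and orth: "!!x y. x : S ==> y : S ==> x ~= y ==> B x y = 0" and sgn: "!!x. x : S ==> B x x = 1 | B x x = -1"
 shows "!!W. subspace W ==> W \<subseteq> V ==> (!!v. v : W ==> v ~= 0 ==> B v v < 0) ==> dim W <= card {x : S. B x x = -1}"
  and "EX W. subspace W & W \<subseteq> span V & (ALL v:W. v ~= 0 --> B v v < 0) & dim W = card {x : S. B x x = -1}"
proof -
 note b = bilinear_simps[OF B]
 have ind: "independent S" using card_eq_dim[of S V] S by blast
 have exp: "v = (SUM x:U. (B v x * B x x) *\<^sub>R x)" if "v : span U" "U \<subseteq> S" for v U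
  using that(1)
 proof (induction rule: span_induct_alt)
  case base
  then show ?case by (simp add: bilinear_lzero[OF B])
 next
  case (step c y w)
  have "(SUM x:U. (B (c *\<^sub>R y + w) x * B x x) *\<^sub>R x)
   = c *\<^sub>R (SUM x:U. (B y x * B x x) *\<^sub>R x) + (SUM x:U. (B w x * B x x) *\<^sub>R x)"
   by (simp add: b sum.distrib scaleR_sum_right distrib_right scaleR_add_left mult.assoc)
  moreover have "(SUM x:U. (B y x * B x x) *\<^sub>R x) = (SUM x:U. if x = y then y else 0)"
   using step(1) that(2) orth sgn by (intro sum.cong refl) (fastforce simp: subset_iff)
  moreover have "finite U" using that(2) S(1) finite_subset by blast
  ultimately show ?case using step by simp
 qed
 have sq: "B v v = (SUM x:U. (B v x)\<^sup>2 * B x x)" if "v : span U" "U \<subseteq> S" for v U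
 proof -
  have "B v v = B v (SUM x:U. (B v x * B x x) *\<^sub>R x)" using exp[OF that] by simp
  also have "\<dots> = (SUM x:U. (B v x)\<^sup>2 * B x x)"
   using B by (simp add: bilinear_def linear_sum linear_cmul power2_eq_square mult_ac)
  finally show ?thesis .
 qed
 let ?N = "{x : S. B x x = -1}" and ?P = "{x : S. B x x = 1}"
 have card: "card S = card ?N + card ?P"
 proof -
  have "S = ?N \<union> ?P" using sgn by auto
  moreover have "?N \<inter> ?P = {}" by auto
  ultimately show ?thesis using card_Un_disjoint[of ?N ?P] S(1) by auto
 qed
 have pos: "B v v \<ge> 0" if "v : span ?P" for v
  using sq[OF that] by (auto intro!: sum_nonneg)
 have dP: "dim (span ?P) = card ?P"
  by (rule dim_span_eq_card_independent, rule independent_mono[OF ind]) auto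
 show "dim W <= card ?N" if W: "subspace W" "W \<subseteq> V" "!!v. v : W ==> v ~= 0 ==> B v v < 0" for W
 proof -
  have "W \<inter> span ?P \<subseteq> {0}" using W(3) pos by fastforce
  then have "dim (W \<inter> span ?P) = 0" by simp
  moreover have "dim {x + y |x y. x : W & y : span ?P} <= dim V"
  proof -
   have "{x + y |x y. x : W & y : span ?P} \<subseteq> span V"
   proof clarify
    fix x y assume xy: "x : W" "y : span ?P"
    have "x : span V" using xy(1) W(2) by (auto intro: span_base)
    moreover have "y : span V" using xy(2) span_mono[of ?P V] S(4) by auto
    ultimately show "x + y : span V" by (rule span_add)
   qed
   then show ?thesis using dim_subset[of _ "span V"] by simp
  qed
  ultimately show ?thesis
   using dim_sums_Int[OF W(1) subspace_span[of ?P]] dP card S(3) by linarith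
 qed
 have "B v v < 0" if v: "v : span ?N" "v ~= 0" for v
 proof -
  have "EX x:?N. B v x ~= 0"
  proof (rule ccontr)
   assume n: "~ (EX x:?N. B v x ~= 0)"
   have "v = (SUM x:?N. (B v x * B x x) *\<^sub>R x)" by (rule exp[OF v(1)]) auto
   also have "\<dots> = 0" using n by (intro sum.neutral) auto
   finally show False using v by simp
  qed
  then obtain x where x: "x : ?N" "B v x ~= 0" by blast
  then have "0 < (SUM x:?N. (B v x)\<^sup>2)"
   using S(1) by (intro sum_pos2[OF _ x(1)]) auto
  moreover have "B v v = (SUM x:?N. (B v x)\<^sup>2 * B x x)" by (rule sq[OF v(1)]) auto
  moreover have "\<dots> = - (SUM x:?N. (B v x)\<^sup>2)" by (simp add: sum_negf[symmetric])
  ultimately show ?thesis by simp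
 qed
 moreover have "dim (span ?N) = card ?N"
  by (rule dim_span_eq_card_independent, rule independent_mono[OF ind]) auto
 moreover have "span ?N \<subseteq> span V" using S(4) by (intro span_mono) auto
 ultimately show "EX W. subspace W & W \<subseteq> span V & (ALL v:W. v ~= 0 --> B v v < 0) & dim W = card ?N"
  by (intro exI[of _ "span ?N"]) auto
qed

lemma signed_bijection:
 fixes J :: "'n => real"
 assumes "finite A" "finite S" "card A = card S" "card {a : A. J a = -1} = card {x : S. q x = -1}"
  and "!!a. a : A ==> J a = 1 | J a = -1" "!!x. x : S ==> q x = 1 | q x = -1"
 obtains e where "bij_betw e A S" "!!a. a : A ==> q (e a) = J a"
proof -
 let ?A = "{a : A. J a = -1}" and ?S = "{x : S. q x = -1}"
 obtain e where e: "bij_betw e ?A ?S"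
  using finite_same_card_bij[of ?A ?S] assms by auto
 have "card (A - ?A) = card (S - ?S)" using assms by (simp add: card_Diff_subset)
 then obtain e' where e': "bij_betw e' (A - ?A) (S - ?S)"
  using finite_same_card_bij[of "A - ?A" "S - ?S"] assms by auto
 let ?e = "%a. if a : ?A then e a else e' a"
 have "bij_betw ?e ?A ?S" using e by (subst bij_betw_cong[where g=e]) auto
 moreover have "bij_betw ?e (A - ?A) (S - ?S)" using e' by (subst bij_betw_cong[where g=e']) auto
 ultimately have b: "bij_betw ?e (?A \<union> (A - ?A)) (?S \<union> (S - ?S))" by (intro bij_betw_combine) auto
 have un: "?A \<union> (A - ?A) = A" "?S \<union> (S - ?S) = S" by auto
 have "q (?e a) = J a" if "a : A" for a
 proof (cases "a : ?A")
  case True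
  then show ?thesis using bij_betwE[OF e] by auto
 next
  case False
  then have "e' a : S - ?S" using bij_betwE[OF e'] that by auto
  then show ?thesis using False that assms(5)[OF that] assms(6)[of "e' a"] by auto
 qed
 then show ?thesis using that b un by simp
qed

lemma bilinear_pform: "bilinear (pform J)"
 unfolding bilinear_def pform_def
 by (auto intro!: linearI simp: algebra_simps sum.distrib sum_distrib_left)

lemma pform_sum:
 "pform J (SUM a:A. c a *\<^sub>R x a) y = (SUM a:A. c a * pform J (x a) y)"
 "pform J y (SUM a:A. c a *\<^sub>R x a) = (SUM a:A. c a * pform J y (x a))"
proof -
 have l: "linear (%x. pform J x y)" "linear (pform J y)"
  using bilinear_pform[of J] by (auto simp: bilinear_def)
 show "pform J (SUM a:A. c a *\<^sub>R x a) y = (SUM a:A. c a * pform J (x a) y)"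
  using linear_sum[OF l(1), of "%a. c a *\<^sub>R x a" A] linear_cmul[OF l(1)] by simp
 show "pform J y (SUM a:A. c a *\<^sub>R x a) = (SUM a:A. c a * pform J y (x a))"
  using linear_sum[OF l(2), of "%a. c a *\<^sub>R x a" A] linear_cmul[OF l(2)] by simp
qed

lemma pform_sym: "pform J x y = pform J y x"
 by (simp add: pform_def mult_ac)

lemma pform_axis: "pform J x (axis i 1) = J i * x $ i"
 by (simp add: pform_def axis_def if_distrib[of "%x. y * x" for y] cong: if_cong)

lemma pform_nondegenerate:
 assumes "!!i. J i ~= 0" "!!y. pform J x y = 0"
 shows "x = 0"
 using assms pform_axis[of J x] by (auto simp: vec_eq_iff)

text \<open>An orthonormal basis of the tangent space exists; by inertia exactly \<open>r\<close> of its members are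
 negative, so that it can be indexed by \<open>T\<close> with the prescribed signs.\<close>

lemma orthonormal_tangent_frame:
 fixes B :: "real ^ 'm::finite => real ^ 'm => real" and J :: "'n::finite => real"
 assumes B: "bilinear B" "!!x y. B x y = B y x" "has_signature B r"
  and T: "card T = CARD('m)" "card {i : T. J i = -1} = r" and J: "!!i. J i = 1 | J i = -1"
 obtains e where "!!i j. i : T ==> j : T ==> B (e i) (e j) = (if i = j then J i else 0)"
proof -
 have nondeg: "v = 0" if "!!w. w : UNIV ==> B v w = 0" for v
  using B(3) that by (simp add: has_signature_def)
 obtain S where S: "finite S" "UNIV \<subseteq> span S" "card S = dim (UNIV :: (real ^ 'm) set)"
  "ALL x:S. ALL y:S. x ~= y --> B x y = 0" "ALL x:S. B x x = 1 | B x x = -1"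
  using orthonormal_basis_exists[OF B(1,2) subspace_UNIV nondeg] by blast
 have "B x y = 0" if "x : S" "y : S" "x ~= y" for x y using S(4) that by blast
 moreover have "B x x = 1 | B x x = -1" if "x : S" for x using S(5) that by blast
 ultimately have i: "!!W. subspace W ==> W \<subseteq> UNIV ==> (!!v. v : W ==> v ~= 0 ==> B v v < 0) ==> dim W <= card {x : S. B x x = -1}"
  "EX W. subspace W & W \<subseteq> span UNIV & (ALL v:W. v ~= 0 --> B v v < 0) & dim W = card {x : S. B x x = -1}"
  using inertia[OF B(1) S(1-3) subset_UNIV] by blast+
 have "card {x : S. B x x = -1} = r"
 proof (rule order_antisym)
  show "card {x : S. B x x = -1} <= r" using i(2) B(3) unfolding has_signature_def by (metis (no_types, lifting))
  obtain W where "subspace W" "ALL v:W. v ~= 0 --> B v v < 0" "dim W = r"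
   using B(3) unfolding has_signature_def by blast
  then show "r <= card {x : S. B x x = -1}" using i(1)[of W] by auto
 qed
 then obtain e where e: "bij_betw e T S" "!!a. a : T ==> B (e a) (e a) = J a"
  using signed_bijection[of T S J "%x. B x x"] S T J by auto
 show ?thesis
 proof (rule that)
  fix i j assume ij: "i : T" "j : T"
  then have "e i : S" "e j : S" using bij_betwE[OF e(1)] by auto
  moreover have "e i = e j \<longleftrightarrow> i = j" using ij bij_betw_imp_inj_on[OF e(1)] by (metis inj_onD)
  ultimately show "B (e i) (e j) = (if i = j then J i else 0)" using S(4) e(2) ij by auto
 qed
qed

text \<open>The orthogonal complement of the given vectors has an orthonormal basis. Its signs agree with
 those of the remaining entries of \<open>J\<close> up to order, again by inertia.\<close>

lemma orthonormal_extension: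
 fixes J :: "'i::finite => real" and e :: "'i => real ^ 'i"
 assumes J: "!!i. J i = 1 | J i = -1"
  and e: "!!a b. a : A ==> b : A ==> pform J (e a) (e b) = (if a = b then J a else 0)"
 obtains e' where "!!a. a : A ==> e' a = e a" "!!a b. pform J (e' a) (e' b) = (if a = b then J a else 0)"
proof -
 let ?B = "pform J"
 have J0: "J i ~= 0" "J i * J i = 1" for i using J[of i] by auto
 note b = bilinear_simps[OF bilinear_pform[of J]]
 have inj: "inj_on e A"
  by (rule inj_onI) (metis e J0(1))
 define V where "V = {v. ALL a:A. ?B v (e a) = 0}"
 have V: "subspace V" by (auto simp: V_def subspace_def b bilinear_lzero[OF bilinear_pform])
 define pr where "pr v = v - (SUM a:A. (J a * ?B v (e a)) *\<^sub>R e a)" for v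
 have lin: "?B (SUM a:A. c a *\<^sub>R x a) y = (SUM a:A. c a * ?B (x a) y)"
  "?B y (SUM a:A. c a *\<^sub>R x a) = (SUM a:A. c a * ?B y (x a))" for c x y and A :: "'i set"
  by (simp_all add: pform_sum)
 have pr: "pr v : V" for v
 proof -
  have "?B (pr v) (e a) = 0" if a: "a : A" for a
  proof -
   have "(SUM c:A. J c * ?B v (e c) * ?B (e c) (e a)) = (SUM c:A. if c = a then J a * J a * ?B v (e a) else 0)"
    using e a by (intro sum.cong refl) auto
   then show ?thesis using a J0(2)[of a]
    by (simp add: pr_def bilinear_lsub[OF bilinear_pform] lin)
  qed
  then show ?thesis by (simp add: V_def)
 qed
 have nondeg: "v = 0" if v: "v : V" "!!w. w : V ==> ?B v w = 0" for v
 proof (rule pform_nondegenerate[of J, OF J0(1)])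
  fix y
  have "?B v (SUM a:A. (J a * ?B y (e a)) *\<^sub>R e a) = 0"
   using v(1) unfolding lin V_def by (intro sum.neutral) auto
  then show "?B v y = 0"
   using v(2)[OF pr[of y]] by (simp add: pr_def bilinear_rsub[OF bilinear_pform])
 qed
 have ob: "EX S. finite S & S \<subseteq> V & V \<subseteq> span S & card S = dim V &
  (ALL x:S. ALL y:S. x ~= y --> ?B x y = 0) & (ALL x:S. ?B x x = 1 | ?B x x = -1)"
  by (rule orthonormal_basis_exists[OF bilinear_pform pform_sym V nondeg])
 obtain S where S: "finite S" "S \<subseteq> V" "V \<subseteq> span S" "card S = dim V"
  "ALL x:S. ALL y:S. x ~= y --> ?B x y = 0" "ALL x:S. ?B x x = 1 | ?B x x = -1"
  using ob by blast
 let ?S = "e ` A \<union> S"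
 have disj: "e ` A \<inter> S = {}"
 proof -
  have "e a ~: V" if "a : A" for a using e[OF that that] that J0(1)[of a] by (auto simp: V_def intro!: bexI[of _ a])
  then show ?thesis using S(2) by auto
 qed
 have orth: "?B x y = 0" if "x : ?S" "y : ?S" "x ~= y" for x y
 proof -
  have "?B s (e a) = 0" "?B (e a) s = 0" if "s : S" "a : A" for s a
   using S(2) that pform_sym[of J] by (auto simp: V_def subset_iff)
  then show ?thesis using that S(5) e by auto
 qed
 have sgn: "?B x x = 1 | ?B x x = -1" if "x : ?S" for x
 proof (cases "x : S")
  case False
  then obtain a where "a : A" "x = e a" using \<open>x : ?S\<close> by blast
  then show ?thesis using e[of a a] J[of a] by simp
 qed (use S(6) in blast)
 have span: "UNIV \<subseteq> span ?S"
 proof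
  fix v
  have "pr v : span ?S" using pr S(3) span_mono[of S ?S] by blast
  moreover have "(SUM a:A. (J a * ?B v (e a)) *\<^sub>R e a) : span ?S"
   by (intro span_sum span_scale span_base) auto
  ultimately have "pr v + (SUM a:A. (J a * ?B v (e a)) *\<^sub>R e a) : span ?S" by (rule span_add)
  then show "v : span ?S" by (simp add: pr_def)
 qed
 have ind: "independent ?S"
 proof (rule independent_if_scalars_zero)
  show "finite ?S" using S(1) by simp
  fix f x assume f: "(SUM x:?S. f x *\<^sub>R x) = 0" and x: "x : ?S"
  have "0 = ?B (SUM x:?S. f x *\<^sub>R x) x" using f bilinear_lzero[OF bilinear_pform] by metis
  also have "\<dots> = (SUM y:?S. f y * ?B y x)"
   by (rule pform_sum)
  also have "\<dots> = (SUM y:?S. if y = x then f x * ?B x x else 0)"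
   using orth x by (intro sum.cong refl) auto
  also have "\<dots> = f x * ?B x x" using x S(1) by simp
  finally show "f x = 0" using sgn[OF x] by auto
 qed
 have cS: "card ?S = dim (UNIV :: (real ^ 'i) set)"
  using ind span S(1) by (metis basis_card_eq_dim subset_UNIV)
 have cA: "card ?S = card A + card S" using card_Un_disjoint[OF _ S(1) disj] card_image[OF inj] by simp
 let ?X = "(%i. axis i 1) ` (UNIV :: 'i set) :: (real ^ 'i) set"
 have Xi: "inj (%i. axis i 1 :: real ^ 'i)" by (rule injI) (simp add: axis_eq_axis)
 have Xs: "UNIV \<subseteq> span ?X"
 proof
  fix v :: "real ^ 'i"
  have "v = (SUM i:UNIV. v $ i *\<^sub>R axis i 1)" by (simp add: vec_eq_iff axis_def if_distrib[of "%x. y * x" for y] cong: if_cong)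
  moreover have "(SUM i:UNIV. v $ i *\<^sub>R axis i 1) : span ?X" by (intro span_sum span_scale span_base) auto
  ultimately show "v : span ?X" by simp
 qed
 have Xq: "?B (axis i 1) (axis j 1) = (if i = j then J i else 0)" for i j
  unfolding pform_axis by (simp add: axis_def)
 have Xo: "?B x y = 0" if "x : ?X" "y : ?X" "x ~= y" for x y using that Xq by auto
 have Xsg: "?B x x = 1 | ?B x x = -1" if x: "x : ?X" for x
 proof -
  obtain i where "x = axis i 1" using x by blast
  then show ?thesis using Xq[of i i] J[of i] by simp
 qed
 have cX: "card ?X = dim (UNIV :: (real ^ 'i) set)" using card_image[OF Xi] by simp
 have in1: "!!W. subspace W ==> W \<subseteq> UNIV ==> (!!v. v : W ==> v ~= 0 ==> ?B v v < 0) ==> dim W <= card {x : ?S. ?B x x = -1}"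
  and in2: "EX W. subspace W & W \<subseteq> span UNIV & (ALL v:W. v ~= 0 --> ?B v v < 0) & dim W = card {x : ?S. ?B x x = -1}"
  by (rule inertia[OF bilinear_pform _ span cS subset_UNIV orth sgn]; use S(1) in simp)+
 have in3: "!!W. subspace W ==> W \<subseteq> UNIV ==> (!!v. v : W ==> v ~= 0 ==> ?B v v < 0) ==> dim W <= card {x : ?X. ?B x x = -1}"
  and in4: "EX W. subspace W & W \<subseteq> span UNIV & (ALL v:W. v ~= 0 --> ?B v v < 0) & dim W = card {x : ?X. ?B x x = -1}"
  by (rule inertia[OF bilinear_pform _ Xs cX subset_UNIV Xo Xsg]; simp)+
 have "card {x : ?S. ?B x x = -1} = card {x : ?X. ?B x x = -1}"
  using in1 in2 in3 in4 by (metis (no_types, lifting) order_antisym subset_UNIV)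
 also have "{x : ?X. ?B x x = -1} = (%i. axis i 1) ` {i. J i = -1}" using Xq by auto
 also have "card \<dots> = card {i. J i = -1}" using Xi by (intro card_image) (auto simp: inj_on_def)
 also have "{i. J i = -1} = {i : A. J i = -1} \<union> {i : -A. J i = -1}" by auto
 also have "card \<dots> = card {i : A. J i = -1} + card {i : -A. J i = -1}" by (intro card_Un_disjoint) auto
 finally have 1: "card {x : ?S. ?B x x = -1} = card {i : A. J i = -1} + card {i : -A. J i = -1}" .
 have "{x : ?S. ?B x x = -1} = e ` {i : A. J i = -1} \<union> {x : S. ?B x x = -1}" using e by auto
 moreover have "card (e ` {i : A. J i = -1} \<union> {x : S. ?B x x = -1})
  = card (e ` {i : A. J i = -1}) + card {x : S. ?B x x = -1}"
  using S(1) disj by (intro card_Un_disjoint) auto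
 moreover have "card (e ` {i : A. J i = -1}) = card {i : A. J i = -1}"
  using inj by (intro card_image) (auto intro: inj_on_subset)
 ultimately have neg: "card {i : -A. J i = -1} = card {x : S. ?B x x = -1}" using 1 by simp
 have "card (-A) = card S"
  using cS cA by (simp add: Compl_eq_Diff_UNIV card_Diff_subset)
 then obtain e2 where e2: "bij_betw e2 (-A) S" "!!a. a : -A ==> ?B (e2 a) (e2 a) = J a"
  using signed_bijection[of "-A" S J "%x. ?B x x"] S(1,6) neg J by auto
 let ?e = "%a. if a : A then e a else e2 a"
 have inS: "e2 a : S" if "a ~: A" for a using bij_betwE[OF e2(1)] that by auto
 have "?B (?e a) (?e b) = (if a = b then J a else 0)" for a b
 proof (cases "a = b")
  case True
  then show ?thesis using e e2(2) by auto
 next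
  case False
  have "?e a ~= ?e b"
  proof
   assume eq: "?e a = ?e b"
   consider "a : A" "b : A" | "a ~: A" "b ~: A" | "a : A" "b ~: A" | "a ~: A" "b : A" by blast
   then show False
   proof cases
    case 1 then show False using eq False inj by (auto dest: inj_onD)
   next
    case 2 then show False using eq False bij_betw_imp_inj_on[OF e2(1)] by (auto dest: inj_onD)
   next
    case 3 then show False using eq inS[of b] disj by auto
   next
    case 4 then show False using eq inS[of a] disj by (metis IntI empty_iff imageI)
   qed
  qed
  moreover have "?e a : ?S" "?e b : ?S" using inS by auto
  ultimately show ?thesis using orth False by simp
 qed
 then show ?thesis using that[of ?e] by simp
qed

section \<open>The Maurer-Cartan form of a moving frame in coordinates\<close>

definition mc :: "(real ^ 'm::finite => real ^ 'i::finite ^ 'i) => real ^ 'm => real ^ 'm => real ^ 'i ^ 'i" where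
 "mc F u v = matrix_inv (F u) ** ddir v F u"

lemma ddir_eq_mc: "invertible (F u) ==> ddir v F u = F u ** mc F u v"
 by (simp add: mc_def matrix_mul_assoc matrix_inv_right)

lemma linear_mc:
 assumes "F differentiable (at u)"
 shows "linear (mc F u)"
 using linear_compose[OF linear_ddir[OF assms] bounded_linear.linear[OF
   bounded_bilinear.bounded_linear_right[OF bounded_bilinear_matrix_mult, of "matrix_inv (F u)"]]]
 by (simp add: o_def mc_def[abs_def])

lemma smooth_on_mc:
 assumes "open W" "smooth_on W F" "!!u. u : W ==> invertible (F u)"
 shows "smooth_on W (%u. mc F u v)"
 unfolding mc_def
 by (intro smooth_on_matrix_mult smooth_on_matrix_inv smooth_on_ddir assms)

lemma has_derivative_matrix_mult:
 fixes A :: "'v::real_normed_vector => real ^ 'n::finite ^ 'm::finite" and B :: "'v => real ^ 'p::finite ^ 'n"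
 assumes "(A has_derivative A') (at u)" "(B has_derivative B') (at u)"
 shows "((%u. A u ** B u) has_derivative (%v. A u ** B' v + A' v ** B u)) (at u)"
 by (rule bounded_bilinear.FDERIV[OF bounded_bilinear_matrix_mult assms])

lemma mc_equation:
 assumes W: "open W" "smooth_on W F" "!!u. u : W ==> invertible (F u)" and u: "u : W"
 shows "ddir w (%u. mc F u v) u - ddir v (%u. mc F u w) u = mc F u v ** mc F u w - mc F u w ** mc F u v"
proof -
 have d: "ddir b (ddir a F) u = F u ** ddir b (%u. mc F u a) u + F u ** mc F u b ** mc F u a" for a b
 proof -
  have "((%u. F u ** mc F u a) has_derivative (%b. F u ** ddir b (%u. mc F u a) u + ddir b F u ** mc F u a)) (at u)"
   by (intro has_derivative_matrix_mult smooth_on_has_derivative[OF W(2) u]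
     smooth_on_has_derivative[OF smooth_on_mc[OF W] u])
  then have "(ddir a F has_derivative (%b. F u ** ddir b (%u. mc F u a) u + ddir b F u ** mc F u a)) (at u)"
   by (rule has_derivative_transform_within_open[OF _ W(1) u]) (simp add: ddir_eq_mc W(3))
  then have "ddir b (ddir a F) u = F u ** ddir b (%u. mc F u a) u + ddir b F u ** mc F u a"
   by (rule ddir_eq)
  then show ?thesis by (simp add: ddir_eq_mc W(3) u)
 qed
 have "F u ** ddir w (%u. mc F u v) u + F u ** mc F u w ** mc F u v
   = F u ** ddir v (%u. mc F u w) u + F u ** mc F u v ** mc F u w"
  using ddir_commute[OF W(1,2) u, where w=w and v=v] unfolding d .
 then have "matrix_inv (F u) ** (F u ** ddir w (%u. mc F u v) u + F u ** mc F u w ** mc F u v)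
   = matrix_inv (F u) ** (F u ** ddir v (%u. mc F u w) u + F u ** mc F u v ** mc F u w)" by simp
 then have "ddir w (%u. mc F u v) u + mc F u w ** mc F u v = ddir v (%u. mc F u w) u + mc F u v ** mc F u w"
  by (simp add: matrix_add_ldistrib matrix_mul_assoc matrix_inv_left W(3) u)
 then show ?thesis by (simp add: algebra_simps)
qed


lemma ddir_nth2:
 assumes "f differentiable (at u)"
 shows "ddir v (%u. f u $ i $ j) u = ddir v f u $ i $ j"
 by (rule ddir_bounded_linear[OF bounded_linear_compose[OF bounded_linear_vec_nth bounded_linear_vec_nth] assms, unfolded o_def])

lemma (in signs) mc_algebra:
 fixes F :: "real ^ 'm::finite => real ^ 'n option ^ 'n option"
 assumes W: "open W" "u : W" "F differentiable (at u)" "!!u. u : W ==> isom_group \<delta> J (F u)"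
 shows "isom_algebra \<delta> J (mc F u v)"
 unfolding mc_def
proof (rule algebra_of_tangent[OF W(4)[OF W(2)]])
 let ?D = "diag_mat (ext \<delta> J)"
 have bt: "bounded_linear (transpose :: real ^ 'n option ^ 'n option => _)"
  by (rule linear_conv_bounded_linear[THEN iffD1], rule linearI) (simp_all add: transpose_def vec_eq_iff)
 have F: "(F has_derivative (%v. ddir v F u)) (at u)" by (rule has_derivative_ddir[OF W(3)])
 have "((%u. F u ** ?D ** transpose (F u)) has_derivative
   (%v. F u ** ?D ** transpose (ddir v F u) + (F u ** 0 + ddir v F u ** ?D) ** transpose (F u))) (at u)"
  by (intro has_derivative_matrix_mult F has_derivative_const bounded_linear.has_derivative[OF bt F])
 moreover have "((%u. F u ** ?D ** transpose (F u)) has_derivative (%v. 0)) (at u)"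
  by (rule has_derivative_transform_within_open[OF has_derivative_const[of ?D] W(1,2)])
   (use W(4) in \<open>simp add: isom_group_def\<close>)
 ultimately have "(%v. F u ** ?D ** transpose (ddir v F u) + (F u ** 0 + ddir v F u ** ?D) ** transpose (F u)) = (%v. 0)"
  by (rule has_derivative_unique)
 from fun_cong[OF this, of v]
 show "ddir v F u ** ?D ** transpose (F u) + F u ** ?D ** transpose (ddir v F u) = 0"
  by (simp add: add.commute matrix_mult_nth vec_eq_iff)
 assume "\<delta> = 0"
 show "ALL b. ddir v F u $ None $ b = 0"
 proof
  fix b
  have "frechet_derivative (%u. F u $ None $ b) (at u) = frechet_derivative (%u. if b = None then 1 else 0) (at u)"
   by (rule frechet_derivative_cong_open[OF W(1,2)]) (use W(4) \<open>\<delta> = 0\<close> in \<open>simp add: isom_group_def\<close>)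
  then have "ddir v (%u. F u $ None $ b) u = 0" by simp
  then show "ddir v F u $ None $ b = 0" by (simp add: ddir_nth2[OF W(3)])
 qed
qed

section \<open>The Gauss equation\<close>

text \<open>An adapted frame of a map into the quadric (\<open>\<delta> = \<plusminus>1\<close>) or into flat space (\<open>\<delta> = 0\<close>) in
 coordinates. That the column \<open>dF e\<^sub>N\<^sub>o\<^sub>n\<^sub>e\<close> is tangent to the frame vectors in \<open>T\<close> is
 expressed by its components \<open>\<theta>\<close>.\<close>

locale coordinate_frame = signs J \<delta> for J :: "'n::finite => real" and \<delta> +
 fixes T :: "'n set" and W :: "(real ^ 'm::finite) set" and F :: "real ^ 'm => real ^ 'n option ^ 'n option"
 assumes W: "open W" and F: "smooth_on W F" and group: "!!u. u : W ==> isom_group \<delta> J (F u)"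
  and normal: "!!u v i. u : W ==> i ~: T ==> mc F u v $ Some i $ None = 0"
  and inj: "!!u v. u : W ==> (!!i. i : T ==> mc F u v $ Some i $ None = 0) ==> v = 0"
  and card_T: "card T = CARD('m)"
begin

definition om :: "real ^ 'm => 'n => 'n => real ^ 'm => real" where
 "om v a b u = mc F u v $ Some a $ Some b"

definition th :: "real ^ 'm => 'n => real ^ 'm => real" where
 "th v a u = mc F u v $ Some a $ None"

lemma F_inv: "u : W ==> invertible (F u)"
 using group group_invertible by blast

lemma F_diff: "u : W ==> F differentiable (at u)"
 by (rule smooth_on_differentiable[OF F])

lemma algebra: "u : W ==> isom_algebra \<delta> J (mc F u v)"
 by (rule mc_algebra[OF W _ F_diff group])

lemma mc_smooth: "smooth_on W (%u. mc F u v)"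
 by (rule smooth_on_mc[OF W F F_inv])

lemma om_smooth: "smooth_on W (om v a b)" and th_smooth: "smooth_on W (th v a)"
 unfolding om_def[abs_def] th_def[abs_def] by (intro smooth_on_vec_nth W mc_smooth)+

lemma om_linear: "u : W ==> linear (%v. om v a b u)" and th_linear: "u : W ==> linear (%v. th v a u)"
proof -
 assume u: "u : W"
 have l: "linear (%v. mc F u v)" using linear_mc[OF F_diff[OF u]] by simp
 show "linear (%v. om v a b u)" "linear (%v. th v a u)"
  unfolding om_def th_def by (auto intro!: linearI simp: linear_add[OF l] linear_cmul[OF l])
qed

lemma th_normal: "u : W ==> a ~: T ==> th v a u = 0"
 by (simp add: th_def normal)

lemma skew: "u : W ==> J a * om v a b u = - J b * om v b a u"
proof -
 assume "u : W"
 then have "om v a b u * J b = - J a * om v b a u"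
  using algebra[of u v] by (simp add: isom_algebra_def om_def eq_neg_iff_add_eq_0)
 then have "J a * J b * (om v a b u * J b) = J a * J b * (- J a * om v b a u)" by simp
 then show ?thesis using J_sq by (simp add: mult_ac)
qed

lemma mc_commutator:
 assumes u: "u : W"
 shows "ddir w (%u. mc F u v $ a $ b) u - ddir v (%u. mc F u w $ a $ b) u
  = (mc F u v ** mc F u w - mc F u w ** mc F u v) $ a $ b"
proof -
 have "(ddir w (%u. mc F u v) u - ddir v (%u. mc F u w) u) $ a $ b
  = (mc F u v ** mc F u w - mc F u w ** mc F u v) $ a $ b"
  by (simp only: mc_equation[OF W F F_inv u])
 then show ?thesis by (simp add: ddir_nth2[OF smooth_on_differentiable[OF mc_smooth u]])
qed

lemma struct_th:
 assumes u: "u : W"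
 shows "ddir w (th v a) u - ddir v (th w a) u = (SUM b:T. om v a b u * th w b u - om w a b u * th v b u)"
proof -
 have n: "mc F u v $ None $ None = 0" for v using algebra[OF u] by (simp add: isom_algebra_def)
 have z: "(SUM b:-T. mc F u v $ Some a $ Some b * mc F u w $ Some b $ None) = 0" for v w
  by (intro sum.neutral) (use normal[OF u] in auto)
 show ?thesis
  unfolding th_def[abs_def] mc_commutator[OF u]
  by (simp add: matrix_mult_nth sum_option n sum_split[where T=T] z om_def sum_subtractf)
qed

lemma struct_om:
 assumes u: "u : W"
 shows "ddir w (om v a b) u - ddir v (om w a b) u
  = (SUM c:T. om v a c u * om w c b u - om w a c u * om v c b u)
   + (SUM c:-T. om v a c u * om w c b u - om w a c u * om v c b u)
   - \<delta> * (th v a u * th w b u - th w a u * th v b u) * J b"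
proof -
 have n: "mc F u v $ None $ Some b = - \<delta> * th v b u * J b" for v
  using algebra[OF u] by (simp add: isom_algebra_def th_def)
 show ?thesis
  unfolding om_def[abs_def] mc_commutator[OF u]
  by (simp add: matrix_mult_nth sum_option n sum_split[where T=T] th_def sum_subtractf algebra_simps)
qed

lemma th_surj:
 assumes u: "u : W"
 shows "EX v. ALL a:T. th v a u = y a"
proof -
 obtain b :: "'m => 'n" where b: "bij_betw b UNIV T"
  using finite_same_card_bij[of "UNIV :: 'm set" T] card_T by auto
 have bT: "b j : T" for j using bij_betwE[OF b] by auto
 define M :: "real ^ 'm ^ 'm" where "M = (\<chi> j k. th (axis k 1) (b j) u)"
 have M: "(M *v v) $ j = th v (b j) u" for v j
 proof -
  have "th v (b j) u = th (SUM k:UNIV. v $ k *\<^sub>R axis k 1) (b j) u" 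
   by (rule arg_cong[where f="%v. th v (b j) u"])
    (simp add: vec_eq_iff axis_def if_distrib[of "%x. y * x" for y] cong: if_cong)
  also have "\<dots> = (SUM k:UNIV. v $ k * th (axis k 1) (b j) u)"
   using linear_sum[OF th_linear[OF u, of "b j"], of "%k. v $ k *\<^sub>R axis k 1" UNIV]
    linear_cmul[OF th_linear[OF u, of "b j"]] by simp
  finally show ?thesis by (simp add: M_def matrix_vector_mult_def mult.commute)
 qed
 have "v = 0" if "M *v v = 0" for v
 proof (rule inj[OF u])
  fix i assume "i : T"
  then obtain j where "i = b j" using b by (auto simp: bij_betw_def)
  then show "mc F u v $ Some i $ None = 0" using M[of v j] that by (simp add: th_def)
 qed
 then have "invertible M" by (metis matrix_left_invertible_ker invertible_left_inverse)
 define v where "v = matrix_inv M *v (\<chi> j. y (b j))"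
 have "M *v v = (\<chi> j. y (b j))"
  unfolding v_def by (simp add: matrix_vector_mul_assoc matrix_inv_right \<open>invertible M\<close>)
 then have "th v (b j) u = y (b j)" for j using M[of v j] by simp
 then have "ALL a:T. th v a u = y a" using b by (auto simp: bij_betw_def)
 then show ?thesis by blast
qed

definition met :: "real ^ 'm => real ^ 'm => real ^ 'm => real" where
 "met v w u = (SUM a:T. J a * th v a u * th w a u)"

lemma met_bilinear: "u : W ==> bilinear (%v w. met v w u)"
 unfolding bilinear_def met_def
 by (auto intro!: linearI simp: linear_add[OF th_linear] linear_cmul[OF th_linear]
   algebra_simps sum.distrib sum_distrib_left)

lemma bilinear_axis:
 fixes f :: "real ^ 'm => real ^ 'm => real"
 assumes "bilinear f"
 shows "f v w = (SUM i:UNIV. SUM j:UNIV. v $ i * w $ j * f (axis i 1) (axis j 1))"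
proof -
 have e: "x = (SUM i:UNIV. x $ i *\<^sub>R axis i 1)" for x :: "real ^ 'm"
  by (simp add: vec_eq_iff axis_def if_distrib[of "%x. y * x" for y] cong: if_cong)
 have l: "linear (f x)" "linear (%x. f x y)" for x y using assms by (auto simp: bilinear_def)
 have "f v w = f (SUM i:UNIV. v $ i *\<^sub>R axis i 1) w" using e[of v] by simp
 also have "\<dots> = (SUM i:UNIV. v $ i * f (axis i 1) w)"
  using linear_sum[OF l(2)[of w], of "%i. v $ i *\<^sub>R axis i 1" UNIV] linear_cmul[OF l(2)[of w]] by simp
 also have "\<dots> = (SUM i:UNIV. v $ i * (SUM j:UNIV. w $ j * f (axis i 1) (axis j 1)))"
 proof (intro sum.cong refl)
  fix i
  have "f (axis i 1) w = f (axis i 1) (SUM j:UNIV. w $ j *\<^sub>R axis j 1)" using e[of w] by simp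
  also have "\<dots> = (SUM j:UNIV. w $ j * f (axis i 1) (axis j 1))"
   using linear_sum[OF l(1)[of "axis i 1"], of "%j. w $ j *\<^sub>R axis j 1" UNIV] linear_cmul[OF l(1)[of "axis i 1"]] by simp
  finally show "v $ i * f (axis i 1) w = v $ i * (SUM j:UNIV. w $ j * f (axis i 1) (axis j 1))" by simp
 qed
 finally show ?thesis by (simp add: sum_distrib_left mult.assoc)
qed

lemma linear_axis:
 fixes f :: "real ^ 'm => real"
 assumes "linear f"
 shows "f v = (SUM i:UNIV. v $ i * f (axis i 1))"
proof -
 have "v = (SUM i:UNIV. v $ i *\<^sub>R axis i 1)"
  by (simp add: vec_eq_iff axis_def if_distrib[of "%x. y * x" for y] cong: if_cong)
 then have "f v = f (SUM i:UNIV. v $ i *\<^sub>R axis i 1)" by simp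
 also have "\<dots> = (SUM i:UNIV. v $ i * f (axis i 1))"
  using linear_sum[OF assms, of "%i. v $ i *\<^sub>R axis i 1" UNIV] linear_cmul[OF assms] by simp
 finally show ?thesis .
qed

text \<open>\<open>yy i j\<close> is the covariant derivative of the \<open>j\<close>-th coordinate field along the \<open>i\<close>-th one, in the frame.\<close>

definition yy :: "'m => 'm => 'n => real ^ 'm => real" where
 "yy i j a u = ddir (axis i 1) (th (axis j 1) a) u + (SUM b:T. om (axis i 1) a b u * th (axis j 1) b u)"

lemma yy_sym: "u : W ==> yy i j a u = yy j i a u"
 using struct_th[of u, where w="axis i 1" and v="axis j 1" and a=a] by (simp add: yy_def sum_subtractf)

lemma th_derivative: "u : W ==> (th v a has_derivative (%w. ddir w (th v a) u)) (at u)"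
 by (rule smooth_on_has_derivative[OF th_smooth])

lemma ddir_met:
 assumes u: "u : W"
 shows "ddir (axis i 1) (met (axis j 1) (axis k 1)) u
  = (SUM a:T. J a * (yy i j a u * th (axis k 1) a u + th (axis j 1) a u * yy i k a u))"
proof -
 let ?e = "%i. axis i 1 :: real ^ 'm"
 have "(met (?e j) (?e k) has_derivative (%w. SUM a:T. J a * th (?e j) a u * ddir w (th (?e k) a) u
   + J a * ddir w (th (?e j) a) u * th (?e k) a u)) (at u)"
  unfolding met_def[abs_def]
  by (auto intro!: has_derivative_sum derivative_eq_intros th_derivative[OF u] simp: algebra_simps)
 then have "ddir (?e i) (met (?e j) (?e k)) u = (SUM a:T. J a * th (?e j) a u * ddir (?e i) (th (?e k) a) u
   + J a * ddir (?e i) (th (?e j) a) u * th (?e k) a u)"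
  by (rule ddir_eq)
 moreover have "(SUM a:T. J a * ((SUM b:T. om (?e i) a b u * th (?e j) b u) * th (?e k) a u))
   + (SUM a:T. J a * (th (?e j) a u * (SUM b:T. om (?e i) a b u * th (?e k) b u))) = 0"
 proof -
  have "(SUM a:T. J a * ((SUM b:T. om (?e i) a b u * th (?e j) b u) * th (?e k) a u))
   = (SUM a:T. SUM b:T. J a * om (?e i) a b u * th (?e j) b u * th (?e k) a u)"
   by (simp add: sum_distrib_left sum_distrib_right mult_ac)
  also have "\<dots> = (SUM b:T. SUM a:T. J a * om (?e i) a b u * th (?e j) b u * th (?e k) a u)" by (rule sum.swap)
  also have "\<dots> = - (SUM a:T. SUM b:T. J a * om (?e i) a b u * th (?e j) a u * th (?e k) b u)"
   unfolding sum_negf[symmetric] by (intro sum.cong refl, subst skew[OF u]) simp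
  also have "(SUM a:T. SUM b:T. J a * om (?e i) a b u * th (?e j) a u * th (?e k) b u)
   = (SUM a:T. J a * (th (?e j) a u * (SUM b:T. om (?e i) a b u * th (?e k) b u)))"
   by (simp add: sum_distrib_left mult_ac)
  finally show ?thesis by simp
 qed
 ultimately show ?thesis
  unfolding yy_def by (simp add: sum.distrib distrib_left distrib_right mult.assoc)
qed

text \<open>Koszul's formula identifies the Christoffel symbols of the metric with the connection \<open>yy\<close> of
 the frame; so the Riemann tensor is the curvature of the connection form \<open>om\<close> on \<open>T\<close>.\<close>

context
 fixes G :: "real ^ 'm => real ^ 'm ^ 'm"
 assumes G: "!!u j k. u : W ==> G u $ j $ k = met (axis j 1) (axis k 1) u"
begin

lemma partial_G: "u : W ==> partial i (%u. G u $ j $ k) u = ddir (axis i 1) (met (axis j 1) (axis k 1)) u"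
 unfolding partial_def by (subst frechet_derivative_cong_open[OF W, of u _ "met (axis j 1) (axis k 1)"]) (simp_all add: G)

lemma koszul:
 assumes u: "u : W"
 shows "partial i (%u. G u $ j $ p) u + partial j (%u. G u $ i $ p) u - partial p (%u. G u $ i $ j) u
  = 2 * (SUM a:T. J a * yy i j a u * th (axis p 1) a u)"
 unfolding partial_G[OF u] ddir_met[OF u] sum_distrib_left sum.distrib[symmetric] sum_subtractf[symmetric]
 by (intro sum.cong refl)
  (simp add: yy_sym[OF u, of j i] yy_sym[OF u, of p i] yy_sym[OF u, of p j] algebra_simps)

lemma metric_inner:
 assumes u: "u : W"
 shows "v \<bullet> (G u *v w) = met v w u"
 using bilinear_axis[OF met_bilinear[OF u], of v w]
 by (simp add: inner_vec_def matrix_vector_mult_def G[OF u] sum_distrib_left mult_ac)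

lemma met_nondegenerate:
 assumes u: "u : W" and 0: "!!w. met v w u = 0"
 shows "v = 0"
proof (rule inj[OF u])
 fix i assume i: "i : T"
 obtain w where w: "ALL a:T. th w a u = (if a = i then 1 else 0)"
  using th_surj[OF u, of "%a. if a = i then 1 else 0"] by blast
 have "met v w u = (SUM a:T. if a = i then J i * th v i u else 0)"
  unfolding met_def using w by (intro sum.cong refl) auto
 then show "mc F u v $ Some i $ None = 0" using i 0[of w] J_nz[of i] by (simp add: th_def)
qed

lemma G_inv:
 assumes u: "u : W"
 shows "invertible (G u)"
proof -
 have "v = 0" if "G u *v v = 0" for v
 proof (rule met_nondegenerate[OF u])
  show "met v w u = 0" for w
   using metric_inner[OF u, of w v] that bilinear_rzero by (simp add: met_def mult_ac)
 qed
 then show ?thesis by (metis matrix_left_invertible_ker invertible_left_inverse)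
qed

lemma th_christoffel:
 assumes u: "u : W" and a: "a : T"
 shows "(SUM l:UNIV. th (axis l 1) a u * christoffel G l i j u) = yy i j a u"
proof -
 obtain z where z: "ALL a:T. th z a u = yy i j a u" using th_surj[OF u, of "%a. yy i j a u"] by blast
 have "(G u *v z) $ p = (SUM a:T. J a * yy i j a u * th (axis p 1) a u)" for p
 proof -
  have "(G u *v z) $ p = axis p 1 \<bullet> (G u *v z)" by (simp add: inner_axis')
  also have "\<dots> = met (axis p 1) z u" by (rule metric_inner[OF u])
  also have "\<dots> = (SUM a:T. J a * yy i j a u * th (axis p 1) a u)"
   unfolding met_def using z by (intro sum.cong refl) simp
  finally show ?thesis .
 qed
 then have "christoffel G l i j u = (matrix_inv (G u) *v (G u *v z)) $ l" for l
  unfolding christoffel_def koszul[OF u] by (simp add: matrix_vector_mult_def[of "matrix_inv (G u)"] sum_divide_distrib)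
 then have "christoffel G l i j u = z $ l" for l
  by (simp add: matrix_vector_mul_assoc matrix_inv_left G_inv[OF u])
 then show ?thesis using linear_axis[OF th_linear[OF u, of a], of z] z a by (simp add: mult.commute)
qed

lemma G_smooth: "smooth_on W G"
proof -
 have "smooth_on W (%u. \<chi> j k. met (axis j 1) (axis k 1) u)"
  unfolding met_def
  by (intro smooth_on_vec_lambda smooth_on_sum smooth_on_mult smooth_on_const W th_smooth)
 then show ?thesis by (rule smooth_on_cong[OF W, rotated]) (simp add: vec_eq_iff G)
qed

lemma christoffel_smooth: "smooth_on W (christoffel G l i j)"
proof -
 have g: "smooth_on W (%u. partial i (%u. G u $ j $ k) u)" for i j k
  unfolding partial_def by (intro smooth_on_ddir smooth_on_vec_nth W G_smooth)
 have m: "smooth_on W (%u. matrix_inv (G u) $ l $ p)" for p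
  by (intro smooth_on_vec_nth W smooth_on_matrix_inv G_smooth G_inv)
 have "smooth_on W (%u. (1/2) * (SUM p:UNIV. matrix_inv (G u) $ l $ p *
   (partial i (%u. G u $ j $ p) u + partial j (%u. G u $ i $ p) u - partial p (%u. G u $ i $ j) u)))"
  by (intro smooth_on_mult smooth_on_sum smooth_on_const smooth_on_add smooth_on_diff W g m)
 then show ?thesis by (rule smooth_on_cong[OF W, rotated]) (simp add: christoffel_def)
qed

definition curv :: "real ^ 'm => real ^ 'm => 'n => 'n => real ^ 'm => real" where
 "curv v w a b u = (SUM c:-T. om w a c u * om v c b u - om v a c u * om w c b u)
   - \<delta> * (th w a u * th v b u - th v a u * th w b u) * J b"

lemma curv_eq:
 "u : W ==> curv v w a b u = ddir v (om w a b) u - ddir w (om v a b) u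
   + (SUM c:T. om v a c u * om w c b u - om w a c u * om v c b u)"
 using struct_om[of u, where w=v and v=w and a=a and b=b] by (simp add: curv_def sum_subtractf)

lemma th_riemann:
 assumes u: "u : W" and a: "a : T"
 shows "(SUM l:UNIV. th (axis l 1) a u * riemann G l k i j u)
  = (SUM b:T. curv (axis i 1) (axis j 1) a b u * th (axis k 1) b u)"
proof -
 let ?e = "%i. axis i 1 :: real ^ 'm"
 let ?C = "christoffel G"
 have dC: "(?C l j k has_derivative (%w. ddir w (?C l j k) u)) (at u)" for l j k
  by (rule smooth_on_has_derivative[OF christoffel_smooth u])
 define S where "S i j = (SUM l:UNIV. th (?e l) a u * (partial i (?C l j k) u + (SUM p:UNIV. ?C l i p u * ?C p j k u)))" for i j
 have S: "S i j = ddir (?e i) (ddir (?e j) (th (?e k) a)) u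
   + (SUM b:T. ddir (?e i) (om (?e j) a b) u * th (?e k) b u + om (?e j) a b u * ddir (?e i) (th (?e k) b) u)
   + (SUM b:T. om (?e i) a b u * yy j k b u)" for i j
 proof -
  have "((%u. SUM l:UNIV. th (?e l) a u * ?C l j k u) has_derivative
    (%w. SUM l:UNIV. th (?e l) a u * ddir w (?C l j k) u + ddir w (th (?e l) a) u * ?C l j k u)) (at u)"
   by (intro has_derivative_sum has_derivative_mult th_derivative[OF u] dC)
  then have "(yy j k a has_derivative
    (%w. SUM l:UNIV. th (?e l) a u * ddir w (?C l j k) u + ddir w (th (?e l) a) u * ?C l j k u)) (at u)"
   by (rule has_derivative_transform_within_open[OF _ W u]) (rule th_christoffel[OF _ a])
  then have 1: "ddir (?e i) (yy j k a) u =
    (SUM l:UNIV. th (?e l) a u * partial i (?C l j k) u) + (SUM l:UNIV. ddir (?e i) (th (?e l) a) u * ?C l j k u)"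
   by (simp add: ddir_eq partial_def sum.distrib)
  have "(yy j k a has_derivative (%w. ddir w (ddir (?e j) (th (?e k) a)) u
    + (SUM b:T. om (?e j) a b u * ddir w (th (?e k) b) u + ddir w (om (?e j) a b) u * th (?e k) b u))) (at u)"
   unfolding yy_def[abs_def]
   by (intro has_derivative_add has_derivative_sum has_derivative_mult th_derivative[OF u]
     smooth_on_has_derivative[OF om_smooth u] smooth_on_has_derivative[OF smooth_on_ddir[OF th_smooth] u])
  then have 2: "ddir (?e i) (yy j k a) u = ddir (?e i) (ddir (?e j) (th (?e k) a)) u
    + (SUM b:T. ddir (?e i) (om (?e j) a b) u * th (?e k) b u + om (?e j) a b u * ddir (?e i) (th (?e k) b) u)"
   by (simp add: ddir_eq add.commute)
  have "(SUM l:UNIV. th (?e l) a u * (SUM p:UNIV. ?C l i p u * ?C p j k u))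
   = (SUM p:UNIV. (SUM l:UNIV. th (?e l) a u * ?C l i p u) * ?C p j k u)"
   unfolding sum_distrib_left sum_distrib_right by (subst sum.swap) (simp add: mult_ac)
  also have "\<dots> = (SUM p:UNIV. ddir (?e i) (th (?e p) a) u * ?C p j k u)
   + (SUM p:UNIV. SUM b:T. om (?e i) a b u * (th (?e p) b u * ?C p j k u))"
   unfolding th_christoffel[OF u a] yy_def sum.distrib[symmetric]
   by (intro sum.cong refl) (simp add: algebra_simps sum_distrib_left)
  also have "(SUM p:UNIV. SUM b:T. om (?e i) a b u * (th (?e p) b u * ?C p j k u))
   = (SUM b:T. om (?e i) a b u * (SUM p:UNIV. th (?e p) b u * ?C p j k u))"
   unfolding sum_distrib_left by (rule sum.swap)
  also have "\<dots> = (SUM b:T. om (?e i) a b u * yy j k b u)"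
   by (intro sum.cong refl) (simp add: th_christoffel[OF u])
  finally have 3: "(SUM l:UNIV. th (?e l) a u * (SUM p:UNIV. ?C l i p u * ?C p j k u))
   = (SUM p:UNIV. ddir (?e i) (th (?e p) a) u * ?C p j k u) + (SUM b:T. om (?e i) a b u * yy j k b u)" .
  have "S i j = (SUM l:UNIV. th (?e l) a u * partial i (?C l j k) u)
    + (SUM l:UNIV. th (?e l) a u * (SUM p:UNIV. ?C l i p u * ?C p j k u))"
   unfolding S_def by (simp add: distrib_left sum.distrib)
  then show ?thesis using 1 2 3 by simp
 qed
 have "(SUM l:UNIV. th (?e l) a u * riemann G l k i j u) = S i j - S j i"
  unfolding S_def riemann_def sum_subtractf[symmetric]
  by (intro sum.cong refl) (simp add: sum_subtractf algebra_simps)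
 also have "\<dots> = (SUM b:T. curv (?e i) (?e j) a b u * th (?e k) b u)"
 proof -
  have "ddir (?e i) (ddir (?e j) (th (?e k) a)) u = ddir (?e j) (ddir (?e i) (th (?e k) a)) u"
   by (rule ddir_commute[OF W th_smooth u])
  moreover have "(SUM b:T. om (?e i) a b u * (SUM c:T. om (?e j) b c u * th (?e k) c u))
   = (SUM b:T. (SUM c:T. om (?e i) a c u * om (?e j) c b u) * th (?e k) b u)" for i j
   unfolding sum_distrib_left sum_distrib_right by (subst sum.swap) (simp add: mult_ac)
  ultimately show ?thesis
   unfolding S yy_def curv_eq[OF u]
   by (simp add: sum.distrib sum_subtractf distrib_left distrib_right left_diff_distrib)
 qed
 finally show ?thesis .
qed

lemma curv_bilinear:
 assumes u: "u : W"
 shows "bilinear (%v w. curv v w a b u)"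
 unfolding bilinear_def curv_def
 by (auto intro!: linearI simp: linear_add[OF th_linear[OF u]] linear_cmul[OF th_linear[OF u]]
   linear_add[OF om_linear[OF u]] linear_cmul[OF om_linear[OF u]]
   algebra_simps sum.distrib sum_subtractf sum_distrib_left)

lemma th_curvature_operator:
 assumes u: "u : W" and a: "a : T"
 shows "th (curvature_operator G u X Y Z) a u = (SUM b:T. curv X Y a b u * th Z b u)"
proof -
 let ?e = "%i. axis i 1 :: real ^ 'm"
 have "th (curvature_operator G u X Y Z) a u
  = (SUM l:UNIV. (SUM i:UNIV. SUM j:UNIV. SUM k:UNIV. X $ i * Y $ j * Z $ k * riemann G l k i j u) * th (?e l) a u)"
  using linear_axis[OF th_linear[OF u, of a], of "curvature_operator G u X Y Z"]
  by (simp add: curvature_operator_def)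
 also have "\<dots> = (SUM i:UNIV. SUM j:UNIV. SUM k:UNIV. SUM l:UNIV. X $ i * Y $ j * Z $ k * (th (?e l) a u * riemann G l k i j u))"
 proof -
  have "(SUM l:UNIV. (SUM i:UNIV. SUM j:UNIV. SUM k:UNIV. X $ i * Y $ j * Z $ k * riemann G l k i j u) * th (?e l) a u)
   = (SUM l:UNIV. SUM i:UNIV. SUM j:UNIV. SUM k:UNIV. X $ i * Y $ j * Z $ k * (th (?e l) a u * riemann G l k i j u))"
   by (simp add: sum_distrib_left sum_distrib_right mult_ac)
  also have "\<dots> = (SUM i:UNIV. SUM l:UNIV. SUM j:UNIV. SUM k:UNIV. X $ i * Y $ j * Z $ k * (th (?e l) a u * riemann G l k i j u))"
   by (rule sum.swap)
  also have "\<dots> = (SUM i:UNIV. SUM j:UNIV. SUM l:UNIV. SUM k:UNIV. X $ i * Y $ j * Z $ k * (th (?e l) a u * riemann G l k i j u))"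
   by (rule sum.cong[OF refl], rule sum.swap)
  also have "\<dots> = (SUM i:UNIV. SUM j:UNIV. SUM k:UNIV. SUM l:UNIV. X $ i * Y $ j * Z $ k * (th (?e l) a u * riemann G l k i j u))"
   by (rule sum.cong[OF refl], rule sum.cong[OF refl], rule sum.swap)
  finally show ?thesis .
 qed
 also have "\<dots> = (SUM i:UNIV. SUM j:UNIV. SUM k:UNIV. SUM b:T. X $ i * Y $ j * Z $ k * (curv (?e i) (?e j) a b u * th (?e k) b u))"
  by (simp only: sum_distrib_left[symmetric] th_riemann[OF u a])
 also have "\<dots> = (SUM i:UNIV. SUM j:UNIV. SUM b:T. SUM k:UNIV. X $ i * Y $ j * Z $ k * (curv (?e i) (?e j) a b u * th (?e k) b u))"
  by (rule sum.cong[OF refl], rule sum.cong[OF refl], rule sum.swap)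
 also have "\<dots> = (SUM i:UNIV. SUM j:UNIV. SUM b:T. X $ i * Y $ j * curv (?e i) (?e j) a b u * th Z b u)"
 proof (intro sum.cong refl)
  fix i j b
  have "(SUM k:UNIV. X $ i * Y $ j * Z $ k * (curv (?e i) (?e j) a b u * th (?e k) b u))
   = X $ i * Y $ j * curv (?e i) (?e j) a b u * (SUM k:UNIV. Z $ k * th (?e k) b u)"
   unfolding sum_distrib_left by (simp add: mult_ac)
  then show "(SUM k:UNIV. X $ i * Y $ j * Z $ k * (curv (?e i) (?e j) a b u * th (?e k) b u))
   = X $ i * Y $ j * curv (?e i) (?e j) a b u * th Z b u"
   using linear_axis[OF th_linear[OF u, of b], of Z] by simp
 qed
 also have "\<dots> = (SUM i:UNIV. SUM b:T. SUM j:UNIV. X $ i * Y $ j * curv (?e i) (?e j) a b u * th Z b u)"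
  by (rule sum.cong[OF refl], rule sum.swap)
 also have "\<dots> = (SUM b:T. SUM i:UNIV. SUM j:UNIV. X $ i * Y $ j * curv (?e i) (?e j) a b u * th Z b u)"
  by (rule sum.swap)
 also have "\<dots> = (SUM b:T. curv X Y a b u * th Z b u)"
  by (simp only: sum_distrib_right[symmetric] bilinear_axis[OF curv_bilinear[OF u], of X Y])
 finally show ?thesis .
qed

text \<open>The second fundamental form in the normal direction \<open>q\<close>.\<close>

definition sff :: "'n => real ^ 'm => real ^ 'm => real ^ 'm => real" where
 "sff q v w u = (SUM b:T. om v q b u * th w b u)"

lemma sff_bilinear: "u : W ==> bilinear (%v w. sff q v w u)"
 unfolding bilinear_def sff_def
 by (auto intro!: linearI simp: linear_add[OF th_linear] linear_cmul[OF th_linear]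
   linear_add[OF om_linear] linear_cmul[OF om_linear] algebra_simps sum.distrib sum_distrib_left)

lemma sff_sym:
 assumes u: "u : W" and q: "q ~: T"
 shows "sff q v w u = sff q w v u"
proof -
 have "frechet_derivative (th v q) (at u) = frechet_derivative (%u. 0) (at u)" for v
  by (rule frechet_derivative_cong_open[OF W u]) (simp add: th_normal q)
 then have "ddir w (th v q) u - ddir v (th w q) u = 0" by simp
 then show ?thesis unfolding struct_th[OF u] sff_def by (simp add: sum_subtractf)
qed

lemma sff_gauss:
 assumes u: "u : W"
 shows "(SUM a:T. SUM b:T. J a * th V a u * (SUM q:-T. om w a q u * om v q b u - om v a q u * om w q b u) * th Z b u)
  = (SUM q:-T. J q * (sff q v V u * sff q w Z u - sff q w V u * sff q v Z u))"
proof -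
 have "(SUM a:T. SUM b:T. J a * th V a u * (SUM q:-T. om w a q u * om v q b u - om v a q u * om w q b u) * th Z b u)
  = (SUM a:T. SUM b:T. SUM q:-T. J q * ((om v q a u * th V a u) * (om w q b u * th Z b u)
    - (om w q a u * th V a u) * (om v q b u * th Z b u)))"
  unfolding sum_distrib_left sum_distrib_right
 proof (intro sum.cong refl)
  fix a b q
  have "J a * th V a u * (om w a q u * om v q b u - om v a q u * om w q b u) * th Z b u
   = (J a * om w a q u) * (th V a u * om v q b u * th Z b u) - (J a * om v a q u) * (th V a u * om w q b u * th Z b u)"
   by (simp add: algebra_simps)
  also have "\<dots> = (- J q * om w q a u) * (th V a u * om v q b u * th Z b u) - (- J q * om v q a u) * (th V a u * om w q b u * th Z b u)"
   by (simp only: skew[OF u, of a _ q])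
  finally show "J a * th V a u * (om w a q u * om v q b u - om v a q u * om w q b u) * th Z b u
   = J q * ((om v q a u * th V a u) * (om w q b u * th Z b u) - (om w q a u * th V a u) * (om v q b u * th Z b u))"
   by (simp add: algebra_simps)
 qed
 also have "\<dots> = (SUM a:T. SUM q:-T. SUM b:T. J q * ((om v q a u * th V a u) * (om w q b u * th Z b u)
    - (om w q a u * th V a u) * (om v q b u * th Z b u)))"
  by (rule sum.cong[OF refl], rule sum.swap)
 also have "\<dots> = (SUM q:-T. SUM a:T. SUM b:T. J q * ((om v q a u * th V a u) * (om w q b u * th Z b u)
    - (om w q a u * th V a u) * (om v q b u * th Z b u)))"
  by (rule sum.swap)
 also have "\<dots> = (SUM q:-T. J q * (sff q v V u * sff q w Z u - sff q w V u * sff q v Z u))"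
  unfolding sff_def by (simp only: sum_product) (simp only: sum_subtractf[symmetric] sum_distrib_left)
 finally show ?thesis .
qed

text \<open>In frame components the sectional curvatures determine the sums of products of second fundamental
 forms on all nondegenerate planes, hence by density on all planes, and by polarization everywhere.\<close>

theorem gauss:
 assumes u: "u : W"
  and sect: "!!X Y. plane_area G u X Y ~= 0 ==> sectional_curvature G u X Y = c"
 shows "gauss_eq J T (c - \<delta>) (mc F u v) (mc F u w)"
proof -
 let ?g = "%v w. met v w u"
 let ?K = "%v w a b. SUM q:-T. om w a q u * om v q b u - om v a q u * om w q b u"
 have area: "plane_area G u X Y = ?g X X * ?g Y Y - (?g X Y)\<^sup>2" for X Y
  by (simp add: plane_area_def metric_inner[OF u])
 have gsym: "?g v w = ?g w v" for v w by (simp add: met_def mult_ac)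
 have quad: "(SUM q:-T. J q * (sff q X X u * sff q Y Y u - (sff q X Y u)\<^sup>2)) = (c - \<delta>) * (?g X X * ?g Y Y - (?g X Y)\<^sup>2)"
  if nz: "?g X X * ?g Y Y - (?g X Y)\<^sup>2 ~= 0" for X Y
 proof -
  have "c * (?g X X * ?g Y Y - (?g X Y)\<^sup>2) = curvature_operator G u X Y Y \<bullet> (G u *v X)"
   using sect[of X Y] nz area[of X Y] unfolding sectional_curvature_def by (simp add: field_simps)
  also have "\<dots> = (SUM a:T. J a * th (curvature_operator G u X Y Y) a u * th X a u)"
   by (simp add: metric_inner[OF u] met_def)
  also have "\<dots> = (SUM a:T. SUM b:T. J a * th X a u * curv X Y a b u * th Y b u)"
   by (intro sum.cong refl) (simp add: th_curvature_operator[OF u] sum_distrib_left sum_distrib_right mult_ac)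
  also have "\<dots> = (SUM a:T. SUM b:T. J a * th X a u * ?K X Y a b * th Y b u)
    - \<delta> * (SUM a:T. SUM b:T. (J a * th X a u * th Y a u) * (J b * th X b u * th Y b u)
     - (J a * th X a u * th X a u) * (J b * th Y b u * th Y b u))"
  proof -
   have "J a * th X a u * curv X Y a b u * th Y b u = J a * th X a u * ?K X Y a b * th Y b u
    - \<delta> * ((J a * th X a u * th Y a u) * (J b * th X b u * th Y b u)
     - (J a * th X a u * th X a u) * (J b * th Y b u * th Y b u))" for a b
    unfolding curv_def by (simp add: algebra_simps del: sum_subtractf)
   moreover have "(SUM a:T. SUM b:T. A a b - \<delta> * B a b) = (SUM a:T. SUM b:T. A a b) - \<delta> * (SUM a:T. SUM b:T. B a b)"
    for A B by (simp only: sum_subtractf sum_distrib_left)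
   ultimately show ?thesis by presburger
  qed
  also have "(SUM a:T. SUM b:T. (J a * th X a u * th Y a u) * (J b * th X b u * th Y b u)
     - (J a * th X a u * th X a u) * (J b * th Y b u * th Y b u)) = (?g X Y)\<^sup>2 - ?g X X * ?g Y Y"
   unfolding met_def power2_eq_square
   by (simp only: sum_product) (simp only: sum_subtractf[symmetric])
  finally show ?thesis
   unfolding sff_gauss[OF u] using sff_sym[OF u]
   by (simp add: algebra_simps power2_eq_square)
 qed
 define hh where "hh p v w = (case p of None => ?g v w | Some q => if q : T then 0 else sff q v w u)" for p v w
 define ss where "ss p = (case p of None => - (c - \<delta>) | Some q => J q)" for p
 have bil: "bilinear (hh p)" for p
 proof (cases p)
  case None
  then show ?thesis using met_bilinear[OF u] by (simp add: hh_def[abs_def])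
 next
  case (Some q)
  have "bilinear (%(v :: real ^ 'm) (w :: real ^ 'm). 0 :: real)" by (auto simp: bilinear_def intro!: linearI)
  then show ?thesis using Some sff_bilinear[OF u] by (cases "q : T") (simp_all add: hh_def[abs_def])
 qed
 have sym: "hh p v w = hh p w v" for p v w
  using gsym sff_sym[OF u] by (cases p) (auto simp: hh_def)
 let ?Q = "insert None (Some ` (-T))"
 have sumQ: "(SUM p:?Q. f p) = f None + (SUM q:-T. f (Some q))" for f :: "'n option => real"
  by (subst sum.insert) (auto simp: sum.reindex)
 have zero1: "(SUM p:?Q. ss p * (hh p X X * hh p Y Y - (hh p X Y)\<^sup>2)) = 0"
  if "?g X X * ?g Y Y - (?g X Y)\<^sup>2 ~= 0" for X Y
  using quad[OF that] unfolding sumQ by (simp add: hh_def ss_def) (simp add: algebra_simps)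
 have unit: "EX V. ALL a':T. th V a' u = (if a' = a then 1 else 0)" for a
  by (rule th_surj[OF u])
 have zero: "(SUM p:?Q. ss p * (hh p X X * hh p Y Y - (hh p X Y)\<^sup>2)) = 0" for X Y
 proof (cases "EX a:T. EX b:T. a ~= b")
  case True
  then obtain a b where ab: "a : T" "b : T" "a ~= b" by blast
  obtain V V' where V: "ALL a':T. th V a' u = (if a' = a then 1 else 0)" "ALL a':T. th V' a' u = (if a' = b then 1 else 0)"
   using unit by metis
  have "?g V V = (SUM a':T. if a' = a then J a else 0)" "?g V' V' = (SUM a':T. if a' = b then J b else 0)"
   "?g V V' = (SUM a':T. 0)"
   unfolding met_def by (intro sum.cong refl; use V ab in auto)+
  then have "?g V V * ?g V' V' - (?g V V')\<^sup>2 ~= 0" using ab J_nz by simp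
  from sectional_zero_dense[OF bil met_bilinear[OF u] sym gsym zero1 this] show ?thesis .
 next
  case False
  have "T ~= {}" using card_T by auto
  then obtain a where a: "T = {a}" using False by blast
  have dep: "th Y a u *\<^sub>R X = th X a u *\<^sub>R Y"
  proof -
   have "th (th Y a u *\<^sub>R X - th X a u *\<^sub>R Y) a u = 0"
    by (simp add: linear_diff[OF th_linear[OF u]] linear_cmul[OF th_linear[OF u]])
   then have "th Y a u *\<^sub>R X - th X a u *\<^sub>R Y = 0"
    by (intro inj[OF u]) (simp add: a th_def)
   then show ?thesis by simp
  qed
  have "hh p X X * hh p Y Y - (hh p X Y)\<^sup>2 = 0" for p
  proof (cases "th X a u = 0")
   case True
   then have "X = 0" by (intro inj[OF u]) (simp add: a th_def)
   then show ?thesis using bilinear_lzero[OF bil] by simp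
  next
   case False
   have "Y = (th Y a u / th X a u) *\<^sub>R X"
    using arg_cong[OF dep, of "%z. (1 / th X a u) *\<^sub>R z"] False by (simp add: divide_inverse_commute)
   then obtain r where "Y = r *\<^sub>R X" by blast
   then show ?thesis by (simp add: bilinear_simps[OF bil] power2_eq_square)
  qed
  then show ?thesis by simp
 qed
 have pol: "(SUM q:-T. J q * (sff q v V u * sff q w Z u - sff q w V u * sff q v Z u))
  = (c - \<delta>) * (?g v V * ?g w Z - ?g w V * ?g v Z)" for v w V Z
  using curvature_polarization[OF bil sym zero, of v V w Z] unfolding sumQ
  by (simp add: hh_def ss_def algebra_simps)
 show ?thesis
  unfolding gauss_eq_def
 proof (intro ballI)
  fix a b assume ab: "a : T" "b : T"
  obtain V Z where V: "ALL a':T. th V a' u = (if a' = a then 1 else 0)" "ALL a':T. th Z a' u = (if a' = b then 1 else 0)"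
   using unit by metis
  have gV: "?g x V = J a * th x a u" "?g x Z = J b * th x b u" for x
  proof -
   have "?g x V = (SUM a':T. if a' = a then J a * th x a u else 0)" "?g x Z = (SUM a':T. if a' = b then J b * th x b u else 0)"
    unfolding met_def by (intro sum.cong refl; use V in auto)+
   then show "?g x V = J a * th x a u" "?g x Z = J b * th x b u" using ab by simp_all
  qed
  have "(SUM a':T. SUM b':T. J a' * th V a' u * ?K v w a' b' * th Z b' u)
   = (SUM a':T. SUM b':T. if a' = a then (if b' = b then J a * ?K v w a b else 0) else 0)"
   by (rule sum.cong[OF refl], rule sum.cong[OF refl]) (use V in auto)
  also have "\<dots> = (SUM a':T. if a' = a then (SUM b':T. if b' = b then J a * ?K v w a b else 0) else 0)"
   by (rule sum.cong[OF refl]) simp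
  finally have "(SUM a':T. SUM b':T. J a' * th V a' u * ?K v w a' b' * th Z b' u) = J a * ?K v w a b"
   using ab by simp
  then have "J a * ?K v w a b = (c - \<delta>) * (J a * th v a u * (J b * th w b u) - J a * th w a u * (J b * th v b u))"
   using pol[of v V w Z] unfolding sff_gauss[OF u] gV by simp
  then have "J a * ?K v w a b = J a * ((c - \<delta>) * (th v a u * th w b u - th w a u * th v b u) * J b)"
   by (simp add: algebra_simps)
  then have K: "?K v w a b = (c - \<delta>) * (th v a u * th w b u - th w a u * th v b u) * J b"
   using J_nz[of a] by simp
  have e: "(SUM q:-T. om v a q u * om w q b u - om w a q u * om v q b u) = - ?K v w a b"
   by (simp add: sum_negf[symmetric])
  have "- ?K v w a b = - (c - \<delta>) * (th v a u * th w b u - th w a u * th v b u) * J b"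
   by (simp only: K mult_minus_left)
  from trans[OF e this]
  show "(SUM q:-T. mc F u v $ Some a $ Some q * mc F u w $ Some q $ Some b - mc F u w $ Some a $ Some q * mc F u v $ Some q $ Some b)
   = - (c - \<delta>) * (mc F u v $ Some a $ None * mc F u w $ Some b $ None - mc F u w $ Some a $ None * mc F u v $ Some b $ None) * J b"
   unfolding om_def th_def .
 qed
qed

end

end

section \<open>The normal bundle in a frame\<close>

lemma orthonormal_frame_matrix:
 "orthonormal_frame J E \<longleftrightarrow> transpose E ** diag_mat J ** E = diag_mat J"
proof -
 have "(transpose E ** diag_mat J ** E) $ a $ b = pform J (column a E) (column b E)" for a b
  unfolding matrix_mult_nth[of _ E] diag_mat_mult by (simp add: transpose_nth pform_def column_def mult_ac)
 then show ?thesis by (auto simp: orthonormal_frame_def vec_eq_iff diag_mat_def)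
qed

lemma diag_mat_sq: "(!!i. J i * J i = 1) ==> diag_mat J ** diag_mat J = mat 1"
 by (rule matrix_eqI) (simp add: diag_mat_mult, simp add: diag_mat_def mat_def)

lemma orthonormal_frame_rows:
 fixes J :: "'i::finite => real"
 assumes J: "!!i. J i * J i = 1"
 shows "orthonormal_frame J E \<longleftrightarrow> E ** diag_mat J ** transpose E = diag_mat J"
proof -
 let ?D = "diag_mat J"
 have DD: "?D ** ?D = mat 1" by (rule diag_mat_sq[OF J])
 have *: "B ** ?D ** A = ?D" if "A ** ?D ** B = ?D" for A B :: "real ^ 'i ^ 'i"
 proof -
  have "A ** (?D ** B ** ?D) = mat 1" using that DD by (simp add: matrix_mul_assoc)
  then have "(?D ** B ** ?D) ** A = mat 1" by (simp add: matrix_left_right_inverse)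
  then have "?D ** (?D ** B ** ?D ** A) = ?D" by simp
  then show ?thesis by (simp add: matrix_mul_assoc DD)
 qed
 show ?thesis unfolding orthonormal_frame_matrix using * by blast
qed

lemma orthonormal_frame_invertible:
 fixes J :: "'i::finite => real"
 assumes J: "!!i. J i * J i = 1" and E: "orthonormal_frame J E"
 shows "invertible E"
proof -
 have "(diag_mat J ** transpose E ** diag_mat J) ** E = mat 1"
 proof -
  have "(diag_mat J ** transpose E ** diag_mat J) ** E = diag_mat J ** (transpose E ** diag_mat J ** E)"
   by (simp add: matrix_mul_assoc)
  also have "\<dots> = mat 1" using E diag_mat_sq[of J, OF J] by (simp add: orthonormal_frame_matrix)
  finally show ?thesis .
 qed
 then show ?thesis unfolding invertible_left_inverse by blast
qed

lemma column_eq_mult: "column b E = E *v axis b 1"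
 by (simp add: vec_eq_iff column_def matrix_vector_mult_def axis_def if_distrib[of "%x. y * x" for y] cong: if_cong)

lemma pform_matrix: "pform J x y = x \<bullet> (diag_mat J *v y)"
proof -
 have "(diag_mat J *v y) $ i = J i * y $ i" for i
  by (simp add: matrix_vector_mult_def diag_mat_def if_distrib[of "%x. x * y" for y] cong: if_cong)
 then show ?thesis by (simp add: pform_def inner_vec_def mult_ac)
qed

lemma pform_frame:
 assumes "orthonormal_frame J E"
 shows "pform J (E *v x) (E *v y) = pform J x y"
proof -
 have "pform J (E *v x) (E *v y) = x \<bullet> (transpose E *v (diag_mat J *v (E *v y)))"
  unfolding pform_matrix vector_transpose_matrix[symmetric, of E x] dot_lmul_matrix by (simp add: vector_transpose_matrix)
 also have "\<dots> = pform J x y"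
 proof -
  have "transpose E *v (diag_mat J *v (E *v y)) = (transpose E ** diag_mat J ** E) *v y"
   by (simp add: matrix_vector_mul_assoc matrix_mul_assoc)
  then show ?thesis using assms by (simp add: orthonormal_frame_matrix pform_matrix)
 qed
 finally show ?thesis .
qed

definition trunc :: "'i set => real ^ 'i::finite => real ^ 'i" where
 "trunc B x = (\<chi> i. if i : B then x $ i else 0)"

lemma trunc_nth: "trunc B x $ i = (if i : B then x $ i else 0)"
 by (simp add: trunc_def)

lemma bounded_linear_trunc: "bounded_linear (trunc B)"
 by (rule linear_conv_bounded_linear[THEN iffD1], rule linearI) (simp_all add: trunc_def vec_eq_iff)

lemma bounded_bilinear_matrix_vector:
 "bounded_bilinear ((*v) :: real ^ 'n::finite ^ 'm::finite => real ^ 'n => real ^ 'm)"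
 by (rule bilinear_conv_bounded_bilinear[THEN iffD1])
  (auto simp: bilinear_def intro!: linearI simp: matrix_vector_right_distrib matrix_vector_mult_add_rdistrib
   scaleR_matrix_vector_assoc matrix_vector_mult_scaleR)

text \<open>A frame along \<open>W\<close> whose columns in \<open>B\<close> span the normal spaces of \<open>f\<close>.\<close>

locale normal_frame =
 fixes J :: "'i::finite => real" and \<tau> :: "real ^ 'i => (real ^ 'i) set" and ch :: "('a, 'm::finite) chart"
  and f :: "'a => real ^ 'i" and W :: "(real ^ 'm) set" and E :: "real ^ 'm => real ^ 'i ^ 'i" and B :: "'i set"
 assumes J: "!!i. J i * J i = 1" and W: "open W" and E: "smooth_on W E" "!!u. u : W ==> orthonormal_frame J (E u)"
  and N: "!!u. u : W ==> normal_space J \<tau> ch f u = {\<xi>. ALL c:-B. pform J \<xi> (column c (E u)) = 0}"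
begin

lemma E_inv: "u : W ==> invertible (E u)"
 using orthonormal_frame_invertible[OF J E(2)] .

lemma J_nz: "J i ~= 0" using J[of i] by auto

lemma pform_column: "u : W ==> pform J (E u *v x) (column c (E u)) = J c * x $ c"
 by (simp add: column_eq_mult pform_frame E(2) pform_axis)

lemma normal_iff: "u : W ==> E u *v x : normal_space J \<tau> ch f u \<longleftrightarrow> trunc B x = x"
 using J_nz by (auto simp: N pform_column trunc_def vec_eq_iff)

lemma orth_proj_frame:
 assumes u: "u : W"
 shows "orth_proj J (normal_space J \<tau> ch f u) (E u *v x) = E u *v trunc B x"
 unfolding orth_proj_def
proof (rule the_equality)
 show "E u *v trunc B x : normal_space J \<tau> ch f u &
   (ALL z:normal_space J \<tau> ch f u. pform J (E u *v x - E u *v trunc B x) z = 0)"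
 proof (intro conjI ballI)
  show "E u *v trunc B x : normal_space J \<tau> ch f u"
   by (simp add: normal_iff[OF u] trunc_def vec_eq_iff)
  fix z assume z: "z : normal_space J \<tau> ch f u"
  have "z = E u *v (matrix_inv (E u) *v z)"
   by (simp add: matrix_vector_mul_assoc matrix_inv_right E_inv[OF u])
  then obtain y where y: "z = E u *v y" by blast
  then have "trunc B y = y" using z normal_iff[OF u] by blast
  then have y0: "y $ i = 0" if "i ~: B" for i
   using trunc_nth[of B y i] that unfolding \<open>trunc B y = y\<close> by simp
  have "pform J (E u *v x - E u *v trunc B x) z = pform J (x - trunc B x) y"
   unfolding y matrix_vector_mult_diff_distrib[symmetric] by (rule pform_frame[OF E(2)[OF u]])
  also have "\<dots> = 0" unfolding pform_def by (intro sum.neutral) (auto simp: trunc_def y0)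
  finally show "pform J (E u *v x - E u *v trunc B x) z = 0" .
 qed
next
 fix y assume y: "y : normal_space J \<tau> ch f u & (ALL z:normal_space J \<tau> ch f u. pform J (E u *v x - y) z = 0)"
 have "y = E u *v (matrix_inv (E u) *v y)"
  by (simp add: matrix_vector_mul_assoc matrix_inv_right E_inv[OF u])
 then obtain y' where y': "y = E u *v y'" by blast
 have t: "trunc B y' = y'" using y y' normal_iff[OF u] by blast
 have "x $ c = y' $ c" if c: "c : B" for c
 proof -
  have "E u *v axis c 1 : normal_space J \<tau> ch f u"
   unfolding normal_iff[OF u] using c by (auto simp: trunc_def vec_eq_iff axis_def)
  then have "pform J (E u *v x - y) (E u *v axis c 1) = 0" using y by blast
  then have "pform J (E u *v (x - y')) (E u *v axis c 1) = 0"
   by (simp add: y' matrix_vector_mult_diff_distrib)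
  then show ?thesis using J_nz[of c] by (simp add: pform_frame[OF E(2)[OF u]] pform_axis)
 qed
 then have "trunc B x = trunc B y'" by (simp add: trunc_def vec_eq_iff)
 then show "y = E u *v trunc B x" using t y' by simp
qed

lemma normal_deriv_frame:
 assumes W': "open W'" "W' \<subseteq> W" and x: "smooth_on W' x" "!!u. u : W' ==> trunc B (x u) = x u"
  and \<xi>: "!!u. u : W' ==> \<xi> u = E u *v x u" and u: "u : W'"
 shows "normal_deriv J \<tau> ch f v \<xi> u = E u *v (ddir v x u + trunc B (mc E u v *v x u))"
  and "trunc B (ddir v x u) = ddir v x u"
proof -
 have uW: "u : W" using W' u by blast
 have dx: "(x has_derivative (%v. ddir v x u)) (at u)" by (rule smooth_on_has_derivative[OF x(1) u])
 have "((%u. trunc B (x u)) has_derivative (%v. trunc B (ddir v x u))) (at u)"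
  by (rule bounded_linear.has_derivative[OF bounded_linear_trunc dx])
 then have "(x has_derivative (%v. trunc B (ddir v x u))) (at u)"
  by (rule has_derivative_transform_within_open[OF _ W'(1) u]) (rule x(2))
 from fun_cong[OF has_derivative_unique[OF this dx]]
 show t: "trunc B (ddir v x u) = ddir v x u" .
 have "((%u. E u *v x u) has_derivative (%v. E u *v ddir v x u + ddir v E u *v x u)) (at u)"
  by (rule bounded_bilinear.FDERIV[OF bounded_bilinear_matrix_vector smooth_on_has_derivative[OF E(1) uW] dx])
 then have "(\<xi> has_derivative (%v. E u *v ddir v x u + ddir v E u *v x u)) (at u)"
  by (rule has_derivative_transform_within_open[OF _ W'(1) u]) (simp add: \<xi>)
 then have "ddir v \<xi> u = E u *v ddir v x u + ddir v E u *v x u" by (rule ddir_eq)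
 also have "\<dots> = E u *v (ddir v x u + mc E u v *v x u)"
  by (simp add: ddir_eq_mc[of E u, OF E_inv[OF uW]] matrix_vector_right_distrib matrix_vector_mul_assoc)
 finally show "normal_deriv J \<tau> ch f v \<xi> u = E u *v (ddir v x u + trunc B (mc E u v *v x u))"
  unfolding normal_deriv_def
  by (simp add: orth_proj_frame[OF uW] linear_add[OF bounded_linear.linear[OF bounded_linear_trunc]] t)
qed

text \<open>The curvature of the normal connection, by the Maurer-Cartan equation of the whole frame.\<close>

definition ricci_form :: "real ^ 'm => real ^ 'm => real ^ 'm => 'i => 'i => real" where
 "ricci_form u v w a b = (SUM c:-B. mc E u v $ a $ c * mc E u w $ c $ b - mc E u w $ a $ c * mc E u v $ c $ b)"

lemma normal_curvature:
 assumes W': "open W'" "W' \<subseteq> W" and x: "smooth_on W' x" "!!u. u : W' ==> trunc B (x u) = x u"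
  and \<xi>: "!!u. u : W' ==> \<xi> u = E u *v x u" and u: "u : W'"
 shows "normal_deriv J \<tau> ch f v (normal_deriv J \<tau> ch f w \<xi>) u - normal_deriv J \<tau> ch f w (normal_deriv J \<tau> ch f v \<xi>) u
  = E u *v (\<chi> a. if a : B then SUM b:B. ricci_form u w v a b * x u $ b else 0)"
proof -
 have uW: "u : W" using W' u by blast
 have sE: "smooth_on W' E" by (rule smooth_on_subset[OF E(1) W'(2)])
 have inv: "invertible (E u)" if "u : W'" for u using E_inv W'(2) that by blast
 have smc: "smooth_on W' (%u. mc E u v)" for v by (rule smooth_on_mc[OF W'(1) sE inv])
 define D where "D w u = ddir w x u + trunc B (mc E u w *v x u)" for w u
 have sD: "smooth_on W' (D w)" for w
  unfolding D_def
  by (intro smooth_on_add smooth_on_ddir W'(1) x(1) smooth_on_bounded_linear[OF bounded_linear_trunc]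
    smooth_on_bilinear[OF bounded_bilinear_matrix_vector] smc)
 have lt: "linear (trunc B)" by (rule bounded_linear.linear[OF bounded_linear_trunc])
 have tt: "trunc B (trunc B y) = trunc B y" for y by (simp add: trunc_def vec_eq_iff)
 have tD: "trunc B (D w u) = D w u" if "u : W'" for w u
  unfolding D_def using normal_deriv_frame(2)[OF W' x \<xi> that] by (simp add: linear_add[OF lt] tt)
 have nD: "normal_deriv J \<tau> ch f w \<xi> u = E u *v D w u" if "u : W'" for w u
  unfolding D_def by (rule normal_deriv_frame(1)[OF W' x \<xi> that])
 have nn: "normal_deriv J \<tau> ch f v (normal_deriv J \<tau> ch f w \<xi>) u = E u *v (ddir v (D w) u + trunc B (mc E u v *v D w u))" for v w
  by (rule normal_deriv_frame(1)[OF W' sD tD nD u])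
 have dD: "ddir v (D w) u = ddir v (ddir w x) u
   + trunc B (mc E u w *v ddir v x u + ddir v (%u. mc E u w) u *v x u)" for v w
  unfolding D_def
  by (rule ddir_eq, intro has_derivative_add smooth_on_has_derivative[OF smooth_on_ddir[OF x(1)] u]
    bounded_linear.has_derivative[OF bounded_linear_trunc]
    bounded_bilinear.FDERIV[OF bounded_bilinear_matrix_vector]
    smooth_on_has_derivative[OF smc u] smooth_on_has_derivative[OF x(1) u])
 have comm: "ddir v (%u. mc E u w) u = ddir w (%u. mc E u v) u + mc E u w ** mc E u v - mc E u v ** mc E u w" for v w
  using mc_equation[OF W'(1) sE inv u, of v w] by (simp add: algebra_simps)
 have "ddir v (D w) u + trunc B (mc E u v *v D w u) - (ddir w (D v) u + trunc B (mc E u w *v D v u))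
  = trunc B (mc E u w *v (mc E u v *v x u - trunc B (mc E u v *v x u))
    - mc E u v *v (mc E u w *v x u - trunc B (mc E u w *v x u)))"
  unfolding dD unfolding D_def comm[of v w] ddir_commute[OF W'(1) x(1) u, of v w]
  by (simp add: linear_add[OF lt] linear_diff[OF lt] matrix_vector_right_distrib matrix_vector_mult_add_rdistrib
    matrix_vector_mult_diff_rdistrib matrix_vector_mult_diff_distrib matrix_vector_mul_assoc)
 also have "\<dots> = (\<chi> a. if a : B then SUM b:B. ricci_form u w v a b * x u $ b else 0)"
 proof -
  have x0: "x u $ b = 0" if "b ~: B" for b
   using trunc_nth[of B "x u" b] that unfolding x(2)[OF u] by simp
  have mv: "(A *v x u) $ c = (SUM b:B. A $ c $ b * x u $ b)" for A :: "real ^ 'i ^ 'i" and c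
   unfolding matrix_vector_mult_def vec_lambda_beta sum_split[where T=B] by (simp add: x0)
  have "(A *v (C *v x u - trunc B (C *v x u))) $ a = (SUM c:-B. A $ a $ c * (SUM b:B. C $ c $ b * x u $ b))" for A C :: "real ^ 'i ^ 'i" and a
  proof -
   have "(A *v (C *v x u - trunc B (C *v x u))) $ a = (SUM c:UNIV. A $ a $ c * (C *v x u - trunc B (C *v x u)) $ c)"
    by (simp add: matrix_vector_mult_def)
   also have "\<dots> = (SUM c:-B. A $ a $ c * (SUM b:B. C $ c $ b * x u $ b))"
    unfolding sum_split[where T=B] by (simp add: trunc_def mv)
   finally show ?thesis .
  qed
  moreover have "(SUM c:-B. A $ a $ c * (SUM b:B. C $ c $ b * x u $ b)) = (SUM b:B. (SUM c:-B. A $ a $ c * C $ c $ b) * x u $ b)"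
   for A C :: "real ^ 'i ^ 'i" and a
   unfolding sum_distrib_left sum_distrib_right by (subst sum.swap) (simp add: mult.assoc)
  ultimately show ?thesis
   by (simp add: vec_eq_iff trunc_def ricci_form_def sum_subtractf left_diff_distrib)
 qed
 finally show ?thesis unfolding nn by (simp add: matrix_vector_mult_diff_distrib[symmetric])
qed

end

lemma flat_normal_bundle_imp_ricci:
 assumes nf: "normal_frame J \<tau> ch f W E B" and flat: "flat_normal_bundle \<A> J \<tau> f"
  and ch: "ch : \<A>" "W \<subseteq> snd ch ` fst ch" and u: "u : W" and ab: "a : B" "b : B"
 shows "normal_frame.ricci_form E B u v w a b = 0"
proof -
 interpret normal_frame J \<tau> ch f W E B by (rule nf)
 let ?\<xi> = "%u. E u *v axis b 1"
 have tb: "trunc B (axis b 1 :: real ^ 'a) = axis b 1" using ab by (auto simp: trunc_def vec_eq_iff axis_def)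
 have sm: "smooth_on W ?\<xi>" by (intro smooth_on_bilinear[OF bounded_bilinear_matrix_vector] W E(1)) simp
 have "normal_deriv J \<tau> ch f w (normal_deriv J \<tau> ch f v ?\<xi>) u = normal_deriv J \<tau> ch f v (normal_deriv J \<tau> ch f w ?\<xi>) u"
  using flat[unfolded flat_normal_bundle_def, rule_format, of ch W ?\<xi> u w v] ch W sm normal_iff tb u by auto
 then have "E u *v (\<chi> a. if a : B then SUM c:B. ricci_form u v w a c * axis b 1 $ c else 0) = 0"
  using normal_curvature[OF W subset_refl _ _ _ u, of "%u. axis b 1" ?\<xi> w v] tb by simp
 then have "(\<chi> a. if a : B then SUM c:B. ricci_form u v w a c * axis b 1 $ c else 0) = (0 :: real ^ 'a)"
  using E_inv[OF u] unfolding invertible_left_inverse matrix_left_invertible_ker by blast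
 from arg_cong[OF this, of "%x. x $ a"]
 have "(SUM c:B. ricci_form u v w a c * axis b 1 $ c) = 0" using ab(1) by simp
 then show ?thesis using ab by (simp add: axis_def if_distrib[of "%x. y * x" for y] cong: if_cong)
qed

lemma ricci_imp_flat_normal_bundle:
 assumes "!!ch u. ch : \<A> ==> u : snd ch ` fst ch ==> EX W E. u : W & normal_frame J \<tau> ch f W E B &
  (ALL u:W. ALL v w. ALL a:B. ALL b:B. normal_frame.ricci_form E B u v w a b = 0)"
 shows "flat_normal_bundle \<A> J \<tau> f"
 unfolding flat_normal_bundle_def
proof (intro ballI allI impI)
 fix ch W' \<xi> u v w
 assume ch: "ch : \<A>" and h: "open W' & W' \<subseteq> snd ch ` fst ch & smooth_on W' \<xi> & (ALL u:W'. \<xi> u : normal_space J \<tau> ch f u)"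
  and u: "u : W'"
 obtain W E where WE: "u : W" "normal_frame J \<tau> ch f W E B"
  "ALL u:W. ALL v w. ALL a:B. ALL b:B. normal_frame.ricci_form E B u v w a b = 0"
  using assms[OF ch, of u] h u by blast
 interpret normal_frame J \<tau> ch f W E B by (rule WE(2))
 let ?W = "W \<inter> W'" and ?x = "%u. matrix_inv (E u) *v \<xi> u"
 have o: "open ?W" using W h by auto
 have sm: "smooth_on ?W ?x"
 proof (rule smooth_on_bilinear[OF bounded_bilinear_matrix_vector o])
  show "smooth_on ?W (%u. matrix_inv (E u))"
   by (rule smooth_on_matrix_inv[OF o smooth_on_subset[OF E(1)]]) (use E_inv in auto)
  have "smooth_on W' \<xi>" using h by blast
  then show "smooth_on ?W \<xi>" by (rule smooth_on_subset) simp
 qed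
 have \<xi>: "\<xi> u = E u *v ?x u" if "u : ?W" for u
  using E_inv[of u] that by (simp add: matrix_vector_mul_assoc matrix_inv_right)
 have t: "trunc B (?x u) = ?x u" if "u : ?W" for u
  using normal_iff[of u "?x u"] h that \<xi>[OF that] by auto
 have "(\<chi> a. if a : B then SUM b:B. ricci_form u w v a b * ?x u $ b else 0) = 0"
  using WE(1,3) by (auto simp: vec_eq_iff intro!: sum.neutral)
 then show "normal_deriv J \<tau> ch f v (normal_deriv J \<tau> ch f w \<xi>) u = normal_deriv J \<tau> ch f w (normal_deriv J \<tau> ch f v \<xi>) u"
  using normal_curvature[OF o Int_lower1 sm t \<xi>, of u v w] u WE(1) by simp
qed

section \<open>Adapted frames and the transformed equation on the manifold\<close>

lemma (in signs) gauge_isom_group: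
 assumes "gauge T G"
 shows "isom_group \<delta>' J G"
 unfolding isom_group_def
proof
 have G0: "G $ None $ None = 1" "G $ Some i $ None = 0" "G $ None $ Some i = 0" for i
  using assms by (auto simp: gauge_def)
 have e: "(G ** diag_mat (ext d J) ** transpose G) $ a $ b
   = G $ a $ None * d * G $ b $ None + (SUM i:UNIV. G $ a $ Some i * J i * G $ b $ Some i)" for a b d
  unfolding matrix_mult_nth[of _ "transpose G"] diag_mat_mult by (simp add: transpose_nth sum_option ext_def)
 have iso: "G ** diag_mat (ext \<delta> J) ** transpose G = diag_mat (ext \<delta> J)"
  using assms by (simp add: gauge_def isom_group_def)
 have ii: "(SUM k:UNIV. G $ Some i $ Some k * J k * G $ Some j $ Some k) = (if i = j then J i else 0)" for i j
  using e[of \<delta> "Some i" "Some j"] unfolding iso by (cases "i = j") (simp_all add: G0 diag_mat_def ext_def)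
 show "G ** diag_mat (ext \<delta>' J) ** transpose G = diag_mat (ext \<delta>' J)"
 proof (rule matrix_eqI)
  fix a b show "(G ** diag_mat (ext \<delta>' J) ** transpose G) $ a $ b = diag_mat (ext \<delta>' J) $ a $ b"
   unfolding e by (cases a; cases b) (auto simp: G0 ii diag_mat_def ext_def)
 qed
 show "\<delta>' = 0 --> (ALL b. G $ None $ b = (if b = None then 1 else 0))"
  proof (intro impI allI)
  fix b show "G $ None $ b = (if b = None then 1 else 0)" using G0 by (cases b) auto
 qed
qed

text \<open>For a form with values in the Lie algebra, \<open>H D H\<^sup>t\<close> is constant along solutions, where \<open>D\<close> is the
 matrix of the form. In the degenerate case \<open>\<delta> = 0\<close> the last row is not controlled by this; it solves
 the same equation as the constant row.\<close>

lemma (in signs) group_preserved: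
 fixes H :: "real ^ 'm::finite => real ^ 'n option ^ 'n option"
 assumes D: "open D" "connected D" "u0 : D" "u : D"
  and lin: "!!u. u : D ==> linear (\<Omega> u)" and cont: "!!v. continuous_on D (%u. \<Omega> u v)"
  and H: "!!u. u : D ==> (H has_derivative (%v. H u ** \<Omega> u v)) (at u)"
  and alg: "!!u v. u : D ==> isom_algebra \<delta> J (\<Omega> u v)" and 0: "isom_group \<delta> J (H u0)"
 shows "isom_group \<delta> J (H u)"
 unfolding isom_group_def
proof
 let ?D = "diag_mat (ext \<delta> J)"
 have bt: "bounded_linear (transpose :: real ^ 'n option ^ 'n option => _)"
  by (rule linear_conv_bounded_linear[THEN iffD1], rule linearI) (simp_all add: transpose_def vec_eq_iff)
 have z: "A ** ?D + ?D ** transpose A = 0" if "isom_algebra \<delta> J A" for A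
 proof (rule matrix_eqI)
  fix a b
  have "A $ Some i $ Some j * J j + J i * A $ Some j $ Some i = 0" "A $ None $ None = 0"
   "A $ None $ Some j = - \<delta> * A $ Some j $ None * J j" for i j using that by (auto simp: isom_algebra_def)
  moreover have "\<delta> * A $ Some j $ None * J j * J j = \<delta> * A $ Some j $ None" for j by (simp add: mult.assoc J)
  ultimately show "(A ** ?D + ?D ** transpose A) $ a $ b = (0 :: real ^ 'n option ^ 'n option) $ a $ b"
   by (cases a; cases b) (simp_all add: diag_mat_mult transpose_nth ext_def mult_ac)
 qed
 have "((%u. H u ** ?D ** transpose (H u)) has_derivative (%v. 0)) (at u within D)" if u: "u : D" for u
 proof -
  have "((%u. H u ** ?D ** transpose (H u)) has_derivative
    (%v. H u ** ?D ** transpose (H u ** \<Omega> u v) + (H u ** 0 + H u ** \<Omega> u v ** ?D) ** transpose (H u))) (at u)"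
   by (intro has_derivative_matrix_mult H u has_derivative_const bounded_linear.has_derivative[OF bt H[OF u]])
  moreover have "H u ** ?D ** transpose (H u ** \<Omega> u v) + (H u ** 0 + H u ** \<Omega> u v ** ?D) ** transpose (H u) = 0" for v
  proof -
   have h0: "H u ** 0 = 0" by (simp add: matrix_mult_nth vec_eq_iff)
   have "H u ** ?D ** transpose (H u ** \<Omega> u v) + (H u ** 0 + H u ** \<Omega> u v ** ?D) ** transpose (H u)
    = H u ** (\<Omega> u v ** ?D + ?D ** transpose (\<Omega> u v)) ** transpose (H u)"
    by (simp add: h0 matrix_transpose_mul matrix_mul_assoc matrix_add_ldistrib matrix_mult_add_left)
   also have "\<dots> = 0" by (simp add: z[OF alg[OF u]] matrix_mult_nth vec_eq_iff)
   finally show ?thesis .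
  qed
  ultimately show ?thesis using has_derivative_at_withinI by force
 qed
 from has_derivative_zero_unique_connected[OF D(1,2) _ D(3,4), of "%u. H u ** ?D ** transpose (H u)"] this
 have "H u ** ?D ** transpose (H u) = H u0 ** ?D ** transpose (H u0)" using at_within_open[OF _ D(1)] by auto
 then show "H u ** ?D ** transpose (H u) = ?D" using 0 by (simp add: isom_group_def)
 show "\<delta> = 0 --> (ALL b. H u $ None $ b = (if b = None then 1 else 0))"
 proof
  assume d: "\<delta> = 0"
  let ?P = "%A :: real ^ 'n option ^ 'n option. \<chi> a b. if a = None then 0 else A $ a $ b"
  let ?C = "(\<chi> a b. if a = None & b = None then 1 else 0) :: real ^ 'n option ^ 'n option"
  have bP: "bounded_linear ?P"
   by (rule linear_conv_bounded_linear[THEN iffD1], rule linearI) (auto simp: vec_eq_iff)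
  have e: "H u = ?P (H u) + ?C"
  proof (rule linear_pde_unique[OF bounded_bilinear_matrix_mult D(1-3) lin cont, of H "%u. ?P (H u) + ?C"])
   show "((%u. ?P (H u) + ?C) has_derivative (%v. (?P (H u) + ?C) ** \<Omega> u v)) (at u)" if u: "u : D" for u
   proof -
    have "((%u. ?P (H u) + ?C) has_derivative (%v. ?P (H u ** \<Omega> u v) + 0)) (at u)"
     by (intro has_derivative_add has_derivative_const bounded_linear.has_derivative[OF bP H[OF u]])
    moreover have "?P (H u ** \<Omega> u v) + 0 = (?P (H u) + ?C) ** \<Omega> u v" for v
    proof (rule matrix_eqI)
     fix a b
     have "\<Omega> u v $ None $ b = 0" using alg[OF u, of v] d by (cases b) (auto simp: isom_algebra_def)
     then show "(?P (H u ** \<Omega> u v) + 0) $ a $ b = ((?P (H u) + ?C) ** \<Omega> u v) $ a $ b"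
      by (cases a) (simp_all add: matrix_mult_nth sum_option)
    qed
    ultimately show ?thesis by simp
   qed
   show "H u0 = ?P (H u0) + ?C"
    using 0 d by (intro matrix_eqI) (auto simp: isom_group_def)
  qed (use H D in auto)
  show "ALL b. H u $ None $ b = (if b = None then 1 else 0)" by (subst e) simp
 qed
qed

text \<open>Both kinds of maps in one: \<open>\<delta> = \<plusminus>1\<close> is meant for maps into the quadric, \<open>\<delta> = 0\<close> for maps into
 the affine hyperplane where the last coordinate is one. The isometries of the target are then linear
 in both cases.\<close>

locale adapted_map = smooth_manifold \<A> + signs J \<delta>
 for \<A> :: "('a::{t2_space, second_countable_topology}, 'm::finite) chart set"
  and J :: "'n::finite => real" and \<delta> :: real +
 fixes T :: "'n set" and f :: "'a => real ^ 'n option"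
 assumes card_T: "card T = CARD('m)" and f_smooth: "smooth_map_on \<A> UNIV f"
  and f_inj: "!!ch x v. ch : \<A> ==> x : fst ch ==> mdiff ch f x v = 0 ==> v = 0"
begin

definition frame :: "'a set => ('a => real ^ 'n option ^ 'n option) => bool" where
 "frame N F \<longleftrightarrow> open N & smooth_map_on \<A> N F & (ALL x:N. isom_group \<delta> J (F x) & (ALL a. F x $ a $ None = f x $ a)) &
   (ALL ch:\<A>. ALL x:N \<inter> fst ch. ALL v. ALL b:-T. mc_form ch F x v $ Some b $ None = 0)"

lemma
 assumes "frame N F"
 shows frame_open: "open N" and frame_smooth: "smooth_map_on \<A> N F"
  and frame_group: "x : N ==> isom_group \<delta> J (F x)" and frame_col: "x : N ==> F x $ a $ None = f x $ a"
  and frame_normal: "ch : \<A> ==> x : N ==> x : fst ch ==> b ~: T ==> mc_form ch F x v $ Some b $ None = 0"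
 using assms by (auto simp: frame_def)

lemma frame_inv: "frame N F ==> x : N ==> invertible (F x)"
 using frame_group group_invertible by blast

lemma frame_subset: "frame N F ==> open N' ==> N' \<subseteq> N ==> frame N' F"
 unfolding frame_def using smooth_map_on_subset by blast

lemma mc_form_eq: "ch : \<A> ==> x : fst ch ==> mc_form ch F x v = mc (rep ch F) (snd ch x) v"
 by (simp add: mc_form_def mc_def mdiff_def rep_chart)

lemma frame_algebra:
 assumes "frame N F" "ch : \<A>" "x : N" "x : fst ch"
 shows "isom_algebra \<delta> J (mc_form ch F x v)"
 unfolding mc_form_eq[OF assms(2,4)]
proof (rule mc_algebra[of "snd ch ` (fst ch \<inter> N)"])
 show "open (snd ch ` (fst ch \<inter> N))" by (rule open_chart_image_Int[OF assms(2) frame_open[OF assms(1)]])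
 show "rep ch F differentiable (at (snd ch x))"
  by (rule smooth_map_on_differentiable[OF frame_smooth[OF assms(1)] assms(2,4,3)])
qed (use assms frame_group in \<open>auto simp: rep_chart[OF assms(2)]\<close>)

lemma mdiff_column:
 fixes F :: "'a => real ^ 'n option ^ 'n option"
 assumes "smooth_map_on \<A> N F" "open N" "ch : \<A>" "x : N" "x : fst ch" "!!y a. y : N ==> F y $ a $ b = g y $ a"
  "invertible (F x)"
 shows "(rep ch g has_derivative (%v. F x *v column b (mc_form ch F x v))) (at (snd ch x))"
proof -
 have bl: "bounded_linear (%A :: real ^ 'n option ^ 'n option. column b A)"
  by (rule linear_conv_bounded_linear[THEN iffD1], rule linearI) (simp_all add: vec_eq_iff column_def)
 have "(rep ch (%x. column b (F x)) has_derivative (%v. column b (mdiff ch F x v))) (at (snd ch x))"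
  using bounded_linear.has_derivative[OF bl mdiff_has_derivative[OF assms(1,3,5,4)]] by (simp add: rep_def o_def)
 then have "(rep ch g has_derivative (%v. column b (mdiff ch F x v))) (at (snd ch x))"
  by (rule rep_has_derivative_cong[OF assms(3,5,2,4), rotated]) (use assms(6) in \<open>simp add: vec_eq_iff column_def\<close>)
 moreover have "column b (mdiff ch F x v) = F x *v column b (mc_form ch F x v)" for v
  unfolding mc_form_def column_eq_mult
  by (simp add: matrix_vector_mul_assoc matrix_mul_assoc matrix_inv_right assms(7))
 ultimately show ?thesis by simp
qed

lemma mdiff_frame:
 assumes "frame N F" "ch : \<A>" "x : N" "x : fst ch"
 shows "mdiff ch f x v = F x *v column None (mc_form ch F x v)"
 using mdiff_eq[OF mdiff_column[OF frame_smooth[OF assms(1)] frame_open[OF assms(1)] assms(2-4) frame_col[OF assms(1)]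
   frame_inv[OF assms(1,3)]]] by simp

lemma coordinate_frame:
 assumes F: "frame N F" and ch: "ch : \<A>" "N \<subseteq> fst ch"
 shows "coordinate_frame J \<delta> T (snd ch ` N) (rep ch F)"
proof unfold_locales
 show "open (snd ch ` N)" by (rule open_chart_image[OF ch(1) frame_open[OF F] ch(2)])
 show "smooth_on (snd ch ` N) (rep ch F)" by (rule smooth_map_onD[OF frame_smooth[OF F] ch])
 fix u assume "u : snd ch ` N"
 then obtain x where x: "u = snd ch x" "x : N" "x : fst ch" using ch by auto
 show "isom_group \<delta> J (rep ch F u)" using frame_group[OF F x(2)] by (simp add: x rep_chart[OF ch(1)])
 show n: "mc (rep ch F) u v $ Some i $ None = 0" if "i ~: T" for i v
  using frame_normal[OF F ch(1) x(2,3) that] by (simp add: x mc_form_eq[OF ch(1) x(3)])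
 show "v = 0" if v: "!!i. i : T ==> mc (rep ch F) u v $ Some i $ None = 0" for v
 proof (rule f_inj[OF ch(1) x(3)])
  have "mc (rep ch F) u v $ None $ None = 0"
   using frame_algebra[OF F ch(1) x(2,3), of v] by (simp add: isom_algebra_def x mc_form_eq[OF ch(1) x(3)])
  then have "mc (rep ch F) u v $ a $ None = 0" for a using n v by (cases a) auto
  then have "column None (mc_form ch F x v) = 0"
   by (simp add: vec_eq_iff column_def x mc_form_eq[OF ch(1) x(3)])
  then show "mdiff ch f x v = 0" using mdiff_frame[OF F ch(1) x(2,3), of v] by simp
 qed
qed (rule card_T)

lemma theta_surj:
 assumes "frame N F" "ch : \<A>" "x : N" "x : fst ch"
 shows "EX v. ALL a. mc_form ch F x v $ Some a $ None = (if a : T then y a else 0)"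
proof -
 let ?N = "N \<inter> fst ch"
 have F: "frame ?N F" using frame_subset[OF assms(1)] frame_open[OF assms(1)] chart_open[OF assms(2)] by blast
 interpret coordinate_frame J \<delta> T "snd ch ` ?N" "rep ch F" by (rule coordinate_frame[OF F assms(2)]) simp
 have u: "snd ch x : snd ch ` ?N" using assms by auto
 obtain v where "ALL a:T. th v a (snd ch x) = y a" using th_surj[OF u] by blast
 then show ?thesis
  using normal[OF u] by (intro exI[of _ v]) (auto simp: th_def mc_form_eq[OF assms(2,4)])
qed


lemma gauge_zero:
 assumes F: "frame N F" and F': "frame N F'" and x: "x : N" and ij: "i ~: T" "j : T"
 shows "(matrix_inv (F x) ** F' x) $ Some i $ Some j = 0"
proof -
 obtain ch where ch: "ch : \<A>" "x : fst ch" by (rule chart_cover)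
 obtain v where v: "ALL a. mc_form ch F' x v $ Some a $ None = (if a : T then (if a = j then 1 else 0) else 0)"
  using theta_surj[OF F' ch(1) x ch(2), where y="%a. if a = j then 1 else 0"] by (rule exE)
 have "mc_form ch F' x v $ None $ None = 0"
  using frame_algebra[OF F' ch(1) x ch(2), of v] by (simp add: isom_algebra_def)
 then have "mc_form ch F' x v $ a $ None = axis (Some j) 1 $ a" for a
  using v ij by (cases a) (auto simp: axis_def)
 then have c: "column None (mc_form ch F' x v) = axis (Some j) 1"
  by (simp add: vec_eq_iff column_def)
 have "F x *v column None (mc_form ch F x v) = F' x *v axis (Some j) 1"
  using mdiff_frame[OF F ch(1) x ch(2), of v] mdiff_frame[OF F' ch(1) x ch(2), of v] c by simp
 then have "matrix_inv (F x) *v (F x *v column None (mc_form ch F x v)) = matrix_inv (F x) *v (F' x *v axis (Some j) 1)" by simp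
 then have "column None (mc_form ch F x v) = (matrix_inv (F x) ** F' x) *v axis (Some j) 1"
  by (simp only: matrix_vector_mul_assoc matrix_inv_left[OF frame_inv[OF F x]] matrix_vector_mul_lid)
 then have "column None (mc_form ch F x v) = column (Some j) (matrix_inv (F x) ** F' x)"
  by (simp only: column_eq_mult)
 from arg_cong[OF this, of "%y. y $ Some i"]
 show ?thesis using frame_normal[OF F ch(1) x ch(2) ij(1)] by (simp add: column_def)
qed

text \<open>The two frames have the same last column, and their tangential columns span the same space, the
 range of the differential; the group relation then makes the remaining off-diagonal blocks vanish.\<close>

lemma frames_gauge:
 assumes F: "frame N F" and F': "frame N F'" and x: "x : N"
 shows "gauge T (matrix_inv (F x) ** F' x)"
proof (rule gaugeI)
 have i: "invertible (F x)" "invertible (F' x)" using frame_inv F F' x by auto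
 show "isom_group \<delta> J (matrix_inv (F x) ** F' x)"
  by (intro group_mult group_inv frame_group[OF F x] frame_group[OF F' x])
 have "column None (F' x) = column None (F x)"
  using frame_col[OF F x] frame_col[OF F' x] by (simp add: vec_eq_iff column_def)
 then have "column None (matrix_inv (F x) ** F' x) = axis None 1"
  unfolding column_eq_mult matrix_vector_mul_assoc[symmetric]
  by (simp add: matrix_vector_mul_assoc matrix_inv_left[OF i(1)])
 then have "column None (matrix_inv (F x) ** F' x) $ a = axis None 1 $ a" for a by simp
 then show "(matrix_inv (F x) ** F' x) $ a $ None = (if a = None then 1 else 0)" for a
  by (simp add: column_def axis_def)
 show "(matrix_inv (F x) ** F' x) $ Some i $ Some j = 0" if "i ~: T" "j : T" for i j
  by (rule gauge_zero[OF F F' x that])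
 have "(matrix_inv (F' x) ** F x) ** (matrix_inv (F x) ** F' x)
  = matrix_inv (F' x) ** (F x ** matrix_inv (F x)) ** F' x" by (simp add: matrix_mul_assoc)
 then have r: "(matrix_inv (F' x) ** F x) ** (matrix_inv (F x) ** F' x) = mat 1"
  by (simp add: matrix_inv_right[OF i(1)] matrix_inv_left[OF i(2)])
 have "matrix_inv (matrix_inv (F x) ** F' x) = matrix_inv (F' x) ** F x"
 proof -
  let ?A = "matrix_inv (F x) ** F' x" and ?B = "matrix_inv (F' x) ** F x"
  have "invertible ?A" using r unfolding invertible_left_inverse by blast
  then have "?B = ?B ** (?A ** matrix_inv ?A)" by (simp add: matrix_inv_right)
  also have "\<dots> = (?B ** ?A) ** matrix_inv ?A" by (rule matrix_mul_assoc)
  also have "\<dots> = matrix_inv ?A" by (simp only: r matrix_mul_lid)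
  finally show ?thesis by (rule sym)
 qed
 then show "matrix_inv (matrix_inv (F x) ** F' x) $ Some i $ Some j = 0" if "i ~: T" "j : T" for i j
  using gauge_zero[OF F' F x that] by simp
qed

lemma mc_form_change:
 assumes "smooth_map_on \<A> N F" "ch : \<A>" "ch' : \<A>" "x : fst ch" "x : fst ch'" "x : N"
 shows "mc_form ch' F x v = mc_form ch F x (mdiff ch' (snd ch) x v)"
 unfolding mc_form_def using mdiff_change[OF assms, of v] by simp

end

text \<open>The source has curvature \<open>\<delta>\<close>, the target \<open>\<delta>'\<close>. The condition on \<open>\<mu>\<close> is the compatibility of the two
 Gauss equations when the second fundamental form is divided by \<open>\<mu>\<close>.\<close>

locale transformed_map = adapted_map \<A> J \<delta> T f + target: signs J \<delta>'
 for \<A> :: "('a::{t2_space, second_countable_topology}, 'm::finite) chart set"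
  and J :: "'n::finite => real" and \<delta> :: real and T :: "'n set" and f :: "'a => real ^ 'n option" and \<delta>' :: real +
 fixes \<mu> c :: real
 assumes \<mu>: "\<mu> ~= 0" "c - \<delta> = \<mu> * \<mu> * (c - \<delta>')"
  and frame_ex: "!!x. EX N F. x : N & frame N F"
  and gauss_eq: "!!N F ch x v w. frame N F ==> ch : \<A> ==> x : N ==> x : fst ch ==>
   gauss_eq J T (c - \<delta>) (mc_form ch F x v) (mc_form ch F x w)"
  and ricci_eq: "!!N F ch x v w. frame N F ==> ch : \<A> ==> x : N ==> x : fst ch ==>
   ricci_eq T (mc_form ch F x v) (mc_form ch F x w)"
begin

abbreviation L where "L \<equiv> unhat_matrix \<mu> \<delta>' J T"

definition solves :: "'a set => ('a => real ^ 'n option ^ 'n option) => ('a => real ^ 'n option ^ 'n option) => bool" where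
 "solves U F H \<longleftrightarrow> (ALL ch:\<A>. ALL x:U \<inter> fst ch.
   (rep ch H has_derivative (%v. H x ** L (mc_form ch F x v))) (at (snd ch x)))"

lemma solvesD: "solves U F H ==> ch : \<A> ==> x : U ==> x : fst ch ==>
  (rep ch H has_derivative (%v. H x ** L (mc_form ch F x v))) (at (snd ch x))"
 by (simp add: solves_def)

lemma solves_subset: "solves U F H ==> U' \<subseteq> U ==> solves U' F H"
 by (auto simp: solves_def)

lemma solves_cong:
 assumes "solves U F H" "open U" "!!x. x : U ==> H x = H' x"
 shows "solves U F H'"
 unfolding solves_def
proof (intro ballI)
 fix ch x assume ch: "ch : \<A>" and x: "x : U \<inter> fst ch"
 have "(rep ch H' has_derivative (%v. H x ** L (mc_form ch F x v))) (at (snd ch x))"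
  by (rule rep_has_derivative_cong[OF ch _ assms(2) _ assms(3) solvesD[OF assms(1) ch]]) (use x in auto)
 then show "(rep ch H' has_derivative (%v. H' x ** L (mc_form ch F x v))) (at (snd ch x))"
  using assms(3) x by simp
qed

text \<open>One chart around each point is enough, because \<open>H\<close> and the form of the frame both change by the
 chain rule.\<close>

lemma solvesI:
 assumes F: "frame U F" and "!!x. x : U ==> EX ch:\<A>. x : fst ch &
   (rep ch H has_derivative (%v. H x ** L (mc_form ch F x v))) (at (snd ch x))"
 shows "solves U F H"
 unfolding solves_def
proof (intro ballI)
 fix ch' x assume ch': "ch' : \<A>" and x: "x : U \<inter> fst ch'"
 obtain ch where ch: "ch : \<A>" "x : fst ch" "(rep ch H has_derivative (%v. H x ** L (mc_form ch F x v))) (at (snd ch x))"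
  using assms(2)[of x] x by blast
 have "(rep ch' H has_derivative (%v. H x ** L (mc_form ch F x (mdiff ch' (snd ch) x v)))) (at (snd ch' x))"
  by (rule rep_has_derivative_change[OF ch(1) ch' ch(2) _ ch(3)]) (use x in auto)
 then show "(rep ch' H has_derivative (%v. H x ** L (mc_form ch' F x v))) (at (snd ch' x))"
  using mc_form_change[OF frame_smooth[OF F] ch(1) ch' ch(2)] x by simp
qed

lemma solves_const_mult:
 assumes "solves U F H"
 shows "solves U F (%x. C ** H x)"
 unfolding solves_def
proof (intro ballI)
 fix ch x assume "ch : \<A>" "x : U \<inter> fst ch"
 then have "(rep ch H has_derivative (%v. H x ** L (mc_form ch F x v))) (at (snd ch x))"
  using assms by (simp add: solves_def)
 from bounded_linear.has_derivative[OF bounded_bilinear.bounded_linear_right[OF bounded_bilinear_matrix_mult, of C] this]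
 show "(rep ch (%x. C ** H x) has_derivative (%v. C ** H x ** L (mc_form ch F x v))) (at (snd ch x))"
  by (simp add: rep_def o_def matrix_mul_assoc)
qed

lemma solves_gauge:
 assumes F: "frame N F" and F': "frame N F'" and H: "solves N F H"
 shows "solves N F' (%x. H x ** (matrix_inv (F x) ** F' x))"
 unfolding solves_def
proof (intro ballI)
 fix ch x assume ch: "ch : \<A>" and "x : N \<inter> fst ch"
 then have x: "x : N" "x : fst ch" by auto
 note N = frame_open[OF F]
 define G where "G = (%x. matrix_inv (F x) ** F' x)"
 have sG: "smooth_map_on \<A> N G" unfolding G_def
  by (intro smooth_map_on_matrix_mult smooth_map_on_matrix_inv N frame_smooth[OF F] frame_smooth[OF F'] frame_inv[OF F])
 have gG: "gauge T (G y)" if "y : N" for y unfolding G_def by (rule frames_gauge[OF F F' that])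
 have F'G: "F' y = F y ** G y" if "y : N" for y
  unfolding G_def by (simp add: matrix_mul_assoc matrix_inv_right frame_inv[OF F that])
 let ?dG = "mdiff ch G x" and ?u = "snd ch x"
 have dG: "(rep ch G has_derivative ?dG) (at ?u)" by (rule mdiff_has_derivative[OF sG ch x(2,1)])
 have dF: "(rep ch F has_derivative mdiff ch F x) (at ?u)" by (rule mdiff_has_derivative[OF frame_smooth[OF F] ch x(2,1)])
 have "(rep ch (%y. F y ** G y) has_derivative (%v. F x ** ?dG v + mdiff ch F x v ** G x)) (at ?u)"
  using has_derivative_matrix_mult[OF dF dG] by (simp add: rep_def o_def rep_chart[unfolded rep_def o_def, OF ch x(2)])
 then have "(rep ch F' has_derivative (%v. F x ** ?dG v + mdiff ch F x v ** G x)) (at ?u)"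
  by (rule rep_has_derivative_cong[OF ch x(2) N x(1), rotated]) (simp add: F'G)
 then have dF': "mdiff ch F' x = (%v. F x ** ?dG v + mdiff ch F x v ** G x)" by (rule mdiff_eq)
 have eq: "G x ** mc_form ch F' x v = mc_form ch F x v ** G x + ?dG v" for v
 proof -
  have "G x ** mc_form ch F' x v = matrix_inv (F x) ** (F' x ** matrix_inv (F' x)) ** mdiff ch F' x v"
   by (simp add: G_def mc_form_def matrix_mul_assoc)
  also have "\<dots> = matrix_inv (F x) ** mdiff ch F' x v" by (simp add: matrix_inv_right frame_inv[OF F' x(1)])
  also have "\<dots> = (matrix_inv (F x) ** F x) ** ?dG v + matrix_inv (F x) ** mdiff ch F x v ** G x"
   by (simp add: dF' matrix_add_ldistrib matrix_mul_assoc)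
  finally show ?thesis by (simp add: matrix_inv_left frame_inv[OF F x(1)] mc_form_def add.commute)
 qed
 have const: "?dG v $ a $ b = 0" if "!!y. y : N ==> G y $ a $ b = k" for a b k v
 proof -
  have "(rep ch (%y. G y $ a $ b) has_derivative (%v. ?dG v $ a $ b)) (at ?u)"
   using bounded_linear.has_derivative[OF bounded_linear_compose[OF bounded_linear_vec_nth[of b] bounded_linear_vec_nth[of a]] dG]
   by (simp add: rep_def o_def)
  then have "(rep ch (%y. k) has_derivative (%v. ?dG v $ a $ b)) (at ?u)"
   by (rule rep_has_derivative_cong[OF ch x(2) N x(1), rotated]) (use that in simp)
  moreover have "(rep ch (%y. k) has_derivative (%v. 0)) (at ?u)" by (simp add: rep_def o_def)
  ultimately have "(%v. ?dG v $ a $ b) = (%v. 0)" by (rule has_derivative_unique)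
  then show ?thesis by metis
 qed
 have z1: "?dG v $ a $ b = 0" if "a = None | b = None" for a b v
 proof -
  have "G y $ a $ b = (if a = b then 1 else 0)" if "y : N" for y
   using gG[OF that] \<open>a = None | b = None\<close> unfolding gauge_def by (cases a; cases b) auto
  then show ?thesis by (rule const)
 qed
 have z2: "?dG v $ Some i $ Some j = 0" if "(i : T) ~= (j : T)" for i j v
  by (rule const[where k=0]) (use gG that in \<open>auto simp: gauge_def\<close>)
 have key: "G x ** L (mc_form ch F' x v) = L (mc_form ch F x v) ** G x + ?dG v" for v
  by (rule gauge_change[OF gG[OF x(1)] eq z1 z2 frame_normal[OF F ch x] frame_normal[OF F' ch x]])
 have "(rep ch (%y. H y ** G y) has_derivative (%v. H x ** ?dG v + H x ** L (mc_form ch F x v) ** G x)) (at ?u)"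
  using has_derivative_matrix_mult[OF solvesD[OF H ch x] dG]
  by (simp add: rep_def o_def rep_chart[unfolded rep_def o_def, OF ch x(2)])
 moreover have "H x ** ?dG v + H x ** L (mc_form ch F x v) ** G x = (H x ** G x) ** L (mc_form ch F' x v)" for v
  by (simp add: matrix_mul_assoc[symmetric] key matrix_add_ldistrib add.commute)
 ultimately show "(rep ch (%y. H y ** (matrix_inv (F y) ** F' y)) has_derivative
   (%v. (H x ** (matrix_inv (F x) ** F' x)) ** L (mc_form ch F' x v))) (at (snd ch x))"
  by (simp add: G_def)
qed

lemma bounded_linear_L: "bounded_linear L"
 by (rule bounded_linear_unhat)

lemma form_regular:
 assumes F: "frame N F" and ch: "ch : \<A>" "N \<subseteq> fst ch"
 shows "!!u. u : snd ch ` N ==> linear (%v. L (mc (rep ch F) u v))"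
  and "!!v. smooth_on (snd ch ` N) (%u. L (mc (rep ch F) u v))"
proof -
 interpret coordinate_frame J \<delta> T "snd ch ` N" "rep ch F" by (rule coordinate_frame[OF F ch])
 show "linear (%v. L (mc (rep ch F) u v))" if "u : snd ch ` N" for u
  using linear_compose[OF linear_mc[OF F_diff[OF that]] bounded_linear.linear[OF bounded_linear_L]] by (simp add: o_def)
 show "smooth_on (snd ch ` N) (%u. L (mc (rep ch F) u v))" for v
  by (rule smooth_on_bounded_linear[OF bounded_linear_L W mc_smooth])
qed

lemma form_flat:
 assumes F: "frame N F" and ch: "ch : \<A>" "N \<subseteq> fst ch" and u: "u : snd ch ` N"
 shows "ddir w (%u. L (mc (rep ch F) u v)) u - ddir v (%u. L (mc (rep ch F) u w)) u
  = L (mc (rep ch F) u v) ** L (mc (rep ch F) u w) - L (mc (rep ch F) u w) ** L (mc (rep ch F) u v)"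
proof -
 interpret coordinate_frame J \<delta> T "snd ch ` N" "rep ch F" by (rule coordinate_frame[OF F ch])
 obtain x where x: "u = snd ch x" "x : N" "x : fst ch" using u ch by auto
 let ?A = "mc (rep ch F) u v" and ?B = "mc (rep ch F) u w"
 define X where "X = ddir w (%u. mc (rep ch F) u v) u - ddir v (%u. mc (rep ch F) u w) u"
 have dm: "(%u. mc (rep ch F) u v) differentiable (at u)" for v by (rule smooth_on_differentiable[OF mc_smooth u])
 have X: "X = ?A ** ?B - ?B ** ?A" unfolding X_def by (rule mc_equation[OF W coordinate_frame_axioms[THEN coordinate_frame.F] F_inv u])
 have X0: "X $ Some i $ None = 0" if "i ~: T" for i
 proof -
  have "ddir w (%u. mc (rep ch F) u v) u $ Some i $ None = 0" for v w
  proof -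
   have "frechet_derivative (%u. mc (rep ch F) u v $ Some i $ None) (at u) = frechet_derivative (%u. 0) (at u)"
    by (rule frechet_derivative_cong_open[OF W u]) (simp add: normal that)
   then show ?thesis by (subst ddir_nth2[OF dm, symmetric]) simp
  qed
  then show ?thesis by (simp add: X_def)
 qed
 have "L X = L ?A ** L ?B - L ?B ** L ?A"
 proof (rule unhat_flat[OF algebra[OF u] normal[OF u] algebra[OF u] normal[OF u] X X0 _ _ \<mu>])
  show "gauss_eq J T (c - \<delta>) ?A ?B"
   using gauss_eq[OF \<open>frame N F\<close> ch(1) x(2,3)] by (simp add: x mc_form_eq[OF ch(1) x(3)])
  show "ricci_eq T ?A ?B"
   using ricci_eq[OF \<open>frame N F\<close> ch(1) x(2,3)] by (simp add: x mc_form_eq[OF ch(1) x(3)])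
 qed
 moreover have "ddir w (%u. L (mc (rep ch F) u v)) u = L (ddir w (%u. mc (rep ch F) u v) u)" for v w
  by (rule ddir_bounded_linear[OF bounded_linear_L dm])
 ultimately show ?thesis
  by (simp add: X_def linear_diff[OF bounded_linear.linear[OF bounded_linear_L]])
qed

lemma solves_coordinates:
 assumes "solves N F H" "ch : \<A>" "N \<subseteq> fst ch" "u : snd ch ` N"
 shows "(rep ch H has_derivative (%v. rep ch H u ** L (mc (rep ch F) u v))) (at u)"
proof -
 obtain x where x: "u = snd ch x" "x : N" "x : fst ch" using assms by auto
 show ?thesis using solvesD[OF assms(1,2) x(2,3)] by (simp add: x rep_chart[OF assms(2)] mc_form_eq[OF assms(2) x(3)])
qed

lemma solves_unique_chart:
 assumes F: "frame N F" and ch: "ch : \<A>" "N \<subseteq> fst ch" "connected (snd ch ` N)"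
  and H: "solves N F H" "solves N F H'" and xy: "x : N" "y : N" "H x = H' x"
 shows "H y = H' y"
proof -
 have eq: "rep ch H (snd ch x) = rep ch H' (snd ch x)"
  using xy ch(2) by (auto simp: rep_chart[OF ch(1)])
 have "rep ch H (snd ch y) = rep ch H' (snd ch y)"
  by (rule linear_pde_unique[OF bounded_bilinear_matrix_mult open_chart_image[OF ch(1) frame_open[OF F] ch(2)] ch(3),
     of "snd ch x" "%u v. L (mc (rep ch F) u v)"])
   (rule imageI[OF xy(1)] form_regular(1)[OF F ch(1,2)] smooth_on_continuous[OF form_regular(2)[OF F ch(1,2)]]
    solves_coordinates[OF H(1) ch(1,2)] solves_coordinates[OF H(2) ch(1,2)] eq imageI[OF xy(2)] | assumption)+
 then show ?thesis using xy ch by (auto simp: rep_chart[OF ch(1)])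
qed

lemma solution_chart:
 assumes F: "frame N F" and x: "x : N"
 obtains ch B H where "ch : \<A>" "B \<subseteq> fst ch" "open B" "x : B" "B \<subseteq> N" "connected (snd ch ` B)" "path_connected B"
  "solves B F H" "!!y. y : B ==> invertible (H y)"
proof -
 obtain ch r0 B0 where B0: "ch : \<A>" "x : fst ch" "r0 > 0" "open B0" "x : B0" "B0 \<subseteq> N" "B0 \<subseteq> fst ch"
  "snd ch ` B0 = ball (snd ch x) r0" "simply_connected B0"
  using chart_ball[OF frame_open[OF F] x] by blast
 have F0: "frame B0 F" by (rule frame_subset[OF F B0(4,6)])
 let ?\<Omega> = "%u v. L (mc (rep ch F) u v)" and ?D = "snd ch ` B0"
 have D: "open ?D" "snd ch x : ?D" using B0 by auto
 have flat: "y ** ddir w (%u. ?\<Omega> u v) u - y ** ddir v (%u. ?\<Omega> u w) u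
   = (y ** ?\<Omega> u v) ** ?\<Omega> u w - (y ** ?\<Omega> u w) ** ?\<Omega> u v" if "u : ?D" for u v w and y :: "real ^ 'n option ^ 'n option"
 proof -
  have "y ** (ddir w (%u. ?\<Omega> u v) u - ddir v (%u. ?\<Omega> u w) u) = y ** (?\<Omega> u v ** ?\<Omega> u w - ?\<Omega> u w ** ?\<Omega> u v)"
   by (simp only: form_flat[OF F0 B0(1,7) that])
  then show ?thesis
   by (simp add: bounded_bilinear.diff_right[OF bounded_bilinear_matrix_mult] matrix_mul_assoc)
 qed
 obtain r1 where r1: "r1 > 0" "ball (snd ch x) r1 \<subseteq> ?D"
  "!!C :: real ^ 'n option ^ 'n option. EX y. y (snd ch x) = C & (ALL u:ball (snd ch x) r1. (y has_derivative (%v. y u ** ?\<Omega> u v)) (at u))"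
  by (rule frobenius_local[OF bounded_bilinear_matrix_mult D form_regular[OF F0 B0(1,7)] flat]) (assumption | rule that)+
 obtain Y where Y: "Y (snd ch x) = mat 1" "ALL u:ball (snd ch x) r1. (Y has_derivative (%v. Y u ** ?\<Omega> u v)) (at u)"
  using r1(3) by blast
 have "isCont (%u. det (Y u)) (snd ch x)"
 proof -
  have "isCont Y (snd ch x)" using Y(2) r1(1) has_derivative_continuous by force
  then have Yc: "isCont (%u. Y u $ i $ j) (snd ch x)" for i j by (intro continuous_intros)
  show ?thesis unfolding det_def by (intro continuous_sum continuous_mult continuous_const continuous_prod Yc)
 qed
 moreover have "det (Y (snd ch x)) ~= 0" by (simp add: Y)
 ultimately obtain r2 where r2: "r2 > 0" "!!u. dist (snd ch x) u < r2 ==> det (Y u) ~= 0"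
  using continuous_at_avoid[of "snd ch x" "%u. det (Y u)" 0] by auto
 define r where "r = min r1 r2"
 define B where "B = B0 \<inter> (fst ch \<inter> snd ch -` ball (snd ch x) r)"
 have im: "snd ch ` B = ball (snd ch x) r"
 proof -
  have "ball (snd ch x) r \<subseteq> snd ch ` B0" using r1 by (auto simp: r_def)
  then show ?thesis unfolding B_def using B0(7) by (force simp: image_iff subset_iff)
 qed
 have B: "open B" unfolding B_def by (intro open_Int B0 open_chart_vimage[OF B0(1) open_ball])
 have xB: "x : B" using B0 r1 r2 by (auto simp: B_def r_def)
 have invB: "inv_into (fst ch) (snd ch) ` ball (snd ch x) r = B"
  unfolding im[symmetric] using chart_inv[OF B0(1)] by (force simp: B_def image_iff)
 have pc: "path_connected B"
 proof -
  have "continuous_on (ball (snd ch x) r) (inv_into (fst ch) (snd ch))"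
   by (rule continuous_on_subset[OF chart_inv_cont[OF B0(1)]]) (use im B0 in \<open>auto simp: B_def\<close>)
  from path_connected_continuous_image[OF this convex_imp_path_connected[OF convex_ball]]
  show ?thesis by (simp add: invB)
 qed
 let ?H = "%y. Y (snd ch y)"
 have "solves B F ?H"
 proof (rule solvesI[OF frame_subset[OF F0 B]])
  show "B \<subseteq> B0" by (auto simp: B_def)
  fix y assume y: "y : B"
  then have yc: "y : fst ch" "snd ch y : ball (snd ch x) r1" by (auto simp: B_def r_def)
  have "(Y has_derivative (%v. ?H y ** ?\<Omega> (snd ch y) v)) (at (snd ch y))" using Y(2) yc by blast
  then have "(rep ch ?H has_derivative (%v. ?H y ** ?\<Omega> (snd ch y) v)) (at (snd ch y))"
   by (rule has_derivative_transform_within_open[OF _ chart_image_open[OF B0(1)]])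
    (use yc in \<open>auto simp: rep_chart[OF B0(1)]\<close>)
  then have "(rep ch ?H has_derivative (%v. ?H y ** L (mc_form ch F y v))) (at (snd ch y))"
   by (simp add: mc_form_eq[OF B0(1) yc(1)])
  then show "EX ch:\<A>. y : fst ch & (rep ch ?H has_derivative (%v. ?H y ** L (mc_form ch F y v))) (at (snd ch y))"
   using B0(1) yc(1) by blast
 qed
 moreover have "invertible (?H y)" if "y : B" for y
  using r2(2)[of "snd ch y"] that by (auto simp: B_def r_def invertible_det_nz)
 moreover have "B \<subseteq> fst ch" "B \<subseteq> N" using B0 by (auto simp: B_def)
 moreover have "connected (snd ch ` B)" unfolding im by (rule connected_ball)
 ultimately show ?thesis using that[OF B0(1) _ B xB] pc by blast
qed

definition Sol :: "'a set => ('a => real ^ 'n option ^ 'n option) => bool" where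
 "Sol V Q \<longleftrightarrow> open V & (ALL N F. frame N F --> solves (N \<inter> V) F (%x. Q x ** F x))"

text \<open>A gauge transformation multiplies \<open>H\<close> and \<open>F\<close> by the same matrix on the right. Hence \<open>H F\<^sup>-\<^sup>1\<close>
 corresponds to a solution for every frame.\<close>

lemma SolI:
 assumes F: "frame B F" and H: "solves B F H"
 shows "Sol B (%x. H x ** matrix_inv (F x))"
 unfolding Sol_def
proof (intro conjI allI impI)
 show "open B" by (rule frame_open[OF F])
 fix N F' assume F': "frame N F'"
 let ?N = "N \<inter> B"
 have o: "open ?N" using frame_open F F' by blast
 have "solves ?N F' (%x. H x ** (matrix_inv (F x) ** F' x))"
  by (rule solves_gauge[OF frame_subset[OF F o] frame_subset[OF F' o] solves_subset[OF H]]) auto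
 then show "solves ?N F' (%x. H x ** matrix_inv (F x) ** F' x)" by (simp add: matrix_mul_assoc)
qed

sublocale local_system Sol
proof
 show "open V" if "Sol V Q" for V Q using that by (simp add: Sol_def)
 show "Sol V' Q" if "Sol V Q" "open V'" "V' \<subseteq> V" for V V' Q
  using that solves_subset unfolding Sol_def by (meson Int_mono subset_refl)
 show "Sol V Q'" if "Sol V Q" "!!x. x : V ==> Q x = Q' x" for V Q Q'
  unfolding Sol_def
 proof (intro conjI allI impI)
  show o: "open V" using that by (simp add: Sol_def)
  fix N F assume F: "frame N F"
  show "solves (N \<inter> V) F (%x. Q' x ** F x)"
   by (rule solves_cong[where H="%x. Q x ** F x"]) (use that F frame_open[OF F] o in \<open>auto simp: Sol_def\<close>)
 qed
 show "Sol V Q" if h: "!!x. x : V ==> EX N. x : N & N \<subseteq> V & Sol N Q" for V Q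
  unfolding Sol_def
 proof (intro conjI allI impI)
  show "open V" unfolding open_subopen[of V] using h by (meson Sol_def)
  fix N F assume F: "frame N F"
  show "solves (N \<inter> V) F (%x. Q x ** F x)"
   unfolding solves_def
  proof (intro ballI)
   fix ch x assume ch: "ch : \<A>" and x: "x : N \<inter> V \<inter> fst ch"
   obtain N' where "x : N'" "Sol N' Q" using h x by blast
   then have "solves (N \<inter> N') F (%x. Q x ** F x)" using F by (simp add: Sol_def)
   from solvesD[OF this ch] show "(rep ch (%x. Q x ** F x) has_derivative (%v. Q x ** F x ** L (mc_form ch F x v))) (at (snd ch x))"
    using x \<open>x : N'\<close> by simp
  qed
 qed
 fix W :: "'a set" and x assume W: "open W" "x : W"
 obtain N F where NF: "x : N" "frame N F" using frame_ex by blast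
 have F: "frame (N \<inter> W) F" using frame_subset[OF NF(2)] frame_open[OF NF(2)] W by blast
 obtain ch B H where B: "ch : \<A>" "B \<subseteq> fst ch" "open B" "x : B" "B \<subseteq> N \<inter> W" "connected (snd ch ` B)" "path_connected B"
  "solves B F H" "!!y. y : B ==> invertible (H y)"
  by (rule solution_chart[OF F]) (use NF W in auto)
 have FB: "frame B F" by (rule frame_subset[OF F B(3,5)])
 have ex: "EX Q. Sol B Q & Q y = w" if y: "y : B" for y w
 proof -
  let ?C = "w ** F y ** matrix_inv (H y)"
  have "Sol B (%z. ?C ** H z ** matrix_inv (F z))" by (rule SolI[OF FB solves_const_mult[OF B(8)]])
  moreover have "?C ** H y ** matrix_inv (F y) = w ** F y ** (matrix_inv (H y) ** H y) ** matrix_inv (F y)"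
   by (simp add: matrix_mul_assoc)
  then have "?C ** H y ** matrix_inv (F y) = w"
   by (simp add: matrix_inv_left[OF B(9)[OF y]] matrix_mul_assoc[symmetric] matrix_inv_right[OF frame_inv[OF FB y]])
  ultimately show ?thesis by blast
 qed
 have un: "Q z = Q' z" if "Sol B Q" "Sol B Q'" "y : B" "z : B" "Q y = Q' y" for Q Q' y z
 proof -
  have s: "solves B F (%x. Q x ** F x)" "solves B F (%x. Q' x ** F x)"
   using that(1,2) FB unfolding Sol_def by (metis Int_absorb)+
  have "Q z ** F z = Q' z ** F z"
   by (rule solves_unique_chart[OF FB B(1,2,6) s that(3,4)]) (simp add: that(5))
  then have "Q z ** F z ** matrix_inv (F z) = Q' z ** F z ** matrix_inv (F z)" by simp
  then show ?thesis by (simp add: matrix_mul_assoc[symmetric] matrix_inv_right[OF frame_inv[OF FB that(4)]])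
 qed
 show "EX B. open B & x : B & B \<subseteq> W & path_connected B & (ALL y:B. ALL w. EX Q. Sol B Q & Q y = w) &
   (ALL Q Q' y z. Sol B Q & Sol B Q' & y : B & z : B & Q y = Q' y --> Q z = Q' z)"
 proof (rule exI[of _ B], intro conjI)
  show "ALL y:B. ALL w. EX Q. Sol B Q & Q y = w" using ex by blast
  show "ALL Q Q' y z. Sol B Q & Sol B Q' & y : B & z : B & Q y = Q' y --> Q z = Q' z" using un by blast
 qed (use B in auto)
qed

lemma Sol_const_mult: "Sol V Q ==> Sol V (%x. C ** Q x)"
 unfolding Sol_def using solves_const_mult[of _ _ _ C] by (simp add: matrix_mul_assoc[symmetric])

text \<open>Being in the group is preserved along solutions in charts and does not depend on the frame, since
 gauge transformations belong to both groups.\<close>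

lemma Sol_group:
 assumes Q: "Sol V Q" "connected V" and F: "frame N F" "p : N" "p : V" "isom_group \<delta>' J (Q p ** F p)"
  and F': "frame N' F'" "x : N'" "x : V"
 shows "isom_group \<delta>' J (Q x ** F' x)"
proof -
 define P where "P x \<longleftrightarrow> (ALL N F. frame N F --> x : N --> isom_group \<delta>' J (Q x ** F x))" for x
 have PI: "P x" if h: "frame N F" "x : N" "isom_group \<delta>' J (Q x ** F x)" for x N F
  unfolding P_def
 proof (intro allI impI)
  fix N' F' assume F': "frame N' F'" "x : N'"
  let ?N = "N \<inter> N'"
  have o: "open ?N" using frame_open h F' by blast
  have "gauge T (matrix_inv (F x) ** F' x)"
   by (rule frames_gauge[OF frame_subset[OF h(1) o] frame_subset[OF F'(1) o]]) (use h F' in auto)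
  then have "isom_group \<delta>' J (Q x ** F x ** (matrix_inv (F x) ** F' x))"
   using target.group_mult[OF h(3)] gauge_isom_group by blast
  moreover have "Q x ** F x ** (matrix_inv (F x) ** F' x) = Q x ** (F x ** matrix_inv (F x)) ** F' x"
   by (simp add: matrix_mul_assoc)
  ultimately show "isom_group \<delta>' J (Q x ** F' x)"
   by (simp add: matrix_inv_right[OF frame_inv[OF h(1,2)]])
 qed
 have "P x"
 proof (rule connected_induction_simple[OF Q(2) F(3) F'(3), where P=P])
  show "P p" by (rule PI[OF F(1,2,4)])
  fix a assume a: "a : V"
  obtain N F where NF: "a : N" "frame N F" using frame_ex by blast
  have oV: "open V" using Q(1) by (simp add: Sol_def)
  have F: "frame (N \<inter> V) F" using frame_subset[OF NF(2)] frame_open[OF NF(2)] oV by blast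
  obtain ch B H where B: "ch : \<A>" "B \<subseteq> fst ch" "open B" "a : B" "B \<subseteq> N \<inter> V" "connected (snd ch ` B)"
   by (rule solution_chart[OF F, of a]) (use NF a in auto)
  have FB: "frame B F" by (rule frame_subset[OF F B(3,5)])
  interpret cf: coordinate_frame J \<delta> T "snd ch ` B" "rep ch F" by (rule coordinate_frame[OF FB B(1,2)])
  have "Sol B Q" by (rule restrict[OF Q(1) B(3)]) (use B in auto)
  then have s: "solves B F (%x. Q x ** F x)" using FB unfolding Sol_def by (metis Int_absorb)
  let ?H = "rep ch (%x. Q x ** F x)"
  have PB: "P z" if yz: "y : B" "z : B" "P y" for y z
  proof (rule PI[OF FB yz(2)])
   have "isom_group \<delta>' J (?H (snd ch z))"
   proof (rule target.group_preserved[of "snd ch ` B" "snd ch y" "snd ch z" "%u v. L (mc (rep ch F) u v)"])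
    show "isom_group \<delta>' J (?H (snd ch y))"
     using yz FB B(2) unfolding P_def by (auto simp: rep_chart[OF B(1)])
    show "(?H has_derivative (%v. ?H u ** L (mc (rep ch F) u v))) (at u)" if "u : snd ch ` B" for u
     by (rule solves_coordinates[OF s B(1,2) that])
    show "isom_algebra \<delta>' J (L (mc (rep ch F) u v))" if "u : snd ch ` B" for u v
     using target.unhat_algebra[OF cf.algebra[OF that]] .
    show "continuous_on (snd ch ` B) (%u. L (mc (rep ch F) u v))" for v
     by (rule smooth_on_continuous[OF form_regular(2)[OF FB B(1,2)]])
    show "linear (%v. L (mc (rep ch F) u v))" if "u : snd ch ` B" for u
     by (rule form_regular(1)[OF FB B(1,2) that])
   qed (rule cf.W B(6) imageI[OF yz(1)] imageI[OF yz(2)])+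
   then show "isom_group \<delta>' J (Q z ** F z)" using yz B(2) by (auto simp: rep_chart[OF B(1)])
  qed
  show "EX T. openin (top_of_set V) T & a : T & (ALL x:T. ALL y:T. P x --> P y)"
  proof (rule exI[of _ B], intro conjI ballI impI)
   show "openin (top_of_set V) B" using B(3,5) by (simp add: openin_open_eq[OF oV])
   show "a : B" by (rule B(4))
  qed (rule PB)
 qed
 then show ?thesis using F' by (simp add: P_def)
qed

end

section \<open>Existence of adapted frames near a point\<close>

lemma bounded_bilinear_pform: "bounded_bilinear (pform K)"
 using bilinear_pform bilinear_conv_bounded_bilinear by blast

lemma gram_schmidt_step:
 fixes K :: "'i::finite => real" and e :: "'i => 'v::euclidean_space => real ^ 'i"
 assumes W: "open W" "u0 : W" and K: "!!i. K i * K i = 1"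
  and e: "!!b. b : B ==> smooth_on W (e b)"
   "!!a b u. u : W ==> a : B ==> b : B ==> pform K (e a u) (e b u) = (if a = b then K a else 0)"
  and v: "smooth_on W v" "!!b. b : B ==> pform K (v u0) (e b u0) = 0" "pform K (v u0) (v u0) = K c"
 obtains W' w where "open W'" "u0 : W'" "W' \<subseteq> W" "smooth_on W' w"
  "!!u. u : W' ==> pform K (w u) (w u) = K c"
  "!!u b. u : W' ==> b : B ==> pform K (w u) (e b u) = 0" "w u0 = v u0"
  "ALL u S. u : W' & subspace S & v u : S & (ALL b:B. e b u : S) --> w u : S"
proof -
 note bb = bounded_bilinear_pform[of K]
 define w0 where "w0 u = v u - (SUM b:B. (K b * pform K (v u) (e b u)) *\<^sub>R e b u)" for u
 define n where "n u = K c * pform K (w0 u) (w0 u)" for u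
 have s0: "smooth_on W w0"
  unfolding w0_def
  by (intro smooth_on_diff smooth_on_sum smooth_on_scaleR smooth_on_mult smooth_on_bilinear[OF bb] smooth_on_const W v(1) e(1))
 have sn: "smooth_on W n" unfolding n_def by (intro smooth_on_mult smooth_on_const smooth_on_bilinear[OF bb] W s0)
 have o0: "pform K (w0 u) (e b u) = 0" if u: "u : W" and b: "b : B" for u b
 proof -
  have "(SUM a:B. K a * pform K (v u) (e a u) * pform K (e a u) (e b u))
    = (SUM a:B. if a = b then pform K (v u) (e b u) else 0)"
   by (rule sum.cong[OF refl]) (use e(2)[OF u _ b] K[of b] in \<open>auto simp: mult_ac\<close>)
  then show ?thesis
   using b by (simp add: w0_def bounded_bilinear.diff_left[OF bb] pform_sum)
 qed
 have w00: "w0 u0 = v u0" by (simp add: w0_def v(2))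
 have n0: "n u0 = 1" by (simp add: n_def w00 v(3) K)
 define W' where "W' = W \<inter> n -` {0<..}"
 have W': "open W'" "W' \<subseteq> W" "u0 : W'"
  unfolding W'_def using continuous_open_preimage[OF smooth_on_continuous[OF sn] W(1) open_greaterThan] W n0 by auto
 have n: "n u > 0" if "u : W'" for u using that by (simp add: W'_def)
 define w where "w u = inverse (sqrt (n u)) *\<^sub>R w0 u" for u
 have sw: "smooth_on W' w"
  unfolding w_def
  by (intro smooth_on_scaleR smooth_on_inverse smooth_on_sqrt W'(1) smooth_on_subset[OF sn W'(2)] smooth_on_subset[OF s0 W'(2)])
   (use n in force)+
 have ww: "pform K (w u) (w u) = K c" if "u : W'" for u
 proof -
  have "pform K (w u) (w u) = pform K (w0 u) (w0 u) / n u"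
   using n[OF that] by (simp add: w_def bounded_bilinear.scaleR_left[OF bb] bounded_bilinear.scaleR_right[OF bb] divide_inverse
     mult.assoc[symmetric] inverse_mult_distrib[symmetric])
  also have "pform K (w0 u) (w0 u) = K c * n u" unfolding n_def by (simp add: mult.assoc[symmetric] K)
  finally show ?thesis using n[OF that] by simp
 qed
 have we: "pform K (w u) (e b u) = 0" if "u : W'" "b : B" for u b
  using o0[of u b] that W'(2) by (auto simp: w_def bounded_bilinear.scaleR_left[OF bb])
 have sub: "ALL u S. u : W' & subspace S & v u : S & (ALL b:B. e b u : S) --> w u : S"
  unfolding w_def w0_def by (intro allI impI subspace_scale subspace_diff subspace_sum) auto
 show ?thesis by (rule that[OF W'(1,3,2) sw ww we _ sub]) (auto simp: w_def n0 w00)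
qed

text \<open>Fields that are orthonormal at one point become orthonormal nearby after a smooth change which
 respects every subspace that contains all of them; those with index in \<open>B\<close>, already
 orthonormal, are kept.\<close>

definition orthonormalized :: "('i::finite => real) => 'i set => 'i set => 'v::euclidean_space => 'v set =>
  ('i => 'v => real ^ 'i) => 'v set => ('i => 'v => real ^ 'i) => bool" where
 "orthonormalized K B C u0 W e W' e' \<longleftrightarrow> open W' & u0 : W' & W' \<subseteq> W & (ALL a:B. e' a = e a) & (ALL a:B \<union> C. smooth_on W' (e' a) & e' a u0 = e a u0) &
  (ALL u:W'. ALL a:B \<union> C. ALL b:B \<union> C. pform K (e' a u) (e' b u) = (if a = b then K a else 0)) &
  (ALL u:W'. ALL S. subspace S & (ALL a:B \<union> C. e a u : S) --> (ALL a:B \<union> C. e' a u : S))"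

lemma gram_schmidt:
 fixes K :: "'i::finite => real" and e :: "'i => 'v::euclidean_space => real ^ 'i"
 assumes W: "open W" "u0 : W" and K: "!!i. K i * K i = 1" and disj: "B \<inter> C = {}"
  and e: "!!b. b : B \<union> C ==> smooth_on W (e b)"
   "!!a b u. u : W ==> a : B ==> b : B ==> pform K (e a u) (e b u) = (if a = b then K a else 0)"
   "!!a b. a : B \<union> C ==> b : B \<union> C ==> pform K (e a u0) (e b u0) = (if a = b then K a else 0)"
 shows "EX W' e'. orthonormalized K B C u0 W e W' e'"
proof -
 have "finite C" by simp
 then show ?thesis using disj e
 proof (induction C rule: finite_induct)
  case empty
  show ?case unfolding orthonormalized_def by (rule exI[of _ W], rule exI[of _ e]) (use W empty in auto)
 next
  case (insert c C)
  have d: "B \<inter> C = {}" "c ~: B \<union> C" using insert by auto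
  have ex: "EX W' e'. orthonormalized K B C u0 W e W' e'"
   by (rule insert.IH[OF d(1)]) (use insert.prems in auto)
  from ex[unfolded orthonormalized_def] obtain W1 e1 where 1: "open W1" "u0 : W1" "W1 \<subseteq> W" "ALL a:B. e1 a = e a"
   "ALL a:B \<union> C. smooth_on W1 (e1 a) & e1 a u0 = e a u0"
   "ALL u:W1. ALL a:B \<union> C. ALL b:B \<union> C. pform K (e1 a u) (e1 b u) = (if a = b then K a else 0)"
   "ALL u:W1. ALL S. subspace S & (ALL a:B \<union> C. e a u : S) --> (ALL a:B \<union> C. e1 a u : S)"
   by (elim exE conjE)
  have sc: "smooth_on W1 (e c)" by (rule smooth_on_subset[OF insert.prems(2) 1(3)]) simp
  have s1: "smooth_on W1 (e1 b)" if "b : B \<union> C" for b using 1(5) that by blast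
  have o1: "pform K (e1 a u) (e1 b u) = (if a = b then K a else 0)" if "u : W1" "a : B \<union> C" "b : B \<union> C" for a b u
   using 1(6) that by blast
  have cb: "pform K (e c u0) (e1 b u0) = 0" if "b : B \<union> C" for b
  proof -
   have "e1 b u0 = e b u0" using 1(5) that by blast
   then show ?thesis using insert.prems(4)[of c b] that d(2) by auto
  qed
  have cc: "pform K (e c u0) (e c u0) = K c" using insert.prems(4)[of c c] by simp
  obtain W2 w where 2: "open W2" "u0 : W2" "W2 \<subseteq> W1" "smooth_on W2 w"
   "!!u. u : W2 ==> pform K (w u) (w u) = K c"
   "!!u b. u : W2 ==> b : B \<union> C ==> pform K (w u) (e1 b u) = 0" "w u0 = e c u0"
   "ALL u S. u : W2 & subspace S & e c u : S & (ALL b:B \<union> C. e1 b u : S) --> w u : S"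
   by (rule gram_schmidt_step[OF 1(1,2) K s1 o1 sc cb cc]) (assumption | rule that)+
  let ?e = "e1(c := w)"
  show ?case unfolding orthonormalized_def
  proof (rule exI[of _ W2], rule exI[of _ ?e], intro conjI ballI allI impI)
   show "?e a = e a" if "a : B" for a using that 1(4) d(2) by auto
   show "smooth_on W2 (?e a)" if "a : B \<union> insert c C" for a
    using that 2(4) smooth_on_subset[OF s1 2(3)] by (cases "a = c") auto
   show "?e a u0 = e a u0" if "a : B \<union> insert c C" for a
    using that 2(7) 1(5) by (cases "a = c") auto
   show "pform K (?e a u) (?e b u) = (if a = b then K a else 0)"
    if "u : W2" "a : B \<union> insert c C" "b : B \<union> insert c C" for u a b
   proof -
    have u1: "u : W1" using that(1) 2(3) by blast
    show ?thesis
    proof (cases "a = c"; cases "b = c")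
     assume "a = c" "b = c" then show ?thesis using 2(5)[OF that(1)] by simp
    next
     assume "a = c" "b ~= c" then show ?thesis using 2(6)[OF that(1), of b] that(3) by auto
    next
     assume "a ~= c" "b = c" then show ?thesis using 2(6)[OF that(1), of a] that(2) by (auto simp: pform_sym[of K _ "w u"])
    next
     assume "a ~= c" "b ~= c" then show ?thesis using o1[OF u1, of a b] that by auto
    qed
   qed
   show "?e a u : S" if h: "u : W2" "subspace S & (ALL a:B \<union> insert c C. e a u : S)" "a : B \<union> insert c C" for u S a
   proof -
    have u1: "u : W1" using h(1) 2(3) by blast
    have e1S: "e1 b u : S" if "b : B \<union> C" for b using 1(7) u1 h(2) that by blast
    have "w u : S" by (rule 2(8)[rule_format]) (use h e1S in auto)
    then show ?thesis using e1S[of a] h(3) by auto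
   qed
  qed (use 1 2 in auto)
 qed
qed


lemma orthonormal_span:
 fixes K :: "'i::finite => real" and e :: "'i => real ^ 'i"
 assumes K: "!!i. K i * K i = 1"
  and e: "!!a b. a : A ==> b : A ==> pform K (e a) (e b) = (if a = b then K a else 0)"
  and R: "dim R <= card A" "e ` A \<subseteq> R" "d : R"
 shows "d = (SUM a:A. (K a * pform K (e a) d) *\<^sub>R e a)"
proof -
 have K0: "K i ~= 0" for i using K[of i] by auto
 have inj: "inj_on e A" by (rule inj_onI) (metis e K0)
 have "independent (e ` A)"
 proof (rule independent_if_scalars_zero)
  show "finite (e ` A)" by simp
  fix h x assume 0: "(SUM x:e ` A. h x *\<^sub>R x) = 0" and "x : e ` A"
  then obtain a where a: "a : A" "x = e a" by blast
  have "(SUM b:A. h (e b) *\<^sub>R e b) = 0" using 0 by (simp add: sum.reindex[OF inj])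
  then have "pform K (SUM b:A. h (e b) *\<^sub>R e b) (e a) = 0" by (simp add: pform_def)
  then have "(SUM b:A. if b = a then h (e a) * K a else 0) = 0"
   unfolding pform_sum by (rule trans[OF sum.cong[OF refl], rotated]) (use e a in auto)
  then show "h x = 0" using a K0[of a] by simp
 qed
 then have "R \<subseteq> span (e ` A)"
  by (rule card_ge_dim_independent[OF R(2)]) (simp add: card_image[OF inj] R(1))
 then have "d : span (e ` A)" using R(3) by blast
 then show ?thesis
 proof (induction rule: span_induct)
  have l: "linear (%d. SUM a:A. (K a * pform K (e a) d) *\<^sub>R e a)"
   by (rule linearI) (simp_all add: bilinear_simps[OF bilinear_pform[of K]] algebra_simps sum.distrib scaleR_sum_right)
  show "subspace {d. d = (SUM a:A. (K a * pform K (e a) d) *\<^sub>R e a)}"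
   unfolding subspace_def mem_Collect_eq using linear_0[OF l] linear_add[OF l] linear_cmul[OF l] by simp
  fix x assume "x : e ` A"
  then obtain b where b: "b : A" "x = e b" by blast
  have "(SUM a:A. (K a * pform K (e a) x) *\<^sub>R e a) = (SUM a:A. if a = b then e b else 0)"
   by (rule sum.cong[OF refl]) (use e b K in auto)
  then show "x = (SUM a:A. (K a * pform K (e a) x) *\<^sub>R e a)" using b by simp
 qed
qed

locale immersed_map = adapted_map \<A> J \<delta> T f
 for \<A> :: "('a::{t2_space, second_countable_topology}, 'm::finite) chart set"
  and J :: "'n::finite => real" and \<delta> :: real and T :: "'n set" and f :: "'a => real ^ 'n option" +
 fixes r :: nat
 assumes on_quadric: "\<delta> ~= 0 ==> pform (ext \<delta> J) (f x) (f x) = \<delta>"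
  and on_plane: "\<delta> = 0 ==> f x $ None = 1"
  and card_neg: "card {i : T. J i = -1} = r"
  and signature: "!!ch x. ch : \<A> ==> x : fst ch ==>
   has_signature (%v w. pform (ext \<delta> J) (mdiff ch f x v) (mdiff ch f x w)) r"
begin

lemma J_cases: "J i = 1 | J i = -1"
proof -
 have "(J i)\<^sup>2 = 1" using J by (simp add: power2_eq_square)
 then show ?thesis by (simp add: power2_eq_1_iff)
qed

text \<open>Orthonormalise \<open>m\<close> derivatives of the map that are orthonormal at the centre, then the position (or
 the last basis vector, if \<open>\<delta> = 0\<close>) and constant vectors that complete the basis at the centre. The
 position is orthogonal to the tangent vectors throughout, so it is kept. For \<open>\<delta> = 0\<close> the degenerate
 form is replaced by one with last entry \<open>1\<close> while orthonormalising.\<close>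

lemma local_frame: "EX N F. x : N & frame N F"
proof -
 obtain ch where ch: "ch : \<A>" "x : fst ch" by (rule chart_cover)
 define g where "g = rep ch f"
 define D where "D = snd ch ` fst ch"
 define u0 where "u0 = snd ch x"
 have D: "open D" "u0 : D" using chart_image_open[OF ch(1)] ch(2) by (auto simp: D_def u0_def)
 have sg: "smooth_on D g" unfolding g_def D_def
  by (rule smooth_map_onD[OF smooth_map_on_subset[OF f_smooth] ch(1)]) auto
 have dg: "g differentiable (at u)" if "u : D" for u by (rule smooth_on_differentiable[OF sg that])
 have gf: "g u = f (inv_into (fst ch) (snd ch) u)" for u by (simp add: g_def rep_apply)
 \<comment> \<open>Tangent vectors have last entry zero if \<open>\<delta> = 0\<close>, so the two forms agree on them.\<close>
 define \<sigma> where "\<sigma> = (if \<delta> = 0 then 1 else \<delta>)"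
 define K where "K = ext \<sigma> J"
 have K: "K a * K a = 1" for a using J \<delta> by (auto simp: K_def ext_def \<sigma>_def split: option.splits)
 have K_cases: "K a = 1 | K a = -1" for a
  using J_cases \<delta> by (auto simp: K_def ext_def \<sigma>_def split: option.splits)
 have KN: "K None = \<sigma>" and KS: "K (Some i) = J i" for i by (simp_all add: K_def ext_def)
 note bb = bounded_bilinear_pform[of K]
 have None0: "ddir v g u $ None = 0" if "\<delta> = 0" "u : D" for u v
 proof -
  have "ddir v (%u. g u $ None) u = 0" using on_plane[OF that(1)] by (simp add: gf)
  then show ?thesis using ddir_bounded_linear[OF bounded_linear_vec_nth dg[OF that(2)], of None v] by simp
 qed
 have met: "pform K (ddir v g u) (ddir w g u) = pform (ext \<delta> J) (ddir v g u) (ddir w g u)" if "u : D" for u v w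
  using None0[OF _ that, of v] by (simp add: pform_def sum_option K_def ext_def \<sigma>_def)
 define B where "B v w = pform (ext \<delta> J) (mdiff ch f x v) (mdiff ch f x w)" for v w
 have "linear (mdiff ch f x)"
  by (rule has_derivative_linear[OF mdiff_has_derivative[OF f_smooth ch UNIV_I]])
 then have "bilinear B"
  unfolding B_def bilinear_def
  by (auto intro!: linearI simp: linear_add linear_cmul bilinear_simps[OF bilinear_pform[of "ext \<delta> J"]])
 moreover have "B v w = B w v" for v w unfolding B_def by (rule pform_sym)
 moreover have "has_signature B r" using signature[OF ch] by (simp add: B_def[abs_def])
 ultimately obtain X where X: "!!i j. i : T ==> j : T ==> B (X i) (X j) = (if i = j then J i else 0)"
  using orthonormal_tangent_frame[OF _ _ _ card_T card_neg J_cases] by blast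
 define e0 where "e0 a u = (case a of None => 0 | Some i => ddir (X i) g u)" for a u
 have s0: "smooth_on D (e0 (Some i))" for i by (simp add: e0_def[abs_def] smooth_on_ddir[OF sg])
 have o0: "pform K (e0 (Some i) u0) (e0 (Some j) u0) = (if i = j then J i else 0)" if "i : T" "j : T" for i j
  using X[OF that] by (cases "i = j") (simp_all add: e0_def met[OF D(2)], simp_all add: B_def mdiff_def g_def u0_def)
 have ex0: "EX W' e'. orthonormalized K {} (Some ` T) u0 D e0 W' e'"
  by (rule gram_schmidt[OF D K]) (use s0 o0 KS in \<open>auto split: if_splits\<close>)
 obtain W1 e1 where W1: "open W1" "u0 : W1" "W1 \<subseteq> D"
  and e1: "ALL a:Some ` T. smooth_on W1 (e1 a) & e1 a u0 = e0 a u0"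
   "ALL u:W1. ALL a:Some ` T. ALL b:Some ` T. pform K (e1 a u) (e1 b u) = (if a = b then K a else 0)"
   "ALL u:W1. ALL S. subspace S & (ALL a:Some ` T. e0 a u : S) --> (ALL a:Some ` T. e1 a u : S)"
  using ex0[unfolded orthonormalized_def Un_empty_left] by (elim exE conjE)
 have range_e1: "e1 (Some i) u : range (%v. ddir v g u)" if "u : W1" "i : T" for u i
 proof -
  have "subspace (range (%v. ddir v g u))"
   using linear_subspace_image[OF linear_ddir[OF dg] subspace_UNIV] W1 that by blast
  moreover have "ALL a:Some ` T. e0 a u : range (%v. ddir v g u)" by (auto simp: e0_def)
  ultimately show ?thesis using e1(3)[rule_format, OF that(1) _ imageI[OF that(2)]] by blast
 qed
 define q where "q u = (if \<delta> = 0 then axis None 1 else g u)" for u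
 have sq: "smooth_on D q" unfolding q_def[abs_def] using sg by (cases "\<delta> = 0") auto
 have qq: "pform K (q u) (q u) = K None" for u
 proof (cases "\<delta> = 0")
  case True then show ?thesis by (simp add: q_def pform_axis KN \<sigma>_def)
 next
  case False then show ?thesis using on_quadric[OF False] by (simp add: q_def K_def \<sigma>_def gf ext_def)
 qed
 have gq: "pform K (ddir v g u) (q u) = 0" if u: "u : D" for u v
 proof (cases "\<delta> = 0")
  case True then show ?thesis using None0[OF True u] by (simp add: q_def pform_axis)
 next
  case False
  have c: "(%u. pform K (g u) (g u)) = (%u. \<delta>)" using on_quadric[OF False] False by (simp add: K_def \<sigma>_def gf)
  have "((%u. pform K (g u) (g u)) has_derivative (%v. pform K (g u) (ddir v g u) + pform K (ddir v g u) (g u))) (at u)"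
   using bounded_bilinear.FDERIV[OF bb has_derivative_ddir[OF dg[OF u]] has_derivative_ddir[OF dg[OF u]]] .
  then have "(%v. pform K (g u) (ddir v g u) + pform K (ddir v g u) (g u)) = (%v. 0)"
   unfolding c by (rule has_derivative_unique) simp
  then show ?thesis using fun_cong[of _ _ v] False by (fastforce simp: q_def pform_sym[of K "g u"])
 qed
 let ?B = "insert None (Some ` T)"
 define e2 where "e2 a = (case a of None => q | Some i => e1 (Some i))" for a
 have o2: "pform K (e2 a u) (e2 b u) = (if a = b then K a else 0)" if u: "u : W1" and ab: "a : ?B" "b : ?B" for a b u
 proof -
  have z: "pform K (e1 (Some i) u) (q u) = 0" if i: "i : T" for i
  proof -
   obtain v where "e1 (Some i) u = ddir v g u" using range_e1[OF u i] by blast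
   then show ?thesis using gq u W1(3) by auto
  qed
  have o: "pform K (e1 (Some i) u) (e1 (Some j) u) = (if i = j then K (Some i) else 0)" if "i : T" "j : T" for i j
   using e1(2)[rule_format, OF u imageI[OF that(1)] imageI[OF that(2)]] by (cases "i = j") simp_all
  show ?thesis
   using ab by (auto simp: e2_def pform_sym[of K "q u"] o z qq split: if_splits)
 qed
 obtain e' where e': "!!a. a : ?B ==> e' a = e2 a u0" "!!a b. pform K (e' a) (e' b) = (if a = b then K a else 0)"
  using orthonormal_extension[of K ?B "%a. e2 a u0", OF K_cases o2[OF W1(2)]] by blast
 define e3 where "e3 a = (if a : ?B then e2 a else (%u. e' a))" for a
 have s3: "smooth_on W1 (e3 a)" for a
  using e1(1) smooth_on_subset[OF sq W1(3)] by (auto simp: e3_def e2_def)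
 have o3: "pform K (e3 a u) (e3 b u) = (if a = b then K a else 0)" if "u : W1" "a : ?B" "b : ?B" for a b u
  using o2[OF that] that by (simp add: e3_def)
 have "e3 a u0 = e' a" for a using e'(1)[of a] by (simp add: e3_def)
 then have o30: "pform K (e3 a u0) (e3 b u0) = (if a = b then K a else 0)" for a b using e'(2) by simp
 have ex3: "EX W' e'. orthonormalized K ?B (- ?B) u0 W1 e3 W' e'"
  by (rule gram_schmidt[OF W1(1,2) K Compl_disjoint s3 o3 o30]) assumption+
 obtain W e where W: "open W" "u0 : W" "W \<subseteq> W1" and ee: "ALL a:?B. e a = e3 a"
  "ALL a:UNIV. smooth_on W (e a) & e a u0 = e3 a u0"
  "ALL u:W. ALL a:UNIV. ALL b:UNIV. pform K (e a u) (e b u) = (if a = b then K a else 0)"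
  using ex3[unfolded orthonormalized_def Compl_partition] by (elim exE conjE)
 have e: "smooth_on W (e a)" "u : W ==> pform K (e a u) (e b u) = (if a = b then K a else 0)" for a b u
  using ee(2,3) by blast+
 have WD: "W \<subseteq> D" using W W1 by blast
 have eN: "e None = q" and eT: "i : T ==> e (Some i) = e1 (Some i)" for i using ee(1) by (auto simp: e3_def e2_def)
 define E where "E u = (\<chi> i j. e j u $ i)" for u
 have colE: "column j (E u) = e j u" for j u by (simp add: E_def column_def vec_eq_iff)
 have oE: "orthonormal_frame K (E u)" if "u : W" for u
  using e(2)[OF that] by (simp add: orthonormal_frame_def colE)
 define F where "F u = (\<chi> i j. if j = None then g u $ i else e j u $ i)" for u
 have group: "isom_group \<delta> J (F u)" if u: "u : W" for u
 proof (cases "\<delta> = 0")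
  case False
  then have "F u = E u" by (auto simp: F_def E_def vec_eq_iff eN q_def)
  moreover have "K = ext \<delta> J" using False by (simp add: K_def \<sigma>_def)
  ultimately show ?thesis using oE[OF u] False orthonormal_frame_rows[OF K, where E="E u"] by (simp add: isom_group_def)
 next
  case True
  have N: "E u $ a $ None = (if a = None then 1 else 0)" for a by (simp add: E_def eN q_def True axis_def)
  have rows: "(E u ** diag_mat K ** transpose (E u)) $ a $ b = (if a = b then K a else 0)" for a b
   using oE[OF u] orthonormal_frame_rows[OF K, where E="E u"] by (simp add: diag_mat_def)
  have "pform K (e (Some j) u) (axis None 1) = 0" for j using e(2)[OF u, of "Some j" None] by (simp add: eN q_def True)
  then have N': "E u $ None $ Some j = 0" for j by (simp add: E_def pform_axis KN \<sigma>_def True)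
  have FS: "F u $ a $ Some j = E u $ a $ Some j" for a j by (simp add: F_def E_def)
  have FN: "F u $ None $ None = 1" using on_plane[OF True] by (simp add: F_def gf)
  have rows': "(SUM k:UNIV. E u $ a $ Some k * J k * E u $ b $ Some k) = (if a = b & a ~= None then K a else 0)" for a b
   using rows[of a b] unfolding matrix_mult_nth[of _ "transpose (E u)"] diag_mat_mult
   by (cases a; cases b) (simp_all add: transpose_nth sum_option N KN KS \<sigma>_def True split: if_splits)
  show ?thesis
   unfolding isom_group_def
  proof (intro conjI impI allI matrix_eqI)
   fix a b
   show "F u $ None $ b = (if b = None then 1 else 0)" by (cases b) (simp_all add: FN FS N')
   show "(F u ** diag_mat (ext \<delta> J) ** transpose (F u)) $ a $ b = diag_mat (ext \<delta> J) $ a $ b"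
    unfolding matrix_mult_nth[of _ "transpose (F u)"] diag_mat_mult
    by (simp add: transpose_nth sum_option FS ext_def True rows' diag_mat_def) (auto simp: K_def ext_def split: option.splits)
  qed
 qed
 have sF: "smooth_on W F"
  unfolding F_def[abs_def]
 proof (intro smooth_on_vec_lambda W(1))
  fix i j show "smooth_on W (%u. if j = None then g u $ i else e j u $ i)"
   using smooth_on_vec_nth[OF W(1) smooth_on_subset[OF sg WD]] smooth_on_vec_nth[OF W(1) e(1)] by (cases "j = None") auto
 qed
 define N where "N = fst ch \<inter> snd ch -` W"
 have N: "open N" "N \<subseteq> fst ch" "x : N"
  using open_chart_vimage[OF ch(1) W(1)] ch(2) W(2) by (auto simp: N_def u0_def)
 let ?F = "%x. F (snd ch x)"
 have imN: "snd ch ` N = W" using WD by (auto simp: N_def D_def)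
 have "smooth_on (snd ch ` N) (rep ch ?F)"
  unfolding imN
 proof (rule smooth_on_cong[OF W(1) _ sF])
  fix u assume "u : W"
  then obtain y where "y : fst ch" "u = snd ch y" using WD by (auto simp: D_def)
  then show "F u = rep ch ?F u" by (simp add: rep_chart[OF ch(1)])
 qed
 then have smF: "smooth_map_on \<A> N ?F" by (rule smooth_map_on_chartI[OF ch(1) N(1,2)])
 have colF: "?F y $ a $ None = f y $ a" if "y : N" for y a
  using that N(2) by (auto simp: F_def g_def rep_chart[OF ch(1)])
 have "frame N ?F"
  unfolding frame_def
 proof (intro conjI N(1) smF ballI allI)
  fix y assume y: "y : N"
  then have yW: "snd ch y : W" by (simp add: N_def)
  show "isom_group \<delta> J (?F y)" by (rule group[OF yW])
  show "?F y $ a $ None = f y $ a" for a by (rule colF[OF y])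
 next
  fix ch' y v b assume ch': "ch' : \<A>" and y': "y : N \<inter> fst ch'" and b: "b : - T"
  then have y: "y : N" "y : fst ch'" "y : fst ch" using N(2) by auto
  define u where "u = snd ch y"
  have uW: "u : W" using y by (simp add: N_def u_def)
  have inv: "invertible (F u)" by (rule group_invertible[OF group[OF uW]])
  have "mdiff ch' f y v = mdiff ch f y (mdiff ch' (snd ch) y v)"
   by (rule mdiff_change[OF f_smooth ch(1) ch' y(3,2) UNIV_I])
  then have d: "mdiff ch' f y v : range (%v. ddir v g u)" by (auto simp: mdiff_def g_def u_def)
  define d where "d = mdiff ch' f y v"
  have "d = (SUM a:Some ` T. (K a * pform K (e1 a u) d) *\<^sub>R e1 a u)"
  proof (rule orthonormal_span[OF K _ _ _ d[folded d_def]])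
   show "pform K (e1 a u) (e1 b u) = (if a = b then K a else 0)" if "a : Some ` T" "b : Some ` T" for a b
    using e1(2) that uW W(3) by blast
   have "dim (range (%v. ddir v g u)) <= dim (UNIV :: (real ^ 'm) set)"
    by (rule dim_image_le[OF linear_ddir[OF dg]]) (use uW WD in auto)
   also have "\<dots> = CARD('m)" by simp
   finally show "dim (range (%v. ddir v g u)) <= card (Some ` T)" by (simp add: card_image card_T)
   show "(%a. e1 a u) ` Some ` T \<subseteq> range (%v. ddir v g u)" using range_e1 uW W(3) by blast
  qed
  also have "\<dots> = (SUM i:T. (J i * pform K (e1 (Some i) u) d) *\<^sub>R e1 (Some i) u)"
   by (simp add: sum.reindex KS)
  finally have ds: "d = (SUM i:T. (J i * pform K (e1 (Some i) u) d) *\<^sub>R e1 (Some i) u)" .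
  define z :: "real ^ 'n option" where
   "z = (\<chi> a. case a of None => 0 | Some i => if i : T then J i * pform K (e1 (Some i) u) d else 0)"
  have "F u *v z = d"
  proof -
   have "(F u *v z) $ a = d $ a" for a
   proof -
    have "(F u *v z) $ a = (SUM i:UNIV. if i : T then e1 (Some i) u $ a * (J i * pform K (e1 (Some i) u) d) else 0)"
     unfolding matrix_vector_mult_def by (simp add: sum_option z_def F_def) (rule sum.cong[OF refl], simp add: eT)
    also have "\<dots> = (SUM i:T. e1 (Some i) u $ a * (J i * pform K (e1 (Some i) u) d))"
     by (simp add: sum.If_cases)
    also have "\<dots> = d $ a" by (subst (2) ds) (simp add: sum_component mult_ac)
    finally show ?thesis .
   qed
   then show ?thesis by (simp add: vec_eq_iff)
  qed
  moreover have "d = F u *v column None (mc_form ch' ?F y v)"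
   using mdiff_eq[OF mdiff_column[OF smF N(1) ch' y(1,2) colF]] inv by (simp add: u_def d_def)
  ultimately have "matrix_inv (F u) *v (F u *v z) = matrix_inv (F u) *v (F u *v column None (mc_form ch' ?F y v))" by simp
  then have "z = column None (mc_form ch' ?F y v)"
   by (simp only: matrix_vector_mul_assoc matrix_inv_left[OF inv] matrix_vector_mul_lid)
  from arg_cong[OF this, of "%z. z $ Some b"] show "mc_form ch' ?F y v $ Some b $ None = 0"
   using b by (simp add: z_def column_def)
 qed
 then show ?thesis using N(3) by blast
qed

end

section \<open>Simply connected neighbourhoods with adapted frames\<close>

text \<open>The map is a perturbation of the identity with Lipschitz constant at most \<open>1/2\<close>; Banach's fixed
 point theorem inverts it.\<close>

lemma shear_bijective:
 fixes \<beta> :: "'v::euclidean_space => real" and w :: 'v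
 assumes L: "!!x y. \<bar>\<beta> x - \<beta> y\<bar> <= L * norm (x - y)" "L * norm w <= 1 / 2"
 obtains \<psi>' where "!!u v. u + \<beta> u *\<^sub>R w = v \<longleftrightarrow> u = \<psi>' v" "continuous_on UNIV \<psi>'"
proof -
 let ?\<psi> = "%u. u + \<beta> u *\<^sub>R w"
 have lip: "norm (\<beta> x *\<^sub>R w - \<beta> y *\<^sub>R w) <= 1/2 * norm (x - y)" for x y
 proof -
  have "norm (\<beta> x *\<^sub>R w - \<beta> y *\<^sub>R w) = \<bar>\<beta> x - \<beta> y\<bar> * norm w" by (simp flip: scaleR_left_diff_distrib)
  also have "\<dots> <= L * norm (x - y) * norm w" by (rule mult_right_mono[OF L(1)]) simp
  also have "\<dots> = (L * norm w) * norm (x - y)" by simp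
  also have "\<dots> <= 1/2 * norm (x - y)" by (rule mult_right_mono[OF L(2)]) simp
  finally show ?thesis .
 qed
 have "EX! u. v - \<beta> u *\<^sub>R w = u" for v
 proof (rule banach_fix_type[of "1/2"])
  show "ALL x y. dist (v - \<beta> x *\<^sub>R w) (v - \<beta> y *\<^sub>R w) <= 1/2 * dist x y"
  proof (intro allI)
   fix x y
   have "dist (v - \<beta> x *\<^sub>R w) (v - \<beta> y *\<^sub>R w) = norm (\<beta> y *\<^sub>R w - \<beta> x *\<^sub>R w)" by (simp add: dist_norm)
   also have "\<dots> <= 1/2 * norm (y - x)" by (rule lip)
   finally show "dist (v - \<beta> x *\<^sub>R w) (v - \<beta> y *\<^sub>R w) <= 1/2 * dist x y" by (simp add: dist_norm norm_minus_commute)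
  qed
 qed auto
 then have "EX! u. ?\<psi> u = v" for v by (simp add: algebra_simps diff_eq_eq eq_commute)
 then have "EX u. ALL u'. ?\<psi> u' = v \<longleftrightarrow> u' = u" for v by metis
 then obtain \<psi>' where \<psi>': "!!u v. ?\<psi> u = v \<longleftrightarrow> u = \<psi>' v" by metis
 have "dist (\<psi>' v) (\<psi>' v') <= 2 * dist v v'" for v v'
 proof -
  have e: "?\<psi> (\<psi>' v) = v" "?\<psi> (\<psi>' v') = v'" using \<psi>' by blast+
  have "\<psi>' v - \<psi>' v' = (v - v') - (\<beta> (\<psi>' v) *\<^sub>R w - \<beta> (\<psi>' v') *\<^sub>R w)"
  proof -
   have "a - a' = (b - b') - (d - d')" if "a + d = b" "a' + d' = b'" for a a' b b' d d' :: 'v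
    using that by (auto simp: algebra_simps)
   then show ?thesis using e by blast
  qed
  then have "norm (\<psi>' v - \<psi>' v') <= norm (v - v') + 1/2 * norm (\<psi>' v - \<psi>' v')"
   using norm_triangle_ineq4[of "v - v'" "\<beta> (\<psi>' v) *\<^sub>R w - \<beta> (\<psi>' v') *\<^sub>R w"] lip[of "\<psi>' v" "\<psi>' v'"] by simp
  then show ?thesis by (simp add: dist_norm)
 qed
 then have "continuous_on UNIV \<psi>'"
  by (intro lipschitz_on_continuous_on[where L=2] lipschitz_onI) auto
 then show ?thesis using that \<psi>' by blast
qed

text \<open>A shear of the coordinates, cut off by a bump function. It serves to drag simply connected sets
 with frames towards \<open>x\<close>; the coordinate expression \<open>\<psi>\<close> keeps pulled back frames smooth.\<close>

lemma (in smooth_manifold) move_point: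
 assumes V: "ch : \<A>" "open V" "x : V" "V \<subseteq> fst ch" "snd ch ` V = ball (snd ch x) \<rho>" "\<rho> > 0"
 obtains N where "open N" "x : N" "N \<subseteq> V" "!!q. q : N ==> \<exists>\<phi> \<phi>' \<psi> C. homeomorphism UNIV UNIV \<phi> \<phi>' & \<phi> x = q &
   closed C & C \<subseteq> V & (ALL y. y ~: C --> \<phi> y = y) & \<phi> ` V \<subseteq> V &
   smooth_on UNIV \<psi> & (ALL y:V. snd ch (\<phi> y) = \<psi> (snd ch y))"
proof -
 let ?h = "snd ch" and ?k = "inv_into (fst ch) (snd ch)"
 define a where "a = ?h x"
 have imV: "?h ` V = ball a \<rho>" using V by (simp add: a_def)
 have kh: "?k (?h y) = y" if "y : V" for y using chart_inv[OF V(1)] that V(4) by blast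
 have k: "?k u : V" "?h (?k u) = u" if u: "u : ball a \<rho>" for u
 proof -
  from u have "u : ?h ` V" by (simp only: imV)
  then obtain y where "y : V" "u = ?h y" by blast
  then show "?k u : V" "?h (?k u) = u" using kh by auto
 qed
 have hV: "?h y : ball a \<rho>" if "y : V" for y using that imV by blast
 obtain \<beta> :: "real ^ 'm => real" and L where \<beta>: "smooth_on UNIV \<beta>" "\<beta> a = 1" "!!x. \<rho> / 2 <= dist a x ==> \<beta> x = 0"
  "L > 0" "!!x y. \<bar>\<beta> x - \<beta> y\<bar> <= L * norm (x - y)"
  by (rule smooth_bump[of "\<rho> / 2" a]) (use V(6) in auto)
 define C where "C = ?k ` cball a (\<rho> / 2)"
 have sub: "cball a (\<rho> / 2) \<subseteq> ball a \<rho>" using V(6) by (auto simp: subset_iff)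
 have ck: "continuous_on (ball a \<rho>) ?k"
  by (rule continuous_on_subset[OF chart_inv_cont[OF V(1)]]) (use imV V(4) in blast)
 have ch: "continuous_on V ?h" by (rule continuous_on_subset[OF chart_cont[OF V(1)] V(4)])
 have CV: "C \<subseteq> V" using k sub by (auto simp: C_def)
 have closed_image: "closed (?k ` S)" if "compact S" "S \<subseteq> ball a \<rho>" for S
  by (rule compact_imp_closed, rule compact_continuous_image[OF continuous_on_subset[OF ck that(2)] that(1)])
 have cC: "closed C" unfolding C_def by (rule closed_image[OF compact_cball sub])
 \<comment> \<open>The second bound makes the shear invertible and keeps it in the ball.\<close>
 define \<epsilon> where "\<epsilon> = min (\<rho> / 2) (1 / (2 * L))"
 have \<epsilon>: "\<epsilon> > 0" using V(6) \<beta>(4) by (simp add: \<epsilon>_def)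
 define N where "N = V \<inter> (fst ch \<inter> ?h -` ball a \<epsilon>)"
 have "open N" unfolding N_def by (intro open_Int V(2) open_chart_vimage[OF V(1)] open_ball)
 moreover have "x : N" using V(3,4) \<epsilon> by (auto simp: N_def a_def)
 moreover have "N \<subseteq> V" by (simp add: N_def)
 moreover have "\<exists>\<phi> \<phi>' \<psi> C. homeomorphism UNIV UNIV \<phi> \<phi>' & \<phi> x = q & closed C & C \<subseteq> V & (ALL y. y ~: C --> \<phi> y = y) & \<phi> ` V \<subseteq> V &
   smooth_on UNIV \<psi> & (ALL y:V. ?h (\<phi> y) = \<psi> (?h y))" if q: "q : N" for q
 proof -
  define w where "w = ?h q - a"
  have nw: "norm w < \<epsilon>" using q by (simp add: N_def w_def dist_norm norm_minus_commute)
  have Lw: "L * norm w <= 1 / 2"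
  proof -
   have "L * norm w <= L * (1 / (2 * L))" using nw \<beta>(4) by (intro mult_left_mono) (simp_all add: \<epsilon>_def)
   then show ?thesis using \<beta>(4) by simp
  qed
  define \<psi> where "\<psi> u = u + \<beta> u *\<^sub>R w" for u
  obtain \<psi>' where \<psi>'0: "!!u v. u + \<beta> u *\<^sub>R w = v \<longleftrightarrow> u = \<psi>' v" and \<psi>'c: "continuous_on UNIV \<psi>'"
   by (rule shear_bijective[OF \<beta>(5) Lw]) (rule that)
  have \<psi>': "\<psi> u = v \<longleftrightarrow> u = \<psi>' v" "continuous_on UNIV \<psi>'" for u v
   unfolding \<psi>_def by (rule \<psi>'0, rule \<psi>'c)
  have s\<psi>: "smooth_on UNIV \<psi>" unfolding \<psi>_def[abs_def]
   by (intro smooth_on_add smooth_on_scaleR smooth_on_const smooth_on_ident \<beta>(1) open_UNIV)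
  have c\<psi>: "continuous_on S \<psi>" "continuous_on S \<psi>'" for S
   by (rule continuous_on_subset[OF smooth_on_continuous[OF s\<psi>]], simp) (rule continuous_on_subset[OF \<psi>'(2)], simp)
  have id: "\<psi> u = u" if "u ~: ball a (\<rho> / 2)" for u using \<beta>(3)[of u] that by (simp add: \<psi>_def)
  have ball: "\<psi> u : ball a \<rho> \<longleftrightarrow> u : ball a \<rho>" for u
  proof (cases "u : ball a (\<rho> / 2)")
   case False then show ?thesis by (simp add: id)
  next
   case True
   obtain z where z: "dist a z = \<rho> / 2" by (rule vector_choose_dist[of "\<rho> / 2" a]) (use V(6) in simp)
   have "norm (u - z) <= dist a u + dist a z"
    using dist_triangle[of u z a] by (simp add: dist_norm norm_minus_commute)
   then have uz: "norm (u - z) <= \<rho>" using True z by simp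
   have "\<bar>\<beta> u\<bar> <= L * \<rho>"
   proof -
    have "\<beta> z = 0" using \<beta>(3)[of z] z by simp
    then have "\<bar>\<beta> u\<bar> <= L * norm (u - z)" using \<beta>(5)[of u z] by simp
    also have "\<dots> <= L * \<rho>" using mult_left_mono[OF uz, of L] \<beta>(4) by simp
    finally show ?thesis .
   qed
   then have "norm (\<beta> u *\<^sub>R w) <= L * \<rho> * norm w" by (simp add: mult_right_mono)
   also have "\<dots> = (L * norm w) * \<rho>" by simp
   also have "\<dots> <= 1/2 * \<rho>" by (rule mult_right_mono[OF Lw]) (use V(6) in simp)
   finally have "norm (\<beta> u *\<^sub>R w) <= \<rho> / 2" by simp
   moreover have "norm (\<psi> u - a) <= norm (u - a) + norm (\<beta> u *\<^sub>R w)"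
    using norm_triangle_ineq[of "u - a" "\<beta> u *\<^sub>R w"] by (simp add: \<psi>_def algebra_simps)
   ultimately have "\<psi> u : ball a \<rho>" using True by (simp add: dist_norm norm_minus_commute)
   moreover have "u : ball a \<rho>" using True V(6) by simp
   ultimately show ?thesis by simp
  qed
  have ball': "\<psi>' v : ball a \<rho> \<longleftrightarrow> v : ball a \<rho>" for v using ball[of "\<psi>' v"] \<psi>'(1)[of "\<psi>' v" v] by simp
  define ext where "ext \<alpha> y = (if y : V then ?k (\<alpha> (?h y)) else y)" for \<alpha> and y :: 'a
  have ext_cont: "continuous_on UNIV (ext \<alpha>)"
   if \<alpha>: "continuous_on (ball a \<rho>) \<alpha>" "!!u. u : ball a \<rho> ==> \<alpha> u : ball a \<rho>"
    and D: "closed D" "!!y. y : V ==> y ~: D ==> \<alpha> (?h y) = ?h y" "D \<subseteq> V" for \<alpha> D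
  proof -
   have "continuous_on V (ext \<alpha>)"
   proof (rule continuous_on_eq)
    show "continuous_on V (%y. ?k (\<alpha> (?h y)))"
     by (rule continuous_on_compose2[OF ck continuous_on_compose2[OF \<alpha>(1) ch]]) (use hV \<alpha>(2) in auto)
   qed (simp add: ext_def)
   moreover have "continuous_on (-D) (ext \<alpha>)"
    by (rule continuous_on_eq[OF continuous_on_id]) (use D kh in \<open>auto simp: ext_def\<close>)
   ultimately have "continuous_on (V \<union> -D) (ext \<alpha>)"
    using V(2) D(1) by (intro continuous_on_open_Un) auto
   moreover have "V \<union> -D = UNIV" using D(3) by blast
   ultimately show ?thesis by simp
  qed
  have extV: "ext \<alpha> y : V" "?h (ext \<alpha> y) = \<alpha> (?h y)" if "y : V" "\<alpha> (?h y) : ball a \<rho>" for \<alpha> y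
   using k[OF that(2)] that(1) by (simp_all add: ext_def)
  have inC: "?h y : cball a (\<rho> / 2) ==> y : V ==> y : C" for y
   unfolding C_def using kh by (metis imageI)
  have out: "\<psi> (?h y) = ?h y" if "y : V" "y ~: C" for y
   using inC[OF _ that(1)] that(2) by (intro id) auto
  have inv: "\<psi> (\<psi>' v) = v" "\<psi>' (\<psi> u) = u" for u v
   using \<psi>'(1)[of "\<psi>' v" v] \<psi>'(1)[of u "\<psi> u"] by simp_all
  have c1: "continuous_on UNIV (ext \<psi>)"
   by (rule ext_cont[OF c\<psi>(1) _ cC out CV]) (use ball in auto)
  define C' where "C' = ?k ` (\<psi> ` cball a (\<rho> / 2))"
  have sub': "\<psi> ` cball a (\<rho> / 2) \<subseteq> ball a \<rho>" using ball sub by blast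
  have cC': "closed C'" unfolding C'_def
   by (rule closed_image[OF compact_continuous_image[OF c\<psi>(1) compact_cball] sub'])
  have CV': "C' \<subseteq> V" using k sub' by (auto simp: C'_def)
  have out': "\<psi>' (?h y) = ?h y" if "y : V" "y ~: C'" for y
  proof -
   have "\<psi>' (?h y) ~: cball a (\<rho> / 2)"
   proof
    assume "\<psi>' (?h y) : cball a (\<rho> / 2)"
    then have "?k (\<psi> (\<psi>' (?h y))) : C'" unfolding C'_def by (intro imageI)
    then show False using that kh by (simp add: inv)
   qed
   then have "\<psi> (\<psi>' (?h y)) = \<psi>' (?h y)" by (intro id) auto
   then show ?thesis by (simp add: inv)
  qed
  have c2: "continuous_on UNIV (ext \<psi>')"
   by (rule ext_cont[OF c\<psi>(2) _ cC' out' CV']) (use ball' in auto)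
  have i1: "ext \<psi>' (ext \<psi> y) = y" for y
  proof (cases "y : V")
   case True
   note e = extV[where \<alpha>=\<psi>, OF True ball[THEN iffD2, OF hV[OF True]]]
   have "ext \<psi>' (ext \<psi> y) = ?k (\<psi>' (?h (ext \<psi> y)))" using e(1) by (simp add: ext_def)
   then show ?thesis by (simp add: e(2) inv kh[OF True])
  qed (simp add: ext_def)
  have i2: "ext \<psi> (ext \<psi>' y) = y" for y
  proof (cases "y : V")
   case True
   note e = extV[where \<alpha>=\<psi>', OF True ball'[THEN iffD2, OF hV[OF True]]]
   have "ext \<psi> (ext \<psi>' y) = ?k (\<psi> (?h (ext \<psi>' y)))" using e(1) by (simp add: ext_def)
   then show ?thesis by (simp add: e(2) inv kh[OF True])
  qed (simp add: ext_def)
  have "homeomorphism UNIV UNIV (ext \<psi>) (ext \<psi>')"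
   by (rule homeomorphismI[OF c1 c2]) (use i1 i2 in auto)
  moreover have "ext \<psi> x = q"
  proof -
   have "\<psi> a = ?h q" by (simp add: \<psi>_def \<beta>(2) w_def)
   then show ?thesis using V(3) q kh by (simp add: ext_def a_def[symmetric] N_def)
  qed
  moreover have "ext \<psi> y = y" if "y ~: C" for y using out[of y] that kh by (auto simp: ext_def)
  moreover have "ext \<psi> ` V \<subseteq> V" "ALL y:V. ?h (ext \<psi> y) = \<psi> (?h y)"
   using extV ball hV by auto
  ultimately show ?thesis using cC CV s\<psi> by blast
 qed
 ultimately show ?thesis using that by blast
qed

context adapted_map
begin

lemma frame_cong:
 assumes F: "frame N F" and eq: "!!x. x : N ==> F x = F' x"
 shows "frame N F'"
 unfolding frame_def
proof (intro conjI ballI allI frame_open[OF F])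
 note o = frame_open[OF F]
 show "smooth_map_on \<A> N F'" by (rule smooth_map_on_cong[OF o eq frame_smooth[OF F]])
 show "isom_group \<delta> J (F' x)" "F' x $ a $ None = f x $ a" if "x : N" for x a
  using frame_group[OF F that] frame_col[OF F that] eq[OF that] by auto
 fix ch x v b assume h: "ch : \<A>" "x : N \<inter> fst ch" "b : - T"
 have "mdiff ch F x = mdiff ch F' x" by (rule mdiff_cong[OF h(1) _ o _ eq]) (use h in auto)
 then have "mc_form ch F' x v = mc_form ch F x v" using eq[of x] h by (simp add: mc_form_def)
 then show "mc_form ch F' x v $ Some b $ None = 0" using frame_normal[OF F h(1)] h by auto
qed

lemma frame_local:
 assumes "!!x. x : U ==> EX N. x : N & N \<subseteq> U & frame N F"
 shows "frame U F"
 unfolding frame_def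
proof (intro conjI ballI allI)
 show "open U" unfolding open_subopen[of U] using assms frame_open by blast
 show "smooth_map_on \<A> U F" 
 proof (rule smooth_map_on_local)
  fix x assume "x : U"
  then obtain N where "x : N" "frame N F" using assms by blast
  then show "EX N. open N & x : N & smooth_map_on \<A> N F" using frame_open frame_smooth by blast
 qed
 show "isom_group \<delta> J (F x)" if "x : U" for x using assms[OF that] frame_group by blast
 show "F x $ a $ None = f x $ a" if "x : U" for x a using assms[OF that] frame_col by blast
 show "mc_form ch F x v $ Some b $ None = 0" if h: "ch : \<A>" "x : U \<inter> fst ch" "b : - T" for ch x v b
 proof -
  obtain N where "x : N" "N \<subseteq> U" "frame N F" using assms[of x] h(2) by blast
  then show ?thesis using frame_normal[of N F ch x b v] h by auto
 qed
qed

lemma frame_gauge: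
 assumes F: "frame N F" and G: "smooth_map_on \<A> N G" "!!x. x : N ==> gauge T (G x)"
 shows "frame N (%x. F x ** G x)"
 unfolding frame_def
proof (intro conjI ballI allI frame_open[OF F])
 note o = frame_open[OF F]
 show sm: "smooth_map_on \<A> N (%x. F x ** G x)" by (rule smooth_map_on_matrix_mult[OF o frame_smooth[OF F] G(1)])
 show g: "isom_group \<delta> J (F x ** G x)" if "x : N" for x
  using group_mult[OF frame_group[OF F that]] G(2)[OF that] by (simp add: gauge_def)
 show c: "(F x ** G x) $ a $ None = f x $ a" if "x : N" for x a
  using G(2)[OF that] frame_col[OF F that, of a] by (simp add: gauge_def matrix_mult_nth sum_option)
 fix ch x v b assume ch: "ch : \<A>" and "x : N \<inter> fst ch" and b: "b : - T"
 then have x: "x : N" "x : fst ch" by auto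
 let ?F = "%x. F x ** G x"
 define z where "z = column None (mc_form ch F x v)"
 define z' where "z' = column None (mc_form ch ?F x v)"
 note iF = frame_inv[OF F x(1)] and iFG = group_invertible[OF g[OF x(1)]]
 have gG: "isom_group \<delta> J (G x)" using G(2)[OF x(1)] by (simp add: gauge_def)
 note iG = group_invertible[OF gG]
 have "mdiff ch f x v = (F x ** G x) *v z'"
  using mdiff_eq[OF mdiff_column[OF sm o ch x c iFG]] by (simp add: z'_def)
 then have "F x *v (G x *v z') = F x *v z"
  using mdiff_frame[OF F ch x, of v] by (simp add: z_def matrix_vector_mul_assoc)
 then have "matrix_inv (F x) *v (F x *v (G x *v z')) = matrix_inv (F x) *v (F x *v z)" by simp
 then have "G x *v z' = z" by (simp only: matrix_vector_mul_assoc matrix_inv_left[OF iF] matrix_vector_mul_lid matrix_mul_lid matrix_mul_assoc)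
 then have "matrix_inv (G x) *v (G x *v z') = matrix_inv (G x) *v z" by simp
 then have z': "z' = matrix_inv (G x) *v z" by (simp only: matrix_vector_mul_assoc matrix_inv_left[OF iG] matrix_vector_mul_lid)
 have zN: "z $ None = 0" using frame_algebra[OF F ch x, of v] by (simp add: z_def column_def isom_algebra_def)
 have "matrix_inv (G x) $ Some b $ Some j * z $ Some j = 0" for j
 proof (cases "j : T")
  case False then show ?thesis using frame_normal[OF F ch x False, of v] by (simp add: z_def column_def)
 next
  case True
  then have "G x $ Some j $ Some b = 0" using G(2)[OF x(1)] b by (auto simp: gauge_def)
  then have "matrix_inv (G x) $ Some b $ Some j * J j = 0"
   using group_inv_nth[OF gG, of "Some b" "Some j"] by (simp add: ext_def)
  then show ?thesis using J_nz by simp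
 qed
 then have "(SUM j:UNIV. matrix_inv (G x) $ Some b $ Some j * z $ Some j) = 0" by (intro sum.neutral ballI)
 then have "z' $ Some b = 0" unfolding z' by (simp add: matrix_vector_mult_def sum_option zN)
 then show "mc_form ch ?F x v $ Some b $ None = 0" by (simp add: z'_def column_def)
qed

end

context immersed_map
begin

definition framed :: "'a => 'a => bool" where
 "framed p q \<longleftrightarrow> (EX U F. open U & simply_connected U & p : U & q : U & frame U F)"

lemma frame_ball:
 obtains ch \<rho> V F where "ch : \<A>" "open V" "x : V" "V \<subseteq> fst ch" "snd ch ` V = ball (snd ch x) \<rho>" "\<rho> > 0"
  "simply_connected V" "frame V F"
proof -
 obtain N F where NF: "x : N" "frame N F" using local_frame by blast
 obtain ch \<rho> V where V: "ch : \<A>" "x : fst ch" "\<rho> > 0" "open V" "x : V" "V \<subseteq> N" "V \<subseteq> fst ch"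
  "snd ch ` V = ball (snd ch x) \<rho>" "simply_connected V"
  by (rule chart_ball[OF frame_open[OF NF(2)] NF(1)])
 show ?thesis by (rule that[OF V(1,4,5,7,8,3,9) frame_subset[OF NF(2) V(4,6)]])
qed

text \<open>If \<open>q\<close> near \<open>x\<close> is reached by a simply connected set \<open>U\<close> with a frame, a homeomorphism \<open>\<phi>\<close> supported
 in a coordinate ball around \<open>x\<close> moves \<open>x\<close> to \<open>q\<close>, and the preimage of \<open>U\<close> reaches \<open>x\<close>. On the ball,
 the frame of the ball is corrected by the gauge transformation pulled back with \<open>\<phi>\<close>; outside the
 support of \<open>\<phi>\<close> this is the old frame.\<close>

lemma framed_closed:
 assumes "!!N. open N ==> x : N ==> EX q:N. framed p q"
 shows "framed p x"
proof -
 obtain ch \<rho> V FV where V: "ch : \<A>" "open V" "x : V" "V \<subseteq> fst ch" "snd ch ` V = ball (snd ch x) \<rho>" "\<rho> > 0"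
  "simply_connected V" and FV: "frame V FV"
  by (rule frame_ball)
 show ?thesis
 proof (cases "p : V")
  case True then show ?thesis using V FV by (auto simp: framed_def)
 next
  case pV: False
  obtain N where N: "open N" "x : N" "N \<subseteq> V" "!!q. q : N ==> \<exists>\<phi> \<phi>' \<psi> C. homeomorphism UNIV UNIV \<phi> \<phi>' & \<phi> x = q &
    closed C & C \<subseteq> V & (ALL y. y ~: C --> \<phi> y = y) & \<phi> ` V \<subseteq> V &
    smooth_on UNIV \<psi> & (ALL y:V. snd ch (\<phi> y) = \<psi> (snd ch y))"
   by (rule move_point[OF V(1-6)]) (rule that)
  obtain q where q: "q : N" "framed p q" using assms[OF N(1,2)] by blast
  obtain \<phi> \<phi>' \<psi> C where \<phi>: "homeomorphism UNIV UNIV \<phi> \<phi>'" "\<phi> x = q" "closed C" "C \<subseteq> V" "ALL y. y ~: C --> \<phi> y = y" "\<phi> ` V \<subseteq> V"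
   "smooth_on UNIV \<psi>" "ALL y:V. snd ch (\<phi> y) = \<psi> (snd ch y)"
   using N(4)[OF q(1)] by (elim exE conjE)
  obtain U F where U: "open U" "simply_connected U" "p : U" "q : U" "frame U F"
   using q(2) unfolding framed_def by (elim exE conjE)
  define U' where "U' = \<phi> -` U"
  have c: "continuous_on UNIV \<phi>" "continuous_on UNIV \<phi>'" and inv: "\<phi> (\<phi>' y) = y" "\<phi>' (\<phi> y) = y" for y
   using \<phi>(1) by (auto simp: homeomorphism_def)
  have oU': "open U'" unfolding U'_def by (rule open_vimage[OF U(1) c(1)])
  have "homeomorphism U U' \<phi>' \<phi>"
   by (rule homeomorphismI[OF continuous_on_subset[OF c(2)] continuous_on_subset[OF c(1)]])
    (auto simp: U'_def inv)
  then have sc: "simply_connected U'" by (rule simply_connected_homeomorphic_image[OF _ U(2)])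
  have pU': "p : U'" using \<phi>(4,5) pV U(3) by (auto simp: U'_def)
  have xU': "x : U'" using \<phi>(2) U(4) by (simp add: U'_def)
  define G where "G y = matrix_inv (FV (\<phi> y)) ** F (\<phi> y)" for y
  define F' where "F' y = (if y : V then FV y ** G y else F y)" for y
  have oUV: "open (U \<inter> V)" using U(1) V(2) by blast
  note fU = frame_subset[OF U(5) oUV Int_lower1] and fV = frame_subset[OF FV oUV Int_lower2]
  let ?N = "U' \<inter> V"
  have oN: "open ?N" using oU' V(2) by blast
  have \<phi>N: "\<phi> y : U \<inter> V" if "y : ?N" for y using that \<phi>(6) by (auto simp: U'_def)
  have "frame ?N (%y. FV y ** G y)"
  proof (rule frame_gauge[OF frame_subset[OF FV oN Int_lower2]])
   show "gauge T (G y)" if "y : ?N" for y unfolding G_def by (rule frames_gauge[OF fV fU \<phi>N[OF that]])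
   show "smooth_map_on \<A> ?N G"
   proof (rule smooth_map_on_chartI[OF V(1) oN])
    show "?N \<subseteq> fst ch" using V(4) by blast
    let ?\<Gamma> = "rep ch (%y. matrix_inv (FV y) ** F y)"
    have "smooth_map_on \<A> (U \<inter> V) (%y. matrix_inv (FV y) ** F y)"
     by (intro smooth_map_on_matrix_mult smooth_map_on_matrix_inv oUV frame_smooth[OF fU] frame_smooth[OF fV] frame_inv[OF fV])
    then have s1: "smooth_on (snd ch ` (U \<inter> V)) ?\<Gamma>"
     by (rule smooth_map_onD[OF _ V(1)]) (use V(4) in blast)
    have o1: "open (snd ch ` (U \<inter> V))" by (rule open_chart_image[OF V(1) oUV]) (use V(4) in blast)
    have o2: "open (snd ch ` ?N)" by (rule open_chart_image[OF V(1) oN]) (use V(4) in blast)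
    have "smooth_on (snd ch ` ?N) (%u. ?\<Gamma> (\<psi> u))"
    proof (rule smooth_on_compose[OF o2 o1 s1 smooth_on_subset[OF \<phi>(7) subset_UNIV]])
     show "\<psi> ` snd ch ` ?N \<subseteq> snd ch ` (U \<inter> V)"
     proof (clarsimp simp only: image_subset_iff)
      fix y assume y: "y : U'" "y : V"
      then have "\<psi> (snd ch y) = snd ch (\<phi> y)" using \<phi>(8) by simp
      then show "\<psi> (snd ch y) : snd ch ` (U \<inter> V)" using \<phi>N[of y] y by auto
     qed
    qed
    then show "smooth_on (snd ch ` ?N) (rep ch G)"
    proof (rule smooth_on_cong[OF o2, rotated])
     fix u assume "u : snd ch ` ?N"
     then obtain y where y: "y : ?N" "u = snd ch y" by blast
     have y1: "y : fst ch" "\<phi> y : fst ch" using y(1) \<phi>N[OF y(1)] V(4) by auto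
     have "\<psi> u = snd ch (\<phi> y)" using \<phi>(8) y by simp
     then show "?\<Gamma> (\<psi> u) = rep ch G u"
      using y1 by (simp add: y(2) rep_chart[OF V(1)] G_def)
    qed
   qed
  qed
  then have f1: "frame ?N F'" by (rule frame_cong) (simp add: F'_def)
  let ?M = "U' - C"
  have oM: "open ?M" using oU' \<phi>(3) by (rule open_Diff)
  have MU: "?M \<subseteq> U" using \<phi>(5) by (auto simp: U'_def)
  have f2: "frame ?M F'"
  proof (rule frame_cong[OF frame_subset[OF U(5) oM MU]])
   fix y assume y: "y : ?M"
   then have "\<phi> y = y" using \<phi>(5) by blast
   then show "F y = F' y"
    using frame_inv[OF FV, of y] by (simp add: F'_def G_def matrix_mul_assoc matrix_inv_right)
  qed
  have "frame U' F'"
  proof (rule frame_local)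
   fix y assume "y : U'"
   then have "y : ?N | y : ?M" using \<phi>(4) by blast
   then show "EX N. y : N & N \<subseteq> U' & frame N F'" using f1 f2 by blast
  qed
  then show ?thesis unfolding framed_def using oU' sc pU' xU' by blast
 qed
qed

lemma framed_all:
 assumes "connected (UNIV :: 'a set)"
 shows "framed p q"
proof -
 let ?S = "{q. framed p q}"
 have "open ?S"
 proof (subst open_subopen, intro ballI)
  fix q assume "q : ?S"
  then obtain U F where "open U" "simply_connected U" "p : U" "q : U" "frame U F"
   unfolding framed_def mem_Collect_eq by (elim exE conjE)
  then show "EX N. open N & q : N & N \<subseteq> ?S" by (intro exI[of _ U]) (auto simp: framed_def)
 qed
 moreover have "closed ?S"
  unfolding closed_def open_subopen[of "- ?S"]
 proof (intro ballI)
  fix x assume "x : - ?S"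
  then have "~ (ALL N. open N --> x : N --> (EX q:N. framed p q))" using framed_closed[of x p] by blast
  then obtain N where "open N" "x : N" "ALL q:N. ~ framed p q" by blast
  then show "EX N. open N & x : N & N \<subseteq> - ?S" by blast
 qed
 moreover have "framed p p"
 proof -
  obtain ch \<rho> V F where "ch : \<A>" "open V" "p : V" "V \<subseteq> fst ch" "snd ch ` V = ball (snd ch p) \<rho>" "\<rho> > 0"
   "simply_connected V" "frame V F" by (rule frame_ball)
  then show ?thesis unfolding framed_def by blast
 qed
 ultimately have "?S = UNIV" using assms unfolding connected_clopen by (simp flip: open_openin closed_closedin) blast
 then show ?thesis by blast
qed

text \<open>The set of points that can be reached from \<open>p\<close> is open and closed. A constant gauge transformation
 then adjusts the value at \<open>p\<close>.\<close>

lemma frame_between: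
 assumes "connected (UNIV :: 'a set)" and F0: "frame N F0" "p : N"
 obtains U F where "open U" "simply_connected U" "p : U" "q : U" "frame U F" "F p = F0 p"
proof -
 obtain U F where U: "open U" "simply_connected U" "p : U" "q : U" "frame U F"
  using framed_all[OF assms(1), of p q] unfolding framed_def by (elim exE conjE)
 let ?G = "matrix_inv (F p) ** F0 p"
 have o: "open (U \<inter> N)" using U(1) frame_open[OF F0(1)] by blast
 have "gauge T ?G"
  by (rule frames_gauge[OF frame_subset[OF U(5) o Int_lower1] frame_subset[OF F0(1) o Int_lower2]]) (use U(3) F0(2) in blast)
 then have "frame U (%x. F x ** ?G)" by (intro frame_gauge U(5) smooth_map_on_const)
 moreover have "F p ** ?G = F0 p" by (simp add: matrix_mul_assoc matrix_inv_right[OF frame_inv[OF U(5,3)]])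
 ultimately show ?thesis using that[OF U(1-4)] by blast
qed

end

section \<open>Geometry read off from adapted frames\<close>

lemma (in signs) group_pform:
 assumes A: "isom_group \<delta> J A" and z: "z $ None = 0" "z' $ None = 0"
 shows "pform (ext \<delta> J) (A *v z) (A *v z') = (SUM i:UNIV. J i * z $ Some i * z' $ Some i)"
proof -
 have e: "A *v z = (SUM i:UNIV. z $ Some i *\<^sub>R column (Some i) A)" if "z $ None = 0" for z :: "real ^ 'n option"
  by (simp add: vec_eq_iff matrix_vector_mult_def sum_option that column_def sum_component mult.commute)
 have "(SUM j:UNIV. z' $ Some j * pform (ext \<delta> J) (column (Some i) A) (column (Some j) A)) = J i * z' $ Some i" for i
  by (simp add: group_columns[OF A] if_distrib[of "%x. y * x" for y] cong: if_cong)
 then show ?thesis unfolding e[OF z(1)] e[OF z(2)]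
  by (subst pform_sum(1)) (simp only: pform_sum(2), simp add: mult_ac)
qed

lemma Compl_normal_indices: "- (Some ` (-T)) = insert None (Some ` T)"
proof (rule set_eqI)
 show "a : - (Some ` (-T)) \<longleftrightarrow> a : insert None (Some ` T)" for a by (cases a) auto
qed

context adapted_map
begin

lemma mc_None_None: "frame N F ==> ch : \<A> ==> x : N ==> x : fst ch ==> mc_form ch F x v $ None $ None = 0"
 using frame_algebra[of N F ch x v] by (simp add: isom_algebra_def)

lemma metric_frame:
 assumes "frame N F" "ch : \<A>" "x : N" "x : fst ch"
 shows "pform (ext \<delta> J) (mdiff ch f x v) (mdiff ch f x w)
  = (SUM i:T. J i * mc_form ch F x v $ Some i $ None * mc_form ch F x w $ Some i $ None)"
proof -
 have "pform (ext \<delta> J) (mdiff ch f x v) (mdiff ch f x w)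
  = (SUM i:UNIV. J i * mc_form ch F x v $ Some i $ None * mc_form ch F x w $ Some i $ None)"
  unfolding mdiff_frame[OF assms]
  by (subst group_pform[OF frame_group[OF assms(1,3)]]) (simp_all add: column_def mc_None_None[OF assms])
 also have "\<dots> = (SUM i:T. J i * mc_form ch F x v $ Some i $ None * mc_form ch F x w $ Some i $ None)"
  by (rule sum.mono_neutral_right) (use frame_normal[OF assms] in auto)
 finally show ?thesis .
qed

text \<open>The metric is allowed to come from another map \<open>f'\<close> because a map into flat space and its lift to
 the affine hyperplane have the same induced metric.\<close>

lemma gauss_frame:
 assumes cc: "constant_curvature \<A> K f' c"
  and met: "!!ch x v w. ch : \<A> ==> x : fst ch ==>
   pform K (mdiff ch f' x v) (mdiff ch f' x w) = pform (ext \<delta> J) (mdiff ch f x v) (mdiff ch f x w)"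
  and F: "frame N F" and ch: "ch : \<A>" and x: "x : N" "x : fst ch"
 shows "gauss_eq J T (c - \<delta>) (mc_form ch F x v) (mc_form ch F x w)"
proof -
 let ?N = "N \<inter> fst ch"
 have F': "frame ?N F" using frame_subset[OF F] frame_open[OF F] chart_open[OF ch] by blast
 interpret cf: coordinate_frame J \<delta> T "snd ch ` ?N" "rep ch F" by (rule coordinate_frame[OF F' ch]) simp
 let ?G = "metric_matrix K ch f'"
 have G: "?G u $ j $ k = cf.met (axis j 1) (axis k 1) u" if "u : snd ch ` ?N" for u j k
 proof -
  obtain y where y: "y : N" "y : fst ch" "u = snd ch y" using \<open>u : snd ch ` ?N\<close> by blast
  show ?thesis
   by (simp add: metric_matrix_def induced_metric_def y(3) chart_inv[OF ch y(2)] met[OF ch y(2)] metric_frame[OF F ch y(1,2)]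
     cf.met_def cf.th_def mc_form_eq[OF ch y(2)])
 qed
 have u: "snd ch x : snd ch ` ?N" using x by blast
 show ?thesis unfolding mc_form_eq[OF ch x(2)]
 proof (rule cf.gauss[OF G u])
  fix X Y assume "plane_area ?G (snd ch x) X Y ~= 0"
  then show "sectional_curvature ?G (snd ch x) X Y = c"
   using cc[unfolded constant_curvature_def, rule_format, OF ch imageI[OF x(2)]] by blast
 qed
qed

lemma mdiff_sum:
 assumes "frame N F" "ch : \<A>" "x : N" "x : fst ch"
 shows "mdiff ch f x v = (SUM i:T. mc_form ch F x v $ Some i $ None *\<^sub>R column (Some i) (F x))"
proof -
 have "mdiff ch f x v = (SUM i:UNIV. mc_form ch F x v $ Some i $ None *\<^sub>R column (Some i) (F x))"
  unfolding mdiff_frame[OF assms] using mc_None_None[OF assms, of v]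
  by (simp add: vec_eq_iff matrix_vector_mult_def sum_option column_def sum_component mult.commute)
 also have "\<dots> = (SUM i:T. mc_form ch F x v $ Some i $ None *\<^sub>R column (Some i) (F x))"
  by (rule sum.mono_neutral_right) (use frame_normal[OF assms] in auto)
 finally show ?thesis .
qed

lemma tangent_column:
 assumes "frame N F" "ch : \<A>" "x : N" "x : fst ch" "i : T"
 shows "column (Some i) (F x) : range (mdiff ch f x)"
proof -
 obtain v where v: "ALL a. mc_form ch F x v $ Some a $ None = (if a : T then (if a = i then 1 else 0) else 0)"
  using theta_surj[OF assms(1-4), where y="%a. if a = i then 1 else 0"] by (rule exE)
 have "mdiff ch f x v = (SUM a:T. if a = i then column (Some i) (F x) else 0)"
  unfolding mdiff_sum[OF assms(1-4)] by (rule sum.cong[OF refl]) (use v in auto)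
 then have "mdiff ch f x v = column (Some i) (F x)" using assms(5) by simp
 then show ?thesis by (rule range_eqI[OF sym])
qed

lemma normal_iff:
 assumes "frame N F" "ch : \<A>" "x : N" "x : fst ch"
 shows "(ALL v. pform K \<xi> (mdiff ch f x v) = 0) \<longleftrightarrow> (ALL i:T. pform K \<xi> (column (Some i) (F x)) = 0)"
proof
 assume h: "ALL v. pform K \<xi> (mdiff ch f x v) = 0"
 show "ALL i:T. pform K \<xi> (column (Some i) (F x)) = 0"
 proof
  fix i assume "i : T"
  from tangent_column[OF assms this] obtain v where "column (Some i) (F x) = mdiff ch f x v" by blast
  then show "pform K \<xi> (column (Some i) (F x)) = 0" using h by simp
 qed
next
 assume h: "ALL i:T. pform K \<xi> (column (Some i) (F x)) = 0"
 show "ALL v. pform K \<xi> (mdiff ch f x v) = 0"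
  unfolding mdiff_sum[OF assms] pform_sum by (simp add: h)
qed

lemma ext_sq: "\<delta> ~= 0 ==> ext \<delta> J a * ext \<delta> J a = 1"
 using J \<delta> by (auto simp: ext_def split: option.splits)

lemma group_iff_orthonormal: "\<delta> ~= 0 ==> isom_group \<delta> J A \<longleftrightarrow> orthonormal_frame (ext \<delta> J) A"
 using orthonormal_frame_rows[OF ext_sq, where E=A] by (simp add: isom_group_def)

text \<open>The Ricci equation in frames is the flatness of the normal bundle, for any description \<open>E\<close> of
 the frames in the ambient space whose columns \<open>\<iota> b\<close> with \<open>b ~: T\<close> are the normal ones.\<close>

lemma normal_bundle_ricci:
 assumes nf: "!!N F ch. frame N F ==> ch : \<A> ==> N \<subseteq> fst ch ==> normal_frame K \<tau> ch h (snd ch ` N) (E ch F) (\<iota> ` (-T))"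
  and rf: "!!N F ch x a b v w. frame N F ==> ch : \<A> ==> N \<subseteq> fst ch ==> x : N ==> a ~: T ==> b ~: T ==>
   normal_frame.ricci_form (E ch F) (\<iota> ` (-T)) (snd ch x) v w (\<iota> a) (\<iota> b) =
   (SUM c:T. mc_form ch F x v $ Some a $ Some c * mc_form ch F x w $ Some c $ Some b
    - mc_form ch F x w $ Some a $ Some c * mc_form ch F x v $ Some c $ Some b)"
 shows "flat_normal_bundle \<A> K \<tau> h ==> frame N F ==> ch : \<A> ==> x : N ==> x : fst ch ==>
   ricci_eq T (mc_form ch F x v) (mc_form ch F x w)"
  and "(!!x. EX N F. x : N & frame N F & (ALL ch:\<A>. ALL y:N \<inter> fst ch. ALL v w. ricci_eq T (mc_form ch F y v) (mc_form ch F y w))) ==>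
   flat_normal_bundle \<A> K \<tau> h"
proof -
 have F': "frame (N \<inter> fst ch) F" if "frame N F" "ch : \<A>" for N F ch
  using frame_subset[OF that(1)] frame_open[OF that(1)] chart_open[OF that(2)] by blast
 show "ricci_eq T (mc_form ch F x v) (mc_form ch F x w)"
  if flat: "flat_normal_bundle \<A> K \<tau> h" and F: "frame N F" and ch: "ch : \<A>" and x: "x : N" "x : fst ch"
  unfolding ricci_eq_def
 proof (intro ballI)
  fix a b assume ab: "a : -T" "b : -T"
  have "normal_frame.ricci_form (E ch F) (\<iota> ` (-T)) (snd ch x) v w (\<iota> a) (\<iota> b) = 0"
   by (rule flat_normal_bundle_imp_ricci[OF nf[OF F'[OF F ch] ch Int_lower2] flat ch])
    (use x ab in auto)
  moreover have "x : N \<inter> fst ch" using x by blast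
  ultimately show "(SUM c:T. mc_form ch F x v $ Some a $ Some c * mc_form ch F x w $ Some c $ Some b
     - mc_form ch F x w $ Some a $ Some c * mc_form ch F x v $ Some c $ Some b) = 0"
   using rf[OF F'[OF F ch] ch Int_lower2, of x a b v w] ab by simp
 qed
 assume ex: "!!x. EX N F. x : N & frame N F &
   (ALL ch:\<A>. ALL y:N \<inter> fst ch. ALL v w. ricci_eq T (mc_form ch F y v) (mc_form ch F y w))"
 show "flat_normal_bundle \<A> K \<tau> h"
 proof (rule ricci_imp_flat_normal_bundle[where B="\<iota> ` (-T)"])
  fix ch u assume ch: "ch : \<A>" and "u : snd ch ` fst ch"
  then obtain x where x: "x : fst ch" "u = snd ch x" by blast
  obtain N F where NF: "x : N" "frame N F"
   "ALL ch:\<A>. ALL y:N \<inter> fst ch. ALL v w. ricci_eq T (mc_form ch F y v) (mc_form ch F y w)"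
   using ex by blast
  let ?N = "N \<inter> fst ch"
  show "EX W E. u : W & normal_frame K \<tau> ch h W E (\<iota> ` (-T)) &
   (ALL u:W. ALL v w. ALL a:\<iota> ` (-T). ALL b:\<iota> ` (-T). normal_frame.ricci_form E (\<iota> ` (-T)) u v w a b = 0)"
  proof (rule exI[of _ "snd ch ` ?N"], rule exI[of _ "E ch F"], intro conjI ballI allI)
   show "u : snd ch ` ?N" using x NF(1) by blast
   show "normal_frame K \<tau> ch h (snd ch ` ?N) (E ch F) (\<iota> ` (-T))"
    by (rule nf[OF F'[OF NF(2) ch] ch Int_lower2])
   fix u v w a b assume "u : snd ch ` ?N" "a : \<iota> ` (-T)" "b : \<iota> ` (-T)"
   then obtain y a' b' where y: "y : ?N" "u = snd ch y" "a = \<iota> a'" "b = \<iota> b'" "a' : -T" "b' : -T" by blast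
   have "ricci_eq T (mc_form ch F y v) (mc_form ch F y w)" using NF(3) ch y(1) by blast
   then show "normal_frame.ricci_form (E ch F) (\<iota> ` (-T)) u v w a b = 0"
    using rf[OF F'[OF NF(2) ch] ch Int_lower2 y(1), of a' b' v w] y(5,6) by (simp add: y(2-4) ricci_eq_def)
  qed
 qed
qed

lemma quadric_normal_frame:
 assumes \<delta>0: "\<delta> ~= 0" and F: "frame N F" and ch: "ch : \<A>" "N \<subseteq> fst ch"
 shows "normal_frame (ext \<delta> J) (quadric_tangent (ext \<delta> J)) ch f (snd ch ` N) (rep ch F) (Some ` (-T))"
proof
 show "ext \<delta> J i * ext \<delta> J i = 1" for i by (rule ext_sq[OF \<delta>0])
 show "open (snd ch ` N)" by (rule open_chart_image[OF ch(1) frame_open[OF F] ch(2)])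
 show "smooth_on (snd ch ` N) (rep ch F)" by (rule smooth_map_onD[OF frame_smooth[OF F] ch])
 fix u assume "u : snd ch ` N"
 then obtain x where x: "x : N" "x : fst ch" "u = snd ch x" using ch by blast
 show "orthonormal_frame (ext \<delta> J) (rep ch F u)"
  using frame_group[OF F x(1)] by (simp add: group_iff_orthonormal[OF \<delta>0] x(3) rep_chart[OF ch(1) x(2)])
 have "column None (F x) = f x" using frame_col[OF F x(1)] by (simp add: column_def vec_eq_iff)
 moreover have "- (Some ` (-T)) = insert None (Some ` T)" by (rule Compl_normal_indices)
 ultimately show "normal_space (ext \<delta> J) (quadric_tangent (ext \<delta> J)) ch f u =
   {\<xi>. ALL c:- (Some ` (-T)). pform (ext \<delta> J) \<xi> (column c (rep ch F u)) = 0}"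
  using normal_iff[OF F ch(1) x(1,2), of "ext \<delta> J"]
  by (simp add: normal_space_def quadric_tangent_def x(3) rep_chart[OF ch(1) x(2)] mdiff_def)
qed

lemma quadric_ricci_form:
 assumes \<delta>0: "\<delta> ~= 0" and F: "frame N F" and ch: "ch : \<A>" "N \<subseteq> fst ch" and x: "x : N" and ab: "a ~: T" "b ~: T"
 shows "normal_frame.ricci_form (rep ch F) (Some ` (-T)) (snd ch x) v w (Some a) (Some b) =
  (SUM c:T. mc_form ch F x v $ Some a $ Some c * mc_form ch F x w $ Some c $ Some b
    - mc_form ch F x w $ Some a $ Some c * mc_form ch F x v $ Some c $ Some b)"
proof -
 interpret nf: normal_frame "ext \<delta> J" "quadric_tangent (ext \<delta> J)" ch f "snd ch ` N" "rep ch F" "Some ` (-T)"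
  by (rule quadric_normal_frame[OF \<delta>0 F ch])
 have xc: "x : fst ch" using x ch by blast
 have "- (Some ` (-T)) = insert None (Some ` T)" by (rule Compl_normal_indices)
 then show ?thesis
  using frame_normal[OF F ch(1) x xc ab(1)]
  by (simp add: nf.ricci_form_def mc_form_eq[OF ch(1) xc] sum.reindex)
qed

lemma
 assumes \<delta>0: "\<delta> ~= 0"
 shows quadric_ricci: "flat_normal_bundle \<A> (ext \<delta> J) (quadric_tangent (ext \<delta> J)) f ==> frame N F ==> ch : \<A> ==> x : N ==> x : fst ch ==>
  ricci_eq T (mc_form ch F x v) (mc_form ch F x w)"
  and quadric_flat_normal_bundle:
   "(!!x. EX N F. x : N & frame N F &
  (ALL ch:\<A>. ALL y:N \<inter> fst ch. ALL v w. ricci_eq T (mc_form ch F y v) (mc_form ch F y w))) ==> flat_normal_bundle \<A> (ext \<delta> J) (quadric_tangent (ext \<delta> J)) f"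
 by (rule normal_bundle_ricci[where E=rep and \<iota>=Some, OF quadric_normal_frame[OF \<delta>0] quadric_ricci_form[OF \<delta>0]], assumption+)+

lemma quadric_frame_iff:
 assumes \<delta>0: "\<delta> ~= 0" and U: "open U"
 shows "quadric_frame \<A> \<delta> J T f U F \<longleftrightarrow> frame U F"
proof
 assume F: "frame U F"
 show "quadric_frame \<A> \<delta> J T f U F"
  unfolding quadric_frame_def adapted_frame_def
 proof (intro conjI ballI)
  show "smooth_map_on \<A> U F" by (rule frame_smooth[OF F])
  fix x assume x: "x : U"
  show "orthonormal_frame (ext \<delta> J) (F x)" using frame_group[OF F x] by (simp add: group_iff_orthonormal[OF \<delta>0])
  show "column None (F x) = f x" using frame_col[OF F x] by (simp add: column_def vec_eq_iff)
 next
  fix ch x i assume ch: "ch : \<A>" and "x : U \<inter> fst ch" and i: "i : T"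
  then show "column (Some i) (F x) : range (mdiff ch f x)" by (intro tangent_column[OF F ch]) auto
 next
  fix ch x i assume ch: "ch : \<A>" and "x : U \<inter> fst ch" and i: "i : - T"
  then have x: "x : U" "x : fst ch" by auto
  have o: "orthonormal_frame (ext \<delta> J) (F x)" using frame_group[OF F x(1)] by (simp add: group_iff_orthonormal[OF \<delta>0])
  have "column None (F x) = f x" using frame_col[OF F x(1)] by (simp add: column_def vec_eq_iff)
  then have 1: "pform (ext \<delta> J) (column (Some i) (F x)) (f x) = 0"
   using o[unfolded orthonormal_frame_def, rule_format, of "Some i" None] by simp
  have "ALL j:T. pform (ext \<delta> J) (column (Some i) (F x)) (column (Some j) (F x)) = 0"
   using o i by (auto simp: orthonormal_frame_def)
  then have "ALL v. pform (ext \<delta> J) (column (Some i) (F x)) (mdiff ch f x v) = 0"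
   using normal_iff[OF F ch x] by blast
  then show "column (Some i) (F x) : normal_space (ext \<delta> J) (quadric_tangent (ext \<delta> J)) ch f (snd ch x)"
   using 1 by (simp add: normal_space_def quadric_tangent_def rep_chart[OF ch x(2)] mdiff_def)
 qed
next
 assume q: "quadric_frame \<A> \<delta> J T f U F"
 have sm: "smooth_map_on \<A> U F" using q by (simp add: quadric_frame_def)
 have o: "orthonormal_frame (ext \<delta> J) (F x)" if "x : U" for x using q that by (simp add: quadric_frame_def)
 have col: "F x $ a $ None = f x $ a" if "x : U" for x a
 proof -
  have "column None (F x) = f x" using q that by (simp add: quadric_frame_def)
  then have "column None (F x) $ a = f x $ a" by simp
  then show ?thesis by (simp add: column_def)
 qed
 show "frame U F"
  unfolding frame_def
 proof (intro conjI ballI allI U sm col)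
  show g: "isom_group \<delta> J (F x)" if "x : U" for x using o[OF that] by (simp add: group_iff_orthonormal[OF \<delta>0])
  fix ch x v b assume ch: "ch : \<A>" and "x : U \<inter> fst ch" and b: "b : - T"
  then have x: "x : U" "x : fst ch" by auto
  define z where "z = column None (mc_form ch F x v)"
  have "mdiff ch f x v = F x *v z"
   using mdiff_eq[OF mdiff_column[OF sm U ch x col group_invertible[OF g[OF x(1)]]]] by (simp add: z_def)
  moreover have "column (Some b) (F x) : normal_space (ext \<delta> J) (quadric_tangent (ext \<delta> J)) ch f (snd ch x)"
   using q ch x b by (simp add: quadric_frame_def adapted_frame_def)
  then have "pform (ext \<delta> J) (column (Some b) (F x)) (mdiff ch f x v) = 0"
   by (simp add: normal_space_def mdiff_def)
  ultimately have "pform (ext \<delta> J) (F x *v axis (Some b) 1) (F x *v z) = 0" by (simp add: column_eq_mult)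
  then have "pform (ext \<delta> J) z (axis (Some b) 1) = 0" unfolding pform_frame[OF o[OF x(1)]] by (simp add: pform_sym)
  then have "J b * z $ Some b = 0" by (simp add: pform_axis ext_def)
  then show "mc_form ch F x v $ Some b $ None = 0" using J_nz by (simp add: z_def column_def)
 qed
qed

text \<open>Left multiplication by a constant does not change the Maurer-Cartan form.\<close>

lemma frame_left_mult:
 assumes A: "isom_group \<delta> J A"
 shows "adapted_map \<A> J \<delta> T (%x. A *v f x)"
  and "frame N F ==> adapted_map.frame \<A> J \<delta> T (%x. A *v f x) N (%x. A ** F x)"
  and "frame N F ==> ch : \<A> ==> x : N ==> x : fst ch ==> mc_form ch (%x. A ** F x) x v = mc_form ch F x v"
proof -
 note iA = group_invertible[OF A]
 have bl: "bounded_linear ((*v) A)" by (rule matrix_vector_mul_bounded_linear)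
 have d: "mdiff ch (%x. A *v f x) x v = A *v mdiff ch f x v" if "ch : \<A>" "x : fst ch" for ch x v
 proof -
  have "(rep ch (%x. A *v f x) has_derivative (%v. A *v mdiff ch f x v)) (at (snd ch x))"
   using bounded_linear.has_derivative[OF bl mdiff_has_derivative[OF f_smooth that UNIV_I]] by (simp add: rep_def o_def)
  from mdiff_eq[OF this] show ?thesis by simp
 qed
 show adapted: "adapted_map \<A> J \<delta> T (%x. A *v f x)"
 proof
  show "card T = CARD('m)" by (rule card_T)
  show "smooth_map_on \<A> UNIV (%x. A *v f x)" by (rule smooth_map_on_bounded_linear[OF bl open_UNIV f_smooth])
  fix ch x v assume h: "ch : \<A>" "x : fst ch" "mdiff ch (%x. A *v f x) x v = 0"
  then have "matrix_inv A *v (A *v mdiff ch f x v) = 0" by (simp add: d)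
  then have "mdiff ch f x v = 0" by (simp only: matrix_vector_mul_assoc matrix_inv_left[OF iA] matrix_vector_mul_lid)
  then show "v = 0" by (rule f_inj[OF h(1,2)])
 qed
 interpret A: adapted_map \<A> J \<delta> T "%x. A *v f x" by (rule adapted)
 show mc: "mc_form ch (%x. A ** F x) x v = mc_form ch F x v" if F: "frame N F" and h: "ch : \<A>" "x : N" "x : fst ch" for ch x v F N
 proof -
  have "(rep ch (%x. A ** F x) has_derivative (%v. A ** mdiff ch F x v)) (at (snd ch x))"
   using bounded_linear.has_derivative[OF bounded_bilinear.bounded_linear_right[OF bounded_bilinear_matrix_mult]
     mdiff_has_derivative[OF frame_smooth[OF F] h(1,3,2)]] by (simp add: rep_def o_def)
  then have e: "mdiff ch (%x. A ** F x) x = (%v. A ** mdiff ch F x v)" by (rule mdiff_eq)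
  note iF = frame_inv[OF F h(2)]
  have "mc_form ch F x v = matrix_inv (A ** F x) ** (A ** F x) ** mc_form ch F x v"
   by (simp add: matrix_inv_left invertible_mult iA iF)
  also have "\<dots> = matrix_inv (A ** F x) ** (A ** (F x ** matrix_inv (F x)) ** mdiff ch F x v)"
   by (simp only: mc_form_def matrix_mul_assoc)
  also have "\<dots> = mc_form ch (%x. A ** F x) x v"
   by (simp add: mc_form_def e matrix_inv_right[OF iF])
  finally show ?thesis by simp
 qed
 show "A.frame N (%x. A ** F x)" if F: "frame N F"
  unfolding A.frame_def
 proof (intro conjI ballI allI frame_open[OF F])
  show "smooth_map_on \<A> N (%x. A ** F x)"
   by (rule smooth_map_on_matrix_mult[OF frame_open[OF F] smooth_map_on_const frame_smooth[OF F]])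
  show "isom_group \<delta> J (A ** F x)" "(A ** F x) $ a $ None = (A *v f x) $ a" if "x : N" for x a
   using group_mult[OF A frame_group[OF F that]] frame_col[OF F that]
   by (auto simp: matrix_mult_nth matrix_vector_mult_def)
  show "mc_form ch (%x. A ** F x) x v $ Some b $ None = 0" if "ch : \<A>" "x : N \<inter> fst ch" "b : -T" for ch x v b
   using mc[OF F that(1)] frame_normal[OF F that(1)] that by auto
 qed
qed

lemma frame_left_cancel:
 assumes A: "isom_group \<delta> J A" and F: "adapted_map.frame \<A> J \<delta> T (%x. A *v f x) N F"
 shows "frame N (%x. matrix_inv A ** F x)"
proof -
 interpret A: adapted_map \<A> J \<delta> T "%x. A *v f x" by (rule frame_left_mult(1)[OF A])
 have "(%x. matrix_inv A *v (A *v f x)) = f"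
  by (simp add: matrix_vector_mul_assoc matrix_inv_left[OF group_invertible[OF A]])
 then show ?thesis using A.frame_left_mult(2)[OF group_inv[OF A] F] by simp
qed

end

text \<open>Flat space is put at height one above the origin, which makes its rigid motions linear.\<close>

definition lift :: "real ^ 'n::finite => real ^ 'n option" where
 "lift y = (\<chi> a. case a of None => 1 | Some i => y $ i)"

definition lift_tangent :: "real ^ 'n::finite => real ^ 'n option" where
 "lift_tangent y = (\<chi> a. case a of None => 0 | Some i => y $ i)"

definition block :: "real ^ 'n option ^ 'n option => real ^ 'n::finite ^ 'n" where
 "block A = (\<chi> i j. A $ Some i $ Some j)"

lemma lift_nth [simp]: "lift y $ None = 1" "lift y $ Some i = y $ i"
 "lift_tangent y $ None = 0" "lift_tangent y $ Some i = y $ i"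
 by (simp_all add: lift_def lift_tangent_def)

lemma block_nth [simp]: "block A $ i $ j = A $ Some i $ Some j"
 by (simp add: block_def)

lemma bounded_linear_block: "bounded_linear block"
 by (rule linear_conv_bounded_linear[THEN iffD1], rule linearI) (simp_all add: vec_eq_iff)

lemma lift_eq: "lift y = lift_tangent y + axis None 1"
proof -
 have "lift y $ a = (lift_tangent y + axis None 1) $ a" for a by (cases a) (simp_all add: axis_def)
 then show ?thesis by (simp add: vec_eq_iff)
qed

lemma bounded_linear_lift_tangent: "bounded_linear lift_tangent"
proof (rule linear_conv_bounded_linear[THEN iffD1], rule linearI)
 show "lift_tangent (x + y) = lift_tangent x + lift_tangent y" for x y :: "real ^ 'n"
  by (simp add: vec_eq_iff lift_tangent_def split: option.split)
 show "lift_tangent (c *\<^sub>R x) = c *\<^sub>R lift_tangent x" for c and x :: "real ^ 'n"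
  by (simp add: vec_eq_iff lift_tangent_def split: option.split)
qed

lemma pform_lift_tangent: "pform (ext d J) (lift_tangent x) y = pform J x (\<chi> i. y $ Some i)"
 "pform (ext d J) y (lift_tangent x) = pform J (\<chi> i. y $ Some i) x"
 by (simp_all add: pform_def sum_option ext_def)

lemma (in smooth_manifold) mdiff_lift:
 assumes "smooth_map_on \<A> UNIV f" "ch : \<A>" "x : fst ch"
 shows "mdiff ch (%x. lift (f x)) x v = lift_tangent (mdiff ch f x v)"
proof -
 have "(rep ch (%x. lift (f x)) has_derivative (%v. lift_tangent (mdiff ch f x v))) (at (snd ch x))"
  using has_derivative_add[OF bounded_linear.has_derivative[OF bounded_linear_lift_tangent mdiff_has_derivative[OF assms UNIV_I]]
   has_derivative_const[of "axis None 1"]]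
  by (simp add: lift_eq rep_def o_def)
 from mdiff_eq[OF this] show ?thesis by simp
qed

lemma isom_group_zero_iff:
 assumes J: "!!i. J i * J i = 1"
 shows "isom_group 0 J A \<longleftrightarrow> orthonormal_frame J (block A) & (ALL b. A $ None $ b = (if b = None then 1 else 0))"
  (is "_ \<longleftrightarrow> _ & ?row")
proof -
 have e: "(A ** diag_mat (ext 0 J) ** transpose A) $ a $ b = (SUM i:UNIV. A $ a $ Some i * J i * A $ b $ Some i)" for a b
  unfolding matrix_mult_nth[of _ "transpose A"] diag_mat_mult by (simp add: transpose_nth sum_option ext_def)
 have "A ** diag_mat (ext 0 J) ** transpose A = diag_mat (ext 0 J) \<longleftrightarrow>
   (ALL i j. (SUM k:UNIV. A $ Some i $ Some k * J k * A $ Some j $ Some k) = diag_mat J $ i $ j)" if ?row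
 proof
  assume h: "A ** diag_mat (ext 0 J) ** transpose A = diag_mat (ext 0 J)"
  show "ALL i j. (SUM k:UNIV. A $ Some i $ Some k * J k * A $ Some j $ Some k) = diag_mat J $ i $ j"
   unfolding e[symmetric] h by (simp add: diag_mat_def ext_def)
 next
  assume h: "ALL i j. (SUM k:UNIV. A $ Some i $ Some k * J k * A $ Some j $ Some k) = diag_mat J $ i $ j"
  show "A ** diag_mat (ext 0 J) ** transpose A = diag_mat (ext 0 J)"
  proof (rule matrix_eqI)
   fix a b show "(A ** diag_mat (ext 0 J) ** transpose A) $ a $ b = diag_mat (ext 0 J) $ a $ b"
    unfolding e using h \<open>?row\<close> by (cases a; cases b) (simp_all add: diag_mat_def ext_def)
  qed
 qed
 moreover have "orthonormal_frame J (block A) \<longleftrightarrow>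
   (ALL i j. (SUM k:UNIV. A $ Some i $ Some k * J k * A $ Some j $ Some k) = diag_mat J $ i $ j)"
  unfolding orthonormal_frame_rows[OF J] vec_eq_iff matrix_mult_nth[of _ "transpose _"] diag_mat_mult by (simp add: transpose_nth)
 ultimately show ?thesis by (auto simp: isom_group_def)
qed

locale adapted_flat_map = adapted_map \<A> J 0 T "%x. lift (f0 x)"
 for \<A> :: "('a::{t2_space, second_countable_topology}, 'm::finite) chart set"
  and J :: "'n::finite => real" and T :: "'n set" and f0 :: "'a => real ^ 'n" +
 assumes f0_smooth: "smooth_map_on \<A> UNIV f0"
begin

lemma last_row: "frame N F ==> x : N ==> F x $ None $ b = (if b = None then 1 else 0)"
 using frame_group by (auto simp: isom_group_def)

lemma orthonormal_block: "frame N F ==> x : N ==> orthonormal_frame J (block (F x))"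
 using frame_group[of N F x] by (simp add: isom_group_zero_iff[OF J])

lemma flat_normal_iff:
 assumes F: "frame N F" "ch : \<A>" "x : N" "x : fst ch"
 shows "(ALL v. pform J \<xi> (mdiff ch f0 x v) = 0) \<longleftrightarrow> (ALL i:T. pform J \<xi> (column i (block (F x))) = 0)"
proof -
 have 1: "pform J \<xi> (mdiff ch f0 x v) = pform (ext 0 J) (lift_tangent \<xi>) (mdiff ch (%x. lift (f0 x)) x v)" for v
  by (simp add: mdiff_lift[OF f0_smooth F(2,4)] pform_lift_tangent)
 have 2: "pform J \<xi> (column i (block (F x))) = pform (ext 0 J) (lift_tangent \<xi>) (column (Some i) (F x))" for i
  by (simp add: pform_lift_tangent column_def)
 show ?thesis unfolding 1 2 by (rule normal_iff[OF F])
qed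

lemma flat_normal_frame:
 assumes F: "frame N F" and ch: "ch : \<A>" "N \<subseteq> fst ch"
 shows "normal_frame J flat_tangent ch f0 (snd ch ` N) (%u. block (rep ch F u)) (id ` (-T))"
proof
 show "J i * J i = 1" for i by (rule J)
 show o: "open (snd ch ` N)" by (rule open_chart_image[OF ch(1) frame_open[OF F] ch(2)])
 show "smooth_on (snd ch ` N) (%u. block (rep ch F u))"
  by (rule smooth_on_bounded_linear[OF bounded_linear_block o smooth_map_onD[OF frame_smooth[OF F] ch]])
 fix u assume "u : snd ch ` N"
 then obtain x where x: "x : N" "x : fst ch" "u = snd ch x" using ch by blast
 show "orthonormal_frame J (block (rep ch F u))"
  using orthonormal_block[OF F x(1)] by (simp add: x(3) rep_chart[OF ch(1) x(2)])
 show "normal_space J flat_tangent ch f0 u = {\<xi>. ALL c:- (id ` (-T)). pform J \<xi> (column c (block (rep ch F u))) = 0}"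
  using flat_normal_iff[OF F ch(1) x(1,2)]
  by (simp add: normal_space_def flat_tangent_def x(3) rep_chart[OF ch(1) x(2)] mdiff_def)
qed

lemma mc_block:
 assumes F: "frame N F" and ch: "ch : \<A>" "N \<subseteq> fst ch" and x: "x : N"
 shows "mc (%u. block (rep ch F u)) (snd ch x) v = block (mc_form ch F x v)"
proof -
 have xc: "x : fst ch" using x ch by blast
 have F': "frame N F" by (rule F)
 have inv: "invertible (block (F x))" by (rule orthonormal_frame_invertible[OF J orthonormal_block[OF F x]])
 have "ddir v (%u. block (rep ch F u)) (snd ch x) = block (mdiff ch F x v)"
  unfolding mdiff_def
  by (rule ddir_bounded_linear[OF bounded_linear_block smooth_map_on_differentiable[OF frame_smooth[OF F] ch(1) xc x]])
 moreover have "block (mdiff ch F x v) = block (F x) ** block (mc_form ch F x v)"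
 proof (rule matrix_eqI)
  fix i j
  have "mdiff ch F x v = F x ** mc_form ch F x v"
   by (simp add: mc_form_def matrix_mul_assoc matrix_inv_right[OF frame_inv[OF F x]])
  moreover have "mc_form ch F x v $ None $ Some j = 0"
   using frame_algebra[OF F ch(1) x xc, of v] by (simp add: isom_algebra_def)
  ultimately show "block (mdiff ch F x v) $ i $ j = (block (F x) ** block (mc_form ch F x v)) $ i $ j"
   by (simp add: matrix_mult_nth sum_option)
 qed
 ultimately show ?thesis
  by (simp add: mc_def rep_chart[OF ch(1) xc] matrix_mul_assoc matrix_inv_left[OF inv])
qed

lemma flat_ricci_form:
 assumes F: "frame N F" and ch: "ch : \<A>" "N \<subseteq> fst ch" and x: "x : N" and ab: "a ~: T" "b ~: T"
 shows "normal_frame.ricci_form (%u. block (rep ch F u)) (id ` (-T)) (snd ch x) v w (id a) (id b) =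
  (SUM c:T. mc_form ch F x v $ Some a $ Some c * mc_form ch F x w $ Some c $ Some b
    - mc_form ch F x w $ Some a $ Some c * mc_form ch F x v $ Some c $ Some b)"
proof -
 interpret nf: normal_frame J flat_tangent ch f0 "snd ch ` N" "%u. block (rep ch F u)" "id ` (-T)"
  by (rule flat_normal_frame[OF F ch])
 show ?thesis unfolding nf.ricci_form_def by (simp add: mc_block[OF F ch x])
qed

lemma
 shows flat_ricci: "flat_normal_bundle \<A> J flat_tangent f0 ==> frame N F ==> ch : \<A> ==> x : N ==> x : fst ch ==>
  ricci_eq T (mc_form ch F x v) (mc_form ch F x w)"
  and flat_flat_normal_bundle:
   "(!!x. EX N F. x : N & frame N F &
  (ALL ch:\<A>. ALL y:N \<inter> fst ch. ALL v w. ricci_eq T (mc_form ch F y v) (mc_form ch F y w))) ==> flat_normal_bundle \<A> J flat_tangent f0"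
 by (rule normal_bundle_ricci[where E="%ch F u. block (rep ch F u)" and \<iota>=id, OF flat_normal_frame flat_ricci_form], assumption+)+

lemma flat_frame_iff:
 assumes U: "open U"
 shows "flat_frame \<A> J T f0 U F \<longleftrightarrow> frame U F"
proof
 assume F: "frame U F"
 show "flat_frame \<A> J T f0 U F"
  unfolding flat_frame_def adapted_frame_def
 proof (intro conjI ballI allI)
  show "smooth_map_on \<A> U F" by (rule frame_smooth[OF F])
  fix x assume x: "x : U"
  show "orthonormal_frame J (\<chi> i j. F x $ Some i $ Some j)"
   using orthonormal_block[OF F x] by (simp add: block_def)
  show "F x $ Some i $ None = f0 x $ i" for i using frame_col[OF F x, of "Some i"] by simp
  show "F x $ None $ Some j = 0" "F x $ None $ None = 1" for j by (simp_all add: last_row[OF F x])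
 next
  fix ch x i assume ch: "ch : \<A>" and "x : U \<inter> fst ch" and i: "i : T"
  then have x: "x : U" "x : fst ch" by auto
  obtain v where "column (Some i) (F x) = lift_tangent (mdiff ch f0 x v)"
   using tangent_column[OF F ch x i] by (auto simp: mdiff_lift[OF f0_smooth ch x(2)])
  then have "column (Some i) (F x) $ Some j = mdiff ch f0 x v $ j" for j by simp
  then have "(\<chi> j. F x $ Some j $ Some i) = mdiff ch f0 x v" by (simp add: vec_eq_iff column_def)
  then show "(\<chi> j. F x $ Some j $ Some i) : range (mdiff ch f0 x)" by (rule range_eqI)
 next
  fix ch x i assume ch: "ch : \<A>" and "x : U \<inter> fst ch" and i: "i : - T"
  then have x: "x : U" "x : fst ch" by auto
  have "ALL j:T. pform J (column i (block (F x))) (column j (block (F x))) = 0"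
   using orthonormal_block[OF F x(1)] i by (auto simp: orthonormal_frame_def)
  then have "ALL v. pform J (column i (block (F x))) (mdiff ch f0 x v) = 0"
   using flat_normal_iff[OF F ch x] by blast
  moreover have "column i (block (F x)) = (\<chi> j. F x $ Some j $ Some i)" by (simp add: column_def)
  ultimately show "(\<chi> j. F x $ Some j $ Some i) : normal_space J flat_tangent ch f0 (snd ch x)"
   by (simp add: normal_space_def flat_tangent_def mdiff_def)
 qed
next
 assume q: "flat_frame \<A> J T f0 U F"
 have sm: "smooth_map_on \<A> U F" using q by (simp add: flat_frame_def)
 have o: "orthonormal_frame J (block (F x))" if "x : U" for x
  using q that by (simp add: flat_frame_def block_def)
 have row: "F x $ None $ b = (if b = None then 1 else 0)" if "x : U" for x b
  using q that by (cases b) (simp_all add: flat_frame_def)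
 have col: "F x $ a $ None = lift (f0 x) $ a" if "x : U" for x a
  using q that by (cases a) (simp_all add: flat_frame_def)
 show "frame U F"
  unfolding frame_def
 proof (intro conjI ballI allI U sm col)
  show g: "isom_group 0 J (F x)" if x: "x : U" for x
   using o[OF x] row[OF x] by (simp add: isom_group_zero_iff[OF J])
  fix ch x v b assume ch: "ch : \<A>" and "x : U \<inter> fst ch" and b: "b : - T"
  then have x: "x : U" "x : fst ch" by auto
  define z where "z = column None (mc_form ch F x v)"
  have d: "lift_tangent (mdiff ch f0 x v) = F x *v z"
   using mdiff_eq[OF mdiff_column[OF sm U ch x col group_invertible[OF g[OF x(1)]]]] mdiff_lift[OF f0_smooth ch x(2)]
   by (simp add: z_def)
  have "(F x *v z) $ None = z $ None" by (simp add: matrix_vector_mult_def sum_option row[OF x(1)])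
  then have zN: "z $ None = 0" unfolding d[symmetric] by simp
  have "mdiff ch f0 x v = block (F x) *v (\<chi> i. z $ Some i)"
  proof -
   have "mdiff ch f0 x v $ i = (F x *v z) $ Some i" for i unfolding d[symmetric] by simp
   then show ?thesis by (simp add: vec_eq_iff matrix_vector_mult_def sum_option zN)
  qed
  moreover have "(\<chi> j. F x $ Some j $ Some b) : normal_space J flat_tangent ch f0 (snd ch x)"
   using q ch x b by (simp add: flat_frame_def adapted_frame_def)
  then have "pform J (column b (block (F x))) (mdiff ch f0 x v) = 0"
   by (simp add: normal_space_def mdiff_def column_def)
  ultimately have "pform J (block (F x) *v axis b 1) (block (F x) *v (\<chi> i. z $ Some i)) = 0" by (simp add: column_eq_mult)
  then have "pform J (\<chi> i. z $ Some i) (axis b 1) = 0" unfolding pform_frame[OF o[OF x(1)]] by (simp add: pform_sym)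
  then show "mc_form ch F x v $ Some b $ None = 0" using J_nz by (simp add: pform_axis z_def column_def)
 qed
qed

end

section \<open>The transformed immersion\<close>

context transformed_map
begin

lemma mdiff_mc: "frame N F ==> ch : \<A> ==> x : N ==> x : fst ch ==> solves N F H ==> invertible (H x) ==>
  mc_form ch H x v = L (mc_form ch F x v)"
 unfolding mc_form_def[of ch H] by (simp add: mdiff_eq[OF solvesD] matrix_mul_assoc matrix_inv_left)

lemma solution_smooth:
 assumes F: "frame N F" and H: "solves N F H"
 shows "smooth_map_on \<A> N H"
proof (rule smooth_map_on_local)
 fix x assume x: "x : N"
 obtain ch where ch: "ch : \<A>" "x : fst ch" by (rule chart_cover)
 let ?N = "N \<inter> fst ch"
 have F': "frame ?N F" using frame_subset[OF F] frame_open[OF F] chart_open[OF ch(1)] by blast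
 have s: "solves ?N F H" by (rule solves_subset[OF H]) blast
 have "smooth_on (snd ch ` ?N) (rep ch H)"
  by (rule linear_pde_smooth[OF bounded_bilinear_matrix_mult open_chart_image[OF ch(1) frame_open[OF F'] Int_lower2]
     form_regular(2)[OF F' ch(1) Int_lower2] solves_coordinates[OF s ch(1) Int_lower2]])
 then have "smooth_map_on \<A> ?N H" by (rule smooth_map_on_chartI[OF ch(1) frame_open[OF F'] Int_lower2])
 then show "EX N. open N & x : N & smooth_map_on \<A> N H" using frame_open[OF F'] x ch(2) by blast
qed

context
 fixes Q :: "'a => real ^ 'n option ^ 'n option" and p N0 F0
 assumes Q: "Sol UNIV Q" and conn: "connected (UNIV :: 'a set)"
  and F0: "frame N0 F0" "p : N0" "isom_group \<delta>' J (Q p ** F0 p)"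
begin

lemma solution_group: "frame N F ==> x : N ==> isom_group \<delta>' J (Q x ** F x)"
 by (rule Sol_group[OF Q conn F0(1,2) UNIV_I F0(3) _ _ UNIV_I])

lemma solution_solves: "frame N F ==> solves N F (%x. Q x ** F x)"
 using Q unfolding Sol_def by (metis Int_UNIV_right)

lemma solution_mc:
 assumes "frame N F" "ch : \<A>" "x : N" "x : fst ch"
 shows "mc_form ch (%x. Q x ** F x) x v = L (mc_form ch F x v)"
 by (rule mdiff_mc[OF assms solution_solves[OF assms(1)] target.group_invertible[OF solution_group[OF assms(1,3)]]])

lemma solution_column: "frame N F ==> x : N ==> (Q x ** F x) $ a $ None = (Q x *v f x) $ a"
 using frame_col[of N F x] by (simp add: matrix_mult_nth matrix_vector_mult_def)

lemma L_column: "L A $ Some i $ None = (if i : T then A $ Some i $ None else 0)" "L A $ None $ None = 0"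
 by (simp_all add: unhat_matrix_def)

text \<open>The columns of \<open>Q F\<close> play for \<open>Q f\<close> the role that those of \<open>F\<close> play for \<open>f\<close>, because the transformed
 form keeps the tangential part of the last column.\<close>

lemma solution_adapted: "adapted_map \<A> J \<delta>' T (%x. Q x *v f x)"
proof
 show "card T = CARD('m)" by (rule card_T)
 show "smooth_map_on \<A> UNIV (%x. Q x *v f x)"
 proof (rule smooth_map_on_local)
  fix x obtain N F where NF: "x : N" "frame N F" using frame_ex by blast
  have bl: "bounded_linear (%A :: real ^ 'n option ^ 'n option. column None A)"
   by (rule linear_conv_bounded_linear[THEN iffD1], rule linearI) (simp_all add: vec_eq_iff column_def)
  have "smooth_map_on \<A> N (%x. column None (Q x ** F x))"
   by (rule smooth_map_on_bounded_linear[OF bl frame_open[OF NF(2)] solution_smooth[OF NF(2) solution_solves[OF NF(2)]]])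
  then have "smooth_map_on \<A> N (%x. Q x *v f x)"
   by (rule smooth_map_on_cong[OF frame_open[OF NF(2)], rotated]) (simp add: vec_eq_iff column_def solution_column[OF NF(2)])
  then show "EX N. open N & x : N & smooth_map_on \<A> N (%x. Q x *v f x)" using frame_open[OF NF(2)] NF(1) by blast
 qed
 fix ch x v assume ch: "ch : \<A>" and x: "x : fst ch" and 0: "mdiff ch (%x. Q x *v f x) x v = 0"
 obtain N F where NF: "x : N" "frame N F" using frame_ex by blast
 let ?H = "%x. Q x ** F x"
 have iH: "invertible (?H x)" by (rule target.group_invertible[OF solution_group[OF NF(2,1)]])
 have "mdiff ch (%x. Q x *v f x) x v = ?H x *v column None (mc_form ch ?H x v)"
  using mdiff_eq[OF mdiff_column[OF solution_smooth[OF NF(2) solution_solves[OF NF(2)]] frame_open[OF NF(2)] ch NF(1) x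
    solution_column[OF NF(2)] iH]] by simp
 then have "matrix_inv (?H x) *v (?H x *v column None (mc_form ch ?H x v)) = 0" using 0 by simp
 then have "column None (L (mc_form ch F x v)) = 0"
  by (simp only: matrix_vector_mul_assoc matrix_inv_left[OF iH] matrix_vector_mul_lid solution_mc[OF NF(2) ch NF(1) x])
 then have "L (mc_form ch F x v) $ Some i $ None = 0" for i by (simp add: column_def vec_eq_iff)
 from this[unfolded L_column] have "mc_form ch F x v $ Some i $ None = 0" if "i : T" for i
  using that by presburger
 then have "mdiff ch f x v = 0" unfolding mdiff_sum[OF NF(2) ch NF(1) x] by simp
 then show "v = 0" by (rule f_inj[OF ch x])
qed

interpretation g: adapted_map \<A> J \<delta>' T "%x. Q x *v f x"
 by (rule solution_adapted)

lemma solution_frame: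
 assumes F: "frame N F"
 shows "g.frame N (%x. Q x ** F x)"
 unfolding g.frame_def
proof (intro conjI ballI allI frame_open[OF F] solution_smooth[OF F solution_solves[OF F]])
 show "isom_group \<delta>' J (Q x ** F x)" "(Q x ** F x) $ a $ None = (Q x *v f x) $ a" if "x : N" for x a
  using solution_group[OF F that] solution_column[OF F that] by auto
 show "mc_form ch (%x. Q x ** F x) x v $ Some b $ None = 0" if "ch : \<A>" "x : N \<inter> fst ch" "b : -T" for ch x v b
  using that by (simp add: solution_mc[OF F that(1)] L_column)
qed

text \<open>In both frames the metric is \<open>\<theta>\<^sup>t J\<^sub>1 \<theta>\<close> with the same \<open>\<theta>\<close>.\<close>

lemma solution_metric:
 assumes "ch : \<A>" "x : fst ch"
 shows "pform (ext \<delta>' J) (mdiff ch (%x. Q x *v f x) x v) (mdiff ch (%x. Q x *v f x) x w)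
  = pform (ext \<delta> J) (mdiff ch f x v) (mdiff ch f x w)"
proof -
 obtain N F where NF: "x : N" "frame N F" using frame_ex by blast
 show ?thesis
  unfolding metric_frame[OF NF(2) assms(1) NF(1) assms(2)] g.metric_frame[OF solution_frame[OF NF(2)] assms(1) NF(1) assms(2)]
  by (rule sum.cong[OF refl]) (simp add: solution_mc[OF NF(2) assms(1) NF(1) assms(2)] L_column)
qed

lemma solution_ricci:
 "EX N F. x : N & g.frame N F & (ALL ch:\<A>. ALL y:N \<inter> fst ch. ALL v w. ricci_eq T (mc_form ch F y v) (mc_form ch F y w))"
proof -
 obtain N F where NF: "x : N" "frame N F" using frame_ex by blast
 have "ricci_eq T (mc_form ch (%x. Q x ** F x) y v) (mc_form ch (%x. Q x ** F x) y w)"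
  if "ch : \<A>" "y : N \<inter> fst ch" for ch y v w
  using ricci_eq_unhat[OF ricci_eq[OF NF(2) that(1)]] that by (simp add: solution_mc[OF NF(2) that(1)])
 then show ?thesis using NF(1) solution_frame[OF NF(2)] by blast
qed

lemma solution_on_quadric:
 assumes "\<delta>' ~= 0"
 shows "pform (ext \<delta>' J) (Q x *v f x) (Q x *v f x) = \<delta>'"
proof -
 obtain N F where NF: "x : N" "frame N F" using frame_ex by blast
 have "Q x *v f x = column None (Q x ** F x)"
  using solution_column[OF NF(2,1)] by (simp add: column_def vec_eq_iff)
 moreover have "orthonormal_frame (ext \<delta>' J) (Q x ** F x)"
  using solution_group[OF NF(2,1)] g.group_iff_orthonormal[OF assms] by blast
 ultimately show ?thesis by (simp add: orthonormal_frame_def ext_def)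
qed

lemma solution_on_plane:
 assumes "\<delta>' = 0"
 shows "(Q x *v f x) $ None = 1"
proof -
 obtain N F where NF: "x : N" "frame N F" using frame_ex by blast
 show ?thesis using solution_group[OF NF(2,1)] solution_column[OF NF(2,1), of None] assms by (simp add: isom_group_def)
qed

end

text \<open>The common form of the two directions of the construction: \<open>A\<close> is the isometry that
 normalises the frame at \<open>p\<close>, and \<open>D x y\<close> says how the constructed map relates at \<open>x\<close> to the last
 column \<open>y\<close> of the transformed frame.\<close>

definition construction :: "real ^ 'n option ^ 'n option => 'a => ('a => real ^ 'n option => bool) => bool" where
 "construction A p D \<longleftrightarrow> isom_group \<delta> J A & (ALL q. EX U F H. open U & simply_connected U & p : U & q : U &
   adapted_map.frame \<A> J \<delta> T (%x. A *v f x) U F & F p = mat 1 & transformed_frame \<A> U p L F H &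
   (ALL x:U. D x (column None (H x))))"

lemma construction_frame:
 assumes "construction A p D"
 obtains N F where "frame N F" "p : N" "A ** F p = mat 1"
proof -
 have A: "isom_group \<delta> J A" using assms by (simp add: construction_def)
 obtain U F H where U: "p : U" "adapted_map.frame \<A> J \<delta> T (%x. A *v f x) U F" "F p = mat 1"
  using assms[unfolded construction_def, THEN conjunct2, rule_format, of p] by (elim exE conjE)
 have "A ** (matrix_inv A ** F p) = mat 1"
  by (simp add: U(3) matrix_inv_right[OF group_invertible[OF A]])
 then show ?thesis using that[OF frame_left_cancel[OF A U(2)] U(1)] by blast
qed

text \<open>The constructed map is \<open>Q f\<close>, where \<open>Q\<close> is the global solution with \<open>Q p = A\<close>.\<close>

lemma construction_value:
 assumes con: "construction A p D" and Q: "Sol UNIV Q" "Q p = A"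
 shows "D x (Q x *v f x)"
proof -
 have A: "isom_group \<delta> J A" using con by (simp add: construction_def)
 note iA = group_invertible[OF A]
 obtain U F H where U: "open U" "simply_connected U" "p : U" "x : U"
  "adapted_map.frame \<A> J \<delta> T (%x. A *v f x) U F" "F p = mat 1" "transformed_frame \<A> U p L F H"
  "ALL x:U. D x (column None (H x))"
  using con[unfolded construction_def, THEN conjunct2, rule_format, of x] by (elim exE conjE)
 define F0 where "F0 = (%x. matrix_inv A ** F x)"
 have F0: "frame U F0" unfolding F0_def by (rule frame_left_cancel[OF A U(5)])
 have FA: "F = (%x. A ** F0 x)" by (simp add: F0_def matrix_mul_assoc matrix_inv_right[OF iA])
 have H: "smooth_map_on \<A> U H" "!!y. y : U ==> invertible (H y)" "H p = mat 1"
  "!!ch y v. ch : \<A> ==> y : U ==> y : fst ch ==> mc_form ch H y v = L (mc_form ch F y v)"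
  using U(7) by (simp_all add: transformed_frame_def)
 have "solves U F0 H"
  unfolding solves_def
 proof (intro ballI)
  fix ch y assume ch: "ch : \<A>" and "y : U \<inter> fst ch"
  then have y: "y : U" "y : fst ch" by auto
  have "mdiff ch H y v = H y ** L (mc_form ch F0 y v)" for v
  proof -
   have "H y ** mc_form ch H y v = mdiff ch H y v"
    by (simp add: mc_form_def matrix_mul_assoc matrix_inv_right[OF H(2)[OF y(1)]])
   then show ?thesis
    using H(4)[OF ch y] frame_left_mult(3)[OF A F0 ch y] by (simp add: FA[symmetric])
  qed
  then have e: "mdiff ch H y = (%v. H y ** L (mc_form ch F0 y v))" by (rule ext)
  show "(rep ch H has_derivative (%v. H y ** L (mc_form ch F0 y v))) (at (snd ch y))"
   using mdiff_has_derivative[OF H(1) ch y(2,1)] unfolding e .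
 qed
 then have s: "Sol U (%y. H y ** matrix_inv (F0 y))" by (rule SolI[OF F0])
 have inv: "F0 y ** matrix_inv (F0 y) = mat 1" "matrix_inv (F0 y) ** F0 y = mat 1" if "y : U" for y
  using matrix_inv_left[OF frame_inv[OF F0 that]] matrix_inv_right[OF frame_inv[OF F0 that]] by auto
 have "A ** F0 p = mat 1" using U(6) by (simp add: FA)
 then have "A ** (F0 p ** matrix_inv (F0 p)) = matrix_inv (F0 p)" by (simp add: matrix_mul_assoc)
 then have "H p ** matrix_inv (F0 p) = Q p" by (simp add: inv(1)[OF U(3)] H(3) Q(2))
 then have "H x ** matrix_inv (F0 x) = Q x"
  by (rule Sol_unique[OF simply_connected_connected[OF U(2)] s restrict[OF Q(1) U(1) subset_UNIV] U(3,4)])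
 then have "Q x ** F0 x = H x" using inv(2)[OF U(4)] by (simp add: matrix_mul_assoc[symmetric] flip: \<open>H x ** matrix_inv (F0 x) = Q x\<close>)
 then have "column None (H x) = Q x *v f x"
  using frame_col[OF F0 U(4)] by (simp add: vec_eq_iff column_def matrix_vector_mult_def matrix_mult_nth flip: \<open>Q x ** F0 x = H x\<close>)
 then show ?thesis using U(4,8) by auto
qed

text \<open>Both solutions take values that move frames into the target group, so they differ by a constant of
 this group.\<close>

lemma solutions_congruent:
 assumes conn: "connected (UNIV :: 'a set)"
  and Q: "Sol UNIV Q" "frame N F" "p : N" "isom_group \<delta>' J (Q p ** F p)"
  and Q': "Sol UNIV Q'" "frame N' F'" "p' : N'" "isom_group \<delta>' J (Q' p' ** F' p')"
 obtains C where "isom_group \<delta>' J C" "!!x. Q' x *v f x = C *v (Q x *v f x)"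
proof -
 let ?H = "Q p ** F p" and ?H' = "Q' p ** F p"
 have H': "isom_group \<delta>' J ?H'" by (rule Sol_group[OF Q'(1) conn Q'(2,3) UNIV_I Q'(4) Q(2,3) UNIV_I])
 define C where "C = ?H' ** matrix_inv ?H"
 have C: "isom_group \<delta>' J C" unfolding C_def by (intro target.group_mult target.group_inv H' Q(4))
 have "C ** ?H = ?H'"
  by (simp add: C_def matrix_mul_assoc[symmetric] matrix_inv_left[OF target.group_invertible[OF Q(4)], unfolded matrix_mul_assoc[symmetric]])
 then have "C ** ?H ** matrix_inv (F p) = ?H' ** matrix_inv (F p)" by simp
 then have e: "C ** Q p = Q' p"
  by (simp add: matrix_mul_assoc[symmetric] matrix_inv_right[OF frame_inv[OF Q(2,3)]])
 have "C ** Q x = Q' x" for x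
  by (rule Sol_unique[OF conn Sol_const_mult[OF Q(1)] Q'(1) UNIV_I UNIV_I e])
 then show ?thesis using that[OF C] by (simp add: matrix_vector_mul_assoc)
qed

end

locale transformed_immersion = transformed_map \<A> J \<delta> T f \<delta>' \<mu> c + immersed_map \<A> J \<delta> T f r
 for \<A> :: "('a::{t2_space, second_countable_topology}, 'm::finite) chart set"
  and J :: "'n::finite => real" and \<delta> :: real and T :: "'n set" and f :: "'a => real ^ 'n option" and \<delta>' \<mu> c :: real
  and r :: nat +
 assumes sc: "simply_connected (UNIV :: 'a set)"
begin

lemma connected_M: "connected (UNIV :: 'a set)"
 by (rule simply_connected_connected[OF sc])

lemma construction_exists:
 obtains A Q N F where "Sol UNIV Q" "frame N F" "p : N" "isom_group \<delta>' J (Q p ** F p)"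
  "!!D. (!!x. D x (Q x *v f x)) ==> construction A p D"
proof -
 obtain N F0 where F0: "p : N" "frame N F0" using frame_ex by blast
 define A where "A = matrix_inv (F0 p)"
 have A: "isom_group \<delta> J A" unfolding A_def by (rule group_inv[OF frame_group[OF F0(2,1)]])
 have AF: "A ** F0 p = mat 1" by (simp add: A_def matrix_inv_left[OF frame_inv[OF F0(2,1)]])
 obtain Q where Q: "Sol UNIV Q" "Q p = A" using global_solution[OF sc] by blast
 have G: "isom_group \<delta>' J (Q p ** F0 p)" by (simp add: Q AF target.group_one)
 have "construction A p D" if D: "!!x. D x (Q x *v f x)" for D
  unfolding construction_def
 proof (intro conjI A allI)
  fix q
  obtain U F where U: "open U" "simply_connected U" "p : U" "q : U" and F: "frame U F" "F p = F0 p"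
   by (rule frame_between[OF connected_M F0(2,1)])
  let ?F = "%x. A ** F x" and ?H = "%x. Q x ** F x"
  have "transformed_frame \<A> U p L ?F ?H"
   unfolding transformed_frame_def
  proof (intro conjI ballI allI)
   show "smooth_map_on \<A> U ?H"
    by (rule solution_smooth[OF F(1) solution_solves[OF Q(1) connected_M F0(2,1) G F(1)]])
   show "invertible (?H x)" if "x : U" for x
    by (rule target.group_invertible[OF solution_group[OF Q(1) connected_M F0(2,1) G F(1) that]])
   show "?H p = mat 1" by (simp add: Q F AF)
   show "mc_form ch ?H x v = L (mc_form ch ?F x v)" if "ch : \<A>" "x : U \<inter> fst ch" for ch x v
    using solution_mc[OF Q(1) connected_M F0(2,1) G F(1) that(1)] frame_left_mult(3)[OF A F(1) that(1)] that(2) by simp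
  qed
  moreover have "D x (column None (?H x))" if "x : U" for x
  proof -
   have "column None (?H x) = Q x *v f x"
    using solution_column[OF Q(1) connected_M F0(2,1) G F(1) that] by (simp add: column_def vec_eq_iff)
   then show ?thesis using D by simp
  qed
  moreover have "?F p = mat 1" by (simp add: F AF)
  ultimately show "EX U F H. open U & simply_connected U & p : U & q : U &
    adapted_map.frame \<A> J \<delta> T (%x. A *v f x) U F & F p = mat 1 & transformed_frame \<A> U p L F H &
    (ALL x:U. D x (column None (H x)))"
   using U frame_left_mult(2)[OF A F(1)] by (intro exI[of _ U] exI[of _ ?F] exI[of _ ?H]) simp
 qed
 then show ?thesis using that[OF Q(1) F0(2,1) G] by blast
qed

lemma construction_solution:
 assumes con: "construction A p D"
 obtains Q N F where "Sol UNIV Q" "frame N F" "p : N" "isom_group \<delta>' J (Q p ** F p)" "!!x. D x (Q x *v f x)"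
proof -
 obtain Q where Q: "Sol UNIV Q" "Q p = A" using global_solution[OF sc] by blast
 obtain N F where F: "frame N F" "p : N" "A ** F p = mat 1" by (rule construction_frame[OF con])
 show ?thesis
  by (rule that[OF Q(1) F(1,2)]) (simp_all add: Q F target.group_one construction_value[OF con Q])
qed

end

section \<open>The two directions of the construction\<close>

text \<open>The square of \<open>\<kappa>\<close> is \<open>\<epsilon> c / (\<epsilon> c - 1)\<close>. For \<open>\<epsilon> c < 0\<close> the first root is imaginary, for \<open>\<epsilon> c > 1\<close>
 the second one.\<close>

lemma kappa_sq:
 assumes \<epsilon>: "\<epsilon> = 1 | \<epsilon> = -1" and c: "\<epsilon> * c < 0 | \<epsilon> * c > 1"
 shows "kappa \<epsilon> c ~= 0" and "kappa \<epsilon> c * kappa \<epsilon> c * (c - \<epsilon>) = c"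
proof -
 let ?k = "kappa \<epsilon> c"
 define x where "x = \<epsilon> * c"
 have k: "?k ~= 0 & ?k * ?k * (x - 1) = x"
 proof (cases "x < 0")
  case True
  have s: "csqrt (of_real x) = \<i> * of_real (sqrt (- x))" "csqrt (of_real (1 - x)) = of_real (sqrt (1 - x))"
   using True by (simp_all del: of_real_diff)
  have "\<i> * (\<i> * of_real (sqrt (- x))) / of_real (sqrt (1 - x)) = of_real (- (sqrt (- x) / sqrt (1 - x)))"
   by (simp add: mult.assoc[symmetric])
  then have "?k = - (sqrt (- x) / sqrt (1 - x))"
   unfolding kappa_def x_def[symmetric] s by simp
  moreover have "sqrt (- x) * sqrt (- x) = - x" "sqrt (1 - x) * sqrt (1 - x) = 1 - x" using True by simp_all
  ultimately have "?k * ?k = - x / (1 - x)" "?k ~= 0" using True by simp_all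
  then show ?thesis using True by (simp add: field_simps)
 next
  case False
  then have x: "x > 1" using c by (simp add: x_def)
  have s: "csqrt (of_real x) = of_real (sqrt x)" "csqrt (of_real (1 - x)) = \<i> * of_real (sqrt (x - 1))"
   using x by (simp_all del: of_real_diff)
  have "\<i> * of_real (sqrt x) / (\<i> * of_real (sqrt (x - 1))) = complex_of_real (sqrt x / sqrt (x - 1))" by simp
  then have "?k = sqrt x / sqrt (x - 1)"
   unfolding kappa_def x_def[symmetric] s by simp
  moreover have "sqrt x * sqrt x = x" "sqrt (x - 1) * sqrt (x - 1) = x - 1" using x by simp_all
  ultimately have "?k * ?k = x / (x - 1)" "?k ~= 0" using x by simp_all
  then show ?thesis using x by (simp add: field_simps)
 qed
 then show "?k ~= 0" by simp
 have "\<epsilon> * \<epsilon> = 1" using \<epsilon> by auto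
 then have "?k * ?k * (c - \<epsilon>) = \<epsilon> * (?k * ?k * (x - 1))" by (simp add: x_def algebra_simps)
 also have "\<dots> = \<epsilon> * \<epsilon> * c" using k by (simp add: x_def)
 finally show "?k * ?k * (c - \<epsilon>) = c" using \<open>\<epsilon> * \<epsilon> = 1\<close> by simp
qed

lemma pseudo_orthogonal_iff: "pseudo_orthogonal K \<Phi> \<longleftrightarrow> (EX A. orthonormal_frame K A & \<Phi> = (*v) A)"
proof
 assume h: "pseudo_orthogonal K \<Phi>"
 then have \<Phi>: "\<Phi> = (*v) (matrix \<Phi>)" by (auto simp: pseudo_orthogonal_def matrix_works)
 have "pform K (column a (matrix \<Phi>)) (column b (matrix \<Phi>)) = (if a = b then K a else 0)" for a b
 proof -
  have "pform K (\<Phi> (axis a 1)) (\<Phi> (axis b 1)) = (if a = b then K a else 0)"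
  proof -
   have "axis a (1 :: real) $ b = (if a = b then 1 else 0)" by (simp add: axis_def)
   then show ?thesis using h by (simp add: pseudo_orthogonal_def pform_axis)
  qed
  then show ?thesis by (subst (asm) (1 2) \<Phi>) (simp add: column_eq_mult)
 qed
 then have "orthonormal_frame K (matrix \<Phi>)" unfolding orthonormal_frame_def by blast
 then show "EX A. orthonormal_frame K A & \<Phi> = (*v) A" using \<Phi> by (intro exI[of _ "matrix \<Phi>"] conjI)
next
 assume "EX A. orthonormal_frame K A & \<Phi> = (*v) A"
 then show "pseudo_orthogonal K \<Phi>" by (auto simp: pseudo_orthogonal_def pform_frame)
qed

text \<open>On the affine hyperplane the translation part becomes the last column.\<close>

lemma rigid_motion_iff:
 assumes J: "!!i. J i * J i = 1"
 shows "rigid_motion J \<Phi> \<longleftrightarrow> (EX A. isom_group 0 J A & (ALL y. lift (\<Phi> y) = A *v lift y))"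
proof
 assume "rigid_motion J \<Phi>"
 then obtain B b where B: "orthonormal_frame J B" "\<Phi> = (%x. B *v x + b)"
  by (auto simp: rigid_motion_def pseudo_orthogonal_iff)
 define A where "A = (\<chi> a. case a of None => axis None 1 | Some i => (\<chi> a'. case a' of None => b $ i | Some j => B $ i $ j))"
 have "block A = B" by (simp add: vec_eq_iff A_def)
 moreover have "A $ None $ a = (if a = None then 1 else 0)" for a by (simp add: A_def axis_def)
 ultimately have "isom_group 0 J A" using B(1) by (simp add: isom_group_zero_iff[OF J])
 moreover have "lift (\<Phi> y) $ a = (A *v lift y) $ a" for y a
  by (cases a) (simp_all add: A_def B(2) matrix_vector_mult_def sum_option axis_def)
 ultimately show "EX A. isom_group 0 J A & (ALL y. lift (\<Phi> y) = A *v lift y)" by (auto simp: vec_eq_iff)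
next
 assume "EX A. isom_group 0 J A & (ALL y. lift (\<Phi> y) = A *v lift y)"
 then obtain A where A: "isom_group 0 J A" "!!y. lift (\<Phi> y) = A *v lift y" by blast
 have "\<Phi> y $ i = (block A *v y + (\<chi> i. A $ Some i $ None)) $ i" for y i
 proof -
  have "\<Phi> y $ i = (A *v lift y) $ Some i" by (simp flip: A(2))
  then show ?thesis by (simp add: matrix_vector_mult_def sum_option)
 qed
 then have "\<Phi> = (%y. block A *v y + (\<chi> i. A $ Some i $ None))" by (simp add: fun_eq_iff vec_eq_iff)
 moreover have "pseudo_orthogonal J ((*v) (block A))"
  using A(1) by (auto simp: isom_group_zero_iff[OF J] pseudo_orthogonal_iff)
 ultimately show "rigid_motion J \<Phi>" unfolding rigid_motion_def by blast
qed

context smooth_manifold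
begin

lemma immersionD:
 assumes f: "immersion \<A> f" and h: "ch : \<A>" "x : fst ch" "mdiff ch f x v = 0"
 shows "v = 0"
proof -
 have l: "linear (mdiff ch f x)"
  using f h by (intro has_derivative_linear[OF mdiff_has_derivative[OF _ h(1,2) UNIV_I]]) (simp add: immersion_def)
 have "inj (mdiff ch f x)" using f h by (simp add: immersion_def)
 then show ?thesis using h(3) linear_0[OF l] by (metis injD)
qed

lemma immersionI:
 assumes f: "smooth_map_on \<A> UNIV f" and h: "!!ch x v. ch : \<A> ==> x : fst ch ==> mdiff ch f x v = 0 ==> v = 0"
 shows "immersion \<A> f"
 unfolding immersion_def
proof (intro conjI ballI f)
 fix ch x assume ch: "ch : \<A>" "x : fst ch"
 have l: "linear (mdiff ch f x)" by (rule has_derivative_linear[OF mdiff_has_derivative[OF f ch UNIV_I]])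
 show "inj (mdiff ch f x)" unfolding linear_injective_0[OF l] using h[OF ch] by blast
qed

lemma adapted_flat_mapI:
 fixes f0 :: "'a => real ^ 'n::finite"
 assumes "adapted_map \<A> J 0 T (%x. lift (f0 x))"
 shows "adapted_flat_map \<A> J T f0"
proof -
 interpret adapted_map \<A> J 0 T "%x. lift (f0 x)" by (rule assms)
 have "bounded_linear (%y :: real ^ 'n option. \<chi> i. y $ Some i)"
  by (rule linear_conv_bounded_linear[THEN iffD1], rule linearI) (simp_all add: vec_eq_iff)
 from smooth_map_on_bounded_linear[OF this open_UNIV f_smooth]
 have "smooth_map_on \<A> UNIV f0" by simp
 then show ?thesis by unfold_locales
qed

end

context transformed_map
begin

lemma construction_flat:
 assumes \<delta>: "\<delta> ~= 0" and L: "L = hat_matrix (kappa \<delta> c) T"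
 shows "canonical_flat \<A> \<delta> J T c f p g \<longleftrightarrow> (EX A. construction A p (%x y. ALL i. g x $ i = y $ Some i))"
proof -
 have e: "(ALL q. EX U F H. open U & simply_connected U & p : U & q : U &
    quadric_frame \<A> \<delta> J T ((*v) A \<circ> f) U F & F p = mat 1 & transformed_frame \<A> U p (hat_matrix (kappa \<delta> c) T) F H &
    (ALL x:U. ALL i. g x $ i = H x $ Some i $ None)) \<longleftrightarrow>
   (ALL q. EX U F H. open U & simply_connected U & p : U & q : U &
    adapted_map.frame \<A> J \<delta> T (%x. A *v f x) U F & F p = mat 1 & transformed_frame \<A> U p L F H &
    (ALL x:U. ALL i. g x $ i = column None (H x) $ Some i))"
  if A: "isom_group \<delta> J A" for A
 proof -
  interpret A: adapted_map \<A> J \<delta> T "%x. A *v f x" by (rule frame_left_mult(1)[OF A])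
  show ?thesis by (simp add: o_def L column_def A.quadric_frame_iff[OF \<delta>] cong: conj_cong)
 qed
 have "canonical_flat \<A> \<delta> J T c f p g \<longleftrightarrow> (EX A. isom_group \<delta> J A & (ALL q. EX U F H. open U & simply_connected U & p : U & q : U &
    quadric_frame \<A> \<delta> J T ((*v) A \<circ> f) U F & F p = mat 1 & transformed_frame \<A> U p (hat_matrix (kappa \<delta> c) T) F H &
    (ALL x:U. ALL i. g x $ i = H x $ Some i $ None)))"
  unfolding canonical_flat_def pseudo_orthogonal_iff group_iff_orthonormal[OF \<delta>] by blast
 also have "\<dots> \<longleftrightarrow> (EX A. construction A p (%x y. ALL i. g x $ i = y $ Some i))"
  unfolding construction_def by (rule ex_cong1, rule conj_cong[OF refl], rule e)
 finally show ?thesis .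
qed

end

lemma construction_quadric:
 assumes "transformed_map \<A> J 0 T (%x. lift (f x)) \<epsilon> (kappa \<epsilon> c) c"
 shows "canonical_quadric \<A> \<epsilon> J T c f p g \<longleftrightarrow>
  (EX A. transformed_map.construction \<A> J 0 T (%x. lift (f x)) \<epsilon> (kappa \<epsilon> c) A p (%x y. g x = y))"
proof -
 interpret transformed_map \<A> J 0 T "%x. lift (f x)" \<epsilon> "kappa \<epsilon> c" c by (rule assms)
 have e: "(ALL q. EX U F H. open U & simply_connected U & p : U & q : U &
    flat_frame \<A> J T (\<Phi> \<circ> f) U F & F p = mat 1 & transformed_frame \<A> U p L F H &
    (ALL x:U. g x = column None (H x))) \<longleftrightarrow>
   (ALL q. EX U F H. open U & simply_connected U & p : U & q : U &
    adapted_map.frame \<A> J 0 T (%x. A *v lift (f x)) U F & F p = mat 1 & transformed_frame \<A> U p L F H &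
    (ALL x:U. g x = column None (H x)))"
  if A: "isom_group 0 J A" and \<Phi>: "!!y. lift (\<Phi> y) = A *v lift y" for A \<Phi>
 proof -
  interpret A: adapted_flat_map \<A> J T "%x. \<Phi> (f x)"
   by (rule adapted_flat_mapI) (use frame_left_mult(1)[OF A] in \<open>simp add: \<Phi>\<close>)
  show ?thesis by (simp add: o_def A.flat_frame_iff[unfolded \<Phi>] cong: conj_cong)
 qed
 show ?thesis
 proof
  assume "canonical_quadric \<A> \<epsilon> J T c f p g"
  then obtain \<Phi> where \<Phi>: "rigid_motion J \<Phi>" and h: "ALL q. EX U F H. open U & simply_connected U & p : U & q : U &
    flat_frame \<A> J T (\<Phi> \<circ> f) U F & F p = mat 1 & transformed_frame \<A> U p L F H &
    (ALL x:U. g x = column None (H x))"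
   unfolding canonical_quadric_def by (elim exE conjE)
  obtain A where A: "isom_group 0 J A" "ALL y. lift (\<Phi> y) = A *v lift y"
   using \<Phi> unfolding rigid_motion_iff[OF J] by (elim exE conjE)
  have "construction A p (%x y. g x = y)"
   unfolding construction_def using A(1) e[OF A(1) A(2)[rule_format], THEN iffD1, OF h] by (rule conjI)
  then show "EX A. construction A p (%x y. g x = y)" by (rule exI)
 next
  assume "EX A. construction A p (%x y. g x = y)"
  then obtain A where A: "isom_group 0 J A" and h: "ALL q. EX U F H. open U & simply_connected U & p : U & q : U &
    adapted_map.frame \<A> J 0 T (%x. A *v lift (f x)) U F & F p = mat 1 & transformed_frame \<A> U p L F H &
    (ALL x:U. g x = column None (H x))"
   unfolding construction_def by (elim exE conjE)
  define \<Phi> where "\<Phi> y = (\<chi> i. (A *v lift y) $ Some i)" for y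
  have "lift (\<Phi> y) $ a = (A *v lift y) $ a" for y a
   using A by (cases a) (simp_all add: \<Phi>_def matrix_vector_mult_def sum_option isom_group_def)
  then have \<Phi>: "lift (\<Phi> y) = A *v lift y" for y by (simp add: vec_eq_iff)
  have "rigid_motion J \<Phi>" unfolding rigid_motion_iff[OF J] using A \<Phi> by blast
  then show "canonical_quadric \<A> \<epsilon> J T c f p g"
   unfolding canonical_quadric_def using e[OF A \<Phi>, THEN iffD2, OF h] by (intro exI[of _ \<Phi>] conjI)
 qed
qed

theorem quadric_to_flat:
 fixes \<A> :: "('a::{t2_space, second_countable_topology}, 'm::finite) chart set"
  and J :: "'n::finite => real" and f :: "'a => real ^ 'n option"
 assumes atlas: "smooth_atlas \<A>" and sc: "simply_connected (UNIV :: 'a set)"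
  and T: "card T = CARD('m)" and J: "!!i. J i * J i = 1" and r: "card {i : T. J i = -1} = r"
  and \<epsilon>: "\<epsilon> = 1 | \<epsilon> = -1" and c: "\<epsilon> * c < 0 | \<epsilon> * c > 1"
  and q: "!!x. pform (ext \<epsilon> J) (f x) (f x) = \<epsilon>" and imm: "immersion \<A> f"
  and flat: "flat_normal_bundle \<A> (ext \<epsilon> J) (quadric_tangent (ext \<epsilon> J)) f"
  and sig: "induced_signature \<A> (ext \<epsilon> J) f r" and cc: "constant_curvature \<A> (ext \<epsilon> J) f c"
 shows "(ALL p. EX g. canonical_flat \<A> \<epsilon> J T c f p g & immersion \<A> g &
       flat_normal_bundle \<A> J flat_tangent g & same_induced_metric \<A> (ext \<epsilon> J) f J g) &
     (ALL p p' g g'. canonical_flat \<A> \<epsilon> J T c f p g & canonical_flat \<A> \<epsilon> J T c f p' g' -->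
       (\<exists>\<Phi>. rigid_motion J \<Phi> & g' = \<Phi> \<circ> g))"
proof -
 interpret smooth_manifold \<A> by unfold_locales (rule atlas)
 have \<epsilon>0: "\<epsilon> ~= 0" using \<epsilon> by auto
 interpret immersed_map \<A> J \<epsilon> T f r
 proof unfold_locales
  show "\<epsilon> : {-1, 0, 1}" using \<epsilon> by auto
  show "smooth_map_on \<A> UNIV f" using imm by (simp add: immersion_def)
  show "has_signature (%v w. pform (ext \<epsilon> J) (mdiff ch f x v) (mdiff ch f x w)) r" if "ch : \<A>" "x : fst ch" for ch x
   using sig that by (simp add: induced_signature_def induced_metric_def[abs_def])
 qed (use J T r q \<epsilon>0 immersionD[OF imm] in auto)
 let ?k = "kappa \<epsilon> c"
 interpret transformed_immersion \<A> J \<epsilon> T f 0 "1 / ?k" c r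
 proof unfold_locales
  note k = kappa_sq[OF \<epsilon> c]
  show "1 / ?k ~= 0" using k by simp
  have "c - \<epsilon> = (?k * ?k * (c - \<epsilon>)) / (?k * ?k)" using k(1) by simp
  then show "c - \<epsilon> = 1 / ?k * (1 / ?k) * (c - 0)" using k(2) by simp
  show "EX N F. x : N & frame N F" for x by (rule local_frame)
  show "gauss_eq J T (c - \<epsilon>) (mc_form ch F x v) (mc_form ch F x w)"
   "ricci_eq T (mc_form ch F x v) (mc_form ch F x w)"
   if "frame N F" "ch : \<A>" "x : N" "x : fst ch" for N F ch x v w
   by (rule gauss_frame[OF cc refl that], rule quadric_ricci[OF \<epsilon>0 flat that])
 qed (use sc J in auto)
 have L: "L = hat_matrix ?k T" by (rule ext) (rule hat_eq_unhat[symmetric])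
 note con = construction_flat[OF \<epsilon>0 L]
 show ?thesis
 proof (intro conjI allI impI)
  fix p
  obtain Q N F where Q: "Sol UNIV Q" "frame N F" "p : N" "isom_group 0 J (Q p ** F p)"
   and ex: "!!D. (!!x. D x (Q x *v f x)) ==> EX A. construction A p D"
   by (rule construction_exists[of p]) blast
  note s = Q(1) connected_M Q(2-4)
  define g where "g x = (\<chi> i. (Q x *v f x) $ Some i)" for x
  have lg: "Q x *v f x = lift (g x)" for x
  proof -
   have "(Q x *v f x) $ a = lift (g x) $ a" for a
    by (cases a) (simp_all add: g_def solution_on_plane[OF s refl])
   then show ?thesis by (simp add: vec_eq_iff)
  qed
  interpret g: adapted_flat_map \<A> J T g
   by (rule adapted_flat_mapI) (use solution_adapted[OF s] in \<open>simp add: lg\<close>)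
  have "canonical_flat \<A> \<epsilon> J T c f p g" unfolding con by (rule ex) (simp add: g_def)
  moreover have "immersion \<A> g"
  proof (rule immersionI[OF g.f0_smooth])
   fix ch x v assume h: "ch : \<A>" "x : fst ch" "mdiff ch g x v = 0"
   have "mdiff ch (%x. lift (g x)) x v = 0"
    by (simp add: mdiff_lift[OF g.f0_smooth h(1,2)] h(3) linear_0[OF bounded_linear.linear[OF bounded_linear_lift_tangent]])
   then show "v = 0" by (rule g.f_inj[OF h(1,2)])
  qed
  moreover have "flat_normal_bundle \<A> J flat_tangent g"
   by (rule g.flat_flat_normal_bundle[OF solution_ricci[OF s, unfolded lg]])
  moreover have "same_induced_metric \<A> (ext \<epsilon> J) f J g"
   unfolding same_induced_metric_def induced_metric_def
  proof (intro ballI allI)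
   fix ch x v w assume h: "ch : \<A>" "x : fst ch"
   show "pform (ext \<epsilon> J) (mdiff ch f x v) (mdiff ch f x w) = pform J (mdiff ch g x v) (mdiff ch g x w)"
    unfolding solution_metric[OF s h, symmetric, unfolded lg] mdiff_lift[OF g.f0_smooth h] by (simp add: pform_lift_tangent)
  qed
  ultimately show "EX g. canonical_flat \<A> \<epsilon> J T c f p g & immersion \<A> g &
    flat_normal_bundle \<A> J flat_tangent g & same_induced_metric \<A> (ext \<epsilon> J) f J g" by blast
 next
  fix p p' g g' assume "canonical_flat \<A> \<epsilon> J T c f p g & canonical_flat \<A> \<epsilon> J T c f p' g'"
  then obtain A A' where A: "construction A p (%x y. ALL i. g x $ i = y $ Some i)"
   and A': "construction A' p' (%x y. ALL i. g' x $ i = y $ Some i)"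
   unfolding con by blast
  obtain Q N F where Q: "Sol UNIV Q" "frame N F" "p : N" "isom_group 0 J (Q p ** F p)" "!!x. ALL i. g x $ i = (Q x *v f x) $ Some i"
   by (rule construction_solution[OF A]) (rule that)
  obtain Q' N' F' where Q': "Sol UNIV Q'" "frame N' F'" "p' : N'" "isom_group 0 J (Q' p' ** F' p')" "!!x. ALL i. g' x $ i = (Q' x *v f x) $ Some i"
   by (rule construction_solution[OF A']) (rule that)
  obtain C where C: "isom_group 0 J C" "!!x. Q' x *v f x = C *v (Q x *v f x)"
   using solutions_congruent[OF connected_M Q(1-4) Q'(1-4)] by blast
  have lift: "Q x *v f x = lift (g x)" for x
  proof -
   have "(Q x *v f x) $ a = lift (g x) $ a" for a
    using Q(5) by (cases a) (simp_all add: solution_on_plane[OF Q(1) connected_M Q(2-4) refl])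
   then show ?thesis by (simp add: vec_eq_iff)
  qed
  define \<Phi> where "\<Phi> y = (\<chi> i. (C *v lift y) $ Some i)" for y
  have "lift (\<Phi> y) $ a = (C *v lift y) $ a" for y a
   using C(1) by (cases a) (simp_all add: \<Phi>_def matrix_vector_mult_def sum_option isom_group_def)
  then have "lift (\<Phi> y) = C *v lift y" for y by (simp add: vec_eq_iff)
  then have "rigid_motion J \<Phi>" unfolding rigid_motion_iff[OF J] using C(1) by blast
  moreover have "g' x $ i = \<Phi> (g x) $ i" for x i using Q'(5) by (simp add: \<Phi>_def C(2) lift)
  then have "g' = \<Phi> \<circ> g" by (simp add: fun_eq_iff vec_eq_iff)
  ultimately show "\<exists>\<Phi>. rigid_motion J \<Phi> & g' = \<Phi> \<circ> g" by blast
 qed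
qed

theorem flat_to_quadric:
 fixes \<A> :: "('a::{t2_space, second_countable_topology}, 'm::finite) chart set"
  and J :: "'n::finite => real" and f :: "'a => real ^ 'n"
 assumes atlas: "smooth_atlas \<A>" and sc: "simply_connected (UNIV :: 'a set)"
  and T: "card T = CARD('m)" and J: "!!i. J i * J i = 1" and r: "card {i : T. J i = -1} = r"
  and \<epsilon>: "\<epsilon> = 1 | \<epsilon> = -1" and c: "\<epsilon> * c < 0 | \<epsilon> * c > 1"
  and imm: "immersion \<A> f" and flat: "flat_normal_bundle \<A> J flat_tangent f"
  and sig: "induced_signature \<A> J f r" and cc: "constant_curvature \<A> J f c"
 shows "(ALL p. EX g. canonical_quadric \<A> \<epsilon> J T c f p g & (ALL x. pform (ext \<epsilon> J) (g x) (g x) = \<epsilon>) & immersion \<A> g &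
       flat_normal_bundle \<A> (ext \<epsilon> J) (quadric_tangent (ext \<epsilon> J)) g & same_induced_metric \<A> J f (ext \<epsilon> J) g) &
     (ALL p p' g g'. canonical_quadric \<A> \<epsilon> J T c f p g & canonical_quadric \<A> \<epsilon> J T c f p' g' -->
       (\<exists>\<Phi>. pseudo_orthogonal (ext \<epsilon> J) \<Phi> & g' = \<Phi> \<circ> g))"
proof -
 interpret smooth_manifold \<A> by unfold_locales (rule atlas)
 have \<epsilon>0: "\<epsilon> ~= 0" using \<epsilon> by auto
 have smf: "smooth_map_on \<A> UNIV f" using imm by (simp add: immersion_def)
 have met: "pform J (mdiff ch f x v) (mdiff ch f x w)
   = pform (ext 0 J) (mdiff ch (%x. lift (f x)) x v) (mdiff ch (%x. lift (f x)) x w)"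
  if "ch : \<A>" "x : fst ch" for ch x v w
  by (simp add: mdiff_lift[OF smf that] pform_lift_tangent)
 interpret immersed_map \<A> J 0 T "%x. lift (f x)" r
 proof unfold_locales
  have "smooth_map_on \<A> UNIV (%x. lift_tangent (f x))"
   by (rule smooth_map_on_bounded_linear[OF bounded_linear_lift_tangent open_UNIV smf])
  then have "smooth_map_on \<A> UNIV (%x. lift_tangent (f x) + axis None 1)"
   unfolding smooth_map_on_def rep_def o_def
   by (auto intro!: smooth_on_add smooth_on_const chart_image_open)
  then show "smooth_map_on \<A> UNIV (%x. lift (f x))" by (simp add: lift_eq)
  show "has_signature (%v w. pform (ext 0 J) (mdiff ch (%x. lift (f x)) x v) (mdiff ch (%x. lift (f x)) x w)) r"
   if "ch : \<A>" "x : fst ch" for ch x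
   using sig that by (simp add: induced_signature_def induced_metric_def[abs_def] met)
  show "v = 0" if h: "ch : \<A>" "x : fst ch" "mdiff ch (%x. lift (f x)) x v = 0" for ch x v
  proof (rule immersionD[OF imm h(1,2)])
   have "lift_tangent (mdiff ch f x v) $ Some i = 0" for i using h(3) unfolding mdiff_lift[OF smf h(1,2)] by simp
   then show "mdiff ch f x v = 0" by (simp add: vec_eq_iff)
  qed
 qed (use J T r in auto)
 interpret flat: adapted_flat_map \<A> J T f by (rule adapted_flat_mapI) (rule adapted_map_axioms)
 let ?k = "kappa \<epsilon> c"
 interpret transformed_immersion \<A> J 0 T "%x. lift (f x)" \<epsilon> ?k c r
 proof unfold_locales
  note k = kappa_sq[OF \<epsilon> c]
  show "?k ~= 0" "c - 0 = ?k * ?k * (c - \<epsilon>)" using k by simp_all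
  show "\<epsilon> : {-1, 0, 1}" using \<epsilon> by auto
  show "EX N F. x : N & frame N F" for x by (rule local_frame)
  show "gauss_eq J T (c - 0) (mc_form ch F x v) (mc_form ch F x w)"
   "ricci_eq T (mc_form ch F x v) (mc_form ch F x w)"
   if "frame N F" "ch : \<A>" "x : N" "x : fst ch" for N F ch x v w
   by (rule gauss_frame[OF cc met that], assumption+, rule flat.flat_ricci[OF flat that])
 qed (use sc J in auto)
 note con = construction_quadric[OF transformed_map_axioms]
 show ?thesis
 proof (intro conjI allI impI)
  fix p
  obtain Q N F where Q: "Sol UNIV Q" "frame N F" "p : N" "isom_group \<epsilon> J (Q p ** F p)"
   and ex: "!!D. (!!x. D x (Q x *v lift (f x))) ==> EX A. construction A p D"
   by (rule construction_exists[of p]) blast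
  note s = Q(1) connected_M Q(2-4)
  define g where "g x = Q x *v lift (f x)" for x
  interpret g: adapted_map \<A> J \<epsilon> T g using solution_adapted[OF s] by (simp add: g_def[abs_def])
  have "canonical_quadric \<A> \<epsilon> J T c f p g" unfolding con by (rule ex) (simp add: g_def)
  moreover have "ALL x. pform (ext \<epsilon> J) (g x) (g x) = \<epsilon>" unfolding g_def using solution_on_quadric[OF s \<epsilon>0] by blast
  moreover have "immersion \<A> g" by (rule immersionI[OF g.f_smooth g.f_inj])
  moreover have "flat_normal_bundle \<A> (ext \<epsilon> J) (quadric_tangent (ext \<epsilon> J)) g"
   by (rule g.quadric_flat_normal_bundle[OF \<epsilon>0]) (use solution_ricci[OF s] in \<open>simp add: g_def[abs_def]\<close>)
  moreover have "same_induced_metric \<A> J f (ext \<epsilon> J) g"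
   unfolding same_induced_metric_def induced_metric_def g_def[abs_def]
   using met solution_metric[OF s] by simp
  ultimately show "EX g. canonical_quadric \<A> \<epsilon> J T c f p g & (ALL x. pform (ext \<epsilon> J) (g x) (g x) = \<epsilon>) & immersion \<A> g &
    flat_normal_bundle \<A> (ext \<epsilon> J) (quadric_tangent (ext \<epsilon> J)) g & same_induced_metric \<A> J f (ext \<epsilon> J) g" by blast
 next
  fix p p' g g' assume "canonical_quadric \<A> \<epsilon> J T c f p g & canonical_quadric \<A> \<epsilon> J T c f p' g'"
  then obtain A A' where A: "construction A p (%x y. g x = y)" and A': "construction A' p' (%x y. g' x = y)"
   unfolding con by blast
  obtain Q N F where Q: "Sol UNIV Q" "frame N F" "p : N" "isom_group \<epsilon> J (Q p ** F p)" "!!x. g x = Q x *v lift (f x)"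
   by (rule construction_solution[OF A]) (rule that)
  obtain Q' N' F' where Q': "Sol UNIV Q'" "frame N' F'" "p' : N'" "isom_group \<epsilon> J (Q' p' ** F' p')" "!!x. g' x = Q' x *v lift (f x)"
   by (rule construction_solution[OF A']) (rule that)
  obtain C where C: "isom_group \<epsilon> J C" "!!x. Q' x *v lift (f x) = C *v (Q x *v lift (f x))"
   using solutions_congruent[OF connected_M Q(1-4) Q'(1-4)] by blast
  interpret g: adapted_map \<A> J \<epsilon> T "%x. Q x *v lift (f x)" by (rule solution_adapted[OF Q(1) connected_M Q(2-4)])
  have "pseudo_orthogonal (ext \<epsilon> J) ((*v) C)"
   using C(1) unfolding g.group_iff_orthonormal[OF \<epsilon>0] pseudo_orthogonal_iff by blast
  moreover have "g' = (*v) C \<circ> g" by (simp add: fun_eq_iff Q(5) Q'(5) C(2))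
  ultimately show "\<exists>\<Phi>. pseudo_orthogonal (ext \<epsilon> J) \<Phi> & g' = \<Phi> \<circ> g" by blast
 qed
qed

section \<open>The theorem\<close>

theorem theorem2p1:
  fixes \<A> :: "('a::{t2_space, second_countable_topology}, 'm::finite) chart set"
    and J :: "'n::finite \<Rightarrow> real" and T :: "'n set" and m k r s :: nat
  assumes "smooth_atlas \<A>" and "simply_connected (UNIV :: 'a set)"
    and "CARD('m) = m" and "card T = m" and "CARD('n) = m + k"
    and "range J \<subseteq> {-1, 1}" and "r \<le> s"
    and "card {i \<in> T. J i = -1} = r" and "card {i \<in> - T. J i = -1} = s - r"
  shows "(\<forall>f c. (c \<in> {..<0} \<union> {1<..}) \<and> range f \<subseteq> pseudo_sphere J \<and> immersion \<A> f \<and>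
             flat_normal_bundle \<A> (ext 1 J) (quadric_tangent (ext 1 J)) f \<and>
             induced_signature \<A> (ext 1 J) f r \<and> constant_curvature \<A> (ext 1 J) f c \<longrightarrow>
           (\<forall>p. \<exists>g. canonical_flat \<A> 1 J T c f p g \<and> immersion \<A> g \<and>
              flat_normal_bundle \<A> J flat_tangent g \<and>
              same_induced_metric \<A> (ext 1 J) f J g) \<and>
           (\<forall>p p' g g'. canonical_flat \<A> 1 J T c f p g \<and> canonical_flat \<A> 1 J T c f p' g' \<longrightarrow>
              (\<exists>\<Phi>. rigid_motion J \<Phi> \<and> g' = \<Phi> \<circ> g)))
    \<and> (\<forall>f c. (c \<in> {..<0} \<union> {1<..}) \<and> immersion \<A> f \<and>
             flat_normal_bundle \<A> J flat_tangent f \<and>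
             induced_signature \<A> J f r \<and> constant_curvature \<A> J f c \<longrightarrow>
           (\<forall>p. \<exists>g. canonical_quadric \<A> 1 J T c f p g \<and> range g \<subseteq> pseudo_sphere J \<and> immersion \<A> g \<and>
              flat_normal_bundle \<A> (ext 1 J) (quadric_tangent (ext 1 J)) g \<and>
              same_induced_metric \<A> J f (ext 1 J) g) \<and>
           (\<forall>p p' g g'. canonical_quadric \<A> 1 J T c f p g \<and> canonical_quadric \<A> 1 J T c f p' g' \<longrightarrow>
              (\<exists>\<Phi>. pseudo_orthogonal (ext 1 J) \<Phi> \<and> g' = \<Phi> \<circ> g)))
    \<and> (\<forall>f c. (c \<in> {..<-1} \<union> {0<..}) \<and> range f \<subseteq> pseudo_hyperbolic J \<and> immersion \<A> f \<and>
             flat_normal_bundle \<A> (ext (-1) J) (quadric_tangent (ext (-1) J)) f \<and>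
             induced_signature \<A> (ext (-1) J) f r \<and> constant_curvature \<A> (ext (-1) J) f c \<longrightarrow>
           (\<forall>p. \<exists>g. canonical_flat \<A> (-1) J T c f p g \<and> immersion \<A> g \<and>
              flat_normal_bundle \<A> J flat_tangent g \<and>
              same_induced_metric \<A> (ext (-1) J) f J g) \<and>
           (\<forall>p p' g g'. canonical_flat \<A> (-1) J T c f p g \<and> canonical_flat \<A> (-1) J T c f p' g' \<longrightarrow>
              (\<exists>\<Phi>. rigid_motion J \<Phi> \<and> g' = \<Phi> \<circ> g)))
    \<and> (\<forall>f c. (c \<in> {..<-1} \<union> {0<..}) \<and> immersion \<A> f \<and>
             flat_normal_bundle \<A> J flat_tangent f \<and>
             induced_signature \<A> J f r \<and> constant_curvature \<A> J f c \<longrightarrow>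
           (\<forall>p. \<exists>g. canonical_quadric \<A> (-1) J T c f p g \<and> range g \<subseteq> pseudo_hyperbolic J \<and> immersion \<A> g \<and>
              flat_normal_bundle \<A> (ext (-1) J) (quadric_tangent (ext (-1) J)) g \<and>
              same_induced_metric \<A> J f (ext (-1) J) g) \<and>
           (\<forall>p p' g g'. canonical_quadric \<A> (-1) J T c f p g \<and> canonical_quadric \<A> (-1) J T c f p' g' \<longrightarrow>
              (\<exists>\<Phi>. pseudo_orthogonal (ext (-1) J) \<Phi> \<and> g' = \<Phi> \<circ> g)))"
proof -
 have J: "J i * J i = 1" for i
 proof -
  have "J i : {-1, 1}" using assms(6) by blast
  then show ?thesis by auto
 qed
 have T: "card T = CARD('m)" using assms(3,4) by simp
 have sphere: "range h \<subseteq> pseudo_sphere J \<longleftrightarrow> (ALL x. pform (ext 1 J) (h x) (h x) = 1)"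
  and hyperbolic: "range h \<subseteq> pseudo_hyperbolic J \<longleftrightarrow> (ALL x. pform (ext (-1) J) (h x) (h x) = -1)"
  for h :: "'a => real ^ 'n option"
  by (auto simp: pseudo_sphere_def pseudo_hyperbolic_def)
 note to_flat = quadric_to_flat[OF assms(1,2) T J assms(8)]
  and to_quadric = flat_to_quadric[OF assms(1,2) T J assms(8)]
 show ?thesis
  unfolding sphere hyperbolic
 proof (intro conjI, goal_cases)
  case 1
  show ?case by (intro allI impI, rule to_flat) auto
 next
  case 2
  show ?case by (intro allI impI, rule to_quadric) auto
 next
  case 3
  show ?case by (intro allI impI, rule to_flat) auto
 next
  case 4
  show ?case by (intro allI impI, rule to_quadric) auto
 qed
qed

end
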